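(* Let $d=2$ and let $\alpha:\mathbb R^2\to U(m)$ be an equivariantly null-homotopic family of matching matrices. Then there exists a sequence $(\alpha_n)_{n\in\mathbb N}$ of families of matching matrices $\alpha_n:\mathbb R^2\to U(m)$ (with the same $\varepsilon$) such that $\sup_{\mathbf k\in\mathbb R^2}\|\alpha_n(\mathbf k)-\alpha(\mathbf k)\|\to0$ as $n\to\infty$ and each $\alpha_n$ is in generic form.
   Context: Fix $m\ge1$; $\varepsilon$ is either the identity $\mathbf 1$ (bosonic) or, for $m$ even, $J=\begin{pmatrix}0&\mathbf 1\\-\mathbf 1&0\end{pmatrix}$ (fermionic). A family of matching matrices is a continuous, $\mathbb Z^2$-periodic map $\alpha:\mathbb R^2\to U(m)$ with $\varepsilon\alpha(\mathbf k)=\alpha(-\mathbf k)^t\varepsilon$; it is equivariantly null-homotopic if there is a map $(t,\mathbf k)\mapsto\alpha_t(\mathbf k)$, continuous in $t\in[0,1]$, with each $\alpha_t$ matching, $\alpha_0=\alpha$, $\alpha_1\equiv\mathbf 1$. High-symmetry points are $\mathbf k_\sharp\in\mathbb R^2$ with $\mathbf k_\sharp\equiv-\mathbf k_\sharp\bmod\mathbb Z^2$ (i.e. $2\mathbf k_\sharp\in\mathbb Z^2$). An equivariantly null-homotopic family $\alpha$ is in generic form if: in the case $\varepsilon=\mathbf 1$, $\alpha(\mathbf k)$ has completely non-degenerate (simple) spectrum for all $\mathbf k$; in the case $\varepsilon=J$, the spectrum of $\alpha(\mathbf k)$ is completely non-degenerate for all $\mathbf k$ that are not high-symmetry points, every eigenvalue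 of $\alpha(\mathbf k_\sharp)$ at each high-symmetry point is exactly doubly degenerate, and there exist constants $A,R>0$ such that for all $\mathbf k$ in the open balls of radius $R$ around the high-symmetry points the spectrum of $\alpha(\mathbf k)$ consists of clusters of two eigenvalues lying at distance at least $A$ from each other. *)

theory Defs
  imports "HOL-Analysis.Analysis" "Jordan_Normal_Form.Char_Poly" "Jordan_Normal_Form.Schur_Decomposition"
begin

definition unitary_mat :: "nat \<Rightarrow> complex mat \<Rightarrow> bool" where
  "unitary_mat m U \<longleftrightarrow> U \<in> carrier_mat m m \<and> mat_adjoint U * U = 1\<^sub>m m"

text \<open>The symplectic matrix J = [[0, 1], [-1, 0]] (blocks of size m/2), for m even.\<close>
definition J_mat :: "nat \<Rightarrow> complex mat" where
  "J_mat m = mat m m (\<lambda>(i,j). if j = i + m div 2 then 1 else if i = j + m div 2 then -1 else 0)"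

text \<open>Admissible choices of epsilon: identity (bosonic) or J for even m (fermionic).\<close>
definition admissible_eps :: "nat \<Rightarrow> complex mat \<Rightarrow> bool" where
  "admissible_eps m \<epsilon> \<longleftrightarrow> \<epsilon> = 1\<^sub>m m \<or> (even m \<and> \<epsilon> = J_mat m)"

definition matching_family :: "nat \<Rightarrow> complex mat \<Rightarrow> (real \<times> real \<Rightarrow> complex mat) \<Rightarrow> bool" where
  "matching_family m \<epsilon> \<alpha> \<longleftrightarrow>
     (\<forall>i<m. \<forall>j<m. continuous_on UNIV (\<lambda>k. \<alpha> k $$ (i,j))) \<and>
     (\<forall>k. \<forall>a b :: int. \<alpha> (k + (of_int a, of_int b)) = \<alpha> k) \<and>
     (\<forall>k. unitary_mat m (\<alpha> k)) \<and>
     (\<forall>k. \<epsilon> * \<alpha> k = transpose_mat (\<alpha> (- k)) * \<epsilon>)"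

definition equiv_null_homotopic :: "nat \<Rightarrow> complex mat \<Rightarrow> (real \<times> real \<Rightarrow> complex mat) \<Rightarrow> bool" where
  "equiv_null_homotopic m \<epsilon> \<alpha> \<longleftrightarrow>
     (\<exists>H :: real \<Rightarrow> real \<times> real \<Rightarrow> complex mat.
        (\<forall>i<m. \<forall>j<m. continuous_on ({0..1} \<times> UNIV) (\<lambda>(t,k). H t k $$ (i,j))) \<and>
        (\<forall>t\<in>{0..1}. matching_family m \<epsilon> (H t)) \<and>
        H 0 = \<alpha> \<and> H 1 = (\<lambda>k. 1\<^sub>m m))"

definition high_symmetry_point :: "real \<times> real \<Rightarrow> bool" where
  "high_symmetry_point k \<longleftrightarrow> 2 * fst k \<in> \<int> \<and> 2 * snd k \<in> \<int>"

definition simple_spectrum :: "complex mat \<Rightarrow> bool" where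
  "simple_spectrum A \<longleftrightarrow> (\<forall>z. Polynomial.order z (char_poly A) \<le> 1)"

definition doubly_degenerate_spectrum :: "complex mat \<Rightarrow> bool" where
  "doubly_degenerate_spectrum A \<longleftrightarrow>
     (\<forall>z. poly (char_poly A) z = 0 \<longrightarrow> Polynomial.order z (char_poly A) = 2)"

definition clustered_spectrum :: "nat \<Rightarrow> real \<Rightarrow> complex mat \<Rightarrow> bool" where
  "clustered_spectrum m A M \<longleftrightarrow>
     (\<exists>es :: complex list. length es = m \<and> char_poly M = (\<Prod>e\<leftarrow>es. [:- e, 1:]) \<and>
       (\<exists>c :: nat \<Rightarrow> nat. (\<forall>i<m. c i < m div 2) \<and>
          (\<forall>p < m div 2. card {i. i < m \<and> c i = p} = 2) \<and>
          (\<forall>i<m. \<forall>j<m. c i \<noteq> c j \<longrightarrow> A \<le> cmod (es ! i - es ! j))))"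

definition generic_form :: "nat \<Rightarrow> complex mat \<Rightarrow> (real \<times> real \<Rightarrow> complex mat) \<Rightarrow> bool" where
  "generic_form m \<epsilon> \<alpha> \<longleftrightarrow> equiv_null_homotopic m \<epsilon> \<alpha> \<and>
     (if \<epsilon> = 1\<^sub>m m then (\<forall>k. simple_spectrum (\<alpha> k))
      else (\<forall>k. \<not> high_symmetry_point k \<longrightarrow> simple_spectrum (\<alpha> k)) \<and>
           (\<forall>k. high_symmetry_point k \<longrightarrow> doubly_degenerate_spectrum (\<alpha> k)) \<and>
           (\<exists>A R. A > 0 \<and> R > 0 \<and>
              (\<forall>ks k. high_symmetry_point ks \<longrightarrow> k \<in> ball ks R \<longrightarrow>
                   clustered_spectrum m A (\<alpha> k))))"

definition cvec_norm :: "complex vec \<Rightarrow> real" where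
  "cvec_norm v = sqrt (\<Sum>i<dim_vec v. (cmod (v $ i))\<^sup>2)"

definition mat_op_norm :: "complex mat \<Rightarrow> real" where
  "mat_op_norm A = Sup {cvec_norm (A *\<^sub>v v) | v. v \<in> carrier_vec (dim_col A) \<and> cvec_norm v = 1}"

end

theory Submission
  imports Defs
begin

text \<open>Multiple eigenvalues have codimension three among Hermitian matrices while the parameter \<open>k\<close> ranges
  over a plane, so they can be perturbed away; a Cayley transform \<open>U \<mapsto> H\<close> based at a point of the unit
  circle outside the spectrum reduces the unitary case to the Hermitian one locally. For the Hermitian
  case one grows the matrix by one row at a time: if a leading block has simple spectrum, a double
  eigenvalue \<open>z\<close> forces, by a Schur complement, a corner block in the image of the map
  \<open>(k, z) \<mapsto> corner\<close> from a three-dimensional into a four-dimensional space, and a small constant shift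
  of the corner avoids this negligible set. Periodic trigonometric approximation makes the map smooth.

  The relation \<open>\<epsilon> \<alpha>(k) = \<alpha>(-k)\<^sup>t \<epsilon>\<close> couples \<open>k\<close> with \<open>-k\<close>. Away from the high-symmetry points these two
  points have disjoint neighbourhoods, so a perturbation near \<open>k\<close> is transported to \<open>-k\<close>, and finitely
  many such neighbourhoods are swept one after another, each step being small enough to preserve the
  simplicity already achieved. Near a high-symmetry point the chart value is replaced by an explicit
  model: a constant matrix with simple spectrum if \<open>\<epsilon> = 1\<close>, and \<open>W (h + sin(2\<pi>k\<^sub>1) \<sigma>\<^sub>3 + sin(2\<pi>k\<^sub>2) \<sigma>\<^sub>1) W\<^sup>*\<close>
  with \<open>W\<close> built from Kramers pairs if \<open>\<epsilon> = J\<close>. All perturbations are homotopic to the original family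
  through straight lines in the charts, which preserves null-homotopy.\<close>

section \<open>Degenerate eigenvalues and principal minors\<close>

text \<open>Simplicity is handled in negated form: \<open>M - z\<close> is degenerate if its
  determinant and all its principal minors of order n - 1 vanish. This is a closed polynomial
  condition in \<open>M\<close> and \<open>z\<close> jointly, so openness and uniform bounds come
  from compactness, and no continuous choice of eigenvalues is made. Normality turns the condition
  into a kernel of dimension two.

  In the Hermitian step the Schur complement controls only those \<open>z\<close> at which one
  chosen minor of the leading block is nonzero. Simplicity of that block keeps some minor above a
  uniform bound at each of its eigenvalues; which one depends on the point, so all corners are
  perturbed, each too little to spoil the earlier ones.

  The dimension count breaks down at high-symmetry points, where the matching relation constrains a
  single matrix: the chart value is real symmetric if \<epsilon> = 1 and has Kramers pairs if
  \<epsilon> = J. The sweep therefore stays outside small discs around these points and meets the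
  models only in annuli where their spectra are already simple.\<close>

definition nullv :: "nat \<Rightarrow> complex mat \<Rightarrow> (nat \<Rightarrow> complex) \<Rightarrow> bool" where
  "nullv n M v \<longleftrightarrow> (\<forall>i<n. (\<Sum>j<n. M $$ (i,j) * v j) = 0)"

text \<open>This says that the kernel has dimension at least two: independence is a nonzero 2 x 2
  minor. Vectors are functions on the naturals, of which only the first \<open>n\<close> values
  matter.\<close>

definition ker2 :: "nat \<Rightarrow> complex mat \<Rightarrow> bool" where
  "ker2 n M \<longleftrightarrow> (\<exists>v w. nullv n M v \<and> nullv n M w \<and> (\<exists>i<n. \<exists>j<n. v i * w j \<noteq> v j * w i))"

text \<open>The determinant of \<open>pin n a M\<close> is the principal minor of \<open>M\<close> without index \<open>a\<close>.\<close>
definition pin :: "nat \<Rightarrow> nat \<Rightarrow> complex mat \<Rightarrow> complex mat" where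
  "pin n a M = mat n n (\<lambda>(i,j). if i = a \<or> j = a then (if i = j then 1 else 0) else M $$ (i,j))"

text \<open>Up to sign, the determinant of \<open>M - z\<close> and the sum of these minors are the
  characteristic polynomial of \<open>M\<close> and its derivative at \<open>z\<close>. Unlike
  \<open>ker2\<close>, the condition is polynomial in the entries and passes to limits.\<close>

definition degen :: "nat \<Rightarrow> complex mat \<Rightarrow> bool" where
  "degen n M \<longleftrightarrow> det M = 0 \<and> (\<forall>a<n. det (pin n a M) = 0)"

abbreviation shift :: "nat \<Rightarrow> complex mat \<Rightarrow> complex \<Rightarrow> complex mat" where
  "shift n M z \<equiv> M - z \<cdot>\<^sub>m 1\<^sub>m n"

lemma shift_carrier [simp]: "M \<in> carrier_mat n n \<Longrightarrow> shift n M z \<in> carrier_mat n n"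
  by auto

lemma shift_index: "M \<in> carrier_mat n n \<Longrightarrow> i < n \<Longrightarrow> j < n \<Longrightarrow>
  shift n M z $$ (i,j) = M $$ (i,j) - (if i = j then z else 0)"
  by auto

lemma pin_carrier [simp]: "pin n a M \<in> carrier_mat n n"
  by (simp add: pin_def)

lemma det_zero_iff_nullv:
  assumes A: "A \<in> carrier_mat n n"
  shows "det A = 0 \<longleftrightarrow> (\<exists>v. nullv n A v \<and> (\<exists>i<n. v i \<noteq> 0))"
proof
  assume "det A = 0"
  then obtain v where v: "v \<in> carrier_vec n" "v \<noteq> 0\<^sub>v n" "A *\<^sub>v v = 0\<^sub>v n"
    using det_0_iff_vec_prod_zero[OF A] by blast
  have "nullv n A (\<lambda>j. v $ j)"
    unfolding nullv_def
  proof (intro allI impI)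
    fix i assume i: "i < n"
    have "(\<Sum>j<n. A $$ (i,j) * v $ j) = (A *\<^sub>v v) $ i"
      using A v(1) i by (auto simp: scalar_prod_def lessThan_atLeast0 intro!: sum.cong)
    then show "(\<Sum>j<n. A $$ (i,j) * v $ j) = 0" using v(3) i by simp
  qed
  moreover have "\<exists>i<n. v $ i \<noteq> 0"
    using v(1,2) by (metis carrier_vecD eq_vecI index_zero_vec(1) index_zero_vec(2))
  ultimately show "\<exists>v. nullv n A v \<and> (\<exists>i<n. v i \<noteq> 0)" by blast
next
  assume "\<exists>v. nullv n A v \<and> (\<exists>i<n. v i \<noteq> 0)"
  then obtain v i0 where v: "nullv n A v" "i0 < n" "v i0 \<noteq> 0" by blast
  have "A *\<^sub>v vec n v = 0\<^sub>v n"
    using A v(1) by (intro eq_vecI) (auto simp: nullv_def scalar_prod_def lessThan_atLeast0)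
  moreover have "vec n v \<noteq> 0\<^sub>v n" using v(2,3) by (metis index_vec index_zero_vec(1))
  ultimately show "det A = 0"
    using det_0_iff_vec_prod_zero[OF A] by (metis vec_carrier)
qed

lemma nullv_lincomb: "nullv n M v \<Longrightarrow> nullv n M w \<Longrightarrow> nullv n M (\<lambda>i. c * v i + d * w i)"
proof -
  assume v: "nullv n M v" and w: "nullv n M w"
  have "(\<Sum>j<n. M $$ (i,j) * (c * v j + d * w j)) =
      c * (\<Sum>j<n. M $$ (i,j) * v j) + d * (\<Sum>j<n. M $$ (i,j) * w j)" for i
    by (simp add: sum_distrib_left sum.distrib algebra_simps)
  with v w show ?thesis by (simp add: nullv_def)
qed

text \<open>Unless both vectors already vanish at \<open>a\<close>, the combination
  \<open>w a * v - v a * w\<close> kills coordinate \<open>a\<close>, and independence keeps it from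
  vanishing altogether.\<close>

lemma ker2_vanishing:
  assumes "ker2 n M" "a < n"
  obtains u where "nullv n M u" "u a = 0" "\<exists>i<n. u i \<noteq> 0"
proof -
  from assms obtain v w i j where v: "nullv n M v" and w: "nullv n M w"
    and ij: "i < n" "j < n" "v i * w j \<noteq> v j * w i" unfolding ker2_def by blast
  show thesis
  proof (cases "v a = 0 \<and> w a = 0")
    case True
    have "v i \<noteq> 0 \<or> v j \<noteq> 0" using ij by auto
    with True v ij that show ?thesis by blast
  next
    case False
    let ?u = "\<lambda>i. w a * v i + (- v a) * w i"
    have "\<exists>i<n. ?u i \<noteq> 0"
    proof (rule ccontr)
      assume "\<not> ?thesis"
      then have e: "w a * v i = v a * w i" "w a * v j = v a * w j" using ij by auto
      show False
      proof (cases "w a = 0")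
        case True
        then show ?thesis using e False ij by auto
      next
        case F: False
        have "w a * (v i * w j) = w a * (v j * w i)" using e by (metis mult.assoc mult.commute)
        then show ?thesis using F ij by simp
      qed
    qed
    then show ?thesis using that[of ?u] nullv_lincomb[OF v w] by fastforce
  qed
qed

lemma nullv_pin:
  assumes "nullv n M u" "u a = 0"
  shows "nullv n (pin n a M) u"
  unfolding nullv_def
proof (intro allI impI)
  fix i assume i: "i < n"
  show "(\<Sum>j<n. pin n a M $$ (i,j) * u j) = 0"
  proof (cases "i = a")
    case True
    then show ?thesis using i assms(2) by (intro sum.neutral) (auto simp: pin_def)
  next
    case False
    have "(\<Sum>j<n. pin n a M $$ (i,j) * u j) = (\<Sum>j<n. M $$ (i,j) * u j)"
      using i False assms(2) by (intro sum.cong) (auto simp: pin_def)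
    then show ?thesis using assms(1) i by (simp add: nullv_def)
  qed
qed

lemma ker2_imp_degen:
  assumes M: "M \<in> carrier_mat n n" and k: "ker2 n M"
  shows "degen n M"
proof -
  have "det (pin n a M) = 0" if a: "a < n" for a
  proof -
    obtain u where u: "nullv n M u" "u a = 0" "\<exists>i<n. u i \<noteq> 0"
      using ker2_vanishing[OF k a] .
    then show ?thesis
      using nullv_pin[OF u(1,2)] det_zero_iff_nullv[OF pin_carrier] by blast
  qed
  moreover have "det M = 0"
  proof -
    from k obtain v w i j where v: "nullv n M v"
      and ij: "i < n" "j < n" "v i * w j \<noteq> v j * w i" unfolding ker2_def by blast
    have "v i \<noteq> 0 \<or> v j \<noteq> 0" using ij by auto
    with v ij show ?thesis using det_zero_iff_nullv[OF M] by blast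
  qed
  ultimately show ?thesis by (simp add: degen_def)
qed

text \<open>Assumption \<open>N\<close> is what normality provides: null vectors of \<open>M\<close>
  are null vectors of its adjoint. For a null vector \<open>v\<close> with
  \<open>v a \<noteq> 0\<close>, the vanishing minor at \<open>a\<close> supplies a nonzero
  \<open>u\<close> with \<open>u a = 0\<close> such that \<open>M u\<close> vanishes outside row
  \<open>a\<close>. Pairing \<open>M u\<close> with \<open>v\<close> gives 0, so row
  \<open>a\<close> vanishes as well and \<open>u\<close> is a second, independent null
  vector.\<close>

lemma degen_imp_ker2:
  assumes M: "M \<in> carrier_mat n n" and d: "degen n M"
    and N: "\<And>u. nullv n M u \<Longrightarrow> \<forall>j<n. (\<Sum>i<n. cnj (M $$ (i,j)) * u i) = 0"
  shows "ker2 n M"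
proof -
  from d have "det M = 0" by (simp add: degen_def)
  then obtain v a where v: "nullv n M v" "a < n" "v a \<noteq> 0"
    using det_zero_iff_nullv[OF M] by blast
  have "det (pin n a M) = 0" using d v(2) by (simp add: degen_def)
  then obtain u i where u: "nullv n (pin n a M) u" "i < n" "u i \<noteq> 0"
    using det_zero_iff_nullv[OF pin_carrier] by blast
  have "(\<Sum>j<n. pin n a M $$ (a,j) * u j) = (\<Sum>j<n. if j = a then u a else 0)"
    using v(2) by (intro sum.cong) (auto simp: pin_def)
  then have ua: "u a = 0" using u(1) v(2) by (simp add: nullv_def)
  define r where "r i = (\<Sum>j<n. M $$ (i,j) * u j)" for i
  have r: "r i = 0" if "i < n" "i \<noteq> a" for i
  proof -
    have "r i = (\<Sum>j<n. pin n a M $$ (i,j) * u j)"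
      unfolding r_def using that ua by (intro sum.cong) (auto simp: pin_def)
    then show ?thesis using u(1) that by (simp add: nullv_def)
  qed
  have "(\<Sum>i<n. cnj (v i) * r i) = (\<Sum>j<n. \<Sum>i<n. cnj (v i) * (M $$ (i,j) * u j))"
    unfolding r_def sum_distrib_left by (rule sum.swap)
  also have "\<dots> = (\<Sum>j<n. cnj (\<Sum>i<n. cnj (M $$ (i,j)) * v i) * u j)"
    by (intro sum.cong refl) (simp add: sum_distrib_right sum_distrib_left algebra_simps)
  also have "\<dots> = 0" using N[OF v(1)] by simp
  finally have "(\<Sum>i<n. cnj (v i) * r i) = 0" .
  moreover have "(\<Sum>i<n. cnj (v i) * r i) = (\<Sum>i<n. if i = a then cnj (v a) * r a else 0)"
    using r by (intro sum.cong) auto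
  ultimately have "r a = 0" using v by simp
  with r have "nullv n M u" unfolding nullv_def r_def[symmetric] by metis
  moreover have "v a * u i \<noteq> v i * u a" using ua v u by simp
  ultimately show ?thesis using v u unfolding ker2_def by blast
qed

lemma det_pin:
  assumes M: "M \<in> carrier_mat n n" and a: "a < n"
  shows "det (pin n a M) = det (mat_delete M a a)"
proof -
  have "det (pin n a M) = (\<Sum>j<n. pin n a M $$ (a,j) * cofactor (pin n a M) a j)"
    by (rule laplace_expansion_row[OF pin_carrier a])
  also have "\<dots> = (\<Sum>j<n. if j = a then cofactor (pin n a M) a a else 0)"
    using a by (intro sum.cong) (auto simp: pin_def)
  also have "\<dots> = cofactor (pin n a M) a a" using a by simp
  also have "\<dots> = det (mat_delete (pin n a M) a a)" by (simp add: cofactor_def)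
  also have "mat_delete (pin n a M) a a = mat_delete M a a"
    using M a unfolding mat_delete_def pin_def
    by (intro eq_matI) auto
  finally show ?thesis .
qed

lemma poly_char_poly_shift:
  assumes M: "M \<in> carrier_mat n n"
  shows "poly (char_poly M) z = (-1)^n * det (shift n M z)"
proof -
  have "poly (char_poly M) z = det (- (char_matrix M z))"
    using M by (simp add: char_poly_matrix)
  also have "\<dots> = (-1)^n * det (char_matrix M z)"
    
    proof -
      have "- char_matrix M z = (-1) \<cdot>\<^sub>m char_matrix M z"
        by (intro eq_matI) auto
      then show ?thesis using det_smult[of "-1" "char_matrix M z"] M by (simp add: char_matrix_def)
    qed
  also have "char_matrix M z = shift n M z"
    using M by (intro eq_matI) (auto simp: char_matrix_def)
  finally show ?thesis .
qed

text \<open>The derivative of the characteristic polynomial is the sum of the characteristic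
  polynomials of the matrices with one row and column deleted. The vanishing minors therefore make
  \<open>z\<close> a common root of the polynomial and its derivative.\<close>

lemma degen_imp_order:
  assumes M: "M \<in> carrier_mat n n" and d: "degen n (shift n M z)"
  shows "\<not> simple_spectrum M"
proof -
  have "poly (char_poly M) z = 0"
    using d poly_char_poly_shift[OF M] by (simp add: degen_def)
  moreover have "poly (pderiv (char_poly M)) z = 0"
  proof -
    have "poly (char_poly (mat_delete M a a)) z = 0" if a: "a < n" for a
    proof -
      have c: "mat_delete M a a \<in> carrier_mat (n-1) (n-1)" using M by (auto simp: mat_delete_def)
      have "shift (n-1) (mat_delete M a a) z = mat_delete (shift n M z) a a"
        using M a unfolding mat_delete_def by (intro eq_matI) auto
      then have "poly (char_poly (mat_delete M a a)) z = (-1)^(n-1) * det (mat_delete (shift n M z) a a)"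
        using poly_char_poly_shift[OF c] by simp
      also have "det (mat_delete (shift n M z) a a) = det (pin n a (shift n M z))"
        using det_pin[OF shift_carrier[OF M] a] by simp
      finally show ?thesis using d a by (simp add: degen_def)
    qed
    then show ?thesis by (simp add: pderiv_char_poly[OF M] poly_sum)
  qed
  moreover have "char_poly M \<noteq> 0"
    using degree_monic_char_poly[OF M] by auto
  moreover have "pderiv (char_poly M) \<noteq> 0"
  proof
    assume "pderiv (char_poly M) = 0"
    then have "degree (char_poly M) = 0" by (simp add: pderiv_eq_0_iff)
    then obtain c where "char_poly M = [:c:]" by (rule degree_eq_zeroE)
    with calculation show False by simp
  qed
  ultimately have "Polynomial.order z (char_poly M) > 1"
    using order_pderiv[of "char_poly M" z] order_root[of "pderiv (char_poly M)" z] by simp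
  then show ?thesis by (auto simp: simple_spectrum_def not_le)
qed

section \<open>Openness of simplicity\<close>

text \<open>Entrywise closeness keeps the estimates elementary; the passage to the operator norm
  costs a factor \<open>m * m\<close>, paid once in \<open>mat_op_norm_bound\<close>.\<close>

definition mclose :: "nat \<Rightarrow> real \<Rightarrow> complex mat \<Rightarrow> complex mat \<Rightarrow> bool" where
  "mclose n d A B \<longleftrightarrow> (\<forall>i<n. \<forall>j<n. cmod (A $$ (i,j) - B $$ (i,j)) < d)"

definition leading_block :: "nat \<Rightarrow> complex mat \<Rightarrow> complex mat" where
  "leading_block n M = mat n n (\<lambda>(i,j). M $$ (i,j))"

lemma leading_block_carrier [simp]: "leading_block n M \<in> carrier_mat n n" by (simp add: leading_block_def)

lemma mclose_mono: "mclose n d A B \<Longrightarrow> d \<le> e \<Longrightarrow> mclose n e A B"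
  unfolding mclose_def by force

lemma mclose_trans: "mclose n d A B \<Longrightarrow> mclose n e B C \<Longrightarrow> mclose n (d + e) A C"
  unfolding mclose_def
proof (intro allI impI)
  fix i j assume a: "\<forall>i<n. \<forall>j<n. cmod (A $$ (i,j) - B $$ (i,j)) < d"
    "\<forall>i<n. \<forall>j<n. cmod (B $$ (i,j) - C $$ (i,j)) < e" "i < n" "j < n"
  have "cmod (A $$ (i,j) - C $$ (i,j)) \<le> cmod (A $$ (i,j) - B $$ (i,j)) + cmod (B $$ (i,j) - C $$ (i,j))"
    using norm_triangle_ineq[of "A $$ (i,j) - B $$ (i,j)" "B $$ (i,j) - C $$ (i,j)"] by simp
  also have "\<dots> < d + e" using a by (intro add_strict_mono) auto
  finally show "cmod (A $$ (i,j) - C $$ (i,j)) < d + e" .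
qed

definition mtendsto :: "nat \<Rightarrow> ('a \<Rightarrow> complex mat) \<Rightarrow> complex mat \<Rightarrow> 'a filter \<Rightarrow> bool" where
  "mtendsto n A L F \<longleftrightarrow> (\<forall>i<n. \<forall>j<n. ((\<lambda>x. A x $$ (i,j)) \<longlongrightarrow> L $$ (i,j)) F)"

lemma tendsto_det:
  assumes "\<And>x. A x \<in> carrier_mat n n" "L \<in> carrier_mat n n" "mtendsto n A L F"
  shows "((\<lambda>x. det (A x)) \<longlongrightarrow> det L) F"
proof -
  have "((\<lambda>x. A x $$ (i, p i)) \<longlongrightarrow> L $$ (i, p i)) F" if "p permutes {0..<n}" "i \<in> {0..<n}" for p i
  proof -
    have "i < n" using that by simp
    moreover have "p i < n" using permutes_in_image[OF that(1)] that(2) by auto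
    ultimately show ?thesis using assms(3) unfolding mtendsto_def by blast
  qed
  then show ?thesis
    unfolding det_def'[OF assms(1)] det_def'[OF assms(2)]
    by (intro tendsto_sum tendsto_mult tendsto_const tendsto_prod) auto
qed

lemma mtendsto_shift:
  assumes "\<And>x. A x \<in> carrier_mat n n" "L \<in> carrier_mat n n" "mtendsto n A L F" "(z \<longlongrightarrow> w) F"
  shows "mtendsto n (\<lambda>x. shift n (A x) (z x)) (shift n L w) F"
  unfolding mtendsto_def
proof (intro allI impI)
  fix i j assume ij: "i < n" "j < n"
  have "((\<lambda>x. A x $$ (i,j) - (if i = j then z x else 0)) \<longlongrightarrow> L $$ (i,j) - (if i = j then w else 0)) F"
    using assms(3,4) ij unfolding mtendsto_def by (cases "i = j") (auto intro!: tendsto_intros)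
  then show "((\<lambda>x. shift n (A x) (z x) $$ (i,j)) \<longlongrightarrow> shift n L w $$ (i,j)) F"
    using ij by (simp add: shift_index[OF assms(1)] shift_index[OF assms(2)] del: index_minus_mat)
qed

lemma mtendsto_pin: "mtendsto n A L F \<Longrightarrow> mtendsto n (\<lambda>x. pin n a (A x)) (pin n a L) F"
  unfolding mtendsto_def pin_def by auto

lemma mtendsto_leading_block: "mtendsto (Suc n) A L F \<Longrightarrow> mtendsto n (\<lambda>x. leading_block n (A x)) (leading_block n L) F"
  unfolding mtendsto_def leading_block_def by auto

text \<open>In the row where an eigenvector has its largest entry the eigenvalue equation bounds
  \<open>z\<close>. This confines eigenvalues to a compact set in
  \<open>uniform_violation\<close>.\<close>

lemma eigenvalue_bound:
  assumes M: "M \<in> carrier_mat n n" and d: "det (shift n M z) = 0"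
    and C: "\<And>i j. i < n \<Longrightarrow> j < n \<Longrightarrow> cmod (M $$ (i,j)) \<le> C"
  shows "cmod z \<le> of_nat n * C"
proof -
  obtain v where v: "nullv n (shift n M z) v" "\<exists>i<n. v i \<noteq> 0"
    using d det_zero_iff_nullv[OF shift_carrier[OF M]] by blast
  have fin: "finite ((\<lambda>i. cmod (v i)) ` {..<n})" "(\<lambda>i. cmod (v i)) ` {..<n} \<noteq> {}" using v by auto
  obtain i where i: "i < n" "Max ((\<lambda>i. cmod (v i)) ` {..<n}) = cmod (v i)"
    using Max_in[OF fin] by auto
  have le: "cmod (v j) \<le> cmod (v i)" if "j < n" for j
    using Max_ge[OF fin(1), of "cmod (v j)"] that i by auto
  have pos: "cmod (v i) > 0" using v(2) le by (metis norm_eq_zero norm_le_zero_iff zero_less_norm_iff)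
  have "(\<Sum>j<n. shift n M z $$ (i,j) * v j) = (\<Sum>j<n. M $$ (i,j) * v j - (if j = i then z * v i else 0))"
    using i(1) by (intro sum.cong refl) (auto simp: shift_index[OF M] algebra_simps simp del: index_minus_mat)
  also have "\<dots> = (\<Sum>j<n. M $$ (i,j) * v j) - z * v i" using i(1) by (simp add: sum_subtractf)
  finally have "z * v i = (\<Sum>j<n. M $$ (i,j) * v j)" using v(1) i(1) by (simp add: nullv_def)
  then have "cmod z * cmod (v i) = cmod (\<Sum>j<n. M $$ (i,j) * v j)" by (metis norm_mult)
  also have "\<dots> \<le> (\<Sum>j<n. C * cmod (v i))"
    by (rule sum_norm_le) (use C i(1) le in \<open>auto simp: norm_mult intro!: mult_mono order_trans[OF norm_ge_zero C]\<close>)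
  also have "\<dots> = of_nat n * C * cmod (v i)" by simp
  finally show ?thesis using pos by simp
qed

text \<open>An eigenvalue condition \<open>V\<close> that is closed under limits and fails along a compact
  family of matrices fails uniformly near the family.\<close>
lemma uniform_violation:
  fixes H :: "'a::metric_space \<Rightarrow> complex mat" and V :: "nat \<Rightarrow> complex mat \<Rightarrow> complex \<Rightarrow> bool"
  assumes S: "compact S"
    and Hc: "\<And>k. H k \<in> carrier_mat n n"
    and cont: "\<And>i j. i < n \<Longrightarrow> j < n \<Longrightarrow> continuous_on S (\<lambda>k. H k $$ (i,j))"
    and bnd: "\<And>j M z. M \<in> carrier_mat n n \<Longrightarrow> V j M z \<Longrightarrow> det (shift n M z) = 0"
    and clo: "\<And>r Ms M zs z. \<lbrakk>strict_mono (r::nat\<Rightarrow>nat); \<And>l. Ms l \<in> carrier_mat n n; M \<in> carrier_mat n n;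
        mtendsto n Ms M sequentially; zs \<longlonglongrightarrow> z; \<And>l. V (r l) (Ms l) (zs l)\<rbrakk> \<Longrightarrow> W M z"
    and no: "\<And>k z. k \<in> S \<Longrightarrow> \<not> W (H k) z"
  shows "\<exists>j. \<forall>k\<in>S. \<forall>M\<in>carrier_mat n n. \<forall>z. mclose n (1 / Suc j) M (H k) \<longrightarrow> \<not> V j M z"
proof (rule ccontr)
  assume "\<not> ?thesis"
  then have "\<forall>j. \<exists>k M z. k \<in> S \<and> M \<in> carrier_mat n n \<and> mclose n (1 / Suc j) M (H k) \<and> V j M z"
    by blast
  then obtain k M z where k: "\<And>j. k j \<in> S" and M: "\<And>j. M j \<in> carrier_mat n n"
    and cl: "\<And>j. mclose n (1 / Suc j) (M j) (H (k j))" and V: "\<And>j. V j (M j) (z j)"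
    by metis
  have "\<exists>C. \<forall>x\<in>S. cmod (H x $$ (i,j)) \<le> C" if "i < n" "j < n" for i j
    using compact_imp_bounded[OF compact_continuous_image[OF cont[OF that] S]]
    unfolding bounded_iff by auto
  then obtain C where C: "\<And>i j x. i < n \<Longrightarrow> j < n \<Longrightarrow> x \<in> S \<Longrightarrow> cmod (H x $$ (i,j)) \<le> C i j"
    by metis
  define B where "B = (\<Sum>i<n. \<Sum>j<n. \<bar>C i j\<bar>) + 1"
  have B: "cmod (M l $$ (i,j)) \<le> B" if "i < n" "j < n" for i j l
  proof -
    have "cmod (M l $$ (i,j)) \<le> cmod (H (k l) $$ (i,j)) + cmod (M l $$ (i,j) - H (k l) $$ (i,j))"
      using norm_triangle_ineq[of "H (k l) $$ (i,j)" "M l $$ (i,j) - H (k l) $$ (i,j)"] by simp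
    also have "\<dots> \<le> \<bar>C i j\<bar> + 1"
    proof (intro add_mono)
      show "cmod (H (k l) $$ (i,j)) \<le> \<bar>C i j\<bar>" using C[OF that k] by (meson abs_ge_self order_trans)
      have "cmod (M l $$ (i,j) - H (k l) $$ (i,j)) < 1 / Suc l"
        using cl[of l] that unfolding mclose_def by blast
      also have "\<dots> \<le> 1" by simp
      finally show "cmod (M l $$ (i,j) - H (k l) $$ (i,j)) \<le> 1" by simp
    qed
    also have "\<bar>C i j\<bar> \<le> (\<Sum>j<n. \<bar>C i j\<bar>)"
      using that by (intro member_le_sum) auto
    also have "\<dots> \<le> (\<Sum>i<n. \<Sum>j<n. \<bar>C i j\<bar>)"
      using that by (intro member_le_sum[of i "{..<n}" "\<lambda>i. \<Sum>j<n. \<bar>C i j\<bar>"]) (auto intro!: sum_nonneg)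
    finally show ?thesis by (simp add: B_def)
  qed
  have zb: "z l \<in> cball 0 (of_nat n * B)" for l
    using eigenvalue_bound[OF M bnd[OF M V] B] by simp
  \<comment> \<open>Two successive extractions: the points of \<open>S\<close> converge along
    \<open>r\<close>, and the eigenvalues, confined to a ball, along the further subsequence
    \<open>q\<close>. The composed index is kept because \<open>V\<close> may depend on the
    scale.\<close>
  obtain x r where x: "x \<in> S" "strict_mono r" "(k \<circ> r) \<longlonglongrightarrow> x"
    using S k unfolding compact_def by metis
  obtain w q where w: "strict_mono q" "((z \<circ> r) \<circ> q) \<longlonglongrightarrow> w"
    using compact_cball[of "0::complex" "of_nat n * B"] zb unfolding compact_def
    by (metis comp_apply)
  have kx: "(\<lambda>l. k (r (q l))) \<longlonglongrightarrow> x" using LIMSEQ_subseq_LIMSEQ[OF x(3) w(1)] by (simp add: o_def)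
  have mono: "strict_mono (\<lambda>l. r (q l))" using x(2) w(1) by (simp add: strict_mono_def)
  have "mtendsto n (\<lambda>l. M (r (q l))) (H x) sequentially"
    unfolding mtendsto_def
  proof (intro allI impI)
    fix i j assume ij: "i < n" "j < n"
    have 1: "(\<lambda>l. H (k (r (q l))) $$ (i,j)) \<longlonglongrightarrow> H x $$ (i,j)"
      using cont[OF ij] k x(1) kx unfolding continuous_on_sequentially by (auto simp: o_def)
    have 2: "(\<lambda>l. M (r (q l)) $$ (i,j) - H (k (r (q l))) $$ (i,j)) \<longlonglongrightarrow> 0"
    proof (rule Lim_null_comparison)
      show "\<forall>\<^sub>F l in sequentially. cmod (M (r (q l)) $$ (i,j) - H (k (r (q l))) $$ (i,j)) \<le> 1 / Suc (r (q l))"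
        using cl ij unfolding mclose_def by (intro always_eventually) (auto intro: less_imp_le)
      show "(\<lambda>l. 1 / Suc (r (q l))) \<longlonglongrightarrow> 0"
        using LIMSEQ_subseq_LIMSEQ[OF lim_inverse_n' [THEN LIMSEQ_Suc] mono] by (simp add: o_def)
    qed
    show "(\<lambda>l. M (r (q l)) $$ (i,j)) \<longlonglongrightarrow> H x $$ (i,j)"
      using tendsto_add[OF 1 2] by simp
  qed
  then have "W (H x) w"
    using clo[OF mono, of "\<lambda>l. M (r (q l))" "H x" "\<lambda>l. z (r (q l))" w] M Hc V w(2) by (simp add: o_def)
  then show False using no x(1) by blast
qed

text \<open>In the limit, minors bounded by \<open>1 / Suc j\<close> all vanish, which
  \<open>no\<close> excludes. The result is simplicity with a margin: at every eigenvalue of every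
  nearby matrix some principal minor exceeds \<eta>, the same number measuring nearness.\<close>

lemma nondegen_uniform:
  fixes H :: "'a::metric_space \<Rightarrow> complex mat"
  assumes S: "compact S"
    and Hc: "\<And>k. H k \<in> carrier_mat n n"
    and cont: "\<And>i j. i < n \<Longrightarrow> j < n \<Longrightarrow> continuous_on S (\<lambda>k. H k $$ (i,j))"
    and no: "\<And>k z. k \<in> S \<Longrightarrow> \<not> degen n (shift n (H k) z)"
  shows "\<exists>\<eta>>0. \<forall>k\<in>S. \<forall>M\<in>carrier_mat n n. \<forall>z. mclose n \<eta> M (H k) \<longrightarrow> det (shift n M z) = 0 \<longrightarrow>
      (\<exists>a<n. cmod (det (pin n a (shift n M z))) > \<eta>)"
proof -
  let ?V = "\<lambda>j M z. det (shift n M z) = 0 \<and> (\<forall>a<n. cmod (det (pin n a (shift n M z))) \<le> 1 / Suc j)"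
  have "\<exists>j. \<forall>k\<in>S. \<forall>M\<in>carrier_mat n n. \<forall>z. mclose n (1 / Suc j) M (H k) \<longrightarrow> \<not> ?V j M z"
  proof (rule uniform_violation[where W = "\<lambda>M z. degen n (shift n M z)", OF S Hc cont])
    fix r :: "nat \<Rightarrow> nat" and Ms M zs z
    assume r: "strict_mono r" and Ms: "\<And>l. Ms l \<in> carrier_mat n n" and M: "M \<in> carrier_mat n n"
      and lim: "mtendsto n Ms M sequentially" "zs \<longlonglongrightarrow> z" and V: "\<And>l. ?V (r l) (Ms l) (zs l)"
    note sh = mtendsto_shift[OF Ms M lim]
    have "det (shift n M z) = 0"
      using tendsto_det[OF shift_carrier[OF Ms] shift_carrier[OF M] sh] V
      by (simp add: LIMSEQ_const_iff)
    moreover have "det (pin n a (shift n M z)) = 0" if "a < n" for a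
    proof -
      have 1: "(\<lambda>l. det (pin n a (shift n (Ms l) (zs l)))) \<longlonglongrightarrow> det (pin n a (shift n M z))"
        by (rule tendsto_det[OF pin_carrier pin_carrier mtendsto_pin[OF sh]])
      have "(\<lambda>l. det (pin n a (shift n (Ms l) (zs l)))) \<longlonglongrightarrow> 0"
      proof (rule Lim_null_comparison)
        show "\<forall>\<^sub>F l in sequentially. cmod (det (pin n a (shift n (Ms l) (zs l)))) \<le> 1 / Suc (r l)"
          using V that by (intro always_eventually) blast
        show "(\<lambda>l. 1 / Suc (r l)) \<longlonglongrightarrow> 0"
          using LIMSEQ_subseq_LIMSEQ[OF lim_inverse_n' [THEN LIMSEQ_Suc] r] by (simp add: o_def)
      qed
      then show ?thesis using 1 LIMSEQ_unique by blast
    qed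
    ultimately show "degen n (shift n M z)" by (simp add: degen_def)
  qed (use no in auto)
  then obtain j where j: "\<forall>k\<in>S. \<forall>M\<in>carrier_mat n n. \<forall>z. mclose n (1 / Suc j) M (H k) \<longrightarrow> \<not> ?V j M z"
    by blast
  show ?thesis
    using j by (intro exI[of _ "1 / Suc j"]) (auto simp: not_le)
qed

text \<open>The non-strict bound on the minor, the reality of \<open>z\<close> and degeneracy all
  pass to limits, so their joint absence is stable under small perturbations. This protects what was
  achieved for one index while another corner is perturbed.\<close>

lemma restricted_nondegen_uniform:
  fixes H :: "'a::metric_space \<Rightarrow> complex mat"
  assumes S: "compact S"
    and Hc: "\<And>k. H k \<in> carrier_mat (Suc n) (Suc n)"
    and cont: "\<And>i j. i < Suc n \<Longrightarrow> j < Suc n \<Longrightarrow> continuous_on S (\<lambda>k. H k $$ (i,j))"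
    and no: "\<And>k z. k \<in> S \<Longrightarrow> z \<in> \<real> \<Longrightarrow> cmod (det (pin n a (shift n (leading_block n (H k)) z))) \<ge> \<eta> \<Longrightarrow>
        \<not> degen (Suc n) (shift (Suc n) (H k) z)"
  shows "\<exists>d>0. \<forall>k\<in>S. \<forall>M\<in>carrier_mat (Suc n) (Suc n). \<forall>z\<in>\<real>. mclose (Suc n) d M (H k) \<longrightarrow>
      cmod (det (pin n a (shift n (leading_block n M) z))) \<ge> \<eta> \<longrightarrow> \<not> degen (Suc n) (shift (Suc n) M z)"
proof -
  let ?V = "\<lambda>M z. z \<in> \<real> \<and> cmod (det (pin n a (shift n (leading_block n M) z))) \<ge> \<eta> \<and> degen (Suc n) (shift (Suc n) M z)"
  have "\<exists>j. \<forall>k\<in>S. \<forall>M\<in>carrier_mat (Suc n) (Suc n). \<forall>z. mclose (Suc n) (1 / Suc j) M (H k) \<longrightarrow> \<not> ?V M z"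
  proof (rule uniform_violation[where W = ?V and V = "\<lambda>_. ?V", OF S Hc cont])
    fix r :: "nat \<Rightarrow> nat" and Ms M zs z
    assume Ms: "\<And>l. Ms l \<in> carrier_mat (Suc n) (Suc n)" and M: "M \<in> carrier_mat (Suc n) (Suc n)"
      and lim: "mtendsto (Suc n) Ms M sequentially" "zs \<longlonglongrightarrow> z" and V: "\<And>l. ?V (Ms l) (zs l)"
    note sh = mtendsto_shift[OF Ms M lim]
    have "det (shift (Suc n) M z) = 0"
      using tendsto_det[OF shift_carrier[OF Ms] shift_carrier[OF M] sh] V
      by (simp add: LIMSEQ_const_iff degen_def)
    moreover have "det (pin (Suc n) c (shift (Suc n) M z)) = 0" if "c < Suc n" for c
      using tendsto_det[OF pin_carrier pin_carrier mtendsto_pin[OF sh, of c]] V that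
      by (simp add: LIMSEQ_const_iff degen_def)
    moreover have "z \<in> \<real>"
      using closed_sequentially[OF closed_complex_Reals] V lim(2) by blast
    moreover have "cmod (det (pin n a (shift n (leading_block n M) z))) \<ge> \<eta>"
    proof (rule LIMSEQ_le_const)
      show "(\<lambda>l. cmod (det (pin n a (shift n (leading_block n (Ms l)) (zs l))))) \<longlonglongrightarrow> cmod (det (pin n a (shift n (leading_block n M) z)))"
        by (intro tendsto_norm tendsto_det[where n = n] pin_carrier mtendsto_pin mtendsto_shift leading_block_carrier mtendsto_leading_block lim)
    qed (use V in auto)
    ultimately show "?V M z" by (simp add: degen_def)
  qed (use no in \<open>auto simp: degen_def\<close>)
  then obtain j where "\<forall>k\<in>S. \<forall>M\<in>carrier_mat (Suc n) (Suc n). \<forall>z. mclose (Suc n) (1 / Suc j) M (H k) \<longrightarrow> \<not> ?V M z"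
    by blast
  then show ?thesis by (intro exI[of _ "1 / Suc j"]) auto
qed

section \<open>Generic Hermitian families\<close>

definition periodic :: "(real \<times> real \<Rightarrow> 'b) \<Rightarrow> bool" where
  "periodic f \<longleftrightarrow> (\<forall>k. \<forall>a b :: int. f (k + (of_int a, of_int b)) = f k)"

text \<open>Functions on the torus, lifted to the plane. Plain differentiability is what the
  negligibility of lower-dimensional images asks for.\<close>

definition periodic_diff :: "(real \<times> real \<Rightarrow> 'b::real_normed_vector) \<Rightarrow> bool" where
  "periodic_diff f \<longleftrightarrow> periodic f \<and> (\<forall>x. f differentiable (at x))"

section \<open>Differentiability of determinants and adjugates\<close>

lemma differentiable_prod_field:
  fixes f :: "'i \<Rightarrow> 'a::real_normed_vector \<Rightarrow> 'b::real_normed_field"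
  assumes "\<And>i. i \<in> I \<Longrightarrow> f i differentiable (at x)"
  shows "(\<lambda>x. \<Prod>i\<in>I. f i x) differentiable (at x)"
proof -
  define f' where "f' i = frechet_derivative (f i) (at x)" for i
  have "(f i has_derivative f' i) (at x)" if "i \<in> I" for i
    unfolding f'_def using assms[OF that] frechet_derivative_works by auto
  from has_derivative_prod[of I f f' x UNIV, OF this] show ?thesis by (rule differentiableI)
qed

lemma differentiable_det:
  fixes A :: "'a::real_normed_vector \<Rightarrow> complex mat"
  assumes A: "\<And>x. A x \<in> carrier_mat n n"
    and d: "\<And>i j. i < n \<Longrightarrow> j < n \<Longrightarrow> (\<lambda>x. A x $$ (i,j)) differentiable (at x)"
  shows "(\<lambda>x. det (A x)) differentiable (at x)"
proof -
  have "(\<lambda>x. A x $$ (i, p i)) differentiable (at x)" if "p permutes {0..<n}" "i \<in> {0..<n}" for p i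
    using d[of i "p i"] that permutes_in_image[OF that(1)] by simp
  then show ?thesis
    unfolding det_def'[OF A]
    by (intro differentiable_sum differentiable_mult differentiable_const differentiable_prod_field ballI)
      (auto simp: finite_permutations)
qed

lemma differentiable_adj:
  fixes A :: "'a::real_normed_vector \<Rightarrow> complex mat"
  assumes A: "\<And>x. A x \<in> carrier_mat n n"
    and d: "\<And>i j. i < n \<Longrightarrow> j < n \<Longrightarrow> (\<lambda>x. A x $$ (i,j)) differentiable (at x)"
    and ij: "i < n" "j < n"
  shows "(\<lambda>x. adj_mat (A x) $$ (i,j)) differentiable (at x)"
proof -
  have "(\<lambda>x. adj_mat (A x) $$ (i,j)) = (\<lambda>x. (-1)^(j+i) * det (mat_delete (A x) j i))"
    using carrier_matD[OF A] ij by (intro ext) (simp add: adj_mat_def cofactor_def)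
  moreover have "(\<lambda>x. det (mat_delete (A x) j i)) differentiable (at x)"
  proof (rule differentiable_det)
    show "mat_delete (A x) j i \<in> carrier_mat (n-1) (n-1)" for x by (rule mat_delete_carrier[OF A])
    fix i' j' assume "i' < n - 1" "j' < n - 1"
    then have "(\<lambda>x. mat_delete (A x) j i $$ (i',j')) =
        (\<lambda>x. A x $$ (if i' < j then i' else Suc i', if j' < i then j' else Suc j'))"
      using carrier_matD[OF A] unfolding mat_delete_def by (intro ext) auto
    then show "(\<lambda>x. mat_delete (A x) j i $$ (i',j')) differentiable (at x)"
      using d \<open>i' < n - 1\<close> \<open>j' < n - 1\<close> by auto
  qed
  ultimately show ?thesis by (auto intro!: differentiable_mult)
qed

text \<open>Cramer's rule; its explicit form makes the solution differentiable in the
  entries.\<close>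

lemma nullv_adj_solve:
  fixes A :: "complex mat"
  assumes A: "A \<in> carrier_mat n n" and d: "det A \<noteq> 0"
    and v: "\<And>i. i < n \<Longrightarrow> (\<Sum>j<n. A $$ (i,j) * v j) = b i" and j: "j < n"
  shows "v j = (\<Sum>i<n. adj_mat A $$ (j,i) * b i) / det A"
proof -
  have "(\<Sum>i<n. adj_mat A $$ (j,i) * b i) = (\<Sum>i<n. \<Sum>l<n. adj_mat A $$ (j,i) * (A $$ (i,l) * v l))"
    using v by (intro sum.cong refl) (simp add: sum_distrib_left flip: v)
  also have "\<dots> = (\<Sum>l<n. (\<Sum>i<n. adj_mat A $$ (j,i) * A $$ (i,l)) * v l)"
    by (subst sum.swap) (simp add: sum_distrib_right mult.assoc)
  also have "\<dots> = (\<Sum>l<n. (adj_mat A * A) $$ (j,l) * v l)"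
    using A adj_mat(1)[OF A] j by (intro sum.cong refl) (auto simp: scalar_prod_def lessThan_atLeast0)
  also have "\<dots> = (\<Sum>l<n. if l = j then det A * v j else 0)"
    unfolding adj_mat(3)[OF A] using j by (intro sum.cong) auto
  also have "\<dots> = det A * v j" using j by simp
  finally show ?thesis using d by (simp add: field_simps)
qed

definition hermitian :: "nat \<Rightarrow> complex mat \<Rightarrow> bool" where
  "hermitian n A \<longleftrightarrow> A \<in> carrier_mat n n \<and> (\<forall>i<n. \<forall>j<n. A $$ (j,i) = cnj (A $$ (i,j)))"

text \<open>A two-dimensional kernel contains a nonzero vector with last coordinate zero, which is
  then a null vector of the leading block. So degeneracies have to be excluded only at eigenvalues
  of that block.\<close>

lemma ker2_leading_block:
  assumes M: "M \<in> carrier_mat (Suc n) (Suc n)" and k: "ker2 (Suc n) (shift (Suc n) M z)"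
  shows "det (shift n (leading_block n M) z) = 0"
proof -
  obtain u where u: "nullv (Suc n) (shift (Suc n) M z) u" "u n = 0" "\<exists>i<Suc n. u i \<noteq> 0"
    using ker2_vanishing[OF k, of n] by auto
  have "nullv n (shift n (leading_block n M) z) u"
    unfolding nullv_def
  proof (intro allI impI)
    fix i assume i: "i < n"
    have "(\<Sum>j<n. shift n (leading_block n M) z $$ (i,j) * u j) = (\<Sum>j<n. shift (Suc n) M z $$ (i,j) * u j)"
      using i M by (intro sum.cong refl) (auto simp: leading_block_def)
    also have "\<dots> = 0" using u(1,2) i unfolding nullv_def by (auto simp: less_Suc_eq)
    finally show "(\<Sum>j<n. shift n (leading_block n M) z $$ (i,j) * u j) = 0" .
  qed
  moreover have "\<exists>i<n. u i \<noteq> 0" using u(2,3) by (metis less_SucE)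
  ultimately show ?thesis using det_zero_iff_nullv[OF shift_carrier[OF leading_block_carrier]] by blast
qed

lemma zero_sum3: "x + y + z = 0 \<Longrightarrow> x = - y - z" for x y z :: complex
proof -
  assume "x + y + z = 0"
  then have "(x + y + z) - y - z = - y - z" by simp
  then show ?thesis by simp
qed

text \<open>For \<open>b < n\<close> this is the general Hermitian matrix supported on rows and
  columns \<open>b\<close> and \<open>n\<close>. It has four real parameters, one more than
  \<open>(k, z)\<close>.\<close>

definition corner :: "nat \<Rightarrow> nat \<Rightarrow> real \<times> complex \<times> real \<Rightarrow> complex mat" where
  "corner n b p = mat (Suc n) (Suc n) (\<lambda>(i,j).
     if i = b \<and> j = b then of_real (fst p) else if i = n \<and> j = b then fst (snd p)
     else if i = b \<and> j = n then cnj (fst (snd p)) else if i = n \<and> j = n then of_real (snd (snd p)) else 0)"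

text \<open>If the block with rows and columns \<open>b\<close> and \<open>n\<close> removed is invertible, a kernel of dimension
  two determines the remaining \<open>2 \<times> 2\<close> block as a Schur complement.\<close>
lemma ker2_determines_corner:
  assumes M: "H \<in> carrier_mat (Suc n) (Suc n)" and b: "b < n"
    and N: "N = pin n b (shift n (leading_block n H) z)" and d: "det N \<noteq> 0"
    and k: "ker2 (Suc n) (shift (Suc n) (H + corner n b p) z)"
    and s1: "\<And>j. s1 j = (\<Sum>i<n. adj_mat N $$ (j,i) * (if i = b then 1 else - H $$ (i,b))) / det N"
    and s2: "\<And>j. s2 j = (\<Sum>i<n. adj_mat N $$ (j,i) * (if i = b then 0 else - H $$ (i,n))) / det N"
  shows "of_real (fst p) = z - H $$ (b,b) - (\<Sum>j\<in>{..<n} - {b}. H $$ (b,j) * s1 j)"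
    and "fst (snd p) = - H $$ (n,b) - (\<Sum>j\<in>{..<n} - {b}. H $$ (n,j) * s1 j)"
    and "of_real (snd (snd p)) = z - H $$ (n,n) - (\<Sum>j\<in>{..<n} - {b}. H $$ (n,j) * s2 j)"
proof -
  let ?M = "shift (Suc n) (H + corner n b p) z"
  have idx: "?M $$ (i,j) = H $$ (i,j) + corner n b p $$ (i,j) - (if i = j then z else 0)"
    if "i < Suc n" "j < Suc n" for i j
    using that M by (auto simp: corner_def)
  have Nc: "N \<in> carrier_mat n n" using N by simp
  have row: "(\<Sum>j<Suc n. f j) = (\<Sum>j\<in>{..<n} - {b}. f j) + f b + f n" for f :: "nat \<Rightarrow> complex"
    using b by (simp add: sum.remove[of "{..<n}" b f])
  \<comment> \<open>Row \<open>b\<close> of \<open>N\<close> is a unit vector; the other rows are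
    the kernel equations with the terms in columns \<open>b\<close> and \<open>n\<close> moved to
    the right-hand side.\<close>
  have Nrow: "(\<Sum>j<n. N $$ (i,j) * v j) = (if i = b then v b else - H $$ (i,b) * v b - H $$ (i,n) * v n)"
    if v: "nullv (Suc n) ?M v" and i: "i < n" for v i
  proof (cases "i = b")
    case True
    have "(\<Sum>j<n. N $$ (i,j) * v j) = (\<Sum>j<n. if j = b then v b else 0)"
      using True b by (intro sum.cong) (auto simp: N pin_def)
    then show ?thesis using True b by simp
  next
    case False
    have "(\<Sum>j<n. N $$ (i,j) * v j) = (\<Sum>j\<in>{..<n} - {b}. N $$ (i,j) * v j) + N $$ (i,b) * v b"
      using b by (simp add: sum.remove[of "{..<n}" b])
    also have "N $$ (i,b) = 0" using False i b by (simp add: N pin_def)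
    also have "(\<Sum>j\<in>{..<n} - {b}. N $$ (i,j) * v j) = (\<Sum>j\<in>{..<n} - {b}. ?M $$ (i,j) * v j)"
      using False i M by (intro sum.cong) (auto simp: N pin_def leading_block_def corner_def)
    also have "\<dots> = - ?M $$ (i,b) * v b - ?M $$ (i,n) * v n"
    proof -
      have "(\<Sum>j<Suc n. ?M $$ (i,j) * v j) = 0" using v[unfolded nullv_def, rule_format, of i] i by linarith
      then show ?thesis
        using zero_sum3[of "\<Sum>j\<in>{..<n} - {b}. ?M $$ (i,j) * v j" "?M $$ (i,b) * v b" "?M $$ (i,n) * v n"]
        unfolding row by simp
    qed
    also have "?M $$ (i,b) = H $$ (i,b)" using i b False by (subst idx) (auto simp: corner_def)
    also have "?M $$ (i,n) = H $$ (i,n)" using i b False by (subst idx) (auto simp: corner_def)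
    finally show ?thesis using False by simp
  qed
  have zero: "v b \<noteq> 0 \<or> v n \<noteq> 0" if v: "nullv (Suc n) ?M v" "\<exists>i<Suc n. v i \<noteq> 0" for v
  proof (rule ccontr)
    assume c: "\<not> ?thesis"
    have "nullv n N v" unfolding nullv_def using Nrow[OF v(1)] c by auto
    moreover have "\<exists>i<n. v i \<noteq> 0" using v(2) c by (metis less_SucE)
    ultimately show False using d det_zero_iff_nullv[OF Nc] by blast
  qed
  have scale: "nullv (Suc n) ?M (\<lambda>i. v i / c)" if "nullv (Suc n) ?M v" for v c
    using nullv_lincomb[OF that that, of "1 / c" 0] by simp
  \<comment> \<open>Coordinates \<open>b\<close> and \<open>n\<close> are normalised to (1, 0) and,
    for \<open>w\<close> below, to (0, 1). The invertible \<open>N\<close> then determines all other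
    coordinates, which are \<open>s1\<close> and \<open>s2\<close>.\<close>
  obtain v where v: "nullv (Suc n) ?M v" "v b = 1" "v n = 0"
  proof -
    obtain u where u: "nullv (Suc n) ?M u" "u n = 0" "\<exists>i<Suc n. u i \<noteq> 0"
      using ker2_vanishing[OF k, of n] by auto
    then show thesis using zero[OF u(1,3)] scale[OF u(1), of "u b"] that[of "\<lambda>i. u i / u b"] by simp
  qed
  obtain w where w: "nullv (Suc n) ?M w" "w b = 0" "w n = 1"
  proof -
    obtain u where u: "nullv (Suc n) ?M u" "u b = 0" "\<exists>i<Suc n. u i \<noteq> 0"
      using ker2_vanishing[OF k, of b] b by auto
    then show thesis using zero[OF u(1,3)] scale[OF u(1), of "u n"] that[of "\<lambda>i. u i / u n"] by simp
  qed
  have vs: "v j = s1 j" if "j < n" for j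
    unfolding s1 by (rule nullv_adj_solve[OF Nc d _ that]) (use Nrow[OF v(1)] v in auto)
  have ws: "w j = s2 j" if "j < n" for j
    unfolding s2 by (rule nullv_adj_solve[OF Nc d _ that]) (use Nrow[OF w(1)] w in auto)
  have rowz: "(\<Sum>j\<in>{..<n} - {b}. H $$ (i,j) * u j) + ?M $$ (i,b) * u b + ?M $$ (i,n) * u n = 0"
    if u: "nullv (Suc n) ?M u" and i: "i = b \<or> i = n" for i u
  proof -
    have "(\<Sum>j<Suc n. ?M $$ (i,j) * u j) = 0"
      using u[unfolded nullv_def, rule_format, of i] i b by linarith
    moreover have "(\<Sum>j\<in>{..<n} - {b}. ?M $$ (i,j) * u j) = (\<Sum>j\<in>{..<n} - {b}. H $$ (i,j) * u j)"
      using i b by (intro sum.cong refl) (subst idx, auto simp: corner_def)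
    ultimately show ?thesis unfolding row by simp
  qed
  have svs: "(\<Sum>j\<in>{..<n} - {b}. H $$ (i,j) * v j) = (\<Sum>j\<in>{..<n} - {b}. H $$ (i,j) * s1 j)" for i
    using vs by (intro sum.cong) auto
  have sws: "(\<Sum>j\<in>{..<n} - {b}. H $$ (i,j) * w j) = (\<Sum>j\<in>{..<n} - {b}. H $$ (i,j) * s2 j)" for i
    using ws by (intro sum.cong) auto
  have Mbb: "?M $$ (b,b) = H $$ (b,b) + of_real (fst p) - z"
    using b by (subst idx) (auto simp: corner_def)
  have Mnb: "?M $$ (n,b) = H $$ (n,b) + fst (snd p)"
    using b by (subst idx) (auto simp: corner_def)
  have Mnn: "?M $$ (n,n) = H $$ (n,n) + of_real (snd (snd p)) - z"
    using b by (subst idx) (auto simp: corner_def)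
  have solve: "p = z - h - S" if "S + (h + p - z) = 0" for p z h S :: complex
  proof -
    have "p = (S + (h + p - z)) + z - h - S" by simp
    then show ?thesis unfolding that by simp
  qed
  show "of_real (fst p) = z - H $$ (b,b) - (\<Sum>j\<in>{..<n} - {b}. H $$ (b,j) * s1 j)"
    by (rule solve) (use rowz[OF v(1), of b] v(2,3) in \<open>unfold svs Mbb, simp\<close>)
  have "fst (snd p) = 0 - H $$ (n,b) - (\<Sum>j\<in>{..<n} - {b}. H $$ (n,j) * s1 j)"
    by (rule solve) (use rowz[OF v(1), of n] v(2,3) in \<open>unfold svs Mnb, simp\<close>)
  then show "fst (snd p) = - H $$ (n,b) - (\<Sum>j\<in>{..<n} - {b}. H $$ (n,j) * s1 j)" by simp
  show "of_real (snd (snd p)) = z - H $$ (n,n) - (\<Sum>j\<in>{..<n} - {b}. H $$ (n,j) * s2 j)"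
    by (rule solve) (use rowz[OF w(1), of n] w(2,3) in \<open>unfold sws Mnn, simp\<close>)
qed

text \<open>The corner blocks admitting a double eigenvalue are the image of the three parameters
  \<open>(k, z)\<close> in a four-dimensional space, hence negligible.\<close>
lemma generic_corner:
  assumes H: "\<And>k. H k \<in> carrier_mat (Suc n) (Suc n)"
    and diff: "\<And>i j k. i < Suc n \<Longrightarrow> j < Suc n \<Longrightarrow> (\<lambda>k::real\<times>real. H k $$ (i,j)) differentiable (at k)"
    and b: "b < n" and \<delta>: "\<delta> > 0"
  obtains p where "norm p < \<delta>"
    "\<And>k z. det (pin n b (shift n (leading_block n (H k)) (of_real z))) \<noteq> 0 \<Longrightarrow>
      \<not> ker2 (Suc n) (shift (Suc n) (H k + corner n b p) (of_real z))"
proof -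
  define N where "N y = pin n b (shift n (leading_block n (H (fst y))) (of_real (snd y)))" for y :: "(real \<times> real) \<times> real"
  define s1 where "s1 y j = (\<Sum>i<n. adj_mat (N y) $$ (j,i) * (if i = b then 1 else - H (fst y) $$ (i,b))) / det (N y)" for y :: "(real \<times> real) \<times> real" and j
  define s2 where "s2 y j = (\<Sum>i<n. adj_mat (N y) $$ (j,i) * (if i = b then 0 else - H (fst y) $$ (i,n))) / det (N y)" for y :: "(real \<times> real) \<times> real" and j
  \<comment> \<open>The corner forced by a double eigenvalue at \<open>y = (k, z)\<close>, as in
    \<open>ker2_determines_corner\<close>. \<open>Re\<close> makes the two diagonal entries real for
    every \<open>y\<close>; at an actual double eigenvalue it changes nothing.\<close>
  define f where "f y = (Re (of_real (snd y) - H (fst y) $$ (b,b) - (\<Sum>j\<in>{..<n} - {b}. H (fst y) $$ (b,j) * s1 y j)),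
     - H (fst y) $$ (n,b) - (\<Sum>j\<in>{..<n} - {b}. H (fst y) $$ (n,j) * s1 y j),
     Re (of_real (snd y) - H (fst y) $$ (n,n) - (\<Sum>j\<in>{..<n} - {b}. H (fst y) $$ (n,j) * s2 y j)))" for y :: "(real \<times> real) \<times> real"
  define G where "G = {y :: (real \<times> real) \<times> real. det (N y) \<noteq> 0}"
  have dH: "(\<lambda>y. H (fst y) $$ (i,j)) differentiable (at y)"
    if "i < Suc n" "j < Suc n" for i j and y :: "(real \<times> real) \<times> real"
  proof -
    have "fst differentiable (at y)" by (intro linear_imp_differentiable linear_fst)
    from differentiable_chain_at[OF this diff[OF that]] show ?thesis by (simp add: o_def)
  qed
  have dz: "(\<lambda>y. complex_of_real (snd y)) differentiable (at y)" for y :: "(real \<times> real) \<times> real"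
    by (intro linear_imp_differentiable bounded_linear.linear
        bounded_linear_compose[OF bounded_linear_of_real bounded_linear_snd])
  have Nc: "N y \<in> carrier_mat n n" for y by (simp add: N_def)
  have dN: "(\<lambda>y. N y $$ (i,j)) differentiable (at y)" if "i < n" "j < n" for i j and y :: "(real \<times> real) \<times> real"
  proof -
    consider "i = b \<or> j = b" | "i \<noteq> b" "j \<noteq> b" "i = j" | "i \<noteq> b" "j \<noteq> b" "i \<noteq> j" by blast
    then show ?thesis
    proof cases
      case 1 then show ?thesis using that by (auto simp: N_def pin_def)
    next
      case 2
      then have "(\<lambda>y. N y $$ (i,j)) = (\<lambda>y. H (fst y) $$ (i,j) - complex_of_real (snd y))"
        using that by (auto simp: N_def pin_def leading_block_def)
      then show ?thesis using dH[of i j] dz that by (auto intro!: differentiable_diff)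
    next
      case 3
      then have "(\<lambda>y. N y $$ (i,j)) = (\<lambda>y. H (fst y) $$ (i,j))"
        using that by (auto simp: N_def pin_def leading_block_def)
      then show ?thesis using dH[of i j] that by auto
    qed
  qed
  have db: "(\<lambda>y. if i = b then c else - H (fst y) $$ (i,l)) differentiable (at y)"
    if "i < n" "l < Suc n" for i l c and y :: "(real \<times> real) \<times> real"
    using dH[of i l y] that by (cases "i = b") auto
  have ds1: "(\<lambda>y. s1 y j) differentiable (at y)" if "y \<in> G" "j < n" for y j
    unfolding s1_def using that b
    by (intro differentiable_divide differentiable_sum ballI differentiable_mult db
        differentiable_adj[OF Nc dN] differentiable_det[OF Nc dN]) (auto simp: G_def)
  have ds2: "(\<lambda>y. s2 y j) differentiable (at y)" if "y \<in> G" "j < n" for y j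
    unfolding s2_def using that b
    by (intro differentiable_divide differentiable_sum ballI differentiable_mult db
        differentiable_adj[OF Nc dN] differentiable_det[OF Nc dN]) (auto simp: G_def)
  have dRe: "(\<lambda>y. Re (g y)) differentiable (at y)" if "g differentiable (at y)"
    for g :: "(real \<times> real) \<times> real \<Rightarrow> complex" and y
    using differentiable_chain_at[OF that, of Re] linear_imp_differentiable[OF bounded_linear.linear[OF bounded_linear_Re]]
    by (simp add: o_def)
  have dPair: "(\<lambda>y. (g y, h y)) differentiable (at y)" if "g differentiable (at y)" "h differentiable (at y)"
    for g :: "(real \<times> real) \<times> real \<Rightarrow> 'u::real_normed_vector" and h :: "(real \<times> real) \<times> real \<Rightarrow> 'v::real_normed_vector" and y
    using that has_derivative_Pair unfolding differentiable_def by blast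
  have df: "f differentiable_on G"
    unfolding differentiable_on_def
  proof
    fix y assume y: "y \<in> G"
    have "f differentiable (at y)"
      unfolding f_def using y b
      by (intro dPair dRe differentiable_diff differentiable_sum ballI differentiable_mult differentiable_minus dH dz ds1 ds2) auto
    then show "f differentiable (at y within G)" by (rule differentiable_at_withinI)
  qed
  have neg: "negligible (f ` G)"
    by (rule negligible_differentiable_image_lowdim[OF _ df]) simp
  have "\<not> ball 0 \<delta> \<subseteq> f ` G"
    using negligible_subset[OF neg] open_not_negligible[OF open_ball, of "0 :: real \<times> complex \<times> real" \<delta>] \<delta> by auto
  then obtain p where p: "p \<in> ball 0 \<delta>" "p \<notin> f ` G" by blast
  show thesis
  proof (rule that)
    show "norm p < \<delta>" using p by simp
    fix k :: "real \<times> real" and z :: real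
    assume d: "det (pin n b (shift n (leading_block n (H k)) (of_real z))) \<noteq> 0"
    show "\<not> ker2 (Suc n) (shift (Suc n) (H k + corner n b p) (of_real z))"
    proof
      assume k2: "ker2 (Suc n) (shift (Suc n) (H k + corner n b p) (of_real z))"
      let ?y = "(k, z)"
      have N': "N ?y = pin n b (shift n (leading_block n (H k)) (of_real z))" by (simp add: N_def)
      have dN': "det (N ?y) \<noteq> 0" using d by (simp add: N')
      have e1: "s1 ?y j = (\<Sum>i<n. adj_mat (N ?y) $$ (j,i) * (if i = b then 1 else - H k $$ (i,b))) / det (N ?y)"
       and e2: "s2 ?y j = (\<Sum>i<n. adj_mat (N ?y) $$ (j,i) * (if i = b then 0 else - H k $$ (i,n))) / det (N ?y)" for j
        by (simp_all only: s1_def s2_def fst_conv)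
      note c = ker2_determines_corner[OF H b N' dN' k2 e1 e2]
      have "fst p = Re (of_real (fst p))" "snd (snd p) = Re (of_real (snd (snd p)))" by simp_all
      then have "p = f ?y" unfolding f_def c[symmetric] fst_conv snd_conv by (simp add: prod_eq_iff)
      moreover have "?y \<in> G" using dN' by (simp add: G_def)
      ultimately show False using p(2) by blast
    qed
  qed
qed

section \<open>Hermitian matrices\<close>

lemma hermitian_carrier: "hermitian n A \<Longrightarrow> A \<in> carrier_mat n n"
  by (simp add: hermitian_def)

lemma hermitianD: "hermitian n A \<Longrightarrow> i < n \<Longrightarrow> j < n \<Longrightarrow> cnj (A $$ (i,j)) = A $$ (j,i)"
  unfolding hermitian_def by metis

lemma hermitianI:
  "A \<in> carrier_mat n n \<Longrightarrow> (\<And>i j. i < n \<Longrightarrow> j < n \<Longrightarrow> A $$ (j,i) = cnj (A $$ (i,j))) \<Longrightarrow> hermitian n A"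
  unfolding hermitian_def by blast

lemma hermitian_eigenvalue_real:
  assumes A: "hermitian n A" and d: "det (shift n A z) = 0"
  shows "z \<in> \<real>"
proof -
  note Ac = hermitian_carrier[OF A]
  obtain v i0 where v: "nullv n (shift n A z) v" and i0: "i0 < n" "v i0 \<noteq> 0"
    using d det_zero_iff_nullv[OF shift_carrier[OF Ac]] by blast
  have ev: "(\<Sum>j<n. A $$ (i,j) * v j) = z * v i" if i: "i < n" for i
  proof -
    have "(\<Sum>j<n. shift n A z $$ (i,j) * v j) = (\<Sum>j<n. A $$ (i,j) * v j - (if j = i then z * v i else 0))"
      using i by (intro sum.cong refl) (auto simp: shift_index[OF Ac] algebra_simps simp del: index_minus_mat)
    also have "\<dots> = (\<Sum>j<n. A $$ (i,j) * v j) - z * v i" using i by (simp add: sum_subtractf)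
    finally show ?thesis using v i by (simp add: nullv_def)
  qed
  define q where "q = (\<Sum>i<n. \<Sum>j<n. cnj (v i) * (A $$ (i,j) * v j))"
  have "q = (\<Sum>i<n. cnj (v i) * (z * v i))"
    unfolding q_def by (intro sum.cong refl) (simp add: sum_distrib_left flip: ev)
  also have "\<dots> = (\<Sum>i<n. z * of_real ((cmod (v i))\<^sup>2))"
    by (intro sum.cong refl) (simp only: complex_norm_square ac_simps)
  also have "\<dots> = z * of_real (\<Sum>i<n. (cmod (v i))\<^sup>2)"
    by (simp only: of_real_sum sum_distrib_left)
  finally have q1: "q = z * of_real (\<Sum>i<n. (cmod (v i))\<^sup>2)" .
  have "cnj q = (\<Sum>i<n. \<Sum>j<n. cnj (v j) * (A $$ (j,i) * v i))"
    unfolding q_def cnj_sum using A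
    by (intro sum.cong refl) (simp add: hermitianD)
  also have "\<dots> = q" unfolding q_def by (rule sum.swap)
  finally have "q \<in> \<real>" by (simp add: Reals_cnj_iff)
  moreover have pos: "(\<Sum>i<n. (cmod (v i))\<^sup>2) > 0"
    using i0 by (intro sum_pos2[of _ i0]) auto
  ultimately have "q / of_real (\<Sum>i<n. (cmod (v i))\<^sup>2) \<in> \<real>"
    by (intro Reals_divide Reals_of_real)
  moreover have "q / of_real (\<Sum>i<n. (cmod (v i))\<^sup>2) = z"
    unfolding q1 using pos by (simp del: of_real_sum)
  ultimately show ?thesis by simp
qed

text \<open>The eigenvalue \<open>z\<close> is real, so \<open>A - z\<close> is itself Hermitian and
  the adjoint condition of \<open>degen_imp_ker2\<close> is immediate.\<close>

lemma hermitian_degen_imp_ker2: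
  assumes A: "hermitian n A" and d: "degen n (shift n A z)"
  shows "ker2 n (shift n A z)"
proof (rule degen_imp_ker2[OF shift_carrier[OF hermitian_carrier[OF A]] d])
  fix u assume u: "nullv n (shift n A z) u"
  have z: "cnj z = z" using hermitian_eigenvalue_real[OF A] d by (simp add: degen_def Reals_cnj_iff)
  show "\<forall>j<n. (\<Sum>i<n. cnj (shift n A z $$ (i,j)) * u i) = 0"
  proof (intro allI impI)
    fix j assume j: "j < n"
    have "(\<Sum>i<n. cnj (shift n A z $$ (i,j)) * u i) = (\<Sum>i<n. shift n A z $$ (j,i) * u i)"
      using j z A by (intro sum.cong refl)
        (auto simp: shift_index[OF hermitian_carrier[OF A]] hermitianD simp del: index_minus_mat)
    then show "(\<Sum>i<n. cnj (shift n A z $$ (i,j)) * u i) = 0" using u j by (simp add: nullv_def)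
  qed
qed

section \<open>Approximation by differentiable periodic functions\<close>

lemma periodic_diff_const [intro]: "periodic_diff (\<lambda>k. c)"
  by (simp add: periodic_diff_def periodic_def)

lemma periodic_diff_add [intro]: "periodic_diff f \<Longrightarrow> periodic_diff g \<Longrightarrow> periodic_diff (\<lambda>k. f k + g k)"
  by (simp add: periodic_diff_def periodic_def)

lemma periodic_diff_mult [intro]:
  fixes f :: "real \<times> real \<Rightarrow> 'a::real_normed_algebra"
  shows "periodic_diff f \<Longrightarrow> periodic_diff g \<Longrightarrow> periodic_diff (\<lambda>k. f k * g k)"
  by (simp add: periodic_diff_def periodic_def)

lemma periodic_diff_linear:
  assumes "bounded_linear h" "periodic_diff f"
  shows "periodic_diff (\<lambda>k. h (f k))"
  using assms differentiable_chain_at[of f _ h] bounded_linear_imp_differentiable[OF assms(1)]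
  unfolding periodic_diff_def periodic_def o_def by simp

lemma periodic_diff_of_real [intro]: "periodic_diff f \<Longrightarrow> periodic_diff (\<lambda>k. complex_of_real (f k))"
  by (rule periodic_diff_linear[OF bounded_linear_of_real])

lemma periodic_diff_cnj [intro]: "periodic_diff f \<Longrightarrow> periodic_diff (\<lambda>k. cnj (f k))"
  by (rule periodic_diff_linear[OF bounded_linear_cnj])

lemma periodic_diff_differentiable: "periodic_diff f \<Longrightarrow> f differentiable (at k)"
  unfolding periodic_diff_def by blast

lemma periodic_diff_continuous: "periodic_diff f \<Longrightarrow> continuous_on S f"
  using differentiable_imp_continuous_within by (fastforce simp: periodic_diff_def intro: continuous_at_imp_continuous_on)

text \<open>The point-separation hypothesis of Stone-Weierstrass for periodic functions. It fails as
  soon as two points of \<open>S\<close> differ by a lattice vector, so \<open>S\<close> may contain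
  at most one point of each class modulo the lattice.\<close>

definition separated :: "(real \<times> real) set \<Rightarrow> bool" where
  "separated S \<longleftrightarrow> compact S \<and> (\<forall>x\<in>S. \<forall>y\<in>S. x \<noteq> y \<longrightarrow> (\<exists>f :: real \<times> real \<Rightarrow> real. periodic_diff f \<and> f x \<noteq> f y))"

lemma approx_periodic_diff_real:
  fixes f :: "real \<times> real \<Rightarrow> real"
  assumes S: "separated S" and f: "continuous_on S f" and e: "e > 0"
  obtains g :: "real \<times> real \<Rightarrow> real" where "periodic_diff g" "\<And>k. k \<in> S \<Longrightarrow> \<bar>f k - g k\<bar> < e"
proof -
  have "\<exists>g. periodic_diff g \<and> (\<forall>k\<in>S. \<bar>f k - g k\<bar> < e)"
  proof (rule Stone_Weierstrass_HOL[where P = periodic_diff, OF _ _ _ _ _ _ f e])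
    show "compact S" using S by (simp add: separated_def)
    show "\<exists>f :: real \<times> real \<Rightarrow> real. periodic_diff f \<and> f x \<noteq> f y" if "x \<in> S \<and> y \<in> S \<and> x \<noteq> y" for x y
      using S that unfolding separated_def by blast
  qed (auto intro: periodic_diff_continuous)
  then show thesis using that by blast
qed

lemma approx_periodic_diff_complex:
  fixes f :: "real \<times> real \<Rightarrow> complex"
  assumes S: "separated S" and f: "continuous_on S f" and e: "e > 0"
  shows "\<exists>g. periodic_diff g \<and> (\<forall>k\<in>S. cmod (g k - f k) < e)"
proof -
  obtain u where u: "periodic_diff u" "\<And>k. k \<in> S \<Longrightarrow> \<bar>Re (f k) - u k\<bar> < e / 2"
    by (rule approx_periodic_diff_real[OF S, of "\<lambda>k. Re (f k)" "e / 2"]) (use f e in \<open>auto intro!: continuous_intros\<close>)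
  obtain v where v: "periodic_diff v" "\<And>k. k \<in> S \<Longrightarrow> \<bar>Im (f k) - v k\<bar> < e / 2"
    by (rule approx_periodic_diff_real[OF S, of "\<lambda>k. Im (f k)" "e / 2"]) (use f e in \<open>auto intro!: continuous_intros\<close>)
  let ?g = "\<lambda>k. complex_of_real (u k) + \<i> * complex_of_real (v k)"
  have "cmod (?g k - f k) < e" if "k \<in> S" for k
  proof -
    have "cmod (?g k - f k) \<le> \<bar>Re (f k) - u k\<bar> + \<bar>Im (f k) - v k\<bar>"
      using cmod_le[of "?g k - f k"] by (simp add: abs_minus_commute)
    then show ?thesis using u(2)[OF that] v(2)[OF that] by linarith
  qed
  then show ?thesis
    using periodic_diff_add[OF periodic_diff_of_real[OF u(1)] periodic_diff_mult[OF periodic_diff_const periodic_diff_of_real[OF v(1)], of \<i>]] by blast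
qed

section \<open>Size and symmetry of corner perturbations\<close>

lemma norm_le_triple:
  fixes p :: "real \<times> complex \<times> real"
  shows "\<bar>fst p\<bar> \<le> norm p" "cmod (fst (snd p)) \<le> norm p" "\<bar>snd (snd p)\<bar> \<le> norm p"
proof -
  obtain a b c where p: "p = (a, b, c)" by (rule prod_cases3)
  have "norm b \<le> norm (b, c)" "norm c \<le> norm (b, c)" "norm (b, c) \<le> norm p" "norm a \<le> norm p"
    unfolding p by (rule norm_fst_le norm_snd_le)+
  then show "\<bar>fst p\<bar> \<le> norm p" "cmod (fst (snd p)) \<le> norm p" "\<bar>snd (snd p)\<bar> \<le> norm p"
    unfolding p fst_conv snd_conv real_norm_def by linarith+
qed

lemma corner_index:
  assumes "i < Suc n" "j < Suc n"
  shows "cmod (corner n b p $$ (i,j)) \<le> norm p"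
proof -
  have "corner n b p $$ (i,j) = (if i = b \<and> j = b then of_real (fst p) else if i = n \<and> j = b then fst (snd p)
     else if i = b \<and> j = n then cnj (fst (snd p)) else if i = n \<and> j = n then of_real (snd (snd p)) else 0)"
    unfolding corner_def index_mat(1)[OF assms] prod.case ..
  then consider "corner n b p $$ (i,j) = of_real (fst p)" | "corner n b p $$ (i,j) = fst (snd p)"
    | "corner n b p $$ (i,j) = cnj (fst (snd p))" | "corner n b p $$ (i,j) = of_real (snd (snd p))"
    | "corner n b p $$ (i,j) = 0" by meson
  then show ?thesis
    using norm_le_triple[of p] by cases (simp_all only: norm_of_real complex_mod_cnj norm_zero norm_ge_zero)
qed

lemma corner_hermitian:
  assumes b: "b < n" and A: "hermitian (Suc n) A"
  shows "hermitian (Suc n) (A + corner n b p)"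
proof (rule hermitianI)
  show "A + corner n b p \<in> carrier_mat (Suc n) (Suc n)"
    using hermitian_carrier[OF A] by (auto simp: corner_def)
  fix i j assume ij: "i < Suc n" "j < Suc n"
  have "(A + corner n b p) $$ (j,i) = A $$ (j,i) + corner n b p $$ (j,i)"
    using ij by (simp add: corner_def)
  also have "\<dots> = cnj (A $$ (i,j) + corner n b p $$ (i,j))"
  proof -
    have "b \<noteq> n" using b by simp
    then have "corner n b p $$ (j,i) = cnj (corner n b p $$ (i,j))"
      unfolding corner_def index_mat(1)[OF ij] index_mat(1)[OF ij(2,1)] prod.case by (cases "i = b"; cases "j = b"; cases "i = n"; cases "j = n") simp_all
    then show ?thesis by (simp only: complex_cnj_add hermitianD[OF A ij])
  qed
  also have "A $$ (i,j) + corner n b p $$ (i,j) = (A + corner n b p) $$ (i,j)"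
    using ij by (simp add: corner_def)
  finally show "(A + corner n b p) $$ (j,i) = cnj ((A + corner n b p) $$ (i,j))" .
qed

lemma pin_corner:
  assumes "b < n" "A \<in> carrier_mat (Suc n) (Suc n)"
  shows "pin n b (shift n (leading_block n (A + corner n b p)) z) = pin n b (shift n (leading_block n A) z)"
  using assms by (intro eq_matI) (auto simp: pin_def leading_block_def corner_def)

lemma mclose_self_corner:
  assumes "A \<in> carrier_mat (Suc n) (Suc n)" "norm p < d"
  shows "mclose (Suc n) d (A + corner n b p) A"
  unfolding mclose_def
proof (intro allI impI)
  fix i j assume ij: "i < Suc n" "j < Suc n"
  have "(A + corner n b p) $$ (i,j) - A $$ (i,j) = corner n b p $$ (i,j)"
    using assms(1) ij by (auto simp: corner_def)
  then show "cmod ((A + corner n b p) $$ (i,j) - A $$ (i,j)) < d"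
    using corner_index[OF ij, of b p] assms(2) by simp
qed

text \<open>Given a family whose leading block has simple spectrum, the corners are perturbed one at a
  time; the quantitative lower bound \<open>\<eta>\<close> makes every step an open condition.\<close>
lemma generic_corners:
  fixes \<eta> \<sigma> :: real
  assumes S: "compact S"
    and Hh: "\<And>k. hermitian (Suc n) (H k)"
    and Hp: "\<And>i j. i < Suc n \<Longrightarrow> j < Suc n \<Longrightarrow> periodic_diff (\<lambda>k. H k $$ (i,j))"
    and \<eta>: "\<eta> > 0" and \<sigma>: "\<sigma> > 0"
  shows "b \<le> n \<Longrightarrow> \<exists>G. (\<forall>k. hermitian (Suc n) (G k)) \<and> (\<forall>i<Suc n. \<forall>j<Suc n. periodic_diff (\<lambda>k. G k $$ (i,j))) \<and>
     (\<forall>k. mclose (Suc n) (\<sigma> * Suc b) (G k) (H k)) \<and>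
     (\<forall>a<b. \<forall>k\<in>S. \<forall>z\<in>\<real>. cmod (det (pin n a (shift n (leading_block n (G k)) z))) \<ge> \<eta> \<longrightarrow>
        \<not> degen (Suc n) (shift (Suc n) (G k) z))"
proof (induction b)
  case 0
  show ?case using Hh Hp \<sigma> by (intro exI[of _ H]) (auto simp: mclose_def)
next
  case (Suc b)
  from Suc.IH[OF Suc_leD[OF Suc.prems]] obtain G where
    G: "\<forall>k. hermitian (Suc n) (G k)" "\<forall>i<Suc n. \<forall>j<Suc n. periodic_diff (\<lambda>k. G k $$ (i,j))"
      "\<forall>k. mclose (Suc n) (\<sigma> * Suc b) (G k) (H k)"
      "\<forall>a<b. \<forall>k\<in>S. \<forall>z\<in>\<real>. cmod (det (pin n a (shift n (leading_block n (G k)) z))) \<ge> \<eta> \<longrightarrow>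
        \<not> degen (Suc n) (shift (Suc n) (G k) z)" by (elim exE conjE)
  have Gh: "hermitian (Suc n) (G k)" and Gc: "mclose (Suc n) (\<sigma> * Suc b) (G k) (H k)" for k
    using G(1,3) by blast+
  have Gp: "periodic_diff (\<lambda>k. G k $$ (i,j))" if "i < Suc n" "j < Suc n" for i j
    using G(2) that by blast
  have Gn: "\<not> degen (Suc n) (shift (Suc n) (G k) z)"
    if "a < b" "k \<in> S" "z \<in> \<real>" "cmod (det (pin n a (shift n (leading_block n (G k)) z))) \<ge> \<eta>" for a k z
    using G(4) that by blast
  have b: "b < n" using Suc.prems by simp
  have "\<forall>a\<in>{..<b}. \<exists>d>0. \<forall>k\<in>S. \<forall>M\<in>carrier_mat (Suc n) (Suc n). \<forall>z\<in>\<real>. mclose (Suc n) d M (G k) \<longrightarrow>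
      cmod (det (pin n a (shift n (leading_block n M) z))) \<ge> \<eta> \<longrightarrow> \<not> degen (Suc n) (shift (Suc n) M z)"
  proof
    fix a assume "a \<in> {..<b}"
    then show "\<exists>d>0. \<forall>k\<in>S. \<forall>M\<in>carrier_mat (Suc n) (Suc n). \<forall>z\<in>\<real>. mclose (Suc n) d M (G k) \<longrightarrow>
      cmod (det (pin n a (shift n (leading_block n M) z))) \<ge> \<eta> \<longrightarrow> \<not> degen (Suc n) (shift (Suc n) M z)"
      by (intro restricted_nondegen_uniform[OF S hermitian_carrier[OF Gh] periodic_diff_continuous[OF Gp]])
        (use Gn in auto)
  qed
  from bchoice[OF this] obtain d where dd: "\<forall>a\<in>{..<b}. d a > 0 \<and> (\<forall>k\<in>S. \<forall>M\<in>carrier_mat (Suc n) (Suc n). \<forall>z\<in>\<real>.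
      mclose (Suc n) (d a) M (G k) \<longrightarrow> cmod (det (pin n a (shift n (leading_block n M) z))) \<ge> \<eta> \<longrightarrow>
      \<not> degen (Suc n) (shift (Suc n) M z))" by (elim exE)
  have d: "d a > 0" if "a < b" for a using dd that by simp
  have dn: "\<not> degen (Suc n) (shift (Suc n) M z)"
    if "a < b" "k \<in> S" "M \<in> carrier_mat (Suc n) (Suc n)" "z \<in> \<real>"
      "mclose (Suc n) (d a) M (G k)" "cmod (det (pin n a (shift n (leading_block n M) z))) \<ge> \<eta>" for a k M z
    using dd[rule_format, of a, THEN conjunct2, rule_format, OF _ that(2,3,4,5,6)] that(1) by simp
  \<comment> \<open>Small enough to keep the nondegeneracy gained for every index below
    \<open>b\<close>; inserting \<sigma> bounds the drift and keeps the set nonempty for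
    \<open>b = 0\<close>.\<close>
  define e where "e = Min (insert \<sigma> (d ` {..<b}))"
  have e: "e > 0" "e \<le> \<sigma>" "\<And>a. a < b \<Longrightarrow> e \<le> d a"
    using d \<sigma> unfolding e_def by auto
  obtain p where p: "norm p < e"
    and pn: "\<And>k z. det (pin n b (shift n (leading_block n (G k)) (of_real z))) \<noteq> 0 \<Longrightarrow>
      \<not> ker2 (Suc n) (shift (Suc n) (G k + corner n b p) (of_real z))"
    using generic_corner[of G n b e, OF hermitian_carrier[OF Gh] periodic_diff_differentiable[OF Gp] b e(1)] by blast
  let ?G = "\<lambda>k. G k + corner n b p"
  have h: "hermitian (Suc n) (?G k)" for k by (rule corner_hermitian[OF b Gh])
  have cl: "mclose (Suc n) e (?G k) (G k)" for k
    by (rule mclose_self_corner[OF hermitian_carrier[OF Gh] p])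
  have "mclose (Suc n) (\<sigma> * Suc (Suc b)) (?G k) (H k)" for k
    using mclose_trans[OF mclose_mono[OF cl e(2)] Gc] by (simp add: algebra_simps)
  moreover have "periodic_diff (\<lambda>k. ?G k $$ (i,j))" if "i < Suc n" "j < Suc n" for i j
  proof -
    have "(\<lambda>k. ?G k $$ (i,j)) = (\<lambda>k. G k $$ (i,j) + corner n b p $$ (i,j))"
      using that hermitian_carrier[OF Gh] by (auto simp: corner_def)
    then show ?thesis using Gp[OF that] by auto
  qed
  moreover have "\<not> degen (Suc n) (shift (Suc n) (?G k) z)"
    if h4: "a < Suc b" "k \<in> S" "z \<in> \<real>" "cmod (det (pin n a (shift n (leading_block n (?G k)) z))) \<ge> \<eta>" for a k z
  proof (cases "a < b")
    case True
    then show ?thesis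
      using dn[OF True h4(2) hermitian_carrier[OF h] h4(3) mclose_mono[OF cl e(3)[OF True]] h4(4)] by blast
  next
    case False
    then have a: "a = b" using h4(1) by simp
    obtain x where x: "z = of_real x" using h4(3) by (rule Reals_cases)
    \<comment> \<open>The corner at \<open>b\<close> sits in the row and column removed from this
      minor, which is therefore the minor of the unperturbed \<open>G\<close>.\<close>
    have "det (pin n b (shift n (leading_block n (G k)) z)) \<noteq> 0"
      using h4(4) \<eta> unfolding a pin_corner[OF b hermitian_carrier[OF Gh]] by auto
    then show ?thesis using pn[of k x] hermitian_degen_imp_ker2[OF h] x by blast
  qed
  ultimately show ?case using h by (intro exI[of _ ?G]) auto
qed

text \<open>Induction on the size: the leading block is made simple, the new row and column are
  approximated entrywise, and the corners are perturbed. A double eigenvalue of the result would be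
  an eigenvalue of the leading block, where some minor exceeds \<eta>, and the perturbation at that
  index excludes it. The approximant is periodic on the whole plane although \<open>H\<close> is
  controlled on \<open>S\<close> only.\<close>

theorem simple_hermitian_approximation:
  assumes S: "separated S"
  shows "\<lbrakk>\<And>k. k \<in> S \<Longrightarrow> hermitian n (H k); \<And>i j. i < n \<Longrightarrow> j < n \<Longrightarrow> continuous_on S (\<lambda>k. H k $$ (i,j)); \<delta> > 0\<rbrakk> \<Longrightarrow>
    \<exists>G. (\<forall>k. hermitian n (G k)) \<and> (\<forall>i<n. \<forall>j<n. periodic_diff (\<lambda>k. G k $$ (i,j))) \<and>
     (\<forall>k\<in>S. mclose n \<delta> (G k) (H k)) \<and> (\<forall>k\<in>S. \<forall>z. \<not> ker2 n (shift n (G k) z))"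
proof (induction n arbitrary: H \<delta>)
  case 0
  show ?case by (intro exI[of _ "\<lambda>k. 0\<^sub>m 0 0"]) (auto simp: hermitian_def mclose_def ker2_def)
next
  case (Suc n)
  have compact: "compact S" using S by (simp add: separated_def)
  have "\<exists>G. (\<forall>k. hermitian n (G k)) \<and> (\<forall>i<n. \<forall>j<n. periodic_diff (\<lambda>k. G k $$ (i,j))) \<and>
     (\<forall>k\<in>S. mclose n (\<delta>/2) (G k) (leading_block n (H k))) \<and> (\<forall>k\<in>S. \<forall>z. \<not> ker2 n (shift n (G k) z))"
  proof (rule Suc.IH)
    show "hermitian n (leading_block n (H k))" if "k \<in> S" for k
      using hermitianD[OF Suc.prems(1)[OF that]] by (intro hermitianI) (auto simp: leading_block_def)
    show "continuous_on S (\<lambda>k. leading_block n (H k) $$ (i,j))" if "i < n" "j < n" for i j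
      using Suc.prems(2)[of i j] that by (auto simp: leading_block_def)
  qed (use Suc.prems(3) in simp)
  then obtain L where Lh: "\<And>k. hermitian n (L k)" and Lp: "\<And>i j. i < n \<Longrightarrow> j < n \<Longrightarrow> periodic_diff (\<lambda>k. L k $$ (i,j))"
    and Lc: "\<And>k. k \<in> S \<Longrightarrow> mclose n (\<delta>/2) (L k) (leading_block n (H k))"
    and Ls: "\<And>k z. k \<in> S \<Longrightarrow> \<not> ker2 n (shift n (L k) z)" by blast
  have "\<forall>i. \<exists>g. i < n \<longrightarrow> periodic_diff g \<and> (\<forall>k\<in>S. cmod (g k - H k $$ (i,n)) < \<delta>/2)"
    using approx_periodic_diff_complex[OF S Suc.prems(2), of _ n "\<delta>/2"] Suc.prems(3) by (simp add: less_SucI)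
  then obtain X where Xp: "\<And>i. i < n \<Longrightarrow> periodic_diff (X i)"
    and Xc: "\<And>i k. i < n \<Longrightarrow> k \<in> S \<Longrightarrow> cmod (X i k - H k $$ (i,n)) < \<delta>/2" by metis
  obtain d :: "real \<times> real \<Rightarrow> real" where dp: "periodic_diff d" and diag_fun: "\<And>k. k \<in> S \<Longrightarrow> \<bar>Re (H k $$ (n,n)) - d k\<bar> < \<delta>/2"
    by (rule approx_periodic_diff_real[OF S, of "\<lambda>k. Re (H k $$ (n,n))" "\<delta>/2"])
      (use Suc.prems(2)[of n n] Suc.prems(3) in \<open>auto intro!: continuous_intros\<close>)
  define K where "K k = mat (Suc n) (Suc n) (\<lambda>(i,j). if i < n \<and> j < n then L k $$ (i,j)
     else if i < n then X i k else if j < n then cnj (X j k) else of_real (d k))" for k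
  have Kh: "hermitian (Suc n) (K k)" for k
    using hermitianD[OF Lh] by (intro hermitianI) (auto simp: K_def)
  have Kp: "periodic_diff (\<lambda>k. K k $$ (i,j))" if "i < Suc n" "j < Suc n" for i j
    using that Lp Xp dp by (cases "i < n"; cases "j < n") (simp_all add: K_def periodic_diff_cnj periodic_diff_of_real)
  have KL: "leading_block n (K k) = L k" for k
    using hermitian_carrier[OF Lh[of k]] by (intro eq_matI) (auto simp: leading_block_def K_def)
  have Kc: "mclose (Suc n) (\<delta>/2) (K k) (H k)" if k: "k \<in> S" for k
    unfolding mclose_def
  proof (intro allI impI)
    fix i j assume ij: "i < Suc n" "j < Suc n"
    note Hh = Suc.prems(1)[OF k]
    consider "i < n" "j < n" | "i < n" "j = n" | "i = n" "j < n" | "i = n" "j = n" using ij by linarith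
    then show "cmod (K k $$ (i,j) - H k $$ (i,j)) < \<delta>/2"
    proof cases
      case 1 then show ?thesis using Lc[OF k] by (auto simp: K_def mclose_def leading_block_def)
    next
      case 2 then show ?thesis using Xc[OF _ k] by (auto simp: K_def)
    next
      case 3
      then have "K k $$ (i,j) - H k $$ (i,j) = cnj (X j k - H k $$ (j,n))"
        using hermitianD[OF Hh, of j n] by (simp add: K_def)
      then show ?thesis using Xc[OF _ k, of j] 3 by (simp only: complex_mod_cnj)
    next
      case 4
      have "H k $$ (n,n) = of_real (Re (H k $$ (n,n)))"
        using hermitianD[OF Hh, of n n] by (simp add: complex_eq_iff)
      then have "cmod (K k $$ (i,j) - H k $$ (i,j)) = cmod (of_real (d k - Re (H k $$ (n,n))))"
        using 4 by (simp add: K_def)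
      then show ?thesis using diag_fun[OF k] by (simp only: norm_of_real abs_minus_commute)
    qed
  qed
  have "\<not> degen n (shift n (L k) z)" if "k \<in> S" for k z
    using hermitian_degen_imp_ker2[OF Lh] Ls[OF that] by blast
  from nondegen_uniform[OF compact hermitian_carrier[OF Lh] periodic_diff_continuous[OF Lp] this]
  obtain \<eta> where \<eta>: "\<eta> > 0" and \<eta>n: "\<And>k M z. k \<in> S \<Longrightarrow> M \<in> carrier_mat n n \<Longrightarrow> mclose n \<eta> M (L k) \<Longrightarrow>
      det (shift n M z) = 0 \<Longrightarrow> \<exists>a<n. cmod (det (pin n a (shift n M z))) > \<eta>"
    by blast
  \<comment> \<open>\<open>generic_corners\<close> with \<open>b = n\<close> moves entries by less
    than \<open>\<sigma> * Suc n\<close>. This total is at most \<eta>, so that the margin of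
    \<open>L\<close> still applies to the leading block, and at most half of \<delta>.\<close>
  define \<sigma> where "\<sigma> = min \<eta> (\<delta>/2) / Suc n"
  have \<sigma>: "\<sigma> > 0" "\<sigma> * Suc n = min \<eta> (\<delta>/2)" using \<eta> Suc.prems(3) by (auto simp: \<sigma>_def)
  from generic_corners[OF compact Kh Kp \<eta> \<sigma>(1) order_refl]
  obtain G where Gh: "\<And>k. hermitian (Suc n) (G k)" and Gp: "\<forall>i<Suc n. \<forall>j<Suc n. periodic_diff (\<lambda>k. G k $$ (i,j))"
    and Gc: "\<And>k. mclose (Suc n) (min \<eta> (\<delta>/2)) (G k) (K k)"
    and Gn: "\<And>a k z. a < n \<Longrightarrow> k \<in> S \<Longrightarrow> z \<in> \<real> \<Longrightarrow> cmod (det (pin n a (shift n (leading_block n (G k)) z))) \<ge> \<eta> \<Longrightarrow>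
        \<not> degen (Suc n) (shift (Suc n) (G k) z)"
    unfolding \<sigma>(2) by blast
  have "mclose (Suc n) \<delta> (G k) (H k)" if "k \<in> S" for k
    using mclose_trans[OF mclose_mono[OF Gc, of "\<delta>/2"] Kc[OF that]] by simp
  moreover have "\<not> ker2 (Suc n) (shift (Suc n) (G k) z)" if k: "k \<in> S" for k z
  proof
    assume k2: "ker2 (Suc n) (shift (Suc n) (G k) z)"
    note dg = ker2_imp_degen[OF shift_carrier[OF hermitian_carrier[OF Gh]] k2]
    have z: "z \<in> \<real>" using hermitian_eigenvalue_real[OF Gh] dg unfolding degen_def by blast
    have "mclose n \<eta> (leading_block n (G k)) (L k)"
      using Gc[of k] unfolding KL[symmetric] by (auto simp: mclose_def leading_block_def)
    from \<eta>n[OF k leading_block_carrier this ker2_leading_block[OF hermitian_carrier[OF Gh] k2]]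
    obtain a where "a < n" "cmod (det (pin n a (shift n (leading_block n (G k)) z))) > \<eta>" by blast
    then show False using Gn[OF _ k z] dg by force
  qed
  ultimately show ?case using Gh Gp by (intro exI[of _ G]) auto
qed

section \<open>The Cayley transform\<close>

lemma mat_adjoint_index:
  "A \<in> carrier_mat n n \<Longrightarrow> i < n \<Longrightarrow> j < n \<Longrightarrow> mat_adjoint A $$ (i,j) = cnj (A $$ (j,i))"
  for A :: "complex mat"
  by (simp add: mat_adjoint_def mat_of_rows_def)

lemma mat_adjoint_dim [simp]:
  "dim_row (mat_adjoint A) = dim_col A" "dim_col (mat_adjoint A) = dim_row A" for A :: "complex mat"
  by (simp_all add: mat_adjoint_def)

lemma mat_adjoint_carrier [simp, intro]: "A \<in> carrier_mat n n \<Longrightarrow> mat_adjoint A \<in> carrier_mat n n"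
  for A :: "complex mat"
  by (intro carrier_matI) simp_all

lemma mult_index:
  "A \<in> carrier_mat n n \<Longrightarrow> B \<in> carrier_mat n n \<Longrightarrow> i < n \<Longrightarrow> j < n \<Longrightarrow>
    (A * B) $$ (i,j) = (\<Sum>l<n. A $$ (i,l) * B $$ (l,j))"
  for A B :: "complex mat"
  by (auto simp: scalar_prod_def lessThan_atLeast0 intro!: sum.cong)

lemma mat_eqI:
  "A \<in> carrier_mat n n \<Longrightarrow> B \<in> carrier_mat n n \<Longrightarrow>
    (\<And>i j. i < n \<Longrightarrow> j < n \<Longrightarrow> A $$ (i,j) = B $$ (i,j)) \<Longrightarrow> A = B"
  by (intro eq_matI) auto

lemma mat_adjoint_mult:
  fixes A B :: "complex mat"
  assumes "A \<in> carrier_mat n n" "B \<in> carrier_mat n n"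
  shows "mat_adjoint (A * B) = mat_adjoint B * mat_adjoint A"
proof (rule mat_eqI)
  show "mat_adjoint (A * B) \<in> carrier_mat n n" "mat_adjoint B * mat_adjoint A \<in> carrier_mat n n"
    using assms by (auto intro: mult_carrier_mat)
  fix i j assume ij: "i < n" "j < n"
  show "mat_adjoint (A * B) $$ (i,j) = (mat_adjoint B * mat_adjoint A) $$ (i,j)"
    using assms ij
    by (simp add: mat_adjoint_index[of _ n] mult_index[of _ n] mult.commute del: index_mult_mat)
qed

lemma mat_adjoint_one: "mat_adjoint (1\<^sub>m n) = (1\<^sub>m n :: complex mat)"
  by (intro mat_eqI[of _ n]) (auto simp: mat_adjoint_index[of _ n])

lemma unitary_carrier: "unitary_mat n U \<Longrightarrow> U \<in> carrier_mat n n"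
  by (simp add: unitary_mat_def)

lemma unitary_right: "unitary_mat n U \<Longrightarrow> U * mat_adjoint U = 1\<^sub>m n"
  unfolding unitary_mat_def using mat_mult_left_right_inverse[of "mat_adjoint U" n U] by auto

lemma unitary_entry_le:
  assumes U: "unitary_mat n U" and ij: "i < n" "j < n"
  shows "cmod (U $$ (i,j)) \<le> 1"
proof -
  note Uc = unitary_carrier[OF U]
  have "(mat_adjoint U * U) $$ (j,j) = 1" using U ij by (simp add: unitary_mat_def)
  then have "(\<Sum>l<n. cnj (U $$ (l,j)) * U $$ (l,j)) = 1"
    using Uc ij by (simp add: mult_index[of _ n] mat_adjoint_index[of _ n] del: index_mult_mat)
  moreover have "(\<Sum>l<n. cnj (U $$ (l,j)) * U $$ (l,j)) = of_real (\<Sum>l<n. (cmod (U $$ (l,j)))\<^sup>2)"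
    unfolding of_real_sum by (intro sum.cong refl) (simp only: complex_norm_square mult.commute)
  ultimately have "(\<Sum>l<n. (cmod (U $$ (l,j)))\<^sup>2) = 1" by (metis of_real_eq_1_iff)
  moreover have "(cmod (U $$ (i,j)))\<^sup>2 \<le> (\<Sum>l<n. (cmod (U $$ (l,j)))\<^sup>2)"
    using ij by (intro member_le_sum[of i "{..<n}" "\<lambda>l. (cmod (U $$ (l,j)))\<^sup>2"]) auto
  ultimately have "(cmod (U $$ (i,j)))\<^sup>2 \<le> 1" by simp
  then show ?thesis by (simp add: power_le_one_iff abs_square_le_1)
qed

text \<open>Written through the adjugate so that continuity of the inverse reduces to continuity of
  determinants.\<close>

definition mat_inv :: "complex mat \<Rightarrow> complex mat" where
  "mat_inv A = (1 / det A) \<cdot>\<^sub>m adj_mat A"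

lemma mat_inv:
  assumes A: "A \<in> carrier_mat n n" and d: "det A \<noteq> 0"
  shows "mat_inv A \<in> carrier_mat n n" "A * mat_inv A = 1\<^sub>m n" "mat_inv A * A = 1\<^sub>m n"
proof -
  note aA = adj_mat[OF A]
  show "mat_inv A \<in> carrier_mat n n" using aA(1) by (simp add: mat_inv_def)
  show "A * mat_inv A = 1\<^sub>m n"
    unfolding mat_inv_def mult_smult_distrib[OF A aA(1)] aA(2) using d by (intro eq_matI) auto
  show "mat_inv A * A = 1\<^sub>m n"
    unfolding mat_inv_def mult_smult_assoc_mat[OF aA(1) A] aA(3) using d by (intro eq_matI) auto
qed

lemma mat_inv_carrier: "A \<in> carrier_mat n n \<Longrightarrow> mat_inv A \<in> carrier_mat n n"
  using adj_mat(1)[of A n] unfolding mat_inv_def by simp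

lemma mat_inv_unique:
  assumes A: "A \<in> carrier_mat n n" and B: "B \<in> carrier_mat n n" and AB: "A * B = 1\<^sub>m n"
  shows "mat_inv A = B" "det A \<noteq> 0"
proof -
  have "det A * det B = 1" using det_mult[OF A B] AB by simp
  then show d: "det A \<noteq> 0" by auto
  have "mat_inv A = mat_inv A * (A * B)" using mat_inv(1)[OF A d] AB by simp
  also have "\<dots> = (mat_inv A * A) * B" using mat_inv(1)[OF A d] A B by (simp add: assoc_mult_mat)
  also have "\<dots> = B" using mat_inv(3)[OF A d] B by simp
  finally show "mat_inv A = B" .
qed

lemma hermitian_iff_adjoint: "A \<in> carrier_mat n n \<Longrightarrow> mat_adjoint A = A \<Longrightarrow> hermitian n A"
  by (rule hermitianI) (metis mat_adjoint_index)+

lemma hermitian_shift_adjoint: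
  assumes "hermitian n A"
  shows "mat_adjoint (shift n A z) = shift n A (cnj z)"
proof (rule mat_eqI)
  note c = hermitian_carrier[OF assms]
  show "mat_adjoint (shift n A z) \<in> carrier_mat n n" "shift n A (cnj z) \<in> carrier_mat n n"
    using c by simp_all
  fix i j assume ij: "i < n" "j < n"
  show "mat_adjoint (shift n A z) $$ (i,j) = shift n A (cnj z) $$ (i,j)"
    unfolding mat_adjoint_index[OF shift_carrier[OF c] ij] shift_index[OF c ij] shift_index[OF c ij(2,1)]
    using hermitianD[OF assms ij(2,1)] by simp
qed

lemma hermitian_det_shift: "hermitian n A \<Longrightarrow> z \<notin> \<real> \<Longrightarrow> det (shift n A z) \<noteq> 0"
  using hermitian_eigenvalue_real by blast

lemma ii_not_real [simp]: "\<i> \<notin> \<real>" "- \<i> \<notin> \<real>"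
  by (auto simp: complex_is_Real_iff)

text \<open>On a real eigenvalue x this is z (x - i) / (x + i), which maps the line onto the unit
  circle without z. Written as an affine function of the resolvent of \<open>H\<close>, it inherits
  the Lipschitz bound and the intertwining relation from those for inverses.\<close>

definition cayley :: "nat \<Rightarrow> complex \<Rightarrow> complex mat \<Rightarrow> complex mat" where
  "cayley n z H = z \<cdot>\<^sub>m 1\<^sub>m n - (2 * \<i> * z) \<cdot>\<^sub>m mat_inv (shift n H (- \<i>))"

definition inv_cayley :: "nat \<Rightarrow> complex \<Rightarrow> complex mat \<Rightarrow> complex mat" where
  "inv_cayley n z U = (- 2 * \<i> * z) \<cdot>\<^sub>m mat_inv (shift n U z) - \<i> \<cdot>\<^sub>m 1\<^sub>m n"

lemma cayley_carrier: "H \<in> carrier_mat n n \<Longrightarrow> cayley n z H \<in> carrier_mat n n"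
  using mat_inv_carrier[of "shift n H (- \<i>)" n] by (auto simp: cayley_def)

lemma inv_cayley_carrier: "U \<in> carrier_mat n n \<Longrightarrow> inv_cayley n z U \<in> carrier_mat n n"
  using mat_inv_carrier[of "shift n U z" n] by (auto simp: inv_cayley_def)

lemma shift_comm:
  fixes A :: "complex mat"
  assumes A: "A \<in> carrier_mat n n"
  shows "shift n A z * shift n A w = shift n A w * shift n A z"
proof -
  have e: "shift n A z * shift n A w = A * A - w \<cdot>\<^sub>m A - z \<cdot>\<^sub>m A + (z * w) \<cdot>\<^sub>m 1\<^sub>m n" for z w
  proof -
    have "shift n A z * shift n A w = A * shift n A w - (z \<cdot>\<^sub>m 1\<^sub>m n) * shift n A w"
      using A by (intro minus_mult_distrib_mat) auto
    also have "A * shift n A w = A * A - A * (w \<cdot>\<^sub>m 1\<^sub>m n)"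
      using A by (intro mult_minus_distrib_mat) auto
    also have "A * (w \<cdot>\<^sub>m 1\<^sub>m n) = w \<cdot>\<^sub>m A" using A mult_smult_distrib[OF A one_carrier_mat] by simp
    also have "(z \<cdot>\<^sub>m 1\<^sub>m n) * shift n A w = z \<cdot>\<^sub>m shift n A w"
      using A mult_smult_assoc_mat[OF one_carrier_mat shift_carrier[OF A]] by simp
    finally show ?thesis using A by (auto intro!: mat_eqI simp: algebra_simps)
  qed
  show ?thesis unfolding e using A by (auto intro!: mat_eqI simp: algebra_simps)
qed

lemma cayley_eq:
  assumes H: "hermitian n H"
  shows "cayley n z H = z \<cdot>\<^sub>m (shift n H \<i> * mat_inv (shift n H (- \<i>)))"
proof -
  note Hc = hermitian_carrier[OF H]
  let ?B = "shift n H (- \<i>)" and ?R = "mat_inv (shift n H (- \<i>))"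
  have B: "?B \<in> carrier_mat n n" using Hc by simp
  note R = mat_inv[OF B hermitian_det_shift[OF H]]
  have "shift n H \<i> = ?B - (2 * \<i>) \<cdot>\<^sub>m 1\<^sub>m n" using Hc by (auto intro!: mat_eqI)
  then have "shift n H \<i> * ?R = ?B * ?R - ((2 * \<i>) \<cdot>\<^sub>m 1\<^sub>m n) * ?R"
    using minus_mult_distrib_mat[OF B _ R(1)] by simp
  also have "\<dots> = 1\<^sub>m n - (2 * \<i>) \<cdot>\<^sub>m ?R"
    using R mult_smult_assoc_mat[OF one_carrier_mat R(1)] by simp
  finally show ?thesis
    unfolding cayley_def using R(1) by (auto intro!: mat_eqI simp: algebra_simps)
qed

text \<open>\<open>H - i\<close> and \<open>H + i\<close> commute and are adjoint to each other, so
  their quotient is unitary.\<close>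

lemma cayley_unitary:
  assumes H: "hermitian n H" and z: "cmod z = 1"
  shows "unitary_mat n (cayley n z H)"
proof -
  note Hc = hermitian_carrier[OF H]
  let ?B = "shift n H (- \<i>)" and ?C = "shift n H \<i>" and ?R = "mat_inv (shift n H (- \<i>))"
  have B: "?B \<in> carrier_mat n n" and C: "?C \<in> carrier_mat n n" using Hc by simp_all
  note R = mat_inv[OF B hermitian_det_shift[OF H]]
  have R1: "?R \<in> carrier_mat n n" and BR: "?B * ?R = 1\<^sub>m n" using R by simp_all
  have CR: "?C * ?R \<in> carrier_mat n n" using C R1 by simp
  have adj: "mat_adjoint (z \<cdot>\<^sub>m A) = cnj z \<cdot>\<^sub>m mat_adjoint A" if "A \<in> carrier_mat n n" for A
    using that by (intro mat_eqI[of _ n]) (auto simp: mat_adjoint_index[of _ n])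
  have "mat_adjoint (?C * ?R) * (?C * ?R) = mat_adjoint ?R * (?B * (?C * ?R))"
    using assoc_mult_mat[OF mat_adjoint_carrier[OF R1] B CR]
    unfolding mat_adjoint_mult[OF C R1] hermitian_shift_adjoint[OF H] complex_cnj_i .
  also have "?B * (?C * ?R) = (?C * ?B) * ?R"
    unfolding assoc_mult_mat[OF B C R1, symmetric] shift_comm[OF Hc, of "- \<i>" \<i>] ..
  also have "\<dots> = ?C" unfolding assoc_mult_mat[OF C B R1] BR using C by simp
  also have "mat_adjoint ?R * ?C = mat_adjoint (?B * ?R)"
    using mat_adjoint_mult[OF B R1] hermitian_shift_adjoint[OF H, of "- \<i>"] by simp
  also have "\<dots> = 1\<^sub>m n" unfolding BR by (rule mat_adjoint_one)
  finally have e: "mat_adjoint (?C * ?R) * (?C * ?R) = 1\<^sub>m n" .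
  have zz: "cnj z * z = 1" using z complex_norm_square[of z] by (simp add: mult.commute)
  have "mat_adjoint (cayley n z H) * cayley n z H = (cnj z \<cdot>\<^sub>m mat_adjoint (?C * ?R)) * (z \<cdot>\<^sub>m (?C * ?R))"
    unfolding cayley_eq[OF H] adj[OF CR] ..
  also have "\<dots> = cnj z \<cdot>\<^sub>m (z \<cdot>\<^sub>m (mat_adjoint (?C * ?R) * (?C * ?R)))"
    using mult_smult_assoc_mat[OF mat_adjoint_carrier[OF CR] smult_carrier_mat[OF CR]]
      mult_smult_distrib[OF mat_adjoint_carrier[OF CR] CR] by simp
  also have "\<dots> = 1\<^sub>m n" unfolding e using zz by (auto intro!: mat_eqI[of _ n] simp: mult.assoc[symmetric])
  finally show ?thesis using cayley_carrier[OF Hc] by (simp add: unitary_mat_def)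
qed

text \<open>With C = U - z and Q its inverse, unitarity of U expresses the adjoint of C times C as a
  linear combination of C and its adjoint. Multiplying by the adjoint of Q on the left and by Q on
  the right turns this into \<open>rel\<close>, a linear relation between Q and its adjoint that
  amounts to self-adjointness of the inverse Cayley transform.\<close>

lemma inv_cayley_hermitian:
  assumes U: "unitary_mat n U" and z: "cmod z = 1" and d: "det (shift n U z) \<noteq> 0"
  shows "hermitian n (inv_cayley n z U)"
proof (rule hermitian_iff_adjoint)
  note Uc = unitary_carrier[OF U]
  show ic: "inv_cayley n z U \<in> carrier_mat n n" by (rule inv_cayley_carrier[OF Uc])
  let ?C = "shift n U z" and ?Q = "mat_inv (shift n U z)"
  have C: "?C \<in> carrier_mat n n" using Uc by simp
  note Q = mat_inv[OF C d]
  note aC = mat_adjoint_carrier[OF C] and aQ = mat_adjoint_carrier[OF Q(1)]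
  have zz: "cnj z * z = 1" using z complex_norm_square[of z] by (simp add: mult.commute)
  \<comment> \<open>unitarity of \<open>U = C + z\<close>, expanded\<close>
  have key: "mat_adjoint ?C * ?C = (- z) \<cdot>\<^sub>m mat_adjoint ?C - cnj z \<cdot>\<^sub>m ?C"
  proof -
    have a: "mat_adjoint ?C = mat_adjoint U - cnj z \<cdot>\<^sub>m 1\<^sub>m n"
      using Uc C by (intro mat_eqI[of _ n]) (auto simp: mat_adjoint_index[of _ n])
    have aU: "mat_adjoint U \<in> carrier_mat n n" using Uc by simp
    have "mat_adjoint ?C * ?C = mat_adjoint U * ?C - (cnj z \<cdot>\<^sub>m 1\<^sub>m n) * ?C"
      unfolding a using aU C by (intro minus_mult_distrib_mat) auto
    also have "mat_adjoint U * ?C = mat_adjoint U * U - mat_adjoint U * (z \<cdot>\<^sub>m 1\<^sub>m n)"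
      by (rule mult_minus_distrib_mat[OF aU Uc smult_carrier_mat[OF one_carrier_mat]])
    also have "mat_adjoint U * U = 1\<^sub>m n" using U by (simp add: unitary_mat_def)
    also have "mat_adjoint U * (z \<cdot>\<^sub>m 1\<^sub>m n) = z \<cdot>\<^sub>m mat_adjoint U"
      unfolding mult_smult_distrib[OF aU one_carrier_mat] right_mult_one_mat[OF aU] ..
    also have "(cnj z \<cdot>\<^sub>m 1\<^sub>m n) * ?C = cnj z \<cdot>\<^sub>m ?C"
      using mult_smult_assoc_mat[OF one_carrier_mat C] C by simp
    finally show ?thesis unfolding a using aU Uc zz
      by (intro mat_eqI[of _ n]) (auto simp: algebra_simps)
  qed
  have "mat_adjoint ?Q * (mat_adjoint ?C * ?C) * ?Q = (mat_adjoint ?Q * mat_adjoint ?C) * (?C * ?Q)"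
    unfolding assoc_mult_mat[OF aQ aC C, symmetric] assoc_mult_mat[OF mult_carrier_mat[OF aQ aC] C Q(1)] ..
  also have "mat_adjoint ?Q * mat_adjoint ?C = mat_adjoint (?C * ?Q)"
    using mat_adjoint_mult[OF C Q(1)] by simp
  also have "\<dots> = 1\<^sub>m n" unfolding Q(2) by (rule mat_adjoint_one)
  also have "1\<^sub>m n * (?C * ?Q) = 1\<^sub>m n" using Q by simp
  finally have one: "mat_adjoint ?Q * (mat_adjoint ?C * ?C) * ?Q = 1\<^sub>m n" .
  have QC: "mat_adjoint ?Q * mat_adjoint ?C = 1\<^sub>m n"
    unfolding mat_adjoint_mult[OF C Q(1), symmetric] Q(2) mat_adjoint_one ..
  have "mat_adjoint ?Q * ((- z) \<cdot>\<^sub>m mat_adjoint ?C - cnj z \<cdot>\<^sub>m ?C)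
     = mat_adjoint ?Q * ((- z) \<cdot>\<^sub>m mat_adjoint ?C) - mat_adjoint ?Q * (cnj z \<cdot>\<^sub>m ?C)"
    by (rule mult_minus_distrib_mat[OF aQ smult_carrier_mat[OF aC] smult_carrier_mat[OF C]])
  also have "\<dots> = (- z) \<cdot>\<^sub>m 1\<^sub>m n - cnj z \<cdot>\<^sub>m (mat_adjoint ?Q * ?C)"
    unfolding mult_smult_distrib[OF aQ aC] mult_smult_distrib[OF aQ C] QC ..
  finally have "mat_adjoint ?Q * ((- z) \<cdot>\<^sub>m mat_adjoint ?C - cnj z \<cdot>\<^sub>m ?C) * ?Q
      = ((- z) \<cdot>\<^sub>m 1\<^sub>m n - cnj z \<cdot>\<^sub>m (mat_adjoint ?Q * ?C)) * ?Q" by (rule arg_cong)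
  also have "\<dots> = ((- z) \<cdot>\<^sub>m 1\<^sub>m n) * ?Q - (cnj z \<cdot>\<^sub>m (mat_adjoint ?Q * ?C)) * ?Q"
    by (rule minus_mult_distrib_mat[OF smult_carrier_mat[OF one_carrier_mat] smult_carrier_mat[OF mult_carrier_mat[OF aQ C]] Q(1)])
  also have "((- z) \<cdot>\<^sub>m 1\<^sub>m n) * ?Q = (- z) \<cdot>\<^sub>m ?Q"
    unfolding mult_smult_assoc_mat[OF one_carrier_mat Q(1)] left_mult_one_mat[OF Q(1)] ..
  also have "(cnj z \<cdot>\<^sub>m (mat_adjoint ?Q * ?C)) * ?Q = cnj z \<cdot>\<^sub>m ((mat_adjoint ?Q * ?C) * ?Q)"
    using aQ C Q(1) by (intro mult_smult_assoc_mat) auto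
  also have "(mat_adjoint ?Q * ?C) * ?Q = mat_adjoint ?Q"
    unfolding assoc_mult_mat[OF aQ C Q(1)] Q(2) by (rule right_mult_one_mat[OF aQ])
  finally have rel: "1\<^sub>m n = (- z) \<cdot>\<^sub>m ?Q - cnj z \<cdot>\<^sub>m mat_adjoint ?Q"
    using one unfolding key by simp
  show "mat_adjoint (inv_cayley n z U) = inv_cayley n z U"
  proof (rule mat_eqI[OF mat_adjoint_carrier[OF ic] ic])
    fix i j assume ij: "i < n" "j < n"
    have "(if i = j then 1 else 0) = - z * ?Q $$ (i,j) - cnj z * cnj (?Q $$ (j,i))"
      using arg_cong[OF rel, of "\<lambda>M. M $$ (i,j)"] ij Q(1) aQ by (simp add: mat_adjoint_index[OF Q(1)])
    then have "cnj z * cnj (?Q $$ (j,i)) = - z * ?Q $$ (i,j) - (if i = j then 1 else 0)" by simp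
    moreover have idx: "inv_cayley n z U $$ (i,j) = - 2 * \<i> * z * ?Q $$ (i,j) - (if i = j then \<i> else 0)"
      if "i < n" "j < n" for i j using that Q(1) by (auto simp: inv_cayley_def)
    have "mat_adjoint (inv_cayley n z U) $$ (i,j) = 2 * \<i> * (cnj z * cnj (?Q $$ (j,i))) + (if i = j then \<i> else 0)"
      unfolding mat_adjoint_index[OF ic ij] idx[OF ij(2,1)] by simp
    ultimately show "mat_adjoint (inv_cayley n z U) $$ (i,j) = inv_cayley n z U $$ (i,j)"
      unfolding idx[OF ij] by (cases "i = j") (simp_all add: right_diff_distrib)
  qed
qed

lemma cayley_inv_cayley:
  assumes U: "U \<in> carrier_mat n n" and z: "z \<noteq> 0" and d: "det (shift n U z) \<noteq> 0"
  shows "cayley n z (inv_cayley n z U) = U"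
proof -
  let ?C = "shift n U z" and ?Q = "mat_inv (shift n U z)"
  have C: "?C \<in> carrier_mat n n" using U by simp
  note Q = mat_inv[OF C d]
  let ?c = "- 2 * \<i> * z"
  have s: "shift n (inv_cayley n z U) (- \<i>) = ?c \<cdot>\<^sub>m ?Q"
    using Q(1) by (intro mat_eqI[of _ n]) (auto simp: inv_cayley_def)
  have "(?c \<cdot>\<^sub>m ?Q) * ((1 / ?c) \<cdot>\<^sub>m ?C) = ?c \<cdot>\<^sub>m ((1 / ?c) \<cdot>\<^sub>m (?Q * ?C))"
    using mult_smult_assoc_mat[OF Q(1) smult_carrier_mat[OF C]] mult_smult_distrib[OF Q(1) C] by simp
  also have "\<dots> = 1\<^sub>m n" unfolding Q(3) using z by (intro mat_eqI[of _ n]) auto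
  finally have "mat_inv (?c \<cdot>\<^sub>m ?Q) = (1 / ?c) \<cdot>\<^sub>m ?C"
    using mat_inv_unique(1)[of "?c \<cdot>\<^sub>m ?Q" n "(1 / ?c) \<cdot>\<^sub>m ?C"] Q(1) C by simp
  then show ?thesis
    unfolding cayley_def s using U z by (intro mat_eqI[of _ n]) (auto simp: field_simps)
qed


text \<open>Resolvent identity. The entries of the resolvent are at most 1 because they are
  recovered from those of a unitary matrix; the factor 2 comes from \<open>2 * \<i> * z\<close>, the
  factor \<open>n * n\<close> from the double sum.\<close>

lemma cayley_lipschitz:
  assumes H: "hermitian n H" and G: "hermitian n G" and z: "cmod z = 1"
    and c: "\<And>i j. i < n \<Longrightarrow> j < n \<Longrightarrow> cmod (G $$ (i,j) - H $$ (i,j)) \<le> \<delta>"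
    and ij: "i < n" "j < n"
  shows "cmod (cayley n z G $$ (i,j) - cayley n z H $$ (i,j)) \<le> 2 * real n * real n * \<delta>"
proof -
  have bound: "mat_inv (shift n A (- \<i>)) \<in> carrier_mat n n"
      "\<And>i j. i < n \<Longrightarrow> j < n \<Longrightarrow> cmod (mat_inv (shift n A (- \<i>)) $$ (i,j)) \<le> 1" if A: "hermitian n A" for A
  proof -
    let ?R = "mat_inv (shift n A (- \<i>))"
    show R: "?R \<in> carrier_mat n n" using mat_inv_carrier[of "shift n A (- \<i>)" n] hermitian_carrier[OF A] by simp
    fix i j assume ij: "i < n" "j < n"
    have "cayley n z A $$ (i,j) = z * (if i = j then 1 else 0) - 2 * \<i> * z * ?R $$ (i,j)"
      using R ij by (auto simp: cayley_def)
    then have "2 * \<i> * z * ?R $$ (i,j) = z * (if i = j then 1 else 0) - cayley n z A $$ (i,j)" by simp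
    then have "2 * cmod (?R $$ (i,j)) = cmod (z * (if i = j then 1 else 0) - cayley n z A $$ (i,j))"
      using z by (metis mult.commute mult_1 norm_ii norm_mult norm_numeral)
    also have "\<dots> \<le> cmod (z * (if i = j then 1 else 0)) + cmod (cayley n z A $$ (i,j))"
      by (rule norm_triangle_ineq4)
    also have "\<dots> \<le> 1 + 1"
      using unitary_entry_le[OF cayley_unitary[OF A z] ij] z by (intro add_mono) (auto simp: norm_mult)
    finally show "cmod (?R $$ (i,j)) \<le> 1" by simp
  qed
  let ?BH = "shift n H (- \<i>)" and ?BG = "shift n G (- \<i>)"
  have BH: "?BH \<in> carrier_mat n n" and BG: "?BG \<in> carrier_mat n n"
    using hermitian_carrier[OF H] hermitian_carrier[OF G] by simp_all
  note RH = mat_inv[OF BH hermitian_det_shift[OF H ii_not_real(2)]] and RG = mat_inv[OF BG hermitian_det_shift[OF G ii_not_real(2)]]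
  let ?D = "G - H"
  have D: "?D \<in> carrier_mat n n" "?D = ?BG - ?BH"
    using hermitian_carrier[OF H] hermitian_carrier[OF G] by (auto intro!: mat_eqI[of _ n])
  have "mat_inv ?BG * (?D * mat_inv ?BH) = mat_inv ?BH - mat_inv ?BG"
  proof -
    have "?D * mat_inv ?BH = ?BG * mat_inv ?BH - ?BH * mat_inv ?BH"
      unfolding D(2) by (rule minus_mult_distrib_mat[OF BG BH RH(1)])
    then have "mat_inv ?BG * (?D * mat_inv ?BH) = mat_inv ?BG * (?BG * mat_inv ?BH) - mat_inv ?BG * 1\<^sub>m n"
      unfolding RH(2) using mult_minus_distrib_mat[OF RG(1) mult_carrier_mat[OF BG RH(1)] one_carrier_mat] by simp
    also have "mat_inv ?BG * (?BG * mat_inv ?BH) = mat_inv ?BH"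
      unfolding assoc_mult_mat[OF RG(1) BG RH(1), symmetric] RG(3) using RH(1) by simp
    also have "mat_inv ?BG * 1\<^sub>m n = mat_inv ?BG" by (rule right_mult_one_mat[OF RG(1)])
    finally show ?thesis .
  qed
  note dec = this
  have "cayley n z G $$ (i,j) - cayley n z H $$ (i,j) = 2 * \<i> * z * (mat_inv ?BH - mat_inv ?BG) $$ (i,j)"
    using RH(1) RG(1) ij by (auto simp: cayley_def algebra_simps)
  also have "\<dots> = 2 * \<i> * z * (\<Sum>l<n. \<Sum>q<n. mat_inv ?BG $$ (i,l) * (?D $$ (l,q) * mat_inv ?BH $$ (q,j)))"
    unfolding dec[symmetric] mult_index[OF RG(1) mult_carrier_mat[OF D(1) RH(1)] ij]
    by (intro arg_cong2[where f = "(*)"] refl sum.cong)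
      (simp add: mult_index[OF D(1) RH(1) _ ij(2)] sum_distrib_left del: index_mult_mat)
  finally have "cmod (cayley n z G $$ (i,j) - cayley n z H $$ (i,j)) =
      2 * cmod (\<Sum>l<n. \<Sum>q<n. mat_inv ?BG $$ (i,l) * (?D $$ (l,q) * mat_inv ?BH $$ (q,j)))"
    using z by (simp add: norm_mult)
  also have "cmod (\<Sum>l<n. \<Sum>q<n. mat_inv ?BG $$ (i,l) * (?D $$ (l,q) * mat_inv ?BH $$ (q,j))) \<le> (\<Sum>l<n. \<Sum>q<n. \<delta>)"
  proof (intro sum_norm_le)
    fix l q assume lq: "l \<in> {..<n}" "q \<in> {..<n}"
    have "cmod (mat_inv ?BG $$ (i,l) * (?D $$ (l,q) * mat_inv ?BH $$ (q,j))) \<le> 1 * (\<delta> * 1)"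
      unfolding norm_mult using lq ij bound(2)[OF G] bound(2)[OF H] c[of l q] hermitian_carrier[OF G] hermitian_carrier[OF H]
      by (intro mult_mono) (auto intro: order_trans[OF norm_ge_zero])
    then show "cmod (mat_inv ?BG $$ (i,l) * (?D $$ (l,q) * mat_inv ?BH $$ (q,j))) \<le> \<delta>" by simp
  qed
  finally show ?thesis by simp
qed

text \<open>With \<open>A\<close> taken at \<open>k\<close> and \<open>B\<close> at
  \<open>- k\<close>, the relation \<open>r\<close> is the matching relation. It survives inverses
  and affine functions, hence both Cayley transforms.\<close>

lemma transpose_intertwine_mat_inv:
  fixes A B E :: "complex mat"
  assumes A: "A \<in> carrier_mat n n" "det A \<noteq> 0" and B: "B \<in> carrier_mat n n" "det B \<noteq> 0"
    and E: "E \<in> carrier_mat n n" and r: "E * A = transpose_mat B * E"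
  shows "E * mat_inv A = transpose_mat (mat_inv B) * E"
proof -
  note mA = mat_inv[OF A] and mB = mat_inv[OF B]
  have tB: "transpose_mat B \<in> carrier_mat n n" and tmB: "transpose_mat (mat_inv B) \<in> carrier_mat n n"
    using B mB by simp_all
  have one: "transpose_mat (mat_inv B) * transpose_mat B = 1\<^sub>m n"
    using transpose_mult[OF B(1) mB(1)] mB(2) by simp
  have "E * mat_inv A = (transpose_mat (mat_inv B) * transpose_mat B) * (E * mat_inv A)"
    unfolding one using E mA(1) by simp
  also have "\<dots> = transpose_mat (mat_inv B) * ((transpose_mat B * E) * mat_inv A)"
    unfolding assoc_mult_mat[OF tmB tB mult_carrier_mat[OF E mA(1)]] assoc_mult_mat[OF tB E mA(1)] ..
  also have "(transpose_mat B * E) * mat_inv A = E"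
    unfolding r[symmetric] assoc_mult_mat[OF E A(1) mA(1)] mA(2) using E by simp
  finally show ?thesis .
qed

lemma transpose_intertwine_affine:
  fixes A B E :: "complex mat"
  assumes A: "A \<in> carrier_mat n n" and B: "B \<in> carrier_mat n n" and E: "E \<in> carrier_mat n n"
    and r: "E * A = transpose_mat B * E"
  shows "E * (c \<cdot>\<^sub>m A - d \<cdot>\<^sub>m 1\<^sub>m n) = transpose_mat (c \<cdot>\<^sub>m B - d \<cdot>\<^sub>m 1\<^sub>m n) * E"
proof -
  have tB: "transpose_mat B \<in> carrier_mat n n" using B by simp
  have "E * (c \<cdot>\<^sub>m A - d \<cdot>\<^sub>m 1\<^sub>m n) = E * (c \<cdot>\<^sub>m A) - E * (d \<cdot>\<^sub>m 1\<^sub>m n)"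
    using A E by (intro mult_minus_distrib_mat) auto
  also have "E * (c \<cdot>\<^sub>m A) = c \<cdot>\<^sub>m (transpose_mat B * E)"
    unfolding mult_smult_distrib[OF E A] r ..
  also have "\<dots> = (c \<cdot>\<^sub>m transpose_mat B) * E" by (rule mult_smult_assoc_mat[OF tB E, symmetric])
  also have "E * (d \<cdot>\<^sub>m 1\<^sub>m n) = (d \<cdot>\<^sub>m 1\<^sub>m n) * E"
    unfolding mult_smult_distrib[OF E one_carrier_mat] mult_smult_assoc_mat[OF one_carrier_mat E] using E by simp
  also have "(c \<cdot>\<^sub>m transpose_mat B) * E - (d \<cdot>\<^sub>m 1\<^sub>m n) * E = (c \<cdot>\<^sub>m transpose_mat B - d \<cdot>\<^sub>m 1\<^sub>m n) * E"
    using tB E by (intro minus_mult_distrib_mat[symmetric]) auto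
  also have "c \<cdot>\<^sub>m transpose_mat B - d \<cdot>\<^sub>m 1\<^sub>m n = transpose_mat (c \<cdot>\<^sub>m B - d \<cdot>\<^sub>m 1\<^sub>m n)"
    using B by (intro mat_eqI[of _ n]) auto
  finally show ?thesis .
qed

lemma smult_one_mat: "A \<in> carrier_mat n n \<Longrightarrow> 1 \<cdot>\<^sub>m A = A" for A :: "complex mat"
  by (intro mat_eqI[of _ n]) auto

lemma transpose_intertwine_cayley:
  assumes A: "hermitian n A" and B: "hermitian n B" and E: "E \<in> carrier_mat n n" and r: "E * A = transpose_mat B * E"
  shows "E * cayley n z A = transpose_mat (cayley n z B) * E"
proof -
  note Ac = hermitian_carrier[OF A] and Bc = hermitian_carrier[OF B]
  have "E * shift n A (- \<i>) = transpose_mat (shift n B (- \<i>)) * E"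
    using transpose_intertwine_affine[OF Ac Bc E r, of 1 "- \<i>"] by (simp only: smult_one_mat[OF Ac] smult_one_mat[OF Bc])
  from transpose_intertwine_mat_inv[OF shift_carrier[OF Ac] hermitian_det_shift[OF A ii_not_real(2)]
      shift_carrier[OF Bc] hermitian_det_shift[OF B ii_not_real(2)] E this]
  have "E * mat_inv (shift n A (- \<i>)) = transpose_mat (mat_inv (shift n B (- \<i>))) * E" .
  from transpose_intertwine_affine[OF mat_inv_carrier[OF shift_carrier[OF Ac]] mat_inv_carrier[OF shift_carrier[OF Bc]] E this,
      of "- (2 * \<i> * z)" "- z"]
  moreover have "cayley n z A = (- (2 * \<i> * z)) \<cdot>\<^sub>m mat_inv (shift n A (- \<i>)) - (- z) \<cdot>\<^sub>m 1\<^sub>m n" if "hermitian n A" for A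
    using mat_inv_carrier[OF shift_carrier[OF hermitian_carrier[OF that]], of "- \<i>"]
    by (intro mat_eqI[of _ n]) (auto simp: cayley_def)
  ultimately show ?thesis using A B by simp
qed

lemma transpose_intertwine_inv_cayley:
  assumes A: "A \<in> carrier_mat n n" "det (shift n A z) \<noteq> 0" and B: "B \<in> carrier_mat n n" "det (shift n B z) \<noteq> 0"
    and E: "E \<in> carrier_mat n n" and r: "E * A = transpose_mat B * E"
  shows "E * inv_cayley n z A = transpose_mat (inv_cayley n z B) * E"
proof -
  have "E * shift n A z = transpose_mat (shift n B z) * E"
    using transpose_intertwine_affine[OF A(1) B(1) E r, of 1 z] by (simp only: smult_one_mat[OF A(1)] smult_one_mat[OF B(1)])
  from transpose_intertwine_mat_inv[OF shift_carrier[OF A(1)] A(2) shift_carrier[OF B(1)] B(2) E this]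
  show ?thesis unfolding inv_cayley_def
    by (rule transpose_intertwine_affine[OF mat_inv_carrier[OF shift_carrier[OF A(1)]] mat_inv_carrier[OF shift_carrier[OF B(1)]] E])
qed

section \<open>Simple spectra and kernels for unitary matrices\<close>

lemma nullv_mult:
  assumes "A \<in> carrier_mat n n" "B \<in> carrier_mat n n" "nullv n B v"
  shows "nullv n (A * B) v"
  unfolding nullv_def
proof (intro allI impI)
  fix i assume i: "i < n"
  have "(\<Sum>j<n. (A * B) $$ (i,j) * v j) = (\<Sum>j<n. \<Sum>l<n. A $$ (i,l) * (B $$ (l,j) * v j))"
    using i by (intro sum.cong refl) (simp add: mult_index[OF assms(1,2)] sum_distrib_right mult.assoc del: index_mult_mat)
  also have "\<dots> = (\<Sum>l<n. A $$ (i,l) * (\<Sum>j<n. B $$ (l,j) * v j))"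
    by (subst sum.swap) (simp add: sum_distrib_left)
  also have "\<dots> = 0" using assms(3) by (simp add: nullv_def)
  finally show "(\<Sum>j<n. (A * B) $$ (i,j) * v j) = 0" .
qed

text \<open>Multiplying \<open>U - w\<close> by \<open>G + i\<close> gives a scalar multiple of
  \<open>G - x\<close> with x = 2 i z / (z - w) - i, so null vectors of the former are null vectors
  of the latter. The value \<open>w = z\<close> is excluded since the product would be a nonzero
  multiple of the identity.\<close>

lemma ker2_cayley:
  assumes G: "hermitian n G" and z: "z \<noteq> 0" and k: "ker2 n (shift n (cayley n z G) w)"
  shows "\<exists>x. ker2 n (shift n G x)"
proof -
  note Gc = hermitian_carrier[OF G]
  let ?B = "shift n G (- \<i>)" and ?U = "cayley n z G"
  have B: "?B \<in> carrier_mat n n" using Gc by simp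
  note R = mat_inv[OF B hermitian_det_shift[OF G ii_not_real(2)]]
  have U: "?U \<in> carrier_mat n n" by (rule cayley_carrier[OF Gc])
  have BU: "?B * shift n ?U w = (z - w) \<cdot>\<^sub>m ?B - (2 * \<i> * z) \<cdot>\<^sub>m 1\<^sub>m n"
  proof -
    have e: "shift n ?U w = (z - w) \<cdot>\<^sub>m 1\<^sub>m n - (2 * \<i> * z) \<cdot>\<^sub>m mat_inv ?B"
      using R(1) by (intro mat_eqI[of _ n]) (auto simp: cayley_def algebra_simps)
    have "?B * shift n ?U w = ?B * ((z - w) \<cdot>\<^sub>m 1\<^sub>m n) - ?B * ((2 * \<i> * z) \<cdot>\<^sub>m mat_inv ?B)"
      unfolding e by (rule mult_minus_distrib_mat[OF B smult_carrier_mat[OF one_carrier_mat] smult_carrier_mat[OF R(1)]])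
    then show ?thesis
      unfolding mult_smult_distrib[OF B one_carrier_mat] mult_smult_distrib[OF B R(1)] R(2) right_mult_one_mat[OF B] .
  qed
  have null: "nullv n ((z - w) \<cdot>\<^sub>m ?B - (2 * \<i> * z) \<cdot>\<^sub>m 1\<^sub>m n) v" if "nullv n (shift n ?U w) v" for v
    using nullv_mult[OF B shift_carrier[OF U] that] unfolding BU .
  have row: "(\<Sum>j<n. ((z - w) \<cdot>\<^sub>m ?B - (2 * \<i> * z) \<cdot>\<^sub>m 1\<^sub>m n) $$ (i,j) * v j)
      = (z - w) * (\<Sum>j<n. ?B $$ (i,j) * v j) - 2 * \<i> * z * v i" if i: "i < n" for i v
  proof -
    have "(\<Sum>j<n. ((z - w) \<cdot>\<^sub>m ?B - (2 * \<i> * z) \<cdot>\<^sub>m 1\<^sub>m n) $$ (i,j) * v j)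
        = (\<Sum>j<n. (z - w) * (?B $$ (i,j) * v j) - (if j = i then 2 * \<i> * z * v i else 0))"
      using i B by (intro sum.cong refl) (auto simp: algebra_simps)
    then show ?thesis using i by (simp add: sum_subtractf sum_distrib_left)
  qed
  obtain v u where vu: "nullv n (shift n ?U w) v" "nullv n (shift n ?U w) u" "\<exists>i<n. \<exists>j<n. v i * u j \<noteq> v j * u i"
    using k unfolding ker2_def by blast
  have ne: "w \<noteq> z"
  proof
    assume "w = z"
    then have "v i = 0" if "i < n" for i
      using null[OF vu(1)] row[OF that, of v] that z by (simp add: nullv_def)
    then show False using vu(3) by auto
  qed
  define x where "x = 2 * \<i> * z / (z - w) - \<i>"
  have "nullv n (shift n G x) v" if "nullv n (shift n ?U w) v" for v
    unfolding nullv_def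
  proof (intro allI impI)
    fix i assume i: "i < n"
    have "(z - w) * (\<Sum>j<n. ?B $$ (i,j) * v j) = 2 * \<i> * z * v i"
      using null[OF that] row[OF i, of v] i by (simp add: nullv_def)
    then have e: "(\<Sum>j<n. ?B $$ (i,j) * v j) = 2 * \<i> * z / (z - w) * v i"
      using ne by (simp add: field_simps)
    have "(\<Sum>j<n. shift n G x $$ (i,j) * v j) = (\<Sum>j<n. ?B $$ (i,j) * v j - (if j = i then 2 * \<i> * z / (z - w) * v i else 0))"
      using i Gc by (intro sum.cong refl) (auto simp: x_def algebra_simps)
    also have "\<dots> = 0" unfolding sum_subtractf e using i by simp
    finally show "(\<Sum>j<n. shift n G x $$ (i,j) * v j) = 0" .
  qed
  then show ?thesis using vu unfolding ker2_def by blast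
qed

text \<open>The normality input of \<open>degen_imp_ker2\<close> for unitary matrices. If
  \<open>u\<close> is an eigenvector for \<open>w\<close>, unitarity shows that \<open>w\<close>
  times the adjoint of \<open>U\<close> fixes \<open>u\<close>; pairing with \<open>u\<close> gives
  modulus 1 for \<open>w\<close>, so the adjoint acts on \<open>u\<close> as
  \<open>cnj w\<close>.\<close>

lemma unitary_nullv_adjoint:
  assumes U: "unitary_mat n U" and u: "nullv n (shift n U w) u"
  shows "\<forall>j<n. (\<Sum>i<n. cnj (shift n U w $$ (i,j)) * u i) = 0"
proof (cases "\<exists>i<n. u i \<noteq> 0")
  case False
  then show ?thesis by (auto intro!: sum.neutral)
next
  case True
  then obtain i0 where i0: "i0 < n" "u i0 \<noteq> 0" by blast
  note Uc = unitary_carrier[OF U]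
  have ev: "(\<Sum>j<n. U $$ (i,j) * u j) = w * u i" if i: "i < n" for i
  proof -
    have "(\<Sum>j<n. shift n U w $$ (i,j) * u j) = (\<Sum>j<n. U $$ (i,j) * u j - (if j = i then w * u i else 0))"
      using i by (intro sum.cong refl) (auto simp: shift_index[OF Uc] algebra_simps simp del: index_minus_mat)
    also have "\<dots> = (\<Sum>j<n. U $$ (i,j) * u j) - w * u i" using i by (simp add: sum_subtractf)
    finally show ?thesis using u i by (simp add: nullv_def)
  qed
  have orth: "(\<Sum>i<n. cnj (U $$ (i,j)) * U $$ (i,l)) = (if j = l then 1 else 0)" if "j < n" "l < n" for j l
  proof -
    have "(mat_adjoint U * U) $$ (j,l) = (if j = l then 1 else 0)"
      using U that by (simp add: unitary_mat_def)
    then show ?thesis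
      unfolding mult_index[OF mat_adjoint_carrier[OF Uc] Uc that] using that
      by (simp add: mat_adjoint_index[OF Uc])
  qed
  define a where "a j = (\<Sum>i<n. cnj (U $$ (i,j)) * u i)" for j
  have wa: "w * a j = u j" if j: "j < n" for j
  proof -
    have "w * a j = (\<Sum>i<n. cnj (U $$ (i,j)) * (\<Sum>l<n. U $$ (i,l) * u l))"
      unfolding a_def sum_distrib_left[of w] by (intro sum.cong refl) (simp only: lessThan_iff ev mult.left_commute)
    also have "\<dots> = (\<Sum>i<n. \<Sum>l<n. cnj (U $$ (i,j)) * (U $$ (i,l) * u l))"
      by (simp add: sum_distrib_left)
    also have "\<dots> = (\<Sum>l<n. \<Sum>i<n. cnj (U $$ (i,j)) * (U $$ (i,l) * u l))" by (rule sum.swap)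
    also have "\<dots> = (\<Sum>l<n. (if j = l then 1 else 0) * u l)"
      using j by (intro sum.cong refl) (simp add: sum_distrib_right mult.assoc flip: orth)
    also have "\<dots> = (\<Sum>l<n. if l = j then u j else 0)" by (intro sum.cong) auto
    finally show ?thesis using j by simp
  qed
  have w0: "w \<noteq> 0" using wa[OF i0(1)] i0(2) by auto
  define s where "s = (\<Sum>i<n. cnj (u i) * u i)"
  have "s = of_real (\<Sum>i<n. (cmod (u i))\<^sup>2)"
    unfolding s_def of_real_sum by (intro sum.cong refl) (simp only: complex_norm_square mult.commute)
  moreover have "(\<Sum>i<n. (cmod (u i))\<^sup>2) > 0" using i0 by (intro sum_pos2[of _ i0]) auto
  ultimately have s0: "s \<noteq> 0" by (simp del: of_real_sum)
  have "(\<Sum>j<n. cnj (u j) * (w * a j)) = s" unfolding s_def using wa by (intro sum.cong) auto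
  then have 1: "w * (\<Sum>j<n. cnj (u j) * a j) = s" by (simp add: sum_distrib_left mult.left_commute)
  have "(\<Sum>j<n. cnj (u j) * a j) = (\<Sum>j<n. \<Sum>i<n. cnj (u j) * (cnj (U $$ (i,j)) * u i))"
    unfolding a_def by (simp add: sum_distrib_left)
  also have "\<dots> = (\<Sum>i<n. \<Sum>j<n. cnj (u j) * (cnj (U $$ (i,j)) * u i))" by (rule sum.swap)
  also have "\<dots> = (\<Sum>i<n. cnj (\<Sum>j<n. U $$ (i,j) * u j) * u i)"
    by (intro sum.cong refl) (simp add: sum_distrib_right mult.assoc mult.left_commute)
  also have "\<dots> = (\<Sum>i<n. cnj w * (cnj (u i) * u i))"
    by (intro sum.cong refl) (simp add: ev mult.assoc)
  also have "\<dots> = cnj w * s" unfolding s_def by (simp add: sum_distrib_left)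
  finally have "w * cnj w = 1" using 1 s0 by (simp add: mult.assoc[symmetric])
  then have a: "a j = cnj w * u j" if "j < n" for j
    using wa[OF that] by (metis mult.assoc mult.commute mult_1)
  show ?thesis
  proof (intro allI impI)
    fix j assume j: "j < n"
    have "(\<Sum>i<n. cnj (shift n U w $$ (i,j)) * u i) = (\<Sum>i<n. cnj (U $$ (i,j)) * u i - (if i = j then cnj w * u j else 0))"
      using j by (intro sum.cong refl) (auto simp: shift_index[OF Uc] algebra_simps simp del: index_minus_mat)
    also have "\<dots> = a j - cnj w * u j" using j by (simp add: sum_subtractf a_def)
    finally show "(\<Sum>i<n. cnj (shift n U w $$ (i,j)) * u i) = 0" using a[OF j] by simp
  qed
qed

lemma unitary_degen_iff_ker2:
  "unitary_mat n U \<Longrightarrow> degen n (shift n U w) \<longleftrightarrow> ker2 n (shift n U w)"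
  using degen_imp_ker2[OF shift_carrier[OF unitary_carrier]] ker2_imp_degen[OF shift_carrier[OF unitary_carrier]]
    unitary_nullv_adjoint by blast

text \<open>Puts the repeated root at the head of the eigenvalue list, so that a Schur form ordered
  by this list has \<open>w\<close> in its first two diagonal positions.\<close>

lemma char_poly_repeated_root:
  fixes A :: "complex mat"
  assumes A: "A \<in> carrier_mat n n" and o: "Polynomial.order w (char_poly A) > 1"
  obtains es where "char_poly A = (\<Prod>e\<leftarrow>w # w # es. [:- e, 1:])"
proof -
  have "[:- w, 1:]^2 dvd char_poly A" using o by (subst order_divides) auto
  then obtain q where q: "char_poly A = [:- w, 1:]^2 * q" by (rule dvdE)
  have m: "monic (char_poly A)" using degree_monic_char_poly[OF A] by simp
  have lq: "lead_coeff q = 1" using m unfolding q lead_coeff_mult by (simp add: lead_coeff_power)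
  obtain as where "Polynomial.smult (lead_coeff q) (\<Prod>a\<leftarrow>as. [:- a, 1:]) = q"
    using fundamental_theorem_algebra_factorized[of q] by blast
  then have "q = (\<Prod>a\<leftarrow>as. [:- a, 1:])" using lq by simp
  then show thesis using q that[of as] by (simp add: power2_eq_square mult.assoc del: mult_pCons_left mult_pCons_right)
qed

text \<open>Algebraic multiplicity two has to yield a kernel of dimension two. In a Schur form
  starting with \<open>w, w\<close>, the first column of \<open>P\<close> is an eigenvector and
  \<open>U - w\<close> sends the second one to a multiple \<open>t\<close> of the first. So
  \<open>t\<close> lies in the kernel and in the range of \<open>U - w\<close>, which are orthogonal
  by \<open>unitary_nullv_adjoint\<close>; hence \<open>t = 0\<close> and the second column is an
  eigenvector too.\<close>

lemma unitary_simple_spectrum: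
  assumes U: "unitary_mat n U" and k: "\<And>w. \<not> ker2 n (shift n U w)"
  shows "simple_spectrum U"
proof (rule ccontr)
  assume "\<not> simple_spectrum U"
  then obtain w where ow: "Polynomial.order w (char_poly U) > 1" by (auto simp: simple_spectrum_def not_le)
  note Uc = unitary_carrier[OF U]
  from char_poly_repeated_root[OF Uc ow] obtain es where
    es: "char_poly U = (\<Prod>e\<leftarrow>w # w # es. [:- e, 1:])" .
  obtain B P Q where BPQ: "schur_decomposition U (w # w # es) = (B,P,Q)" by (cases "schur_decomposition U (w # w # es)")
  from schur_decomposition[OF Uc es BPQ]
  have wit: "similar_mat_wit U B P Q" and ut: "upper_triangular B" and dg: "diag_mat B = w # w # es" by auto
  note sw = similar_mat_witD2[OF Uc wit]
  have B: "B \<in> carrier_mat n n" and P: "P \<in> carrier_mat n n" and Q: "Q \<in> carrier_mat n n"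
    and PQ: "P * Q = 1\<^sub>m n" and QP: "Q * P = 1\<^sub>m n" and UPBQ: "U = P * B * Q" using sw by blast+
  have n: "2 \<le> n" using arg_cong[OF dg, of length] B by (simp add: diag_mat_def)
  have B00: "B $$ (0,0) = w" using arg_cong[OF dg, of "\<lambda>l. l ! 0"] n B by (simp add: diag_mat_def)
  have B11: "B $$ (1,1) = w" using arg_cong[OF dg, of "\<lambda>l. l ! 1"] n B by (simp add: diag_mat_def)
  have UP: "U * P = P * B"
    unfolding UPBQ assoc_mult_mat[OF mult_carrier_mat[OF P B] Q P] QP
    by (rule right_mult_one_mat[OF mult_carrier_mat[OF P B]])
  have Bz: "B $$ (l,j) = 0" if "l < n" "j < l" for l j using ut that B by (auto simp: upper_triangular_def)
  have null0: "(\<Sum>l<n. U $$ (i,l) * P $$ (l,0)) = w * P $$ (i,0)" if i: "i < n" for i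
  proof -
    have "(\<Sum>l<n. U $$ (i,l) * P $$ (l,0)) = (\<Sum>l<n. P $$ (i,l) * B $$ (l,0))"
      using arg_cong[OF UP, of "\<lambda>M. M $$ (i,0)"] n i
      by (simp add: mult_index[OF Uc P] mult_index[OF P B] del: index_mult_mat)
    also have "\<dots> = (\<Sum>l<n. if l = 0 then P $$ (i,0) * w else 0)"
      using Bz[of _ 0] B00 by (intro sum.cong) auto
    finally show ?thesis using n by simp
  qed
  have null1: "(\<Sum>l<n. U $$ (i,l) * P $$ (l,1)) = w * P $$ (i,1) + B $$ (0,1) * P $$ (i,0)" if i: "i < n" for i
  proof -
    have "(\<Sum>l<n. U $$ (i,l) * P $$ (l,1)) = (\<Sum>l<n. P $$ (i,l) * B $$ (l,1))"
      using arg_cong[OF UP, of "\<lambda>M. M $$ (i,1)"] n i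
      by (simp add: mult_index[OF Uc P] mult_index[OF P B] del: index_mult_mat)
    also have "\<dots> = (\<Sum>l\<in>{0,1}. P $$ (i,l) * B $$ (l,1))"
      using Bz[of _ 1] n by (intro sum.mono_neutral_right) auto
    finally show ?thesis using B11 by simp
  qed
  have sh: "(\<Sum>j<n. shift n U w $$ (i,j) * v j) = (\<Sum>j<n. U $$ (i,j) * v j) - w * v i" if i: "i < n" for i v
  proof -
    have "(\<Sum>j<n. shift n U w $$ (i,j) * v j) = (\<Sum>j<n. U $$ (i,j) * v j - (if j = i then w * v i else 0))"
      using i by (intro sum.cong refl) (auto simp: shift_index[OF Uc] algebra_simps simp del: index_minus_mat)
    then show ?thesis using i by (simp add: sum_subtractf)
  qed
  define t where "t i = B $$ (0,1) * P $$ (i,0)" for i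
  have N0: "nullv n (shift n U w) (\<lambda>i. P $$ (i,0))"
    unfolding nullv_def by (simp add: sh null0 del: index_minus_mat)
  have Nt: "nullv n (shift n U w) t"
    using nullv_lincomb[OF N0 N0, of "B $$ (0,1)" 0] unfolding t_def[abs_def] by simp
  have t1: "(\<Sum>j<n. shift n U w $$ (i,j) * P $$ (j,1)) = t i" if "i < n" for i
    unfolding sh[OF that] null1[OF that] t_def by simp
  have "(\<Sum>i<n. cnj (t i) * t i) = (\<Sum>i<n. \<Sum>j<n. cnj (t i) * (shift n U w $$ (i,j) * P $$ (j,1)))"
    by (intro sum.cong refl) (simp add: sum_distrib_left del: index_minus_mat flip: t1)
  also have "\<dots> = (\<Sum>j<n. \<Sum>i<n. cnj (t i) * (shift n U w $$ (i,j) * P $$ (j,1)))" by (rule sum.swap)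
  also have "\<dots> = (\<Sum>j<n. cnj (\<Sum>i<n. cnj (shift n U w $$ (i,j)) * t i) * P $$ (j,1))"
    by (intro sum.cong refl) (simp add: sum_distrib_right sum_distrib_left mult_ac del: index_minus_mat One_nat_def)
  also have "\<dots> = 0" using unitary_nullv_adjoint[OF U Nt] by (intro sum.neutral) (auto simp del: index_minus_mat)
  finally have "(\<Sum>i<n. cnj (t i) * t i) = 0" .
  moreover have "(\<Sum>i<n. cnj (t i) * t i) = of_real (\<Sum>i<n. (cmod (t i))\<^sup>2)"
    unfolding of_real_sum by (intro sum.cong refl) (simp only: complex_norm_square mult.commute)
  ultimately have "(\<Sum>i<n. (cmod (t i))\<^sup>2) = 0" by (simp del: of_real_sum)
  then have "\<forall>i\<in>{..<n}. (cmod (t i))\<^sup>2 = 0" by (subst (asm) sum_nonneg_eq_0_iff) auto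
  then have N1: "nullv n (shift n U w) (\<lambda>i. P $$ (i,1))"
    unfolding nullv_def by (simp add: t1 del: index_minus_mat One_nat_def)
  have Qrow: "(\<Sum>i<n. Q $$ (a,i) * P $$ (i,b)) = (if a = b then 1 else 0)" if "a < n" "b < n" for a b
    using arg_cong[OF QP, of "\<lambda>M. M $$ (a,b)"] that by (simp add: mult_index[OF Q P] del: index_mult_mat)
  \<comment> \<open>Independence of the two columns comes from the left inverse \<open>Q\<close> of
    \<open>P\<close>.\<close>
  have "\<exists>i<n. \<exists>j<n. P $$ (i,0) * P $$ (j,1) \<noteq> P $$ (j,0) * P $$ (i,1)"
  proof (rule ccontr)
    assume c: "\<not> ?thesis"
    have "P $$ (j,1) = 0" if j: "j < n" for j
    proof -
      have "P $$ (j,1) = (\<Sum>i<n. Q $$ (0,i) * P $$ (i,0)) * P $$ (j,1)" using Qrow[of 0 0] n by simp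
      also have "\<dots> = (\<Sum>i<n. P $$ (j,0) * (Q $$ (0,i) * P $$ (i,1)))"
        unfolding sum_distrib_right
      proof (intro sum.cong refl)
        fix i assume "i \<in> {..<n}"
        then have "P $$ (i,0) * P $$ (j,1) = P $$ (j,0) * P $$ (i,1)" using c j by auto
        then show "Q $$ (0,i) * P $$ (i,0) * P $$ (j,1) = P $$ (j,0) * (Q $$ (0,i) * P $$ (i,1))"
          by (metis mult.assoc mult.left_commute)
      qed
      also have "\<dots> = 0" using Qrow[of 0 1] n by (simp flip: sum_distrib_left)
      finally show ?thesis .
    qed
    then have "(\<Sum>i<n. Q $$ (1,i) * P $$ (i,1)) = 0" by simp
    then show False using Qrow[of 1 1] n by simp
  qed
  then have "ker2 n (shift n U w)" using N0 N1 unfolding ker2_def by blast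
  then show False using k by blast
qed

lemma unitary_simple_spectrum_iff:
  "unitary_mat n U \<Longrightarrow> simple_spectrum U \<longleftrightarrow> (\<forall>w. \<not> degen n (shift n U w))"
  using degen_imp_order[OF unitary_carrier] unitary_simple_spectrum unitary_degen_iff_ker2 by blast

lemma simple_spectrum_cayley:
  "hermitian n G \<Longrightarrow> cmod z = 1 \<Longrightarrow> (\<And>x. \<not> ker2 n (shift n G x)) \<Longrightarrow> simple_spectrum (cayley n z G)"
  using unitary_simple_spectrum[OF cayley_unitary] ker2_cayley by (metis norm_zero zero_neq_one)

section \<open>Perturbation of matching families in a chart\<close>

definition mcont :: "nat \<Rightarrow> 'a::topological_space set \<Rightarrow> ('a \<Rightarrow> complex mat) \<Rightarrow> bool" where
  "mcont n S A \<longleftrightarrow> (\<forall>i<n. \<forall>j<n. continuous_on S (\<lambda>x. A x $$ (i,j)))"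

lemma periodicD: "periodic f \<Longrightarrow> f (k + (of_int a, of_int b)) = f k"
  unfolding periodic_def by blast

lemma mcont_det:
  assumes "\<And>x. A x \<in> carrier_mat n n" "mcont n S A"
  shows "continuous_on S (\<lambda>x. det (A x))"
  unfolding continuous_on_def
proof
  fix x assume "x \<in> S"
  then have "mtendsto n A (A x) (at x within S)"
    using assms(2) unfolding mcont_def mtendsto_def continuous_on_def by blast
  then show "((\<lambda>x. det (A x)) \<longlongrightarrow> det (A x)) (at x within S)"
    by (rule tendsto_det[OF assms(1) assms(1)])
qed

lemma mcont_subset: "mcont n S A \<Longrightarrow> T \<subseteq> S \<Longrightarrow> mcont n T A"
  unfolding mcont_def by (meson continuous_on_subset)

lemma mcont_cong: "mcont n S A \<Longrightarrow> (\<And>x. x \<in> S \<Longrightarrow> A x = B x) \<Longrightarrow> mcont n S B"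
  unfolding mcont_def by (metis (no_types, lifting) continuous_on_cong)

lemma mcont_shift:
  assumes "\<And>x. A x \<in> carrier_mat n n" "mcont n S A"
  shows "mcont n S (\<lambda>x. shift n (A x) z)"
  unfolding mcont_def
proof (intro allI impI)
  fix i j assume ij: "i < n" "j < n"
  show "continuous_on S (\<lambda>x. shift n (A x) z $$ (i,j))"
    unfolding shift_index[OF assms(1) ij]
    using assms(2) ij unfolding mcont_def by (intro continuous_on_diff continuous_on_const) auto
qed

lemma mcont_mat_inv:
  assumes A: "\<And>x. A x \<in> carrier_mat n n" and c: "mcont n S A" and d: "\<And>x. x \<in> S \<Longrightarrow> det (A x) \<noteq> 0"
  shows "mcont n S (\<lambda>x. mat_inv (A x))"
  unfolding mcont_def
proof (intro allI impI)
  fix i j assume ij: "i < n" "j < n"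
  have e: "mat_inv (A x) $$ (i,j) = 1 / det (A x) * ((-1)^(j+i) * det (mat_delete (A x) j i))" for x
    using A[of x] ij by (simp add: mat_inv_def adj_mat_def cofactor_def carrier_matD[OF A])
  have "mcont (n-1) S (\<lambda>x. mat_delete (A x) j i)"
    unfolding mcont_def
  proof (intro allI impI)
    fix i' j' assume ij': "i' < n - 1" "j' < n - 1"
    then have "(\<lambda>x. mat_delete (A x) j i $$ (i',j')) =
        (\<lambda>x. A x $$ (if i' < j then i' else Suc i', if j' < i then j' else Suc j'))"
      using carrier_matD[OF A] unfolding mat_delete_def by (intro ext) auto
    moreover have "(if i' < j then i' else Suc i') < n" "(if j' < i then j' else Suc j') < n"
      using ij' by auto
    ultimately show "continuous_on S (\<lambda>x. mat_delete (A x) j i $$ (i',j'))"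
      using c unfolding mcont_def by presburger
  qed
  from mcont_det[OF mat_delete_carrier[OF A] this]
  have "continuous_on S (\<lambda>x. det (mat_delete (A x) j i))" .
  then show "continuous_on S (\<lambda>x. mat_inv (A x) $$ (i,j))"
    unfolding e using d by (intro continuous_intros mcont_det[OF A c]) auto
qed

lemma mcont_affine:
  assumes "\<And>x. A x \<in> carrier_mat n n" "mcont n S A"
  shows "mcont n S (\<lambda>x. c \<cdot>\<^sub>m A x - d \<cdot>\<^sub>m 1\<^sub>m n)"
  unfolding mcont_def
proof (intro allI impI)
  fix i j assume ij: "i < n" "j < n"
  have "(c \<cdot>\<^sub>m A x - d \<cdot>\<^sub>m 1\<^sub>m n) $$ (i,j) = c * A x $$ (i,j) - d * (if i = j then 1 else 0)" for x
    using carrier_matD[OF assms(1), of x] ij by simp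
  then show "continuous_on S (\<lambda>x. (c \<cdot>\<^sub>m A x - d \<cdot>\<^sub>m 1\<^sub>m n) $$ (i,j))"
    using assms(2) ij unfolding mcont_def by (auto intro!: continuous_on_diff continuous_on_mult continuous_on_const)
qed

lemma cayley_alt: "H \<in> carrier_mat n n \<Longrightarrow>
    cayley n z H = (- (2 * \<i> * z)) \<cdot>\<^sub>m mat_inv (shift n H (- \<i>)) - (- z) \<cdot>\<^sub>m 1\<^sub>m n"
  using mat_inv_carrier[OF shift_carrier, of H n "- \<i>"]
  by (intro mat_eqI[of _ n]) (auto simp: cayley_def)

lemma mcont_cayley:
  assumes H: "\<And>x. hermitian n (H x)" and c: "mcont n S H"
  shows "mcont n S (\<lambda>x. cayley n z (H x))"
  unfolding cayley_alt[OF hermitian_carrier[OF H]]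
  by (intro mcont_affine mat_inv_carrier shift_carrier hermitian_carrier[OF H] mcont_mat_inv mcont_shift c
      hermitian_det_shift[OF H ii_not_real(2)])

lemma mcont_inv_cayley:
  assumes "\<And>x. U x \<in> carrier_mat n n" "mcont n S U" "\<And>x. x \<in> S \<Longrightarrow> det (shift n (U x) z) \<noteq> 0"
  shows "mcont n S (\<lambda>x. inv_cayley n z (U x))"
  unfolding inv_cayley_def
  by (intro mcont_affine mat_inv_carrier shift_carrier assms mcont_mat_inv mcont_shift)

lemma mcont_add:
  assumes "\<And>x. A x \<in> carrier_mat n n" "\<And>x. B x \<in> carrier_mat n n" "mcont n S A" "mcont n S B"
  shows "mcont n S (\<lambda>x. A x + B x)"
  using assms(3,4) carrier_matD[OF assms(1)] carrier_matD[OF assms(2)] unfolding mcont_def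
  by (auto intro!: continuous_on_add)

lemma mcont_open_Un:
  assumes "open S" "open T" "mcont n S A" "mcont n T A"
  shows "mcont n (S \<union> T) A"
  using assms continuous_on_open_Un unfolding mcont_def by blast

section \<open>Matching families and their homotopies\<close>

lemma matchingD:
  assumes "matching_family m \<epsilon> \<alpha>"
  shows "mcont m UNIV \<alpha>" "\<And>k a b. \<alpha> (k + (of_int a, of_int b)) = \<alpha> k" "\<And>k. unitary_mat m (\<alpha> k)"
    "\<And>k. \<epsilon> * \<alpha> k = transpose_mat (\<alpha> (- k)) * \<epsilon>"
  using assms unfolding matching_family_def mcont_def by blast+

lemma matching_periodic: "matching_family m \<epsilon> \<alpha> \<Longrightarrow> periodic \<alpha>"
  by (simp add: matching_family_def periodic_def)

lemma matchingI:
  assumes "mcont m UNIV \<alpha>" "periodic \<alpha>" "\<And>k. unitary_mat m (\<alpha> k)"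
    "\<And>k. \<epsilon> * \<alpha> k = transpose_mat (\<alpha> (- k)) * \<epsilon>"
  shows "matching_family m \<epsilon> \<alpha>"
  using assms unfolding matching_family_def mcont_def periodic_def by blast

text \<open>The parameter ranges over all reals because the straight lines in a chart are defined
  for every t; the piece over [0, 1] is what enters a null-homotopy.\<close>

definition matching_homotopic :: "nat \<Rightarrow> complex mat \<Rightarrow> (real \<times> real \<Rightarrow> complex mat) \<Rightarrow> (real \<times> real \<Rightarrow> complex mat) \<Rightarrow> bool" where
  "matching_homotopic m \<epsilon> \<alpha> \<beta> \<longleftrightarrow> (\<exists>G :: real \<Rightarrow> real \<times> real \<Rightarrow> complex mat. mcont m UNIV (\<lambda>(t,k). G t k) \<and>
     (\<forall>t. matching_family m \<epsilon> (G t)) \<and> G 0 = \<alpha> \<and> G 1 = \<beta>)"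

text \<open>Concatenation at double speed: the homotopy run backwards from \<beta> to \<alpha>,
  followed by the null-homotopy of \<alpha>.\<close>

lemma matching_homotopic_null_homotopic:
  assumes "matching_homotopic m \<epsilon> \<alpha> \<beta>" "equiv_null_homotopic m \<epsilon> \<alpha>"
  shows "equiv_null_homotopic m \<epsilon> \<beta>"
proof -
  obtain G where Gc: "mcont m UNIV (\<lambda>(t::real,k). G t k)" and Gm: "\<And>t. matching_family m \<epsilon> (G t)"
    and G: "G 0 = \<alpha>" "G 1 = \<beta>" using assms(1) unfolding matching_homotopic_def by auto
  define Q where "Q H \<longleftrightarrow> (\<forall>i<m. \<forall>j<m. continuous_on ({0..1} \<times> UNIV) (\<lambda>(t,k). H t k $$ (i,j))) \<and>
      (\<forall>t\<in>{0..1}. matching_family m \<epsilon> (H t)) \<and> H 0 = \<alpha> \<and> H 1 = (\<lambda>k. 1\<^sub>m m)" for H :: "real \<Rightarrow> real \<times> real \<Rightarrow> complex mat"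
  have "\<exists>H. Q H" using assms(2) unfolding equiv_null_homotopic_def Q_def .
  then obtain H where QH: "Q H" by (rule exE)
  note q = QH[unfolded Q_def]
  note H' = q[THEN conjunct1] q[THEN conjunct2, THEN conjunct1]
    and H = q[THEN conjunct2, THEN conjunct2, THEN conjunct1] q[THEN conjunct2, THEN conjunct2, THEN conjunct2]
  have Hc: "continuous_on ({0..1} \<times> UNIV) (\<lambda>(t,k). H t k $$ (i,j))" if "i < m" "j < m" for i j
    using H'(1) that by blast
  have Hm: "matching_family m \<epsilon> (H t)" if "t \<in> {0..1}" for t using H'(2) that by blast
  define K where "K t = (if t \<le> 1/2 then G (1 - 2 * t) else H (2 * t - 1))" for t :: real
  have "continuous_on ({0..1} \<times> UNIV) (\<lambda>(t,k). K t k $$ (i,j))" if ij: "i < m" "j < m" for i j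
  proof -
    let ?S = "{0..1/2::real} \<times> (UNIV :: (real \<times> real) set)" and ?T = "{1/2..1::real} \<times> (UNIV :: (real \<times> real) set)"
    have g: "continuous_on UNIV (\<lambda>x. G (fst x) (snd x) $$ (i,j))"
      using Gc ij by (auto simp: mcont_def case_prod_beta)
    have "continuous_on ?S (\<lambda>x. G (fst (1 - 2 * fst x, snd x)) (snd (1 - 2 * fst x, snd x)) $$ (i,j))"
      by (rule continuous_on_compose2[OF g]) (auto intro!: continuous_intros)
    moreover have "continuous_on ?T (\<lambda>x. (\<lambda>(t,k). H t k $$ (i,j)) (2 * fst x - 1, snd x))"
      by (rule continuous_on_compose2[OF Hc[OF ij]]) (auto intro!: continuous_intros)
    moreover have mid: "a * 2 = 1 \<Longrightarrow> G (1 - 2 * a) = H (2 * a - 1)" for a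
      by (simp add: G H mult.commute)
    ultimately have "continuous_on (?S \<union> ?T) (\<lambda>x. if fst x \<le> 1/2 then G (1 - 2 * fst x) (snd x) $$ (i,j)
        else H (2 * fst x - 1) (snd x) $$ (i,j))"
      by (intro continuous_on_If) (auto simp: closed_Times mid)
    moreover have "?S \<union> ?T = {0..1} \<times> UNIV" by auto
    moreover have "(\<lambda>(t,k). K t k $$ (i,j)) = (\<lambda>x. if fst x \<le> 1/2 then G (1 - 2 * fst x) (snd x) $$ (i,j)
        else H (2 * fst x - 1) (snd x) $$ (i,j))" by (auto simp: K_def fun_eq_iff)
    ultimately show ?thesis by (simp only:)
  qed
  moreover have "matching_family m \<epsilon> (K t)" if "t \<in> {0..1}" for t
    using Gm Hm[of "2 * t - 1"] that by (auto simp: K_def)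
  ultimately show ?thesis
    unfolding equiv_null_homotopic_def by (intro exI[of _ K]) (auto simp: K_def G H)
qed

text \<open>Null-homotopy enters as an implication, so that successive perturbations compose and
  their tolerances add up (\<open>near_trans\<close>).\<close>

definition near :: "nat \<Rightarrow> complex mat \<Rightarrow> real \<Rightarrow> (real \<times> real \<Rightarrow> complex mat) \<Rightarrow> (real \<times> real \<Rightarrow> complex mat) \<Rightarrow> bool" where
  "near m \<epsilon> \<delta> \<alpha> \<beta> \<longleftrightarrow> matching_family m \<epsilon> \<beta> \<and> (equiv_null_homotopic m \<epsilon> \<alpha> \<longrightarrow> equiv_null_homotopic m \<epsilon> \<beta>) \<and>
     (\<forall>k. mclose m \<delta> (\<beta> k) (\<alpha> k))"

lemma near_refl: "matching_family m \<epsilon> \<alpha> \<Longrightarrow> \<delta> > 0 \<Longrightarrow> near m \<epsilon> \<delta> \<alpha> \<alpha>"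
  by (simp add: near_def mclose_def)

lemma near_mono: "near m \<epsilon> \<delta> \<alpha> \<beta> \<Longrightarrow> \<delta> \<le> \<delta>' \<Longrightarrow> near m \<epsilon> \<delta>' \<alpha> \<beta>"
  unfolding near_def using mclose_mono by blast

lemma near_trans: "near m \<epsilon> \<delta> \<alpha> \<beta> \<Longrightarrow> near m \<epsilon> \<delta>' \<beta> \<gamma> \<Longrightarrow> near m \<epsilon> (\<delta> + \<delta>') \<alpha> \<gamma>"
  unfolding near_def using mclose_trans[of m \<delta>' _ _ \<delta>] by (metis add.commute)

lemma intertwine_add:
  fixes \<epsilon> A B A' B' :: "complex mat"
  assumes c: "\<epsilon> \<in> carrier_mat n n" "A \<in> carrier_mat n n" "B \<in> carrier_mat n n" "A' \<in> carrier_mat n n" "B' \<in> carrier_mat n n"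
    and r: "\<epsilon> * A = transpose_mat A' * \<epsilon>" "\<epsilon> * B = transpose_mat B' * \<epsilon>"
  shows "\<epsilon> * (A + B) = transpose_mat (A' + B') * \<epsilon>"
proof -
  have "\<epsilon> * (A + B) = transpose_mat A' * \<epsilon> + transpose_mat B' * \<epsilon>"
    unfolding mult_add_distrib_mat[OF c(1-3)] r ..
  also have "\<dots> = (transpose_mat A' + transpose_mat B') * \<epsilon>"
    using c by (intro add_mult_distrib_mat[symmetric]) auto
  also have "transpose_mat A' + transpose_mat B' = transpose_mat (A' + B')"
    using c by (intro mat_eqI[of _ n]) auto
  finally show ?thesis .
qed

lemma intertwine_smult:
  fixes \<epsilon> A A' :: "complex mat"
  assumes c: "\<epsilon> \<in> carrier_mat n n" "A \<in> carrier_mat n n" "A' \<in> carrier_mat n n"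
    and r: "\<epsilon> * A = transpose_mat A' * \<epsilon>"
  shows "\<epsilon> * (c \<cdot>\<^sub>m A) = transpose_mat (c \<cdot>\<^sub>m A') * \<epsilon>"
proof -
  have "\<epsilon> * (c \<cdot>\<^sub>m A) = c \<cdot>\<^sub>m (transpose_mat A' * \<epsilon>)" unfolding mult_smult_distrib[OF c(1,2)] r ..
  also have "\<dots> = (c \<cdot>\<^sub>m transpose_mat A') * \<epsilon>"
    using c by (intro mult_smult_assoc_mat[symmetric]) auto
  also have "c \<cdot>\<^sub>m transpose_mat A' = transpose_mat (c \<cdot>\<^sub>m A')" using c by (intro mat_eqI[of _ n]) auto
  finally show ?thesis .
qed

lemma hermitian_add_smult:
  assumes "hermitian n A" "hermitian n B"
  shows "hermitian n (A + complex_of_real t \<cdot>\<^sub>m B)"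
proof (rule hermitianI)
  note c = hermitian_carrier[OF assms(1)] hermitian_carrier[OF assms(2)]
  show "A + complex_of_real t \<cdot>\<^sub>m B \<in> carrier_mat n n" using c by simp
  fix i j assume ij: "i < n" "j < n"
  have e: "(A + complex_of_real t \<cdot>\<^sub>m B) $$ (i,j) = A $$ (i,j) + of_real t * B $$ (i,j)" if "i < n" "j < n" for i j
    using c that by simp
  show "(A + complex_of_real t \<cdot>\<^sub>m B) $$ (j,i) = cnj ((A + complex_of_real t \<cdot>\<^sub>m B) $$ (i,j))"
    unfolding e[OF ij] e[OF ij(2,1)] using hermitianD[OF assms(1) ij] hermitianD[OF assms(2) ij] by simp
qed

text \<open>Adding \<open>E\<close> to the chart value over \<Omega> and keeping \<alpha> elsewhere
  defines a continuous family, since both recipes agree on the overlap of \<Omega> with the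
  complement of \<open>K\<close>. Scaling \<open>E\<close> by t gives the homotopy, and
  \<open>cayley_lipschitz\<close> the distance.\<close>

lemma local_modification:
  assumes al: "matching_family m \<epsilon> \<alpha>" and eps: "\<epsilon> \<in> carrier_mat m m" "transpose_mat \<epsilon> * \<epsilon> = 1\<^sub>m m"
    and z: "cmod z = 1" and Om: "open \<Omega>" and K: "closed K" "K \<subseteq> \<Omega>"
    and chart: "\<And>k. k \<in> \<Omega> \<Longrightarrow> det (shift m (\<alpha> k) z) \<noteq> 0"
    and Eh: "\<And>k. hermitian m (E k)" and Ec: "mcont m UNIV E" and Ep: "periodic E"
    and Em: "\<And>k. \<epsilon> * E k = transpose_mat (E (- k)) * \<epsilon>"
    and E0: "\<And>k. k \<notin> K \<Longrightarrow> E k = 0\<^sub>m m m"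
    and Eb: "\<And>k i j. i < m \<Longrightarrow> j < m \<Longrightarrow> cmod (E k $$ (i,j)) \<le> \<eta>"
    and \<eta>: "2 * real m * real m * \<eta> < \<delta>" "\<delta> > 0"
  obtains \<beta> where "near m \<epsilon> \<delta> \<alpha> \<beta>" "\<And>k. k \<in> \<Omega> \<Longrightarrow> \<beta> k = cayley m z (inv_cayley m z (\<alpha> k) + E k)"
    "\<And>k. E k = 0\<^sub>m m m \<Longrightarrow> \<beta> k = \<alpha> k"
proof -
  note a = matchingD[OF al]
  have ac: "\<alpha> k \<in> carrier_mat m m" for k using unitary_carrier[OF a(3)] .
  have z0: "z \<noteq> 0" using z by auto
  \<comment> \<open>The default 0 off \<Omega> keeps \<open>H\<close> Hermitian everywhere, so that
    the lemmas on Hermitian families apply without case distinction.\<close>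
  define H where "H k = (if k \<in> \<Omega> then inv_cayley m z (\<alpha> k) else 0\<^sub>m m m)" for k
  have h0: "hermitian m (0\<^sub>m m m)" by (rule hermitianI) auto
  have Hh: "hermitian m (H k)" for k
    using inv_cayley_hermitian[OF a(3) z chart] h0 by (simp add: H_def)
  define G where "G t k = (if k \<in> \<Omega> then cayley m z (H k + complex_of_real t \<cdot>\<^sub>m E k) else \<alpha> k)" for t k
  have Gh: "hermitian m (H k + complex_of_real t \<cdot>\<^sub>m E k)" for t k by (rule hermitian_add_smult[OF Hh Eh])
  have Hcay: "cayley m z (H k) = \<alpha> k" if "k \<in> \<Omega>" for k
    using cayley_inv_cayley[OF ac z0 chart[OF that]] that by (simp add: H_def)
  have G0: "G t k = \<alpha> k" if "E k = 0\<^sub>m m m" for t k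
  proof -
    have "H k + complex_of_real t \<cdot>\<^sub>m E k = H k"
      unfolding that using hermitian_carrier[OF Hh[of k]] by (intro mat_eqI[of _ m]) auto
    then show ?thesis using Hcay by (simp add: G_def)
  qed
  have inO: "k \<in> \<Omega>" if "E k \<noteq> 0\<^sub>m m m" for k using E0 K(2) that by blast
  have Gu: "unitary_mat m (G t k)" for t k
    using a(3) cayley_unitary[OF Gh z] by (simp add: G_def)
  \<comment> \<open>Translates and reflections of a point are located through \<open>E\<close>:
    where it is nonzero they lie in \<Omega> as well, and where it vanishes \<open>G\<close> is
    \<alpha>. For reflections this is \<open>neg0\<close>, which rests on the invertibility of
    \<epsilon>.\<close>
  have Gper: "G t (k + (of_int x, of_int y)) = G t k" for t k and x y :: int
  proof (cases "E k = 0\<^sub>m m m")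
    case True
    then have "E (k + (of_int x, of_int y)) = 0\<^sub>m m m" using periodicD[OF Ep] by simp
    then show ?thesis using True G0 a(2) by simp
  next
    case False
    then have "E (k + (of_int x, of_int y)) \<noteq> 0\<^sub>m m m" using periodicD[OF Ep] by simp
    then have "k \<in> \<Omega>" "k + (of_int x, of_int y) \<in> \<Omega>" using inO False by auto
    then show ?thesis using a(2) periodicD[OF Ep] by (simp add: G_def H_def)
  qed
  have neg0: "E (- k) = 0\<^sub>m m m \<longleftrightarrow> E k = 0\<^sub>m m m" for k
  proof -
    have one: "E k = 0\<^sub>m m m" if "E (- k) = 0\<^sub>m m m" for k
    proof -
      have "E k = (transpose_mat \<epsilon> * \<epsilon>) * E k" unfolding eps by (rule left_mult_one_mat[OF hermitian_carrier[OF Eh], symmetric])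
      also have "\<dots> = transpose_mat \<epsilon> * (\<epsilon> * E k)"
        using eps(1) by (intro assoc_mult_mat[OF _ eps(1) hermitian_carrier[OF Eh]]) simp
      also have "\<epsilon> * E k = 0\<^sub>m m m" unfolding Em that using eps(1) by simp
      also have "transpose_mat \<epsilon> * 0\<^sub>m m m = 0\<^sub>m m m" using eps(1) by simp
      finally show ?thesis .
    qed
    show ?thesis using one[of k] one[of "- k"] by auto
  qed
  have Gm: "\<epsilon> * G t k = transpose_mat (G t (- k)) * \<epsilon>" for t k
  proof (cases "E k = 0\<^sub>m m m")
    case True
    then show ?thesis using G0[of k] G0[of "- k"] neg0 a(4) by simp
  next
    case False
    then have O: "k \<in> \<Omega>" "- k \<in> \<Omega>" using inO neg0 by auto
    have "\<epsilon> * H k = transpose_mat (H (- k)) * \<epsilon>"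
      using transpose_intertwine_inv_cayley[OF ac chart[OF O(1)] ac chart[OF O(2)] eps(1) a(4)] O by (simp add: H_def)
    from intertwine_add[OF eps(1) hermitian_carrier[OF Hh] _ hermitian_carrier[OF Hh] _ this
      intertwine_smult[OF eps(1) hermitian_carrier[OF Eh] hermitian_carrier[OF Eh] Em, of "complex_of_real t"]]
    have "\<epsilon> * (H k + complex_of_real t \<cdot>\<^sub>m E k) = transpose_mat (H (- k) + complex_of_real t \<cdot>\<^sub>m E (- k)) * \<epsilon>"
      using hermitian_carrier[OF Eh] by simp
    from transpose_intertwine_cayley[OF Gh Gh eps(1) this] show ?thesis using O by (simp add: G_def)
  qed
  have Gc: "mcont m UNIV (\<lambda>(t,k). G t k)"
  proof -
    have c: "continuous_on S (\<lambda>x. f (snd x))" if "continuous_on (snd ` S) f"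
      for S :: "(real \<times> real \<times> real) set" and f :: "real \<times> real \<Rightarrow> complex"
      using continuous_on_compose[OF continuous_on_snd[OF continuous_on_id] that] by (simp add: o_def)
    have sn: "snd ` (UNIV \<times> \<Omega>) \<subseteq> \<Omega>" "snd ` (UNIV \<times> - K) \<subseteq> - K" by auto
    have Hc: "mcont m \<Omega> H"
      by (rule mcont_cong[OF mcont_inv_cayley[OF ac mcont_subset[OF a(1)] chart]]) (auto simp: H_def)
    have 1: "mcont m (UNIV \<times> \<Omega>) (\<lambda>x. H (snd x) + complex_of_real (fst x) \<cdot>\<^sub>m E (snd x))"
      unfolding mcont_def
    proof (intro allI impI)
      fix i j assume ij: "i < m" "j < m"
      have e: "(H (snd x) + complex_of_real (fst x) \<cdot>\<^sub>m E (snd x)) $$ (i,j) =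
         H (snd x) $$ (i,j) + complex_of_real (fst x) * E (snd x) $$ (i,j)" for x
        using carrier_matD[OF hermitian_carrier[OF Hh[of "snd x"]]] carrier_matD[OF hermitian_carrier[OF Eh[of "snd x"]]] ij by simp
      show "continuous_on (UNIV \<times> \<Omega>) (\<lambda>x. (H (snd x) + complex_of_real (fst x) \<cdot>\<^sub>m E (snd x)) $$ (i,j))"
      proof -
        have "continuous_on \<Omega> (\<lambda>k. H k $$ (i,j))" "continuous_on UNIV (\<lambda>k. E k $$ (i,j))"
          using Hc Ec ij unfolding mcont_def by blast+
        then have "continuous_on (snd ` (UNIV \<times> \<Omega> :: (real \<times> real \<times> real) set)) (\<lambda>k. H k $$ (i,j))"
          "continuous_on (snd ` (UNIV \<times> \<Omega> :: (real \<times> real \<times> real) set)) (\<lambda>k. E k $$ (i,j))"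
          using sn(1) by (auto elim: continuous_on_subset)
        then show ?thesis
          unfolding e by (intro continuous_on_add continuous_on_mult c continuous_intros)
      qed
    qed
    have "mcont m (UNIV \<times> \<Omega>) (\<lambda>(t,k). G t k)"
      by (rule mcont_cong[OF mcont_cayley[OF Gh 1]]) (auto simp: G_def)
    moreover have "mcont m (UNIV \<times> - K) (\<lambda>(t,k). G t k)"
    proof (rule mcont_cong)
      show "mcont m (UNIV \<times> - K) (\<lambda>x :: real \<times> real \<times> real. \<alpha> (snd x))"
        using a(1) unfolding mcont_def by (auto intro!: c intro: continuous_on_subset)
    qed (use G0 E0 in auto)
    moreover have "open (UNIV \<times> \<Omega> :: (real \<times> real \<times> real) set)" "open (UNIV \<times> - K :: (real \<times> real \<times> real) set)"
      using Om K(1) by (auto intro!: open_Times)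
    ultimately have "mcont m (UNIV \<times> \<Omega> \<union> UNIV \<times> - K) (\<lambda>(t,k). G t k)" by (intro mcont_open_Un)
    moreover have "UNIV \<times> \<Omega> \<union> UNIV \<times> - K = (UNIV :: (real \<times> real \<times> real) set)" using K(2) by auto
    ultimately show ?thesis by simp
  qed
  have Gmatch: "matching_family m \<epsilon> (G t)" for t
  proof (rule matchingI)
    show "mcont m UNIV (G t)"
      unfolding mcont_def
    proof (intro allI impI)
      fix i j assume ij: "i < m" "j < m"
      have g: "continuous_on UNIV (\<lambda>x. G (fst x) (snd x) $$ (i,j))"
        using Gc ij by (auto simp: mcont_def case_prod_beta)
      have "continuous_on UNIV (\<lambda>k. G (fst (t, k)) (snd (t, k)) $$ (i,j))"
        by (rule continuous_on_compose2[OF g]) (auto intro!: continuous_intros)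
      then show "continuous_on UNIV (\<lambda>k. G t k $$ (i,j))" by simp
    qed
  qed (use Gper Gu Gm in \<open>auto simp: periodic_def\<close>)
  have G00: "G 0 = \<alpha>"
  proof
    fix k
    have "H k + complex_of_real 0 \<cdot>\<^sub>m E k = H k"
      using hermitian_carrier[OF Hh[of k]] hermitian_carrier[OF Eh[of k]] by (intro mat_eqI[of _ m]) auto
    then show "G 0 k = \<alpha> k" using Hcay by (simp add: G_def)
  qed
  have hom: "matching_homotopic m \<epsilon> \<alpha> (G 1)" unfolding matching_homotopic_def using Gc Gmatch G00 by blast
  have one: "complex_of_real 1 \<cdot>\<^sub>m E k = E k" for k using smult_one_mat[OF hermitian_carrier[OF Eh[of k]]] by simp
  have cl: "mclose m \<delta> (G 1 k) (\<alpha> k)" for k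
  proof (cases "k \<in> \<Omega>")
    case True
    have "cmod (cayley m z (H k + complex_of_real 1 \<cdot>\<^sub>m E k) $$ (i,j) - cayley m z (H k) $$ (i,j)) \<le> 2 * real m * real m * \<eta>"
      if ij: "i < m" "j < m" for i j
    proof (rule cayley_lipschitz[OF Hh Gh z _ ij])
      fix i' j' assume "i' < m" "j' < m"
      then show "cmod ((H k + complex_of_real 1 \<cdot>\<^sub>m E k) $$ (i',j') - H k $$ (i',j')) \<le> \<eta>"
        using Eb[of i' j' k] carrier_matD[OF hermitian_carrier[OF Hh[of k]]] carrier_matD[OF hermitian_carrier[OF Eh[of k]]]
        unfolding one by simp
    qed
    then show ?thesis using \<eta>(1) True Hcay[OF True] unfolding mclose_def G_def by fastforce
  next
    case False
    then show ?thesis using \<eta>(2) by (simp add: G_def mclose_def)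
  qed
  show thesis
  proof (rule that[of "G 1"])
    show "near m \<epsilon> \<delta> \<alpha> (G 1)" unfolding near_def using Gmatch matching_homotopic_null_homotopic[OF hom] cl by blast
    show "G 1 k = cayley m z (inv_cayley m z (\<alpha> k) + E k)" if "k \<in> \<Omega>" for k
      using that by (simp only: G_def H_def one if_True)
  qed (rule G0)
qed

text \<open>A smooth periodic substitute for the squared distance of \<open>k\<close> to the integer lattice.\<close>
definition lattice_gap :: "real \<times> real \<Rightarrow> real" where
  "lattice_gap k = 2 - cos (2 * pi * fst k) - cos (2 * pi * snd k)"

lemma cos_int_shift: "cos (2 * pi * (x + of_int a)) = cos (2 * pi * x)"
  using cos.plus_of_int[of "2 * pi * x" a] by (simp add: algebra_simps)

lemma sin_int_shift: "sin (2 * pi * (x + of_int a)) = sin (2 * pi * x)"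
  using sin.plus_of_int[of "2 * pi * x" a] by (simp add: algebra_simps)

lemma lattice_gap_periodic: "lattice_gap (k + (of_int a, of_int b)) = lattice_gap k"
  by (simp add: lattice_gap_def cos_int_shift)

lemma lattice_gap_minus: "lattice_gap (- k) = lattice_gap k"
  by (simp add: lattice_gap_def)

lemma lattice_gap_continuous [continuous_intros]:
  fixes f :: "'a::real_normed_vector \<Rightarrow> real \<times> real"
  shows "continuous_on S f \<Longrightarrow> continuous_on S (\<lambda>x. lattice_gap (f x))"
  unfolding lattice_gap_def
  by (intro continuous_on_diff continuous_on_const continuous_on_cos continuous_on_mult continuous_on_fst continuous_on_snd)

lemma lattice_gap_small_near_integers:
  assumes e: "e > 0"
  shows "\<exists>\<rho>>0. \<forall>k. lattice_gap k < \<rho> \<longrightarrow> (\<exists>a b :: int. \<bar>fst k - of_int a\<bar> < e \<and> \<bar>snd k - of_int b\<bar> < e)"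
proof -
  \<comment> \<open>The cap 1/4 keeps \<open>2 * pi * f\<close> in the range where the cosine
    decreases.\<close>
  define f where "f = min e (1/4)"
  have f: "0 < f" "f \<le> e" "f \<le> 1/4" using e by (auto simp: f_def)
  have key: "\<bar>x - of_int (round x)\<bar> < f" if "1 - cos (2 * pi * x) < 1 - cos (2 * pi * f)" for x
  proof (rule ccontr)
    assume c: "\<not> ?thesis"
    define y where "y = \<bar>x - of_int (round x)\<bar>"
    have y: "f \<le> y" "y \<le> 1/2" using c of_int_round_abs_le[of x] by (auto simp: y_def abs_minus_commute)
    have "cos (2 * pi * x) = cos (2 * pi * (x - of_int (round x)))"
      using cos_int_shift[of "x - of_int (round x)" "round x"] by simp
    also have "\<dots> = cos (2 * pi * y)" unfolding y_def
      using cos_abs_real[of "2 * pi * (x - of_int (round x))"] by (simp add: abs_mult)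
    also have "\<dots> \<le> cos (2 * pi * f)"
      using y f by (intro cos_monotone_0_pi_le) auto
    finally show False using that by simp
  qed
  have "cos (2 * pi * f) < cos 0" using f by (intro cos_monotone_0_pi) auto
  then have pos: "1 - cos (2 * pi * f) > 0" by simp
  show ?thesis
  proof (intro exI[of _ "1 - cos (2 * pi * f)"] conjI pos allI impI)
    fix k assume "lattice_gap k < 1 - cos (2 * pi * f)"
    moreover have "cos (2 * pi * fst k) \<le> 1" "cos (2 * pi * snd k) \<le> 1" by simp_all
    ultimately have "1 - cos (2 * pi * fst k) < 1 - cos (2 * pi * f)" "1 - cos (2 * pi * snd k) < 1 - cos (2 * pi * f)"
      unfolding lattice_gap_def by linarith+
    from key[OF this(1)] key[OF this(2)]
    show "\<exists>a b :: int. \<bar>fst k - of_int a\<bar> < e \<and> \<bar>snd k - of_int b\<bar> < e"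
      using f by (intro exI[of _ "round (fst k)"] exI[of _ "round (snd k)"]) simp
  qed
qed

lemma lattice_gap_small: "r > 0 \<Longrightarrow> \<exists>R>0. \<forall>k. \<bar>fst k\<bar> < R \<longrightarrow> \<bar>snd k\<bar> < R \<longrightarrow> lattice_gap k < r"
proof -
  assume r: "r > 0"
  have "continuous_on UNIV lattice_gap" using lattice_gap_continuous[OF continuous_on_id, of UNIV] by simp
  then have "\<exists>d>0. \<forall>k\<in>UNIV. dist k 0 < d \<longrightarrow> dist (lattice_gap k) (lattice_gap 0) < r"
    using r unfolding continuous_on_iff by (meson UNIV_I)
  then obtain d where d: "d > 0" "\<And>k. dist k 0 < d \<Longrightarrow> dist (lattice_gap k) (lattice_gap 0) < r" by blast
  have "lattice_gap k < r" if "\<bar>fst k\<bar> < d/2" "\<bar>snd k\<bar> < d/2" for k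
  proof -
    have "norm k \<le> \<bar>fst k\<bar> + \<bar>snd k\<bar>" using norm_Pair_le[of "fst k" "snd k"] by simp
    then have "dist (lattice_gap k) (lattice_gap 0) < r" using that by (intro d(2)) simp
    moreover have "lattice_gap 0 = 0" by (simp add: lattice_gap_def)
    ultimately show ?thesis by (simp add: dist_real_def)
  qed
  then show ?thesis using d(1) by (intro exI[of _ "d/2"]) auto
qed

text \<open>The common properties of the identity and of J: real orthogonal, and symmetric or
  antisymmetric according to the sign \<open>s\<close>. Away from the high-symmetry points both
  cases are treated together through it.\<close>

definition eps_sym :: "nat \<Rightarrow> complex mat \<Rightarrow> bool" where
  "eps_sym m \<epsilon> \<longleftrightarrow> \<epsilon> \<in> carrier_mat m m \<and> transpose_mat \<epsilon> * \<epsilon> = 1\<^sub>m m \<and>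
     (\<exists>s. s * s = 1 \<and> transpose_mat \<epsilon> = s \<cdot>\<^sub>m \<epsilon>) \<and>
     (\<forall>i<m. \<forall>j<m. \<epsilon> $$ (i,j) \<in> \<real> \<and> cmod (\<epsilon> $$ (i,j)) \<le> 1)"

lemma J_mat_carrier: "J_mat m \<in> carrier_mat m m" by (simp add: J_mat_def)

lemma J_mat_orthogonal:
  assumes "even m"
  shows "transpose_mat (J_mat m) * J_mat m = 1\<^sub>m m"
proof (rule mat_eqI)
  fix i j assume ij: "i < m" "j < m"
  define p where "p = m div 2"
  have m: "m = 2 * p" using assms by (simp add: p_def)
  define q where "q = (if i < p then i + p else i - p)"
  define s :: complex where "s = (if i < p then -1 else 1)"
  have q: "q < m" using ij m by (auto simp: q_def)
  have Jli: "J_mat m $$ (l,i) = (if l = q then s else 0)" if "l < m" for l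
    using that ij m by (auto simp: J_mat_def p_def[symmetric] q_def s_def)
  have "(transpose_mat (J_mat m) * J_mat m) $$ (i,j) = (\<Sum>l<m. J_mat m $$ (l,i) * J_mat m $$ (l,j))"
    using ij J_mat_carrier[of m]
    by (subst mult_index[of _ m]) (auto intro!: sum.cong)
  also have "\<dots> = (\<Sum>l<m. if l = q then s * J_mat m $$ (q,j) else 0)"
    by (intro sum.cong refl) (auto simp: Jli)
  also have "\<dots> = s * J_mat m $$ (q,j)" using q by simp
  also have "J_mat m $$ (q,j) = (if i = j then s else 0)"
    using q ij m by (auto simp: J_mat_def p_def[symmetric] q_def s_def)
  finally show "(transpose_mat (J_mat m) * J_mat m) $$ (i,j) = 1\<^sub>m m $$ (i,j)"
    using ij by (auto simp: s_def)
qed (use J_mat_carrier[of m] in auto)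

lemma J_mat_antisym:
  assumes "even m"
  shows "transpose_mat (J_mat m) = (-1) \<cdot>\<^sub>m J_mat m"
proof (rule mat_eqI[of _ m])
  obtain p where m: "m = 2 * p" using assms by (rule evenE)
  fix i j assume "i < m" "j < m"
  then show "transpose_mat (J_mat m) $$ (i,j) = ((-1) \<cdot>\<^sub>m J_mat m) $$ (i,j)"
    by (auto simp: J_mat_def m)
qed (auto simp: J_mat_def)

lemma eps_sym_admissible:
  assumes "admissible_eps m \<epsilon>"
  shows "eps_sym m \<epsilon>"
proof -
  consider "\<epsilon> = 1\<^sub>m m" | "even m" "\<epsilon> = J_mat m" using assms by (auto simp: admissible_eps_def)
  then show ?thesis
  proof cases
    case 1
    have "1\<^sub>m m = 1 \<cdot>\<^sub>m (1\<^sub>m m :: complex mat)" by (intro mat_eqI[of _ m]) auto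
    then show ?thesis unfolding 1 eps_sym_def
      by (auto intro!: exI[of _ 1])
  next
    case 2
    show ?thesis unfolding eps_sym_def 2(2)
      using J_mat_carrier J_mat_orthogonal[OF 2(1)] J_mat_antisym[OF 2(1)]
      by (intro conjI exI[of _ "-1"]) (auto simp: J_mat_def)
  qed
qed

lemma eps_symD:
  assumes "eps_sym m \<epsilon>"
  shows "\<epsilon> \<in> carrier_mat m m" "transpose_mat \<epsilon> * \<epsilon> = 1\<^sub>m m" "\<epsilon> * transpose_mat \<epsilon> = 1\<^sub>m m"
proof -
  show 1: "\<epsilon> \<in> carrier_mat m m" "transpose_mat \<epsilon> * \<epsilon> = 1\<^sub>m m" using assms by (simp_all add: eps_sym_def)
  show "\<epsilon> * transpose_mat \<epsilon> = 1\<^sub>m m"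
    using mat_mult_left_right_inverse[OF transpose_carrier_mat[THEN iffD2, OF 1(1)] 1] .
qed

text \<open>The relation \<open>\<epsilon> X = Y\<^sup>t \<epsilon>\<close> solved for \<open>X\<close> in terms of \<open>Y\<close>.\<close>
definition eps_transpose :: "complex mat \<Rightarrow> complex mat \<Rightarrow> complex mat" where
  "eps_transpose \<epsilon> X = transpose_mat \<epsilon> * (transpose_mat X * \<epsilon>)"

context
  fixes m :: nat and \<epsilon> :: "complex mat"
  assumes eps: "eps_sym m \<epsilon>"
begin

lemma tr_eps: "transpose_mat \<epsilon> \<in> carrier_mat m m" using eps_symD(1)[OF eps] by simp

lemma eps_transpose_carrier: "X \<in> carrier_mat m m \<Longrightarrow> eps_transpose \<epsilon> X \<in> carrier_mat m m"
  using mult_carrier_mat[OF tr_eps mult_carrier_mat[OF _ eps_symD(1)[OF eps]]] unfolding eps_transpose_def by simp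

text \<open>The second identity is the transpose of the first, the sign in
  \<open>transpose_mat \<epsilon> = s \<cdot>\<^sub>m \<epsilon>\<close> cancelling from both sides.
  Together they show that adding to a family at \<open>k\<close> its \<open>eps_transpose\<close>
  formed at \<open>- k\<close> produces the matching relation.\<close>

lemma eps_transpose_intertwine:
  assumes X: "X \<in> carrier_mat m m"
  shows "\<epsilon> * eps_transpose \<epsilon> X = transpose_mat X * \<epsilon>" "transpose_mat (eps_transpose \<epsilon> X) * \<epsilon> = \<epsilon> * X"
proof -
  note c = eps_symD[OF eps]
  have tX: "transpose_mat X \<in> carrier_mat m m" using X by simp
  show 1: "\<epsilon> * eps_transpose \<epsilon> X = transpose_mat X * \<epsilon>"
    unfolding eps_transpose_def assoc_mult_mat[OF c(1) tr_eps mult_carrier_mat[OF tX c(1)], symmetric] c(3)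
    by (rule left_mult_one_mat[OF mult_carrier_mat[OF tX c(1)]])
  obtain s where s: "s * s = 1" "transpose_mat \<epsilon> = s \<cdot>\<^sub>m \<epsilon>" using eps by (auto simp: eps_sym_def)
  have tS: "transpose_mat (eps_transpose \<epsilon> X) \<in> carrier_mat m m" using eps_transpose_carrier[OF X] by simp
  have "transpose_mat (eps_transpose \<epsilon> X) * transpose_mat \<epsilon> = transpose_mat \<epsilon> * X"
    using arg_cong[OF 1, of transpose_mat] transpose_mult[OF c(1) eps_transpose_carrier[OF X]] transpose_mult[OF tX c(1)] by simp
  then have "s \<cdot>\<^sub>m (transpose_mat (eps_transpose \<epsilon> X) * \<epsilon>) = s \<cdot>\<^sub>m (\<epsilon> * X)"
    unfolding s(2) mult_smult_distrib[OF tS c(1)] mult_smult_assoc_mat[OF c(1) X] .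
  then have "s \<cdot>\<^sub>m (s \<cdot>\<^sub>m (transpose_mat (eps_transpose \<epsilon> X) * \<epsilon>)) = s \<cdot>\<^sub>m (s \<cdot>\<^sub>m (\<epsilon> * X))" by simp
  moreover have "s \<cdot>\<^sub>m (s \<cdot>\<^sub>m A) = A" if "A \<in> carrier_mat m m" for A
    using that s(1) by (intro mat_eqI[of _ m]) (auto simp: mult.assoc[symmetric])
  ultimately show "transpose_mat (eps_transpose \<epsilon> X) * \<epsilon> = \<epsilon> * X"
    using mult_carrier_mat[OF tS c(1)] mult_carrier_mat[OF c(1) X] by metis
qed

lemma eps_transpose_index:
  assumes X: "X \<in> carrier_mat m m" and ij: "i < m" "j < m"
  shows "eps_transpose \<epsilon> X $$ (i,j) = (\<Sum>l<m. \<Sum>q<m. \<epsilon> $$ (l,i) * (X $$ (q,l) * \<epsilon> $$ (q,j)))"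
proof -
  note c = eps_symD[OF eps]
  have tX: "transpose_mat X \<in> carrier_mat m m" using X by simp
  have "eps_transpose \<epsilon> X $$ (i,j) = (\<Sum>l<m. transpose_mat \<epsilon> $$ (i,l) * (\<Sum>q<m. transpose_mat X $$ (l,q) * \<epsilon> $$ (q,j)))"
    unfolding eps_transpose_def mult_index[OF tr_eps mult_carrier_mat[OF tX c(1)] ij]
  proof (intro sum.cong refl)
    fix l assume "l \<in> {..<m}"
    then have "l < m" by simp
    from mult_index[OF tX c(1) this ij(2)]
    show "transpose_mat \<epsilon> $$ (i,l) * (transpose_mat X * \<epsilon>) $$ (l,j) =
        transpose_mat \<epsilon> $$ (i,l) * (\<Sum>q<m. transpose_mat X $$ (l,q) * \<epsilon> $$ (q,j))" by (rule arg_cong)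
  qed
  also have "\<dots> = (\<Sum>l<m. \<Sum>q<m. \<epsilon> $$ (l,i) * (X $$ (q,l) * \<epsilon> $$ (q,j)))"
    unfolding sum_distrib_left using X c(1) ij by (intro sum.cong refl) auto
  finally show ?thesis .
qed

lemma eps_transpose_bound:
  assumes X: "X \<in> carrier_mat m m" and b: "\<And>i j. i < m \<Longrightarrow> j < m \<Longrightarrow> cmod (X $$ (i,j)) \<le> \<eta>" and ij: "i < m" "j < m"
  shows "cmod (eps_transpose \<epsilon> X $$ (i,j)) \<le> real m * real m * \<eta>"
proof -
  have "cmod (eps_transpose \<epsilon> X $$ (i,j)) \<le> (\<Sum>l<m. \<Sum>q<m. \<eta>)"
    unfolding eps_transpose_index[OF X ij]
  proof (intro sum_norm_le)
    fix l q assume lq: "l \<in> {..<m}" "q \<in> {..<m}"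
    have e: "cmod (\<epsilon> $$ (l,i)) \<le> 1" "cmod (\<epsilon> $$ (q,j)) \<le> 1" using eps lq ij by (auto simp: eps_sym_def)
    have "cmod (\<epsilon> $$ (l,i) * (X $$ (q,l) * \<epsilon> $$ (q,j))) \<le> 1 * (\<eta> * 1)"
      unfolding norm_mult using e b[of q l] lq by (intro mult_mono) (auto intro: order_trans[OF norm_ge_zero])
    then show "cmod (\<epsilon> $$ (l,i) * (X $$ (q,l) * \<epsilon> $$ (q,j))) \<le> \<eta>" by simp
  qed
  then show ?thesis by simp
qed

lemma eps_transpose_hermitian:
  assumes X: "hermitian m X"
  shows "hermitian m (eps_transpose \<epsilon> X)"
proof (rule hermitianI[OF eps_transpose_carrier[OF hermitian_carrier[OF X]]])
  fix i j assume ij: "i < m" "j < m"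
  have r: "cnj (\<epsilon> $$ (i,j)) = \<epsilon> $$ (i,j)" if "i < m" "j < m" for i j
    using eps that by (auto simp: eps_sym_def Reals_cnj_iff)
  have "cnj (eps_transpose \<epsilon> X $$ (i,j)) = (\<Sum>l<m. \<Sum>q<m. \<epsilon> $$ (l,i) * (X $$ (l,q) * \<epsilon> $$ (q,j)))"
    unfolding eps_transpose_index[OF hermitian_carrier[OF X] ij] cnj_sum complex_cnj_mult
    using ij by (intro sum.cong refl) (simp add: r hermitianD[OF X])
  also have "\<dots> = (\<Sum>q<m. \<Sum>l<m. \<epsilon> $$ (l,i) * (X $$ (l,q) * \<epsilon> $$ (q,j)))" by (rule sum.swap)
  also have "\<dots> = eps_transpose \<epsilon> X $$ (j,i)"
    unfolding eps_transpose_index[OF hermitian_carrier[OF X] ij(2,1)] by (intro sum.cong refl) (simp add: mult_ac)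
  finally show "eps_transpose \<epsilon> X $$ (j,i) = cnj (eps_transpose \<epsilon> X $$ (i,j))" by simp
qed

text \<open>The matching relation makes \<open>\<alpha> k\<close> similar to the transpose of
  \<open>\<alpha> (- k)\<close> through the orthogonal \<epsilon>. Thus a chart valid at
  \<open>k\<close> is valid at \<open>- k\<close>.\<close>

lemma char_poly_minus:
  assumes al: "matching_family m \<epsilon> \<alpha>"
  shows "char_poly (\<alpha> (- k)) = char_poly (\<alpha> k)"
proof -
  note c = eps_symD[OF eps] and a = matchingD[OF al]
  have ac: "\<alpha> k \<in> carrier_mat m m" for k using unitary_carrier[OF a(3)] .
  have t: "transpose_mat (\<alpha> (- k)) \<in> carrier_mat m m" using ac by simp
  have e: "\<epsilon> * \<alpha> k * transpose_mat \<epsilon> = transpose_mat (\<alpha> (- k))"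
    unfolding a(4) assoc_mult_mat[OF t c(1) tr_eps] c(3) by (rule right_mult_one_mat[OF t])
  have "{transpose_mat (\<alpha> (- k)), \<alpha> k, \<epsilon>, transpose_mat \<epsilon>} \<subseteq> carrier_mat m m"
    using t ac[of k] c(1) tr_eps by blast
  from similar_matI[OF this c(3) c(2) e[symmetric]]
  have "similar_mat (transpose_mat (\<alpha> (- k))) (\<alpha> k)" .
  then have "char_poly (transpose_mat (\<alpha> (- k))) = char_poly (\<alpha> k)" by (rule char_poly_similar)
  then show ?thesis using char_poly_transpose_mat[OF ac] by simp
qed

end

section \<open>Resolving degeneracies away from the high-symmetry points\<close>

definition periodic_set :: "(real \<times> real) set \<Rightarrow> bool" where
  "periodic_set S \<longleftrightarrow> (\<forall>k. \<forall>a b :: int. k \<in> S \<longrightarrow> k + (of_int a, of_int b) \<in> S)"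

lemma periodic_representative:
  fixes k :: "real \<times> real"
  shows "\<exists>a b :: int. k + (of_int a, of_int b) \<in> cbox (0,0) (1,1 :: real)"
proof -
  have "k + (of_int (- \<lfloor>fst k\<rfloor>), of_int (- \<lfloor>snd k\<rfloor>)) \<in> cbox (0,0) (1,1)"
  proof (cases k)
    case (Pair x y)
    have "x - real_of_int \<lfloor>x\<rfloor> \<le> 1" "y - real_of_int \<lfloor>y\<rfloor> \<le> 1" by linarith+
    then show ?thesis using Pair by (simp add: cbox_Pair_eq)
  qed
  then show ?thesis by blast
qed

text \<open>\<open>S\<close> may be unbounded, but by periodicity its part in the unit square
  decides; there \<open>uniform_violation\<close> applies with a predicate independent of the
  scale.\<close>

lemma periodic_stability:
  assumes al: "matching_family m \<epsilon> \<alpha>" and S: "closed S" "periodic_set S"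
    and bnd: "\<And>M z. M \<in> carrier_mat m m \<Longrightarrow> V M z \<Longrightarrow> det (shift m M z) = 0"
    and clo: "\<And>Ms M zs z. \<lbrakk>\<And>l::nat. Ms l \<in> carrier_mat m m; M \<in> carrier_mat m m;
        mtendsto m Ms M sequentially; zs \<longlonglongrightarrow> z; \<And>l. V (Ms l) (zs l)\<rbrakk> \<Longrightarrow> V M z"
    and no: "\<And>k z. k \<in> S \<Longrightarrow> \<not> V (\<alpha> k) z"
  shows "\<exists>\<eta>>0. \<forall>\<beta>. matching_family m \<epsilon> \<beta> \<longrightarrow> (\<forall>k. mclose m \<eta> (\<beta> k) (\<alpha> k)) \<longrightarrow> (\<forall>k\<in>S. \<forall>z. \<not> V (\<beta> k) z)"
proof -
  note a = matchingD[OF al]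
  have comp: "compact (S \<inter> cbox (0,0) (1,1))" using S(1) by (intro closed_Int_compact) auto
  have "\<exists>j. \<forall>k\<in>S \<inter> cbox (0,0) (1,1). \<forall>M\<in>carrier_mat m m. \<forall>z. mclose m (1 / Suc j) M (\<alpha> k) \<longrightarrow> \<not> V M z"
  proof (rule uniform_violation[where V = "\<lambda>_. V" and W = V, OF comp unitary_carrier[OF a(3)]])
    show "continuous_on (S \<inter> cbox (0,0) (1,1)) (\<lambda>k. \<alpha> k $$ (i,j))" if "i < m" "j < m" for i j
      using a(1) that continuous_on_subset[OF _ subset_UNIV] unfolding mcont_def by blast
    show "V M z" if "\<And>l. Ms l \<in> carrier_mat m m" "M \<in> carrier_mat m m" "mtendsto m Ms M sequentially"
        "zs \<longlonglongrightarrow> z" "\<And>l. V (Ms l) (zs l)" for Ms M zs z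
      using that by (rule clo)
  qed (use bnd no in auto)
  then obtain j where j: "\<And>k M z. k \<in> S \<Longrightarrow> k \<in> cbox (0,0) (1,1) \<Longrightarrow> M \<in> carrier_mat m m \<Longrightarrow>
      mclose m (1 / Suc j) M (\<alpha> k) \<Longrightarrow> \<not> V M z" by blast
  show ?thesis
  proof (intro exI[of _ "1 / Suc j"] conjI allI impI ballI)
    fix \<beta> k z assume b: "matching_family m \<epsilon> \<beta>" "\<forall>k. mclose m (1 / real (Suc j)) (\<beta> k) (\<alpha> k)" "k \<in> S"
    obtain x y :: int where xy: "k + (of_int x, of_int y) \<in> cbox (0,0) (1,1)" using periodic_representative by blast
    have "\<not> V (\<beta> (k + (of_int x, of_int y))) z"
    proof (rule j[OF _ xy unitary_carrier[OF matchingD(3)[OF b(1)]] spec[OF b(2)]])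
      show "k + (of_int x, of_int y) \<in> S" using S(2) b(3) unfolding periodic_set_def by blast
    qed
    then show "\<not> V (\<beta> k) z" using matchingD(2)[OF b(1)] by simp
  qed simp
qed

lemma simple_stability:
  assumes al: "matching_family m \<epsilon> \<alpha>" and S: "closed S" "periodic_set S"
    and s: "\<And>k. k \<in> S \<Longrightarrow> simple_spectrum (\<alpha> k)"
  shows "\<exists>\<eta>>0. \<forall>\<beta>. matching_family m \<epsilon> \<beta> \<longrightarrow> (\<forall>k. mclose m \<eta> (\<beta> k) (\<alpha> k)) \<longrightarrow> (\<forall>k\<in>S. simple_spectrum (\<beta> k))"
proof -
  have "\<exists>\<eta>>0. \<forall>\<beta>. matching_family m \<epsilon> \<beta> \<longrightarrow> (\<forall>k. mclose m \<eta> (\<beta> k) (\<alpha> k)) \<longrightarrow>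
      (\<forall>k\<in>S. \<forall>z. \<not> degen m (shift m (\<beta> k) z))"
  proof (rule periodic_stability[OF al S])
    fix Ms :: "nat \<Rightarrow> complex mat" and M zs z
    assume Ms: "\<And>l. Ms l \<in> carrier_mat m m" and M: "M \<in> carrier_mat m m"
      and lim: "mtendsto m Ms M sequentially" "zs \<longlonglongrightarrow> z" and V: "\<And>l. degen m (shift m (Ms l) (zs l))"
    note sh = mtendsto_shift[OF Ms M lim]
    have "det (shift m M z) = 0"
      using tendsto_det[OF shift_carrier[OF Ms] shift_carrier[OF M] sh] V
      by (simp add: LIMSEQ_const_iff degen_def)
    moreover have "det (pin m c (shift m M z)) = 0" if "c < m" for c
      using tendsto_det[OF pin_carrier pin_carrier mtendsto_pin[OF sh, of c]] V that
      by (simp add: LIMSEQ_const_iff degen_def)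
    ultimately show "degen m (shift m M z)" by (simp add: degen_def)
  next
    show "\<not> degen m (shift m (\<alpha> k) z)" if "k \<in> S" for k z
      using s[OF that] unitary_simple_spectrum_iff[OF matchingD(3)[OF al]] by blast
  qed (simp add: degen_def)
  then show ?thesis using unitary_simple_spectrum_iff[OF matchingD(3)] by metis
qed

text \<open>The clause \<open>z = w\<close> freezes the spectral parameter, which casts
  invertibility at the chart point as a condition on eigenvalues.\<close>

lemma chart_stability:
  assumes al: "matching_family m \<epsilon> \<alpha>" and S: "closed S" "periodic_set S"
    and s: "\<And>k. k \<in> S \<Longrightarrow> det (shift m (\<alpha> k) w) \<noteq> 0"
  shows "\<exists>\<eta>>0. \<forall>\<beta>. matching_family m \<epsilon> \<beta> \<longrightarrow> (\<forall>k. mclose m \<eta> (\<beta> k) (\<alpha> k)) \<longrightarrow> (\<forall>k\<in>S. det (shift m (\<beta> k) w) \<noteq> 0)"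
proof -
  have "\<exists>\<eta>>0. \<forall>\<beta>. matching_family m \<epsilon> \<beta> \<longrightarrow> (\<forall>k. mclose m \<eta> (\<beta> k) (\<alpha> k)) \<longrightarrow>
      (\<forall>k\<in>S. \<forall>z. \<not> (z = w \<and> det (shift m (\<beta> k) z) = 0))"
  proof (rule periodic_stability[OF al S])
    fix Ms :: "nat \<Rightarrow> complex mat" and M zs z
    assume Ms: "\<And>l. Ms l \<in> carrier_mat m m" and M: "M \<in> carrier_mat m m"
      and lim: "mtendsto m Ms M sequentially" "zs \<longlonglongrightarrow> z" and V: "\<And>l. zs l = w \<and> det (shift m (Ms l) (zs l)) = 0"
    note sh = mtendsto_shift[OF Ms M lim]
    have "(\<lambda>l. det (shift m (Ms l) (zs l))) = (\<lambda>l. 0)" using V by (intro ext) blast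
    then have "det (shift m M z) = 0"
      using tendsto_det[OF shift_carrier[OF Ms] shift_carrier[OF M] sh] by (simp only: LIMSEQ_const_iff)
    moreover have "zs = (\<lambda>l. w)" using V by (intro ext) blast
    then have "z = w" using lim(2) by (simp only: LIMSEQ_const_iff)
    ultimately show "z = w \<and> det (shift m M z) = 0" by simp
  qed (use s in auto)
  then show ?thesis by blast
qed

text \<open>A neighbourhood of \<open>c\<close> on which \<open>z\<close> defines a Cayley chart and which is disjoint from its reflection in
  the origin; the last clause keeps every point within 1/8 of a translate of \<open>c\<close>, where suitable sine
  functions separate points.\<close>
definition cell :: "nat \<Rightarrow> (real \<times> real \<Rightarrow> complex mat) \<Rightarrow> (real \<times> real) set \<Rightarrow> (real \<times> real) \<Rightarrow> real \<Rightarrow> complex \<Rightarrow> bool" where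
  "cell m \<alpha> N c r z \<longleftrightarrow> r > 0 \<and> cmod z = 1 \<and>
     (\<forall>k. lattice_gap (k - c) \<le> 3 * r \<longrightarrow> det (shift m (\<alpha> k) z) \<noteq> 0 \<and> k \<in> N \<and> lattice_gap (k + c) > 3 * r \<and>
        (\<exists>a b :: int. \<bar>fst k + of_int a - fst c\<bar> \<le> 1/8 \<and> \<bar>snd k + of_int b - snd c\<bar> \<le> 1/8))"

section \<open>Cells, cutoffs and the perturbation inside one cell\<close>

lemma cellD:
  assumes "cell m \<alpha> N c r z"
  shows "r > 0" "cmod z = 1" "\<And>k. lattice_gap (k - c) \<le> 3 * r \<Longrightarrow> det (shift m (\<alpha> k) z) \<noteq> 0"
    "\<And>k. lattice_gap (k - c) \<le> 3 * r \<Longrightarrow> k \<in> N" "\<And>k. lattice_gap (k - c) \<le> 3 * r \<Longrightarrow> lattice_gap (k + c) > 3 * r"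
    "\<And>k. lattice_gap (k - c) \<le> 3 * r \<Longrightarrow> \<exists>a b :: int. \<bar>fst k + of_int a - fst c\<bar> \<le> 1/8 \<and> \<bar>snd k + of_int b - snd c\<bar> \<le> 1/8"
  using assms unfolding cell_def by blast+

lemma lattice_gap_shift_periodic: "lattice_gap (k + (of_int a, of_int b) - c) = lattice_gap (k - c)"
proof -
  have "k + (of_int a, of_int b) - c = (k - c) + (of_int a, of_int b)" by simp
  then show ?thesis by (simp only: lattice_gap_periodic)
qed

lemma lattice_gap_plus_swap: "lattice_gap (- k - c) = lattice_gap (k + c)" "lattice_gap (- k + c) = lattice_gap (k - c)"
proof -
  have "- k - c = - (k + c)" "- k + c = - (k - c)" by simp_all
  then show "lattice_gap (- k - c) = lattice_gap (k + c)" "lattice_gap (- k + c) = lattice_gap (k - c)" by (simp_all only: lattice_gap_minus)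
qed

lemma continuous_lattice_gap_diff: "continuous_on S (\<lambda>k. lattice_gap (k - c))"
  by (intro continuous_intros)

lemma periodic_diff_sin:
  "periodic_diff (\<lambda>k. sin (2 * pi * (fst k - a)))" "periodic_diff (\<lambda>k. sin (2 * pi * (snd k - a)))"
proof -
  have s: "(\<lambda>x. sin (2 * pi * (x - a))) differentiable (at x)" for x :: real
    unfolding real_differentiable_def
    by (rule exI[of _ "cos (2 * pi * (x - a)) * (2 * pi)"]) (auto intro!: derivative_eq_intros)
  have f: "(fst :: real \<times> real \<Rightarrow> real) differentiable (at k)" "(snd :: real \<times> real \<Rightarrow> real) differentiable (at k)" for k
    by (intro bounded_linear_imp_differentiable bounded_linear_fst bounded_linear_snd)+
  have p: "sin (2 * pi * (x + of_int n - a)) = sin (2 * pi * (x - a))" for x and n :: int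
    using sin_int_shift[of "x - a" n] by (simp add: algebra_simps)
  show "periodic_diff (\<lambda>k. sin (2 * pi * (fst k - a)))" "periodic_diff (\<lambda>k. sin (2 * pi * (snd k - a)))"
    using differentiable_chain_at[OF f(1) s] differentiable_chain_at[OF f(2) s] p
    by (simp_all add: periodic_diff_def periodic_def o_def)
qed

text \<open>Within 1/8 of the centre the arguments \<open>2 * pi * (x - a)\<close> stay in the
  interval where the sine is injective, so the two sines centred at \<open>c\<close> separate
  points.\<close>

lemma separated_box:
  assumes S: "closed S"
    and b: "\<And>k. k \<in> S \<Longrightarrow> \<bar>fst k - fst c\<bar> \<le> 1/8 \<and> \<bar>snd k - snd c\<bar> \<le> 1/8"
  shows "separated S"
proof -
  have "S \<subseteq> cbox (fst c - 1/8, snd c - 1/8) (fst c + 1/8, snd c + 1/8)"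
  proof
    fix k assume "k \<in> S"
    from b[OF this] have "fst c - 1/8 \<le> fst k \<and> fst k \<le> fst c + 1/8" "snd c - 1/8 \<le> snd k \<and> snd k \<le> snd c + 1/8"
      by linarith+
    then show "k \<in> cbox (fst c - 1/8, snd c - 1/8) (fst c + 1/8, snd c + 1/8)"
      by (simp add: cbox_Pair_eq mem_Times_iff)
  qed
  then have comp: "compact S"
    using S bounded_subset[OF bounded_cbox] by (auto simp: compact_eq_bounded_closed)
  have inj: "x = y" if "\<bar>x - a\<bar> \<le> 1/8" "\<bar>y - a\<bar> \<le> 1/8" "sin (2 * pi * (x - a)) = sin (2 * pi * (y - a))" for x y a :: real
  proof -
    have u: "\<bar>2 * pi * (u - a)\<bar> \<le> pi/2" if "\<bar>u - a\<bar> \<le> 1/8" for u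
    proof -
      have "\<bar>2 * pi * (u - a)\<bar> = 2 * pi * \<bar>u - a\<bar>" by (simp add: abs_mult)
      also have "\<dots> \<le> 2 * pi * (1/8)" using that by (intro mult_left_mono) auto
      also have "\<dots> \<le> pi / 2" by simp
      finally show ?thesis .
    qed
    have "2 * pi * (x - a) = 2 * pi * (y - a)"
    proof (rule sin_inj_pi)
      show "- (pi / 2) \<le> 2 * pi * (x - a)" "2 * pi * (x - a) \<le> pi / 2"
        using u[OF that(1)] by linarith+
      show "- (pi / 2) \<le> 2 * pi * (y - a)" "2 * pi * (y - a) \<le> pi / 2"
        using u[OF that(2)] by linarith+
    qed (rule that(3))
    then show ?thesis by simp
  qed
  have "\<exists>f :: real \<times> real \<Rightarrow> real. periodic_diff f \<and> f x \<noteq> f y" if "x \<in> S" "y \<in> S" "x \<noteq> y" for x y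
  proof (rule ccontr)
    assume n: "\<not> ?thesis"
    have "sin (2 * pi * (fst x - fst c)) = sin (2 * pi * (fst y - fst c))"
      "sin (2 * pi * (snd x - snd c)) = sin (2 * pi * (snd y - snd c))"
      using n periodic_diff_sin(1)[of "fst c"] periodic_diff_sin(2)[of "snd c"] by blast+
    then have "fst x = fst y" "snd x = snd y"
      using inj[of "fst x" "fst c" "fst y"] inj[of "snd x" "snd c" "snd y"] b[OF that(1)] b[OF that(2)] by blast+
    then show False using that(3) by (simp add: prod_eq_iff)
  qed
  then show ?thesis using comp unfolding separated_def by blast
qed

lemma hermitian_smult_diff:
  assumes "hermitian n A" "hermitian n B"
  shows "hermitian n (complex_of_real t \<cdot>\<^sub>m (A - B))"
proof (rule hermitianI)
  note c = hermitian_carrier[OF assms(1)] hermitian_carrier[OF assms(2)]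
  show "complex_of_real t \<cdot>\<^sub>m (A - B) \<in> carrier_mat n n" using c by (intro smult_carrier_mat minus_carrier_mat)
  fix i j assume ij: "i < n" "j < n"
  have e: "(complex_of_real t \<cdot>\<^sub>m (A - B)) $$ (i,j) = of_real t * (A $$ (i,j) - B $$ (i,j))" if "i < n" "j < n" for i j
    using c that by simp
  show "(complex_of_real t \<cdot>\<^sub>m (A - B)) $$ (j,i) = cnj ((complex_of_real t \<cdot>\<^sub>m (A - B)) $$ (i,j))"
    unfolding e[OF ij] e[OF ij(2,1)] using hermitianD[OF assms(1) ij] hermitianD[OF assms(2) ij] by simp
qed

lemma hermitian_zero: "hermitian n (0\<^sub>m n n)" by (rule hermitianI) auto

lemma hermitian_add: "hermitian n A \<Longrightarrow> hermitian n B \<Longrightarrow> hermitian n (A + B)"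
proof -
  assume a: "hermitian n A" "hermitian n B"
  have "A + complex_of_real 1 \<cdot>\<^sub>m B = A + B"
    using hermitian_carrier[OF a(1)] hermitian_carrier[OF a(2)] by (intro mat_eqI[of _ n]) auto
  then show ?thesis using hermitian_add_smult[OF a, of 1] by simp
qed

text \<open>The perturbation inside a chart that replaces \<open>H\<close> by \<open>G\<close> on \<open>lattice_gap (k - c) \<le> r\<close>.\<close>
definition bump_diff :: "nat \<Rightarrow> real \<times> real \<Rightarrow> real \<Rightarrow> (real \<times> real \<Rightarrow> complex mat) \<Rightarrow> (real \<times> real \<Rightarrow> complex mat) \<Rightarrow>
    real \<times> real \<Rightarrow> complex mat" where
  "bump_diff m c r G H k = (if lattice_gap (k - c) < 3 * r
     then complex_of_real (max 0 (min 1 (2 - lattice_gap (k - c) / r))) \<cdot>\<^sub>m (G k - H k) else 0\<^sub>m m m)"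

context
  fixes m :: nat and c :: "real \<times> real" and r \<eta> :: real and G H :: "real \<times> real \<Rightarrow> complex mat"
  assumes r: "r > 0"
    and Gh: "\<And>k. hermitian m (G k)" and Hh: "\<And>k. lattice_gap (k - c) < 3 * r \<Longrightarrow> hermitian m (H k)"
    and Gp: "periodic G" and Hp: "periodic H"
    and Gc: "mcont m UNIV G" and Hc: "mcont m {k. lattice_gap (k - c) < 3 * r} H"
    and cl: "\<And>k. lattice_gap (k - c) \<le> 2 * r \<Longrightarrow> mclose m \<eta> (G k) (H k)" and \<eta>: "\<eta> > 0"
begin

lemma bump_diff_hermitian: "hermitian m (bump_diff m c r G H k)"
  using hermitian_smult_diff[OF Gh Hh] hermitian_zero by (auto simp: bump_diff_def)

lemma bump_diff_outside: "lattice_gap (k - c) > 2 * r \<Longrightarrow> bump_diff m c r G H k = 0\<^sub>m m m"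
proof -
  assume a: "lattice_gap (k - c) > 2 * r"
  have z: "max 0 (min 1 (2 - lattice_gap (k - c) / r)) = 0" using a r by (simp add: field_simps max_def min_def)
  have "complex_of_real 0 \<cdot>\<^sub>m (G k - H k) = 0\<^sub>m m m" if "lattice_gap (k - c) < 3 * r"
    using hermitian_carrier[OF Gh[of k]] hermitian_carrier[OF Hh[OF that]] by (intro mat_eqI[of _ m]) auto
  then show ?thesis unfolding bump_diff_def z by simp
qed

lemma bump_diff_inside: "lattice_gap (k - c) \<le> r \<Longrightarrow> bump_diff m c r G H k = G k - H k"
proof -
  assume a: "lattice_gap (k - c) \<le> r"
  have z: "max 0 (min 1 (2 - lattice_gap (k - c) / r)) = 1" using a r by (simp add: field_simps max_def min_def)
  have "lattice_gap (k - c) < 3 * r" using a r by simp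
  moreover have "complex_of_real 1 \<cdot>\<^sub>m (G k - H k) = G k - H k" by (intro eq_matI) auto
  ultimately show ?thesis unfolding bump_diff_def z by simp
qed

lemma bump_diff_periodic: "periodic (bump_diff m c r G H)"
  unfolding periodic_def bump_diff_def lattice_gap_shift_periodic periodicD[OF Gp] periodicD[OF Hp] by blast

lemma bump_diff_bound:
  assumes ij: "i < m" "j < m"
  shows "cmod (bump_diff m c r G H k $$ (i,j)) \<le> \<eta>"
proof (cases "lattice_gap (k - c) \<le> 2 * r")
  case True
  let ?t = "max 0 (min 1 (2 - lattice_gap (k - c) / r))"
  have lt: "lattice_gap (k - c) < 3 * r" using True r by simp
  have "bump_diff m c r G H k $$ (i,j) = complex_of_real ?t * (G k $$ (i,j) - H k $$ (i,j))"
    using lt ij hermitian_carrier[OF Gh[of k]] hermitian_carrier[OF Hh[OF lt]] by (simp add: bump_diff_def)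
  then have "cmod (bump_diff m c r G H k $$ (i,j)) = \<bar>?t\<bar> * cmod (G k $$ (i,j) - H k $$ (i,j))"
    by (simp only: norm_mult norm_of_real)
  also have "\<dots> \<le> 1 * \<eta>"
    using cl[OF True] ij unfolding mclose_def by (intro mult_mono) (auto intro: less_imp_le)
  finally show ?thesis by simp
next
  case False
  then show ?thesis using bump_diff_outside[of k] \<eta> ij by simp
qed

text \<open>The regions below \<open>3 * r\<close> and above \<open>2 * r\<close> are open and cover
  the plane, and beyond \<open>2 * r\<close> the cutoff is already 0. The room between both radii
  makes the case distinction in the definition continuous.\<close>

lemma bump_diff_continuous: "mcont m UNIV (bump_diff m c r G H)"
proof -
  let ?S = "{k. lattice_gap (k - c) < 3 * r}" and ?T = "{k. 2 * r < lattice_gap (k - c)}"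
  have o: "open ?S" "open ?T" by (intro open_Collect_less continuous_lattice_gap_diff continuous_on_const)+
  have "mcont m ?S (bump_diff m c r G H)"
    unfolding mcont_def
  proof (intro allI impI)
    fix i j assume ij: "i < m" "j < m"
    have "continuous_on ?S (\<lambda>k. complex_of_real (max 0 (min 1 (2 - lattice_gap (k - c) / r))) * (G k $$ (i,j) - H k $$ (i,j)))"
    proof -
      have "continuous_on ?S (\<lambda>k. G k $$ (i,j))" "continuous_on ?S (\<lambda>k. H k $$ (i,j))"
        using mcont_subset[OF Gc subset_UNIV, of ?S] Hc ij unfolding mcont_def by blast+
      then show ?thesis using r
        by (intro continuous_on_mult continuous_on_of_real continuous_on_max continuous_on_min continuous_on_const
          continuous_on_diff continuous_on_divide continuous_lattice_gap_diff) auto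
    qed
    note C = this
    have e: "bump_diff m c r G H k $$ (i,j) =
        complex_of_real (max 0 (min 1 (2 - lattice_gap (k - c) / r))) * (G k $$ (i,j) - H k $$ (i,j))" if "k \<in> ?S" for k
      using that ij hermitian_carrier[OF Gh[of k]] hermitian_carrier[OF Hh[of k]] by (simp add: bump_diff_def)
    show "continuous_on ?S (\<lambda>k. bump_diff m c r G H k $$ (i,j))"
      by (rule continuous_on_eq[OF C]) (simp only: e)
  qed
  moreover have "mcont m ?T (bump_diff m c r G H)"
    by (rule mcont_cong[of m ?T "\<lambda>k. 0\<^sub>m m m"]) (auto simp: mcont_def bump_diff_outside)
  ultimately have "mcont m (?S \<union> ?T) (bump_diff m c r G H)" using o by (intro mcont_open_Un)
  moreover have "?S \<union> ?T = UNIV" using r by auto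
  ultimately show ?thesis by simp
qed

end

lemma mcont_minus:
  assumes "mcont m UNIV (A :: real \<times> real \<Rightarrow> complex mat)"
  shows "mcont m UNIV (\<lambda>k. A (- k))"
  unfolding mcont_def
proof (intro allI impI)
  fix i j assume ij: "i < m" "j < m"
  have c: "continuous_on UNIV (\<lambda>k. A k $$ (i,j))" using assms ij by (simp add: mcont_def)
  show "continuous_on UNIV (\<lambda>k. A (- k) $$ (i,j))"
    by (rule continuous_on_compose2[OF c]) (auto intro!: continuous_intros)
qed

lemma periodic_minus: "periodic A \<Longrightarrow> periodic (\<lambda>k :: real \<times> real. A (- k))"
  unfolding periodic_def
proof (intro allI)
  fix k :: "real \<times> real" and a b :: int assume A: "\<forall>k. \<forall>a b :: int. A (k + (of_int a, of_int b)) = A k"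
  have "- (k + (of_int a, of_int b)) = - k + (of_int (- a), of_int (- b))" by simp
  then show "A (- (k + (of_int a, of_int b))) = A (- k)" using A by metis
qed

lemma mcont_eps_transpose:
  assumes eps: "eps_sym m \<epsilon>" and A: "\<And>k. A k \<in> carrier_mat m m" "mcont m S A"
  shows "mcont m S (\<lambda>k. eps_transpose \<epsilon> (A k))"
  unfolding mcont_def
proof (intro allI impI)
  fix i j assume ij: "i < m" "j < m"
  show "continuous_on S (\<lambda>k. eps_transpose \<epsilon> (A k) $$ (i,j))"
    unfolding eps_transpose_index[OF eps A(1) ij]
    using A(2) by (intro continuous_on_sum continuous_on_mult continuous_on_const) (simp add: mcont_def)
qed

text \<open>The bump around \<open>c\<close> and its \<epsilon>-transpose around \<open>- c\<close>
  add up to a perturbation obeying the matching relation. As a cell is disjoint from its reflection,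
  the second summand vanishes near \<open>c\<close>, where the new chart value is exactly the simple
  approximant \<open>G\<close>. The stability threshold \<theta> preserves simplicity on
  \<open>S\<close>.\<close>

lemma cell_step:
  assumes al: "matching_family m \<epsilon> \<alpha>" and eps: "eps_sym m \<epsilon>" and cell: "cell m \<alpha> N c r z"
    and S: "closed S" "periodic_set S" "\<And>k. k \<in> S \<Longrightarrow> simple_spectrum (\<alpha> k)" and \<delta>: "\<delta> > 0"
  obtains \<beta> where "near m \<epsilon> \<delta> \<alpha> \<beta>" "\<And>k. k \<in> S \<or> lattice_gap (k - c) \<le> r \<Longrightarrow> simple_spectrum (\<beta> k)"
    "\<And>k. \<lbrakk>lattice_gap (k - c) > 2 * r; lattice_gap (k + c) > 2 * r\<rbrakk> \<Longrightarrow> \<beta> k = \<alpha> k"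
proof -
  note a = matchingD[OF al] and cd = cellD[OF cell]
  have ac: "\<alpha> k \<in> carrier_mat m m" for k using unitary_carrier[OF a(3)] .
  have r: "r > 0" and z: "cmod z = 1" using cd by blast+
  obtain \<theta> where \<theta>: "\<theta> > 0" and th: "\<And>\<beta>. matching_family m \<epsilon> \<beta> \<Longrightarrow> (\<And>k. mclose m \<theta> (\<beta> k) (\<alpha> k)) \<Longrightarrow> (\<forall>k\<in>S. simple_spectrum (\<beta> k))"
    using simple_stability[OF al S] by blast
  define \<delta>' where "\<delta>' = min \<delta> \<theta>"
  have \<delta>': "\<delta>' > 0" "\<delta>' \<le> \<delta>" "\<delta>' \<le> \<theta>" using \<delta> \<theta> by (auto simp: \<delta>'_def)
  define M where "M = real m * real m"
  have M: "M \<ge> 0" by (simp add: M_def)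
  \<comment> \<open>One factor \<open>1 + M\<close> pays for the \<epsilon>-transposed bump, whose
    entries are at most \<open>M * \<eta>\<close>; the other one and the 2 pay for
    \<open>cayley_lipschitz\<close>.\<close>
  define \<eta> where "\<eta> = \<delta>' / (2 * (1 + M) * (1 + M))"
  have \<eta>: "\<eta> > 0" using \<delta>'(1) M by (simp add: \<eta>_def)
  have \<eta>b: "2 * real m * real m * ((1 + M) * \<eta>) < \<delta>'"
  proof -
    have "(1 + M) * \<eta> = \<delta>' / (2 * (1 + M))" using M by (simp add: \<eta>_def)
    then have "2 * M * ((1 + M) * \<eta>) = (2 * (M * \<delta>')) / (2 * (1 + M))" by simp
    then have "2 * M * ((1 + M) * \<eta>) = \<delta>' * (M / (1 + M))"
      unfolding mult_divide_mult_cancel_left[of "2 :: real", OF zero_neq_numeral[symmetric]] by simp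
    then have "2 * real m * real m * ((1 + M) * \<eta>) = \<delta>' * (M / (1 + M))" by (simp add: M_def mult.assoc)
    also have "\<dots> < \<delta>' * 1" using M \<delta>'(1) by (intro mult_strict_left_mono) (auto simp: field_simps)
    finally show ?thesis by simp
  qed
  \<comment> \<open>One period of the cell. The sublevel set itself contains all lattice translates,
    which periodic functions cannot tell apart; estimates on \<open>T\<close> spread to it by
    \<open>rep\<close>.\<close>
  define T where "T = {k. lattice_gap (k - c) \<le> 2 * r} \<inter> {k. \<bar>fst k - fst c\<bar> \<le> 1/8} \<inter> {k. \<bar>snd k - snd c\<bar> \<le> 1/8}"
  have "closed T"
    unfolding T_def by (intro closed_Int closed_Collect_le continuous_lattice_gap_diff continuous_intros)
  then have sT: "separated T" by (rule separated_box[of _ c]) (auto simp: T_def)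
  define H where "H k = inv_cayley m z (\<alpha> k)" for k
  have Hh: "hermitian m (H k)" if "lattice_gap (k - c) \<le> 3 * r" for k
    unfolding H_def using inv_cayley_hermitian[OF a(3) z cd(3)[OF that]] .
  have Hp: "periodic H" using a(2) by (simp add: periodic_def H_def)
  have Hc: "mcont m {k. lattice_gap (k - c) \<le> 3 * r} H"
    unfolding H_def using cd(3) by (intro mcont_inv_cayley ac mcont_subset[OF a(1)]) auto
  have TH: "T \<subseteq> {k. lattice_gap (k - c) \<le> 3 * r}" using r by (auto simp: T_def)
  have "\<exists>G. (\<forall>k. hermitian m (G k)) \<and> (\<forall>i<m. \<forall>j<m. periodic_diff (\<lambda>k. G k $$ (i,j))) \<and>
     (\<forall>k\<in>T. mclose m \<eta> (G k) (H k)) \<and> (\<forall>k\<in>T. \<forall>x. \<not> ker2 m (shift m (G k) x))"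
  proof (rule simple_hermitian_approximation[OF sT _ _ \<eta>])
    show "hermitian m (H k)" if "k \<in> T" for k using Hh TH that by blast
    show "continuous_on T (\<lambda>k. H k $$ (i,j))" if "i < m" "j < m" for i j
      using mcont_subset[OF Hc TH] that by (simp add: mcont_def)
  qed
  then obtain G where Gh: "\<And>k. hermitian m (G k)" and Gd: "\<And>i j. i < m \<Longrightarrow> j < m \<Longrightarrow> periodic_diff (\<lambda>k. G k $$ (i,j))"
    and Gcl: "\<And>k. k \<in> T \<Longrightarrow> mclose m \<eta> (G k) (H k)" and Gs: "\<And>k x. k \<in> T \<Longrightarrow> \<not> ker2 m (shift m (G k) x)" by blast
  have Gp: "periodic G"
    unfolding periodic_def
  proof (intro allI)
    fix k and x y :: int
    show "G (k + (of_int x, of_int y)) = G k"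
    proof (rule mat_eqI[OF hermitian_carrier[OF Gh] hermitian_carrier[OF Gh]])
      fix i j assume "i < m" "j < m"
      then have "periodic (\<lambda>k. G k $$ (i,j))" using Gd unfolding periodic_diff_def by blast
      then show "G (k + (of_int x, of_int y)) $$ (i,j) = G k $$ (i,j)" by (rule periodicD)
    qed
  qed
  have Gc: "mcont m UNIV G" unfolding mcont_def using periodic_diff_continuous[OF Gd] by blast
  have rep: "\<exists>x y :: int. k + (of_int x, of_int y) \<in> T" if k: "lattice_gap (k - c) \<le> 2 * r" for k
  proof -
    have "lattice_gap (k - c) \<le> 3 * r" using k r by simp
    then obtain x y :: int where xy: "\<bar>fst k + of_int x - fst c\<bar> \<le> 1/8" "\<bar>snd k + of_int y - snd c\<bar> \<le> 1/8"
      using cd(6) by blast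
    have "k + (of_int x, of_int y) \<in> T" unfolding T_def using xy k by (simp add: lattice_gap_shift_periodic)
    then show ?thesis by blast
  qed
  have cl: "mclose m \<eta> (G k) (H k)" if "lattice_gap (k - c) \<le> 2 * r" for k
    using rep[OF that] Gcl periodicD[OF Gp] periodicD[OF Hp] by metis
  have sk: "\<not> ker2 m (shift m (G k) x)" if "lattice_gap (k - c) \<le> 2 * r" for k x
    using rep[OF that] Gs periodicD[OF Gp] by metis
  have Hh': "hermitian m (H k)" if "lattice_gap (k - c) < 3 * r" for k using Hh that by simp
  have Hc': "mcont m {k. lattice_gap (k - c) < 3 * r} H" by (rule mcont_subset[OF Hc]) auto
  let ?B = "bump_diff m c r G H"
  note bd = r Gh Hh' Gp Hp Gc Hc' cl \<eta>
  have Bh: "hermitian m (?B k)" for k using bump_diff_hermitian[OF bd] by blast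
  have Bout: "?B k = 0\<^sub>m m m" if "lattice_gap (k - c) > 2 * r" for k using bump_diff_outside[OF bd that] .
  have Bin: "?B k = G k - H k" if "lattice_gap (k - c) \<le> r" for k using bump_diff_inside[OF bd that] .
  have Bper: "periodic ?B" using bump_diff_periodic[OF bd] .
  have Bb: "cmod (?B k $$ (i,j)) \<le> \<eta>" if "i < m" "j < m" for i j k
    using bump_diff_bound[OF bd that] .
  have Bc: "mcont m UNIV ?B" using bump_diff_continuous[OF bd] .
  define E where "E k = ?B k + eps_transpose \<epsilon> (?B (- k))" for k
  have sgc: "eps_transpose \<epsilon> (?B k) \<in> carrier_mat m m" for k using eps_transpose_carrier[OF eps hermitian_carrier[OF Bh]] .
  have sig0: "eps_transpose \<epsilon> (0\<^sub>m m m) = 0\<^sub>m m m"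
    by (intro mat_eqI[of _ m] eps_transpose_carrier[OF eps]) (auto simp: eps_transpose_index[OF eps])
  have Eh: "hermitian m (E k)" for k unfolding E_def by (intro hermitian_add eps_transpose_hermitian[OF eps] Bh)
  have Ec: "mcont m UNIV E"
    unfolding E_def by (intro mcont_add sgc hermitian_carrier[OF Bh] Bc mcont_eps_transpose[OF eps] mcont_minus)
  have Ep: "periodic E"
    using periodicD[OF Bper] periodicD[OF periodic_minus[OF Bper]] unfolding periodic_def E_def by simp
  have Em: "\<epsilon> * E k = transpose_mat (E (- k)) * \<epsilon>" for k
  proof -
    have "\<epsilon> * (eps_transpose \<epsilon> (?B (- k)) + ?B k) = transpose_mat (?B (- k) + eps_transpose \<epsilon> (?B k)) * \<epsilon>"
      by (rule intertwine_add[OF eps_symD(1)[OF eps] sgc hermitian_carrier[OF Bh] hermitian_carrier[OF Bh] sgc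
          eps_transpose_intertwine(1)[OF eps hermitian_carrier[OF Bh]] eps_transpose_intertwine(2)[OF eps hermitian_carrier[OF Bh], symmetric]])
    moreover have "eps_transpose \<epsilon> (?B (- k)) + ?B k = E k"
      unfolding E_def by (rule comm_add_mat[OF sgc hermitian_carrier[OF Bh]])
    ultimately show ?thesis by (simp add: E_def)
  qed
  let ?K = "{k. lattice_gap (k - c) \<le> 2 * r} \<union> {k. lattice_gap (k + c) \<le> 2 * r}"
  let ?O = "{k. lattice_gap (k - c) < 3 * r} \<union> {k. lattice_gap (k + c) < 3 * r}"
  have cplus: "continuous_on UNIV (\<lambda>k. lattice_gap (k + c))" by (intro continuous_intros)
  have E0: "E k = 0\<^sub>m m m" if "k \<notin> ?K" for k
  proof -
    have "?B k = 0\<^sub>m m m" using that by (intro Bout) auto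
    moreover have "?B (- k) = 0\<^sub>m m m" using that by (intro Bout) (auto simp: lattice_gap_plus_swap)
    ultimately show ?thesis unfolding E_def using sig0 by simp
  qed
  \<comment> \<open>Near \<open>- c\<close> invertibility is transported from \<open>- k\<close> by
    the equality of characteristic polynomials.\<close>
  have chart: "det (shift m (\<alpha> k) z) \<noteq> 0" if "k \<in> ?O" for k
  proof (cases "lattice_gap (k - c) < 3 * r")
    case True then show ?thesis using cd(3) by simp
  next
    case False
    then have "lattice_gap (- k - c) \<le> 3 * r" using that by (auto simp: lattice_gap_plus_swap)
    from cd(3)[OF this] have "poly (char_poly (\<alpha> (- k))) z \<noteq> 0" by (simp add: poly_char_poly_shift[OF ac])
    then show ?thesis using char_poly_minus[OF eps al, of k] by (auto simp: poly_char_poly_shift[OF ac])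
  qed
  obtain \<beta> where b: "near m \<epsilon> \<delta>' \<alpha> \<beta>" "\<And>k. k \<in> ?O \<Longrightarrow> \<beta> k = cayley m z (inv_cayley m z (\<alpha> k) + E k)"
    "\<And>k. E k = 0\<^sub>m m m \<Longrightarrow> \<beta> k = \<alpha> k"
  proof (rule local_modification[OF al eps_symD(1,2)[OF eps] z _ _ _ chart Eh Ec Ep Em E0 _ \<eta>b \<delta>'(1)])
    show "open ?O" by (intro open_Un open_Collect_less continuous_lattice_gap_diff cplus continuous_on_const)
    show "closed ?K" by (intro closed_Un closed_Collect_le continuous_lattice_gap_diff cplus continuous_on_const)
    show "?K \<subseteq> ?O" using r by auto
    show "cmod (E k $$ (i,j)) \<le> (1 + M) * \<eta>" if ij: "i < m" "j < m" for i j k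
    proof -
      have "E k $$ (i,j) = ?B k $$ (i,j) + eps_transpose \<epsilon> (?B (- k)) $$ (i,j)"
        unfolding E_def using ij carrier_matD[OF sgc[of "- k"]] by simp
      also have "cmod \<dots> \<le> cmod (?B k $$ (i,j)) + cmod (eps_transpose \<epsilon> (?B (- k)) $$ (i,j))" by (rule norm_triangle_ineq)
      also have "\<dots> \<le> \<eta> + M * \<eta>"
        unfolding M_def by (intro add_mono Bb ij eps_transpose_bound[OF eps hermitian_carrier[OF Bh]])
      finally show ?thesis by (simp add: algebra_simps)
    qed
  qed (assumption, assumption, rule that)
  have bm: "matching_family m \<epsilon> \<beta>" and bc: "\<And>k. mclose m \<delta>' (\<beta> k) (\<alpha> k)" using b(1) unfolding near_def by blast+
  have in_simple: "simple_spectrum (\<beta> k)" if k: "lattice_gap (k - c) \<le> r" for k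
  proof -
    have k3: "lattice_gap (k - c) \<le> 3 * r" "lattice_gap (k - c) \<le> 2 * r" "lattice_gap (k - c) < 3 * r" using k r by simp_all
    have "lattice_gap (- k - c) > 2 * r" using cd(5)[OF k3(1)] r by (simp add: lattice_gap_plus_swap)
    then have B0: "?B (- k) = 0\<^sub>m m m" by (rule Bout)
    have "E k = G k - H k" unfolding E_def Bin[OF k] B0 sig0
      using hermitian_carrier[OF Gh[of k]] hermitian_carrier[OF Hh[OF k3(1)]] by (intro mat_eqI[of _ m]) auto
    then have "inv_cayley m z (\<alpha> k) + E k = G k"
      unfolding H_def[symmetric] using hermitian_carrier[OF Gh[of k]] hermitian_carrier[OF Hh[OF k3(1)]]
      by (intro mat_eqI[of _ m]) auto
    then have "\<beta> k = cayley m z (G k)" using b(2)[of k] k3 by simp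
    then show ?thesis using simple_spectrum_cayley[OF Gh z sk[OF k3(2)]] by simp
  qed
  show thesis
  proof (rule that)
    show "near m \<epsilon> \<delta> \<alpha> \<beta>" by (rule near_mono[OF b(1) \<delta>'(2)])
    show "simple_spectrum (\<beta> k)" if "k \<in> S \<or> lattice_gap (k - c) \<le> r" for k
      using that in_simple th[OF bm mclose_mono[OF bc \<delta>'(3)]] by blast
    show "\<beta> k = \<alpha> k" if "lattice_gap (k - c) > 2 * r" "lattice_gap (k + c) > 2 * r" for k
      using b(3) E0[of k] that by auto
  qed
qed

lemma closed_lattice_gap_le: "closed {k. lattice_gap (k - c) \<le> r}"
  by (intro closed_Collect_le continuous_lattice_gap_diff continuous_on_const)

lemma periodic_set_lattice_gap_le: "periodic_set {k. lattice_gap (k - c) \<le> r}"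
  by (simp add: periodic_set_def lattice_gap_shift_periodic)

lemma periodic_set_Un: "periodic_set S \<Longrightarrow> periodic_set T \<Longrightarrow> periodic_set (S \<union> T)"
  unfolding periodic_set_def by blast

text \<open>After each cell its sublevel set of radius \<open>r\<close> joins \<open>S\<close>, on
  which later steps preserve simplicity. Being a cell depends on the family only through
  invertibility in the chart, an open condition, so a small enough step leaves the remaining cells
  intact. The set \<open>N\<close> records where the family may change.\<close>

lemma cell_sweep:
  assumes eps: "eps_sym m \<epsilon>" and N: "\<And>k. k \<in> N \<Longrightarrow> - k \<in> N"
  shows "\<lbrakk>matching_family m \<epsilon> \<alpha>; \<forall>(c,r,z)\<in>set cs. cell m \<alpha> N c r z; closed S; periodic_set S;
      \<forall>k\<in>S. simple_spectrum (\<alpha> k); \<delta> > 0\<rbrakk> \<Longrightarrow>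
    \<exists>\<beta>. near m \<epsilon> \<delta> \<alpha> \<beta> \<and> (\<forall>k. k \<notin> N \<longrightarrow> \<beta> k = \<alpha> k) \<and>
      (\<forall>k. k \<in> S \<or> (\<exists>(c,r,z)\<in>set cs. lattice_gap (k - c) \<le> r) \<longrightarrow> simple_spectrum (\<beta> k))"
proof (induction cs arbitrary: \<alpha> S \<delta>)
  case Nil
  then show ?case by (intro exI[of _ \<alpha>]) (auto intro: near_refl)
next
  case (Cons x cs)
  obtain c r z where x: "x = (c,r,z)" by (rule prod_cases3)
  note al = Cons.prems(1)
  have cell: "cell m \<alpha> N c r z" using Cons.prems(2) x by simp
  note cd = cellD[OF cell]
  have "\<exists>\<eta>>0. \<forall>\<beta>. matching_family m \<epsilon> \<beta> \<longrightarrow> (\<forall>k. mclose m \<eta> (\<beta> k) (\<alpha> k)) \<longrightarrow> (\<forall>(c,r,z)\<in>set cs. cell m \<beta> N c r z)"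
  proof -
    have "\<forall>y\<in>set cs. \<exists>\<eta>>0. \<forall>\<beta>. matching_family m \<epsilon> \<beta> \<longrightarrow> (\<forall>k. mclose m \<eta> (\<beta> k) (\<alpha> k)) \<longrightarrow>
       cell m \<beta> N (fst y) (fst (snd y)) (snd (snd y))"
    proof
      fix y assume y: "y \<in> set cs"
      obtain c' r' z' where y': "y = (c',r',z')" by (rule prod_cases3)
      have ce: "cell m \<alpha> N c' r' z'" using Cons.prems(2) y y' by auto
      obtain \<eta> where \<eta>: "\<eta> > 0" "\<And>\<beta>. matching_family m \<epsilon> \<beta> \<Longrightarrow> (\<And>k. mclose m \<eta> (\<beta> k) (\<alpha> k)) \<Longrightarrow>
          (\<forall>k\<in>{k. lattice_gap (k - c') \<le> 3 * r'}. det (shift m (\<beta> k) z') \<noteq> 0)"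
        using chart_stability[OF al closed_lattice_gap_le periodic_set_lattice_gap_le, of c' "3 * r'" z'] cellD(3)[OF ce] by blast
      have "cell m \<beta> N c' r' z'" if "matching_family m \<epsilon> \<beta>" "\<forall>k. mclose m \<eta> (\<beta> k) (\<alpha> k)" for \<beta>
        using \<eta>(2)[OF that(1) spec[OF that(2)]] ce unfolding cell_def by blast
      then show "\<exists>\<eta>>0. \<forall>\<beta>. matching_family m \<epsilon> \<beta> \<longrightarrow> (\<forall>k. mclose m \<eta> (\<beta> k) (\<alpha> k)) \<longrightarrow>
          cell m \<beta> N (fst y) (fst (snd y)) (snd (snd y))"
        using \<eta>(1) unfolding y' fst_conv snd_conv by blast
    qed
    from bchoice[OF this] obtain f where f: "\<forall>y\<in>set cs. f y > 0 \<and> (\<forall>\<beta>. matching_family m \<epsilon> \<beta> \<longrightarrow>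
        (\<forall>k. mclose m (f y) (\<beta> k) (\<alpha> k)) \<longrightarrow> cell m \<beta> N (fst y) (fst (snd y)) (snd (snd y)))" by (rule exE)
    define \<eta> where "\<eta> = Min (insert 1 (f ` set cs))"
    have \<eta>: "\<eta> > 0" "\<And>y. y \<in> set cs \<Longrightarrow> \<eta> \<le> f y" using f unfolding \<eta>_def by auto
    have "\<forall>(c,r,z)\<in>set cs. cell m \<beta> N c r z" if b: "matching_family m \<epsilon> \<beta>" "\<forall>k. mclose m \<eta> (\<beta> k) (\<alpha> k)" for \<beta>
    proof
      fix y assume y: "y \<in> set cs"
      have "\<forall>k. mclose m (f y) (\<beta> k) (\<alpha> k)" using b(2) mclose_mono \<eta>(2)[OF y] by blast
      then have "cell m \<beta> N (fst y) (fst (snd y)) (snd (snd y))" using f y b(1) by blast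
      then show "case y of (c,r,z) \<Rightarrow> cell m \<beta> N c r z" by (simp add: case_prod_beta)
    qed
    then show ?thesis using \<eta>(1) by blast
  qed
  then obtain \<eta> where \<eta>: "\<eta> > 0" and ce: "\<And>\<beta>. matching_family m \<epsilon> \<beta> \<Longrightarrow> (\<And>k. mclose m \<eta> (\<beta> k) (\<alpha> k)) \<Longrightarrow>
      \<forall>(c,r,z)\<in>set cs. cell m \<beta> N c r z" by blast
  have mpos: "min (\<delta>/2) \<eta> > 0" using Cons.prems(6) \<eta> by simp
  obtain \<beta> where b: "near m \<epsilon> (min (\<delta>/2) \<eta>) \<alpha> \<beta>" "\<And>k. k \<in> S \<or> lattice_gap (k - c) \<le> r \<Longrightarrow> simple_spectrum (\<beta> k)"
    "\<And>k. \<lbrakk>lattice_gap (k - c) > 2 * r; lattice_gap (k + c) > 2 * r\<rbrakk> \<Longrightarrow> \<beta> k = \<alpha> k"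
    using cell_step[OF al eps cell Cons.prems(3,4) bspec[OF Cons.prems(5)] mpos] by blast
  have bm: "matching_family m \<epsilon> \<beta>" and bc: "mclose m (min (\<delta>/2) \<eta>) (\<beta> k) (\<alpha> k)" for k
    using b(1) unfolding near_def by blast+
  have "\<exists>\<gamma>. near m \<epsilon> (\<delta>/2) \<beta> \<gamma> \<and> (\<forall>k. k \<notin> N \<longrightarrow> \<gamma> k = \<beta> k) \<and>
      (\<forall>k. k \<in> S \<union> {k. lattice_gap (k - c) \<le> r} \<or> (\<exists>(c,r,z)\<in>set cs. lattice_gap (k - c) \<le> r) \<longrightarrow> simple_spectrum (\<gamma> k))"
  proof (rule Cons.IH[OF bm])
    show "\<forall>(c,r,z)\<in>set cs. cell m \<beta> N c r z" by (rule ce[OF bm mclose_mono[OF bc]]) simp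
    show "closed (S \<union> {k. lattice_gap (k - c) \<le> r})" by (intro closed_Un Cons.prems(3) closed_lattice_gap_le)
    show "periodic_set (S \<union> {k. lattice_gap (k - c) \<le> r})" by (intro periodic_set_Un Cons.prems(4) periodic_set_lattice_gap_le)
    show "\<forall>k\<in>S \<union> {k. lattice_gap (k - c) \<le> r}. simple_spectrum (\<beta> k)" using b(2) by blast
    show "\<delta>/2 > 0" using Cons.prems(6) by simp
  qed
  then obtain \<gamma> where g: "near m \<epsilon> (\<delta>/2) \<beta> \<gamma>" "\<And>k. k \<notin> N \<Longrightarrow> \<gamma> k = \<beta> k"
    "\<And>k. k \<in> S \<union> {k. lattice_gap (k - c) \<le> r} \<or> (\<exists>(c,r,z)\<in>set cs. lattice_gap (k - c) \<le> r) \<Longrightarrow> simple_spectrum (\<gamma> k)" by blast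
  have "near m \<epsilon> \<delta> \<alpha> \<gamma>" using near_trans[OF near_mono[OF b(1), of "\<delta>/2"] g(1)] by simp
  moreover have "\<gamma> k = \<alpha> k" if k: "k \<notin> N" for k
  proof -
    have "lattice_gap (k - c) > 3 * r" using cd(4)[of k] k by force
    moreover have "lattice_gap (k + c) > 3 * r"
    proof (rule ccontr)
      assume "\<not> lattice_gap (k + c) > 3 * r"
      then have "- k \<in> N" using cd(4)[of "- k"] by (simp add: lattice_gap_plus_swap)
      then show False using N[of "- k"] k by simp
    qed
    ultimately show ?thesis using g(2)[OF k] b(3)[of k] cd(1) by simp
  qed
  moreover have "simple_spectrum (\<gamma> k)" if "k \<in> S \<or> (\<exists>(c,r,z)\<in>set (x # cs). lattice_gap (k - c) \<le> r)" for k
    using that x by (intro g(3)) auto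
  ultimately show ?case by blast
qed

text \<open>An arc of the unit circle is infinite, the set of eigenvalues finite.\<close>

lemma exists_unit_non_eigenvalue:
  assumes A: "A \<in> carrier_mat m m"
  shows "\<exists>z. cmod z = 1 \<and> det (shift m A z) \<noteq> 0"
proof -
  define f where "f t = Complex t (sqrt (1 - t\<^sup>2))" for t
  have n: "cmod (f t) = 1" if "t \<in> {0..1}" for t
  proof -
    have "t\<^sup>2 \<le> 1" using that by (simp add: power_le_one)
    then show ?thesis by (simp add: f_def cmod_def)
  qed
  have inj: "inj_on f {0..1}" by (auto simp: inj_on_def f_def)
  have inf: "infinite (f ` {0..1})"
  proof
    assume "finite (f ` {0..1})"
    from finite_imageD[OF this inj] show False using infinite_Icc[of "0::real" 1] by simp
  qed
  have "finite {z. poly (char_poly A) z = 0}"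
    using degree_monic_char_poly[OF A] by (intro poly_roots_finite) auto
  then have "\<not> f ` {0..1} \<subseteq> {z. poly (char_poly A) z = 0}" using inf finite_subset by blast
  then obtain t where "t \<in> {0..1}" "poly (char_poly A) (f t) \<noteq> 0" by blast
  then show ?thesis using n by (intro exI[of _ "f t"]) (auto simp: poly_char_poly_shift[OF A])
qed

text \<open>Small values of \<open>lattice_gap (k - c)\<close> put \<open>k\<close> near a lattice
  translate of \<open>c\<close>. Hence these sublevel sets serve as a neighbourhood base for
  periodic open sets, in place of metric balls.\<close>

lemma lattice_gap_ball:
  assumes "open U" "c \<in> U" "periodic_set U"
  shows "\<exists>\<rho>>0. \<forall>k. lattice_gap (k - c) < \<rho> \<longrightarrow> k \<in> U"
proof -
  obtain e where e: "e > 0" "\<And>k. dist k c < e \<Longrightarrow> k \<in> U"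
    using assms(1,2) unfolding open_dist by blast
  obtain \<rho> where \<rho>: "\<rho> > 0" "\<And>k. lattice_gap k < \<rho> \<Longrightarrow> \<exists>a b :: int. \<bar>fst k - of_int a\<bar> < e/2 \<and> \<bar>snd k - of_int b\<bar> < e/2"
    using lattice_gap_small_near_integers[of "e/2"] e(1) by auto
  have "k \<in> U" if kc: "lattice_gap (k - c) < \<rho>" for k
  proof -
    obtain a b :: int where ab: "\<bar>fst (k - c) - of_int a\<bar> < e/2" "\<bar>snd (k - c) - of_int b\<bar> < e/2"
      using \<rho>(2)[OF kc] by blast
    let ?v = "k + (of_int (- a), of_int (- b))"
    have "dist ?v c \<le> \<bar>fst (?v - c)\<bar> + \<bar>snd (?v - c)\<bar>"
      using norm_Pair_le[of "fst (?v - c)" "snd (?v - c)"] unfolding prod.collapse real_norm_def dist_norm .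
    also have "\<dots> = \<bar>fst (k - c) - of_int a\<bar> + \<bar>snd (k - c) - of_int b\<bar>" by (simp add: algebra_simps)
    also have "\<dots> < e" using ab by linarith
    finally have "?v \<in> U" by (rule e(2))
    then have "?v + (of_int a, of_int b) \<in> U" using assms(3) unfolding periodic_set_def by blast
    moreover have "?v + (of_int a, of_int b) = k" by (cases k) simp
    ultimately show ?thesis by (simp only:)
  qed
  then show ?thesis using \<rho>(1) by blast
qed

text \<open>If both \<open>k - c\<close> and \<open>k + c\<close> were close to the lattice, so
  would be their difference \<open>2 * c\<close>. As \<open>c\<close> is not a high-symmetry point,
  \<open>2 * c\<close> keeps a positive distance from the lattice.\<close>

lemma cell_exists:
  assumes al: "matching_family m \<epsilon> \<alpha>" and N: "open N" "periodic_set N" "c \<in> N" and c: "\<not> high_symmetry_point c"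
  shows "\<exists>r z. cell m \<alpha> N c r z"
proof -
  note a = matchingD[OF al]
  have ac: "\<alpha> k \<in> carrier_mat m m" for k using unitary_carrier[OF a(3)] .
  obtain z where z: "cmod z = 1" "det (shift m (\<alpha> c) z) \<noteq> 0" using exists_unit_non_eigenvalue[OF ac] by blast
  let ?U = "{k. det (shift m (\<alpha> k) z) \<noteq> 0} \<inter> N"
  have "continuous_on UNIV (\<lambda>k. det (shift m (\<alpha> k) z))"
    by (intro mcont_det[OF shift_carrier[OF ac]] mcont_shift ac a(1))
  then have "open ?U" using N(1) by (intro open_Int open_Collect_neq continuous_on_const)
  moreover have "periodic_set ?U" using N(2) a(2) by (auto simp: periodic_set_def)
  ultimately obtain \<rho>1 where r1: "\<rho>1 > 0" "\<And>k. lattice_gap (k - c) < \<rho>1 \<Longrightarrow> k \<in> ?U"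
    using lattice_gap_ball[of ?U c] z(2) N(3) by blast
  obtain \<rho>2 where r2: "\<rho>2 > 0" "\<And>k. lattice_gap k < \<rho>2 \<Longrightarrow> \<exists>a b :: int. \<bar>fst k - of_int a\<bar> < 1/8 \<and> \<bar>snd k - of_int b\<bar> < 1/8"
    using lattice_gap_small_near_integers[of "1/8"] by auto
  have D2: "lattice_gap (c + c) > 0"
  proof (rule ccontr)
    assume "\<not> lattice_gap (c + c) > 0"
    moreover have "cos (2 * pi * fst (c + c)) \<le> 1" "cos (2 * pi * snd (c + c)) \<le> 1" by simp_all
    ultimately have e: "cos (2 * pi * fst (c + c)) = 1" "cos (2 * pi * snd (c + c)) = 1"
      unfolding lattice_gap_def by linarith+
    have "x \<in> \<int>" if "cos (2 * pi * x) = 1" for x :: real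
    proof -
      from iffD1[OF cos_one_2pi_int that] obtain j :: int where "2 * pi * x = real_of_int j * 2 * pi"
        by (rule exE)
      then have "x = real_of_int j" by simp
      then show ?thesis by simp
    qed
    from this[OF e(1)] this[OF e(2)] show False using c by (simp add: high_symmetry_point_def)
  qed
  obtain R where R: "R > 0" "\<And>k. \<bar>fst k\<bar> < R \<Longrightarrow> \<bar>snd k\<bar> < R \<Longrightarrow> lattice_gap k < lattice_gap (c + c)"
    using lattice_gap_small[OF D2] by blast
  obtain \<rho>3 where r3: "\<rho>3 > 0" "\<And>k. lattice_gap k < \<rho>3 \<Longrightarrow> \<exists>a b :: int. \<bar>fst k - of_int a\<bar> < R/2 \<and> \<bar>snd k - of_int b\<bar> < R/2"
    using lattice_gap_small_near_integers[of "R/2"] R(1) by auto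
  have sep: "lattice_gap (k + c) \<ge> \<rho>3" if k: "lattice_gap (k - c) < \<rho>3" for k
  proof (rule ccontr)
    assume "\<not> ?thesis"
    then have k': "lattice_gap (k + c) < \<rho>3" by simp
    obtain i j :: int where ij: "\<bar>fst (k - c) - of_int i\<bar> < R/2" "\<bar>snd (k - c) - of_int j\<bar> < R/2" using r3(2)[OF k] by blast
    obtain i' j' :: int where ij': "\<bar>fst (k + c) - of_int i'\<bar> < R/2" "\<bar>snd (k + c) - of_int j'\<bar> < R/2" using r3(2)[OF k'] by blast
    \<comment> \<open>This lattice translate of \<open>c + c\<close> would have both coordinates
      below \<open>R\<close>, hence a smaller gap than \<open>c + c\<close>, against
      periodicity.\<close>
    let ?v = "(c + c) + (of_int (i - i'), of_int (j - j'))"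
    have f: "fst ?v = fst c + fst c + (of_int i - of_int i')" "snd ?v = snd c + snd c + (of_int j - of_int j')" by simp_all
    have "lattice_gap ?v < lattice_gap (c + c)"
    proof (rule R(2))
      show "\<bar>fst ?v\<bar> < R" unfolding f using ij(1) ij'(1) unfolding fst_diff fst_add by linarith
      show "\<bar>snd ?v\<bar> < R" unfolding f using ij(2) ij'(2) unfolding snd_diff snd_add by linarith
    qed
    then show False by (simp only: lattice_gap_periodic)
  qed
  \<comment> \<open>Dividing by 4 leaves \<open>3 * r\<close> strictly below all three
    radii.\<close>
  define r where "r = min \<rho>1 (min \<rho>2 \<rho>3) / 4"
  have r: "r > 0" "3 * r < \<rho>1" "3 * r < \<rho>2" "3 * r < \<rho>3" using r1(1) r2(1) r3(1) by (auto simp: r_def)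
  have "cell m \<alpha> N c r z"
    unfolding cell_def
  proof (intro conjI allI impI r(1) z(1))
    fix k assume k: "lattice_gap (k - c) \<le> 3 * r"
    have "k \<in> ?U" using k r(2) by (intro r1(2)) simp
    then show "det (shift m (\<alpha> k) z) \<noteq> 0" "k \<in> N" by blast+
    show "lattice_gap (k + c) > 3 * r" using sep[of k] k r(4) by simp
    have "lattice_gap (k - c) < \<rho>2" using k r(3) by simp
    then obtain i j :: int where ij: "\<bar>fst (k - c) - of_int i\<bar> < 1/8" "\<bar>snd (k - c) - of_int j\<bar> < 1/8" using r2(2) by blast
    show "\<exists>a b :: int. \<bar>fst k + of_int a - fst c\<bar> \<le> 1/8 \<and> \<bar>snd k + of_int b - snd c\<bar> \<le> 1/8"
    proof (rule exI[of _ "- i"], rule exI[of _ "- j"])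
      have "\<bar>fst k + of_int (- i) - fst c\<bar> \<le> 1/8" using ij(1) unfolding fst_diff of_int_minus by linarith
      moreover have "\<bar>snd k + of_int (- j) - snd c\<bar> \<le> 1/8" using ij(2) unfolding snd_diff of_int_minus by linarith
      ultimately show "\<bar>fst k + of_int (- i) - fst c\<bar> \<le> 1/8 \<and> \<bar>snd k + of_int (- j) - snd c\<bar> \<le> 1/8" ..
    qed
  qed
  then show ?thesis by blast
qed

text \<open>By periodicity it is enough to cover the part of \<open>F\<close> in the unit square,
  which is compact, by finitely many cells inside \<open>N\<close> and to sweep them.
  \<open>S\<close> carries simplicity known beforehand through the sweep.\<close>

theorem generic_away_from_symmetry:
  assumes al: "matching_family m \<epsilon> \<alpha>" and eps: "eps_sym m \<epsilon>"
    and S: "closed S" "periodic_set S" "\<And>k. k \<in> S \<Longrightarrow> simple_spectrum (\<alpha> k)"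
    and F: "closed F" "periodic_set F" and N: "open N" "periodic_set N" "F \<subseteq> N" "\<And>k. k \<in> N \<Longrightarrow> - k \<in> N"
    and hs: "\<And>k. k \<in> F \<Longrightarrow> \<not> high_symmetry_point k" and \<delta>: "\<delta> > 0"
  obtains \<beta> where "near m \<epsilon> \<delta> \<alpha> \<beta>" "\<And>k. k \<notin> N \<Longrightarrow> \<beta> k = \<alpha> k" "\<And>k. k \<in> S \<union> F \<Longrightarrow> simple_spectrum (\<beta> k)"
proof -
  have "\<forall>c\<in>F. \<exists>p. cell m \<alpha> N c (fst p) (snd p)"
    using cell_exists[OF al N(1,2)] N(3) hs by (metis fst_conv snd_conv subsetD)
  from bchoice[OF this] obtain p where p: "\<And>c. c \<in> F \<Longrightarrow> cell m \<alpha> N c (fst (p c)) (snd (p c))" by blast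
  let ?F = "F \<inter> cbox (0,0) (1,1)"
  have comp: "compact ?F" using F(1) by (intro closed_Int_compact) auto
  have "\<exists>C'\<subseteq>?F. finite C' \<and> ?F \<subseteq> (\<Union>c\<in>C'. {k. lattice_gap (k - c) < fst (p c)})"
  proof (rule compactE_image[OF comp, of ?F "\<lambda>c. {k. lattice_gap (k - c) < fst (p c)}"])
    show "open {k. lattice_gap (k - c) < fst (p c)}" for c
      by (intro open_Collect_less continuous_lattice_gap_diff continuous_on_const)
    show "?F \<subseteq> (\<Union>c\<in>?F. {k. lattice_gap (k - c) < fst (p c)})"
    proof
      fix c assume c: "c \<in> ?F"
      then have "fst (p c) > 0" using cellD(1)[OF p] by blast
      then have "c \<in> {k. lattice_gap (k - c) < fst (p c)}" by (simp add: lattice_gap_def)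
      then show "c \<in> (\<Union>c\<in>?F. {k. lattice_gap (k - c) < fst (p c)})" using c by blast
    qed
  qed blast
  then obtain C where C: "C \<subseteq> ?F" "finite C" "?F \<subseteq> (\<Union>c\<in>C. {k. lattice_gap (k - c) < fst (p c)})" by blast
  obtain cl where cl: "set cl = C" using finite_list[OF C(2)] by blast
  define cs where "cs = map (\<lambda>c. (c, fst (p c), snd (p c))) cl"
  have cells: "\<forall>(c,r,z)\<in>set cs. cell m \<alpha> N c r z"
  proof
    fix y assume "y \<in> set cs"
    then obtain c where "c \<in> C" "y = (c, fst (p c), snd (p c))" using cl unfolding cs_def set_map by blast
    then show "case y of (c,r,z) \<Rightarrow> cell m \<alpha> N c r z" using p[of c] C(1) by auto
  qed
  have "\<forall>k\<in>S. simple_spectrum (\<alpha> k)" using S(3) by blast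
  from cell_sweep[where N = N, OF eps N(4) al cells S(1,2) this \<delta>]
  obtain \<beta> where b: "near m \<epsilon> \<delta> \<alpha> \<beta>" "\<forall>k. k \<notin> N \<longrightarrow> \<beta> k = \<alpha> k"
    "\<And>k. k \<in> S \<or> (\<exists>(c,r,z)\<in>set cs. lattice_gap (k - c) \<le> r) \<Longrightarrow> simple_spectrum (\<beta> k)" by blast
  have bm: "matching_family m \<epsilon> \<beta>" using b(1) by (simp add: near_def)
  show thesis
  proof (rule that)
    show "near m \<epsilon> \<delta> \<alpha> \<beta>" by (rule b(1))
    show "\<beta> k = \<alpha> k" if "k \<notin> N" for k using b(2) that by blast
    fix k assume "k \<in> S \<union> F"
    then consider "k \<in> S" | "k \<in> F" by blast
    then show "simple_spectrum (\<beta> k)"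
    proof cases
      case 1 then show ?thesis using b(3) by blast
    next
      case 2
      obtain x y :: int where xy: "k + (of_int x, of_int y) \<in> cbox (0,0) (1,1)" using periodic_representative by blast
      let ?k = "k + (of_int x, of_int y)"
      have "?k \<in> ?F" using xy 2 F(2) unfolding periodic_set_def by blast
      then obtain c where c: "c \<in> C" "lattice_gap (?k - c) < fst (p c)" using C(3) by blast
      have "\<exists>(c,r,z)\<in>set cs. lattice_gap (?k - c) \<le> r"
        using c cl by (intro bexI[of _ "(c, fst (p c), snd (p c))"]) (auto simp: cs_def)
      then have "simple_spectrum (\<beta> ?k)" using b(3) by blast
      then show ?thesis using matchingD(2)[OF bm] by simp
    qed
  qed
qed

section \<open>Orthonormal eigenbases and Kramers pairs\<close>

definition ip :: "nat \<Rightarrow> (nat \<Rightarrow> complex) \<Rightarrow> (nat \<Rightarrow> complex) \<Rightarrow> complex" where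
  "ip n v w = (\<Sum>i<n. cnj (v i) * w i)"

definition mat_fun :: "nat \<Rightarrow> complex mat \<Rightarrow> (nat \<Rightarrow> complex) \<Rightarrow> nat \<Rightarrow> complex" where
  "mat_fun n H v i = (\<Sum>j<n. H $$ (i,j) * v j)"

lemma ip_self: "ip n v v = of_real (\<Sum>i<n. (cmod (v i))\<^sup>2)"
  unfolding ip_def of_real_sum by (intro sum.cong refl) (simp only: complex_norm_square mult.commute)

lemma ip_cnj: "cnj (ip n v w) = ip n w v"
  by (simp add: ip_def mult.commute)

lemma ip_mat_fun:
  assumes H: "hermitian n H"
  shows "ip n (mat_fun n H v) w = ip n v (mat_fun n H w)"
proof -
  have "ip n (mat_fun n H v) w = (\<Sum>i<n. \<Sum>j<n. cnj (v j) * (H $$ (j,i) * w i))"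
    unfolding ip_def mat_fun_def cnj_sum sum_distrib_right
    by (intro sum.cong refl) (simp add: hermitianD[OF H] mult_ac)
  also have "\<dots> = ip n v (mat_fun n H w)"
    unfolding ip_def mat_fun_def sum_distrib_left by (rule sum.swap)
  finally show ?thesis .
qed

text \<open>Fewer than \<open>n\<close> linear conditions are padded with zero rows to a singular
  square matrix: its transpose annihilates the unit vector with index \<open>s\<close>.\<close>

lemma exists_orthogonal:
  assumes s: "s < n"
  shows "\<exists>y. (\<exists>i<n. y i \<noteq> 0) \<and> (\<forall>j<s. ip n (c j) y = 0)"
proof -
  let ?A = "mat n n (\<lambda>(j,i). if j < s then cnj (c j i) else 0)"
  have A: "?A \<in> carrier_mat n n" by simp
  have "nullv n (transpose_mat ?A) (\<lambda>i. if i = s then 1 else 0)"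
    unfolding nullv_def using s by (auto intro!: sum.neutral)
  then have "det (transpose_mat ?A) = 0"
    by (subst det_zero_iff_nullv[OF transpose_carrier_mat[THEN iffD2, OF A]])
      (intro exI[of _ "\<lambda>i. if i = s then 1 else 0"] conjI exI[of _ s], simp_all add: s)
  then have "det ?A = 0" using det_transpose[OF A] by simp
  then obtain y where y: "nullv n ?A y" "\<exists>i<n. y i \<noteq> 0" using det_zero_iff_nullv[OF A] by blast
  have "ip n (c j) y = 0" if "j < s" for j
  proof -
    have "(\<Sum>i<n. ?A $$ (j,i) * y i) = 0"
      by (rule y(1)[unfolded nullv_def, rule_format]) (use that s in simp)
    then show ?thesis using that s by (simp add: ip_def)
  qed
  then show ?thesis using y(2) by blast
qed

text \<open>The vectors \<open>y, Hy, H\<^sup>2y, \<dots>\<close> are dependent; splitting off linear factors from an annihilating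
  polynomial produces an eigenvector in their span.\<close>
lemma eigenvector_in_cyclic_space:
  fixes H :: "complex mat" and y :: "nat \<Rightarrow> complex"
  assumes y: "\<exists>i<n. y i \<noteq> 0"
  shows "\<exists>a :: nat \<Rightarrow> complex. \<exists>N z. let w = (\<lambda>i. \<Sum>j<N. a j * (mat_fun n H ^^ j) y i) in
    (\<exists>i<n. w i \<noteq> 0) \<and> (\<forall>i<n. mat_fun n H w i = z * w i)"
proof -
  define h where "h j = (mat_fun n H ^^ j) y" for j
  \<comment> \<open>For \<open>degree p < N\<close> this is the polynomial \<open>p\<close>
    evaluated at \<open>H\<close> and applied to \<open>y\<close>.\<close>
  define pv where "pv N p i = (\<Sum>j<N. coeff p j * h j i)" for N and p :: "complex poly" and i
  have pvN: "pv (Suc N) p i = pv N p i" if "degree p < N" for N p i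
    using that by (simp add: pv_def coeff_eq_0)
  have mat_fun_pv: "mat_fun n H (pv N q) i = pv (Suc N) (pCons 0 q) i" for N q i
  proof -
    have "mat_fun n H (pv N q) i = (\<Sum>l<n. \<Sum>j<N. coeff q j * (H $$ (i,l) * h j l))"
      unfolding mat_fun_def pv_def sum_distrib_left by (intro sum.cong refl) (simp add: mult_ac)
    also have "\<dots> = (\<Sum>j<N. \<Sum>l<n. coeff q j * (H $$ (i,l) * h j l))" by (rule sum.swap)
    also have "\<dots> = (\<Sum>j<N. coeff q j * h (Suc j) i)"
      by (simp add: h_def mat_fun_def sum_distrib_left)
    also have "\<dots> = pv (Suc N) (pCons 0 q) i"
      unfolding pv_def by (subst sum.lessThan_Suc_shift) simp
    finally show ?thesis .
  qed
  \<comment> \<open>Induction on the degree, writing p = (X - z) q: either \<open>q\<close> applied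
    to \<open>y\<close> is nonzero and thus an eigenvector for \<open>z\<close>, or \<open>q\<close>
    is an annihilating polynomial of smaller degree.\<close>
  have main: "\<exists>q N z. (\<exists>i<n. pv N q i \<noteq> 0) \<and> (\<forall>i<n. mat_fun n H (pv N q) i = z * pv N q i)"
    if "p \<noteq> 0" "degree p < N" "\<forall>i<n. pv N p i = 0" for p N
    using that
  proof (induction "degree p" arbitrary: p N rule: less_induct)
    case less
    show ?case
    proof (cases "degree p = 0")
      case True
      then obtain a where a: "p = [:a:]" by (rule degree_eq_zeroE)
      have "pv N p i = a * y i" for i
      proof -
        obtain N' where N: "N = Suc N'" using less.prems(2) by (cases N) auto
        show ?thesis unfolding pv_def N a by (subst sum.lessThan_Suc_shift) (simp add: h_def)
      qed
      then show ?thesis using less.prems(1,3) a y by auto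
    next
      case False
      then have "\<not> constant (poly p)" by (simp add: constant_degree)
      then obtain z where "poly p z = 0" using fundamental_theorem_of_algebra by blast
      then obtain q where q: "p = [:- z, 1:] * q" using poly_eq_0_iff_dvd by (metis dvdE)
      have q0: "q \<noteq> 0" using less.prems(1) q by auto
      have dp: "degree p = Suc (degree q)" unfolding q using q0 by (subst degree_mult_eq) auto
      obtain N' where N: "N = Suc N'" using less.prems(2) by (cases N) auto
      have dq: "degree q < N'" using less.prems(2) dp N by simp
      have pe: "p = pCons 0 q - Polynomial.smult z q" unfolding q by simp
      have "pv N p i = mat_fun n H (pv N' q) i - z * pv N' q i" for i
      proof -
        have "pv N p i = pv N (pCons 0 q) i - z * pv N q i"
          unfolding pe pv_def by (simp add: sum_subtractf sum_distrib_left algebra_simps)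
        then show ?thesis using mat_fun_pv pvN[OF dq] N by simp
      qed
      then have ev: "\<forall>i<n. mat_fun n H (pv N' q) i = z * pv N' q i" using less.prems(3) by simp
      show ?thesis
      proof (cases "\<forall>i<n. pv N' q i = 0")
        case True
        show ?thesis by (rule less.hyps[OF _ q0 dq True]) (simp add: dp)
      next
        case False
        then show ?thesis using ev by blast
      qed
    qed
  qed
  \<comment> \<open>The \<open>n + 1\<close> vectors \<open>h 0, ..., h n\<close> as columns, with a
    zero row added to make the matrix square; a null vector gives the coefficients of the
    annihilating polynomial.\<close>
  let ?A = "mat (Suc n) (Suc n) (\<lambda>(i,j). if i < n then h j i else 0)"
  have A: "?A \<in> carrier_mat (Suc n) (Suc n)" by simp
  have "nullv (Suc n) (transpose_mat ?A) (\<lambda>i. if i = n then 1 else 0)"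
    unfolding nullv_def by (auto intro!: sum.neutral)
  then have "det (transpose_mat ?A) = 0"
    by (subst det_zero_iff_nullv[OF transpose_carrier_mat[THEN iffD2, OF A]])
      (intro exI[of _ "\<lambda>i. if i = n then 1 else 0"] conjI exI[of _ n], simp_all)
  then have "det ?A = 0" using det_transpose[OF A] by simp
  then obtain a i0 where a: "nullv (Suc n) ?A a" "i0 < Suc n" "a i0 \<noteq> 0" using det_zero_iff_nullv[OF A] by blast
  define p where "p = (\<Sum>j<Suc n. monom (a j) j)"
  have cp: "coeff p j = (if j < Suc n then a j else 0)" for j
    unfolding p_def coeff_sum coeff_monom by (simp add: sum.delta)
  have "p \<noteq> 0" using cp[of i0] a(2,3) by auto
  moreover have "degree p < Suc n" using cp by (intro degree_lessI) (auto simp: \<open>p \<noteq> 0\<close>)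
  moreover have "\<forall>i<n. pv (Suc n) p i = 0"
  proof (intro allI impI)
    fix i assume i: "i < n"
    have "(\<Sum>j<Suc n. ?A $$ (i,j) * a j) = 0"
      by (rule a(1)[unfolded nullv_def, rule_format]) (use i in simp)
    moreover have "(\<Sum>j<Suc n. ?A $$ (i,j) * a j) = pv (Suc n) p i"
      unfolding pv_def using i by (intro sum.cong refl) (simp add: cp)
    ultimately show "pv (Suc n) p i = 0" by simp
  qed
  ultimately obtain q N z where "(\<exists>i<n. pv N q i \<noteq> 0) \<and> (\<forall>i<n. mat_fun n H (pv N q) i = z * pv N q i)"
    using main by blast
  then show ?thesis
    unfolding Let_def h_def[symmetric] by (intro exI[of _ "coeff q"] exI[of _ N] exI[of _ z]) (simp add: pv_def[abs_def])
qed

text \<open>The orthogonal complement of eigenvectors is invariant under \<open>H\<close>, so the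
  cyclic space of a vector \<open>y\<close> orthogonal to all of them stays in it, and with it the
  eigenvector found there.\<close>

lemma eigenvector_in_complement:
  assumes H: "hermitian n H" and s: "s < n"
    and c: "\<And>j i. j < s \<Longrightarrow> i < n \<Longrightarrow> mat_fun n H (c j) i = of_real (\<mu> j) * c j i"
  shows "\<exists>v x. (\<exists>i<n. v i \<noteq> 0) \<and> (\<forall>i<n. mat_fun n H v i = of_real x * v i) \<and> (\<forall>j<s. ip n (c j) v = 0)"
proof -
  obtain y where y: "\<exists>i<n. y i \<noteq> 0" "\<And>j. j < s \<Longrightarrow> ip n (c j) y = 0" using exists_orthogonal[OF s] by blast
  have orth: "ip n (c j) ((mat_fun n H ^^ l) y) = 0" if j: "j < s" for j l
  proof (induction l)
    case 0
    then show ?case using y(2)[OF j] by simp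
  next
    case (Suc l)
    have "ip n (c j) ((mat_fun n H ^^ Suc l) y) = ip n (mat_fun n H (c j)) ((mat_fun n H ^^ l) y)"
      by (simp add: ip_mat_fun[OF H])
    also have "\<dots> = of_real (\<mu> j) * ip n (c j) ((mat_fun n H ^^ l) y)"
      unfolding ip_def sum_distrib_left using c[OF j] by (intro sum.cong refl) simp
    finally show ?case using Suc by simp
  qed
  obtain a :: "nat \<Rightarrow> complex" and N z where w: "\<exists>i<n. (\<Sum>j<N. a j * (mat_fun n H ^^ j) y i) \<noteq> 0"
    "\<forall>i<n. mat_fun n H (\<lambda>i. \<Sum>j<N. a j * (mat_fun n H ^^ j) y i) i = z * (\<Sum>j<N. a j * (mat_fun n H ^^ j) y i)"
    using eigenvector_in_cyclic_space[OF y(1), of H] unfolding Let_def by blast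
  define v where "v i = (\<Sum>j<N. a j * (mat_fun n H ^^ j) y i)" for i
  have v: "\<exists>i<n. v i \<noteq> 0" "\<forall>i<n. mat_fun n H v i = z * v i" using w unfolding v_def[abs_def] by auto
  have "nullv n (shift n H z) v"
    unfolding nullv_def
  proof (intro allI impI)
    fix i assume i: "i < n"
    have "(\<Sum>j<n. shift n H z $$ (i,j) * v j) = (\<Sum>j<n. H $$ (i,j) * v j - (if j = i then z * v i else 0))"
      using i by (intro sum.cong refl) (auto simp: shift_index[OF hermitian_carrier[OF H]] algebra_simps simp del: index_minus_mat)
    also have "\<dots> = mat_fun n H v i - z * v i" using i by (simp add: sum_subtractf mat_fun_def)
    finally show "(\<Sum>j<n. shift n H z $$ (i,j) * v j) = 0" using v(2) i by simp
  qed
  then have "z \<in> \<real>"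
    using hermitian_eigenvalue_real[OF H] det_zero_iff_nullv[OF shift_carrier[OF hermitian_carrier[OF H]]] v(1) by blast
  then obtain x where x: "z = of_real x" by (rule Reals_cases)
  have "ip n (c j) v = 0" if "j < s" for j
  proof -
    have "ip n (c j) v = (\<Sum>i<n. \<Sum>l<N. a l * (cnj (c j i) * (mat_fun n H ^^ l) y i))"
      unfolding ip_def v_def sum_distrib_left by (intro sum.cong refl) (simp add: mult_ac)
    also have "\<dots> = (\<Sum>l<N. \<Sum>i<n. a l * (cnj (c j i) * (mat_fun n H ^^ l) y i))" by (rule sum.swap)
    also have "\<dots> = (\<Sum>l<N. a l * ip n (c j) ((mat_fun n H ^^ l) y))" by (simp add: ip_def sum_distrib_left)
    finally show ?thesis using orth[OF that] by simp
  qed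
  then show ?thesis using v x by blast
qed

lemma mat_fun_scale: "mat_fun n H (\<lambda>i. d * v i) i = d * mat_fun n H v i"
  by (simp add: mat_fun_def sum_distrib_left mult_ac)

lemma ip_scale: "ip n v (\<lambda>i. d * w i) = d * ip n v w"
  by (simp add: ip_def sum_distrib_left mult_ac)

lemma normalize:
  assumes "\<exists>i<n. v i \<noteq> 0"
  shows "\<exists>d::real. d \<noteq> 0 \<and> ip n (\<lambda>i. of_real d * v i) (\<lambda>i. of_real d * v i) = 1"
proof -
  define s where "s = (\<Sum>i<n. (cmod (v i))\<^sup>2)"
  obtain i0 where "i0 < n" "v i0 \<noteq> 0" using assms by blast
  then have s: "s > 0" unfolding s_def by (intro sum_pos2[of _ i0]) auto
  have sc: "ip n (\<lambda>i. of_real t * v i) (\<lambda>i. of_real t * v i) = of_real (t\<^sup>2) * ip n v v" for t :: real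
    unfolding ip_def sum_distrib_left by (intro sum.cong refl) (simp add: power2_eq_square mult_ac)
  have "ip n (\<lambda>i. of_real (1 / sqrt s) * v i) (\<lambda>i. of_real (1 / sqrt s) * v i) = of_real ((1 / sqrt s)\<^sup>2) * ip n v v"
    by (rule sc)
  also have "\<dots> = of_real ((1 / sqrt s)\<^sup>2 * s)" unfolding ip_self s_def[symmetric] by simp
  also have "(1 / sqrt s)\<^sup>2 * s = 1" using s by (simp add: power_divide)
  finally show ?thesis using s by (intro exI[of _ "1 / sqrt s"]) auto
qed

text \<open>For real \<open>H\<close> the conjugate of an eigenvector is an eigenvector for the same
  real eigenvalue, and still orthogonal to the earlier real vectors. Real basis vectors make the
  diagonalising matrix real orthogonal, as the symmetry at a bosonic high-symmetry point
  demands.\<close>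

lemma real_eigenbasis:
  assumes H: "hermitian n H" and R: "\<And>i j. i < n \<Longrightarrow> j < n \<Longrightarrow> cnj (H $$ (i,j)) = H $$ (i,j)"
  shows "r \<le> n \<Longrightarrow> \<exists>c \<mu>. (\<forall>j<r. \<forall>i<n. cnj (c j i) = c j i \<and> mat_fun n H (c j) i = of_real (\<mu> j) * c j i) \<and>
     (\<forall>j<r. \<forall>l<r. ip n (c j) (c l) = (if j = l then 1 else 0))"
proof (induction r)
  case 0
  then show ?case by simp
next
  case (Suc r)
  from Suc.IH[OF Suc_leD[OF Suc.prems]] obtain c \<mu> where
    cm: "(\<forall>j<r. \<forall>i<n. cnj (c j i) = c j i \<and> mat_fun n H (c j) i = of_real (\<mu> j) * c j i) \<and>
      (\<forall>j<r. \<forall>l<r. ip n (c j) (c l) = (if j = l then 1 else 0))" by (elim exE)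
  note c = cm[THEN conjunct1, rule_format, THEN conjunct1] cm[THEN conjunct1, rule_format, THEN conjunct2]
    cm[THEN conjunct2, rule_format]
  have rn: "r < n" using Suc.prems by simp
  obtain v x where v: "\<exists>i<n. v i \<noteq> 0" "\<And>i. i < n \<Longrightarrow> mat_fun n H v i = of_real x * v i" "\<And>j. j < r \<Longrightarrow> ip n (c j) v = 0"
    using eigenvector_in_complement[where c = c and \<mu> = \<mu>, OF H rn c(2)] by blast
  have cv: "mat_fun n H (\<lambda>i. cnj (v i)) i = of_real x * cnj (v i)" if i: "i < n" for i
  proof -
    have "mat_fun n H (\<lambda>i. cnj (v i)) i = cnj (mat_fun n H v i)"
      unfolding mat_fun_def cnj_sum using R i by (intro sum.cong refl) simp
    then show ?thesis using v(2)[OF i] by simp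
  qed
  have ci: "ip n (c j) (\<lambda>i. cnj (v i)) = 0" if j: "j < r" for j
  proof -
    have "ip n (c j) (\<lambda>i. cnj (v i)) = cnj (ip n (c j) v)"
      unfolding ip_def cnj_sum using c(1)[OF j] by (intro sum.cong refl) simp
    then show ?thesis using v(3)[OF j] by simp
  qed
  \<comment> \<open>Twice the real part of \<open>v\<close>, or minus twice its imaginary part if
    the real part vanishes at \<open>i0\<close>.\<close>
  obtain d e :: complex where u: "\<exists>i<n. d * v i + e * cnj (v i) \<noteq> 0" "\<And>i. cnj (d * v i + e * cnj (v i)) = d * v i + e * cnj (v i)"
  proof -
    obtain i0 where i0: "i0 < n" "v i0 \<noteq> 0" using v(1) by blast
    show thesis
    proof (cases "Re (v i0) = 0")
      case False
      then show ?thesis using that[of 1 1] i0(1) by (auto simp: complex_eq_iff)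
    next
      case True
      then have "Im (v i0) \<noteq> 0" using i0 by (simp add: complex_eq_iff)
      then show ?thesis using that[of \<i> "- \<i>"] i0(1) by (auto simp: complex_eq_iff)
    qed
  qed
  define u where "u i = d * v i + e * cnj (v i)" for i
  have u0: "\<exists>i<n. u i \<noteq> 0" "\<And>i. cnj (u i) = u i" using u unfolding u_def by blast+
  have ue: "mat_fun n H u i = of_real x * u i" if "i < n" for i
  proof -
    have "mat_fun n H u i = d * mat_fun n H v i + e * mat_fun n H (\<lambda>i. cnj (v i)) i"
      by (simp add: mat_fun_def u_def sum_distrib_left sum.distrib algebra_simps)
    then show ?thesis using v(2)[OF that] cv[OF that] by (simp add: u_def algebra_simps)
  qed
  have ui: "ip n (c j) u = 0" if "j < r" for j
  proof -
    have "ip n (c j) u = d * ip n (c j) v + e * ip n (c j) (\<lambda>i. cnj (v i))"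
      by (simp add: ip_def u_def sum_distrib_left sum.distrib algebra_simps)
    then show ?thesis using v(3)[OF that] ci[OF that] by simp
  qed
  obtain t :: real where t: "t \<noteq> 0" "ip n (\<lambda>i. of_real t * u i) (\<lambda>i. of_real t * u i) = 1"
    using normalize[OF u0(1)] by blast
  define w where "w i = of_real t * u i" for i
  have w: "ip n w w = 1" "\<And>i. cnj (w i) = w i" "\<And>i. i < n \<Longrightarrow> mat_fun n H w i = of_real x * w i"
    "\<And>j. j < r \<Longrightarrow> ip n (c j) w = 0"
    using t(2) u0(2) ue ui unfolding w_def[abs_def] mat_fun_scale ip_scale by simp_all
  have w': "ip n w (c j) = 0" if "j < r" for j using w(4)[OF that] ip_cnj[of n "c j" w] by simp
  show ?case
  proof (intro exI[of _ "c(r := w)"] exI[of _ "\<mu>(r := x)"] conjI allI impI)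
    fix j i assume "j < Suc r" "i < n"
    then show "cnj ((c(r := w)) j i) = (c(r := w)) j i" "mat_fun n H ((c(r := w)) j) i = of_real ((\<mu>(r := x)) j) * (c(r := w)) j i"
      using c w by (cases "j = r"; simp)+
  next
    fix j l assume "j < Suc r" "l < Suc r"
    then show "ip n ((c(r := w)) j) ((c(r := w)) l) = (if j = l then 1 else 0)"
      using c w w' by (cases "j = r"; cases "l = r"; simp)
  qed
qed

text \<open>The Kramers partner \<open>J\<^sup>-\<^sup>1 cnj v\<close> of a vector.\<close>
definition kramers :: "nat \<Rightarrow> (nat \<Rightarrow> complex) \<Rightarrow> nat \<Rightarrow> complex" where
  "kramers p v i = (if i < p then - cnj (v (i + p)) else cnj (v (i - p)))"

section \<open>Kramers pairs\<close>

lemma sum_double: "(\<Sum>i<2 * p. f i) = (\<Sum>i<p. f i + f (i + p))" for f :: "nat \<Rightarrow> complex"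
proof -
  have "(\<Sum>i<2 * p. f i) = (\<Sum>i=0..<p. f i) + (\<Sum>i=p..<p + p. f i)"
    by (simp add: lessThan_atLeast0 sum.atLeastLessThan_concat mult_2)
  also have "(\<Sum>i=p..<p + p. f i) = (\<Sum>i=0..<p. f (i + p))"
    using sum.shift_bounds_nat_ivl[of f 0 p p] by simp
  finally show ?thesis by (simp add: sum.distrib lessThan_atLeast0)
qed

lemma ip_kramers: "ip (2 * p) (kramers p v) (kramers p w) = cnj (ip (2 * p) v w)"
  unfolding ip_def sum_double by (simp add: kramers_def add.commute mult.commute)

lemma kramers_kramers: "i < 2 * p \<Longrightarrow> kramers p (kramers p v) i = - v i"
  by (auto simp: kramers_def)

lemma ip_kramers_left: "ip (2 * p) (kramers p v) w = - cnj (ip (2 * p) v (kramers p w))"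
  unfolding ip_def sum_double by (simp add: kramers_def sum_negf algebra_simps sum.distrib flip: sum_negf)

lemma ip_kramers_self: "ip (2 * p) v (kramers p v) = 0"
  unfolding ip_def sum_double by (simp add: kramers_def)


text \<open>J exchanges the two halves of the index range up to sign, so each entry of either
  product has a single summand.\<close>

lemma J_intertwine_entries:
  fixes H H' :: "complex mat"
  assumes H: "H \<in> carrier_mat (2 * p) (2 * p)" "H' \<in> carrier_mat (2 * p) (2 * p)"
    and J: "J_mat (2 * p) * H = transpose_mat H' * J_mat (2 * p)" and ij: "i < p" "j < p"
  shows "H $$ (i + p, j + p) = H' $$ (j, i)" "H $$ (i + p, j) = - H' $$ (j + p, i)"
    "H $$ (i, j + p) = - H' $$ (j, i + p)" "H $$ (i, j) = H' $$ (j + p, i + p)"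
proof -
  have tH: "transpose_mat H' \<in> carrier_mat (2 * p) (2 * p)" using H by simp
  have l: "(J_mat (2 * p) * H) $$ (a, b) = (if a < p then H $$ (a + p, b) else - H $$ (a - p, b))"
    if "a < 2 * p" "b < 2 * p" for a b
  proof -
    have "(J_mat (2 * p) * H) $$ (a, b) = (\<Sum>l<2 * p. if l = (if a < p then a + p else a - p)
        then (if a < p then H $$ (a + p, b) else - H $$ (a - p, b)) else 0)"
      unfolding mult_index[OF J_mat_carrier H(1) that] using that
      by (intro sum.cong refl) (auto simp: J_mat_def)
    then show ?thesis using that by auto
  qed
  have r: "(transpose_mat H' * J_mat (2 * p)) $$ (a, b) = (if b < p then - H' $$ (b + p, a) else H' $$ (b - p, a))"
    if "a < 2 * p" "b < 2 * p" for a b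
  proof -
    have "(transpose_mat H' * J_mat (2 * p)) $$ (a, b) = (\<Sum>l<2 * p. if l = (if b < p then b + p else b - p)
        then (if b < p then - H' $$ (b + p, a) else H' $$ (b - p, a)) else 0)"
      unfolding mult_index[OF tH J_mat_carrier that] using that H(2)
      by (intro sum.cong refl) (auto simp: J_mat_def)
    then show ?thesis using that by auto
  qed
  have e: "(if a < p then H $$ (a + p, b) else - H $$ (a - p, b)) = (if b < p then - H' $$ (b + p, a) else H' $$ (b - p, a))"
    if "a < 2 * p" "b < 2 * p" for a b
    using l[OF that] r[OF that] J by simp
  show "H $$ (i + p, j + p) = H' $$ (j, i)" using e[of i "j + p"] ij by simp
  show "H $$ (i + p, j) = - H' $$ (j + p, i)" using e[of i j] ij by simp
  have "- H $$ (i, j + p) = H' $$ (j, i + p)" using e[of "i + p" "j + p"] ij by simp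
  from this[symmetric] show "H $$ (i, j + p) = - H' $$ (j, i + p)" by simp
  show "H $$ (i, j) = H' $$ (j + p, i + p)" using e[of "i + p" j] ij by simp
qed

lemma J_intertwineI:
  fixes H H' :: "complex mat"
  assumes H: "H \<in> carrier_mat (2 * p) (2 * p)" "H' \<in> carrier_mat (2 * p) (2 * p)"
    and r: "\<And>i j. i < p \<Longrightarrow> j < p \<Longrightarrow> H $$ (i + p, j + p) = H' $$ (j, i)" "\<And>i j. i < p \<Longrightarrow> j < p \<Longrightarrow> H $$ (i + p, j) = - H' $$ (j + p, i)"
    "\<And>i j. i < p \<Longrightarrow> j < p \<Longrightarrow> H $$ (i, j + p) = - H' $$ (j, i + p)" "\<And>i j. i < p \<Longrightarrow> j < p \<Longrightarrow> H $$ (i, j) = H' $$ (j + p, i + p)"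
  shows "J_mat (2 * p) * H = transpose_mat H' * J_mat (2 * p)"
proof (rule mat_eqI)
  have tH: "transpose_mat H' \<in> carrier_mat (2 * p) (2 * p)" using H by simp
  show "J_mat (2 * p) * H \<in> carrier_mat (2 * p) (2 * p)" "transpose_mat H' * J_mat (2 * p) \<in> carrier_mat (2 * p) (2 * p)"
    using mult_carrier_mat[OF J_mat_carrier H(1)] mult_carrier_mat[OF tH J_mat_carrier] by blast+
  fix a b assume ab: "a < 2 * p" "b < 2 * p"
  have "(J_mat (2 * p) * H) $$ (a, b) = (\<Sum>l<2 * p. if l = (if a < p then a + p else a - p)
        then (if a < p then H $$ (a + p, b) else - H $$ (a - p, b)) else 0)"
    unfolding mult_index[OF J_mat_carrier H(1) ab] using ab
    by (intro sum.cong refl) (auto simp: J_mat_def)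
  also have "\<dots> = (if a < p then H $$ (a + p, b) else - H $$ (a - p, b))" using ab by auto
  also have "\<dots> = (if b < p then - H' $$ (b + p, a) else H' $$ (b - p, a))"
    using ab r(1)[of a "b - p"] r(2)[of a b] r(3)[of "a - p" "b - p"] r(4)[of "a - p" b]
    by (cases "a < p"; cases "b < p") auto
  also have "\<dots> = (\<Sum>l<2 * p. if l = (if b < p then b + p else b - p)
        then (if b < p then - H' $$ (b + p, a) else H' $$ (b - p, a)) else 0)" using ab by auto
  also have "\<dots> = (transpose_mat H' * J_mat (2 * p)) $$ (a, b)"
    unfolding mult_index[OF tH J_mat_carrier ab] using ab H(2)
    by (intro sum.cong refl) (auto simp: J_mat_def)
  finally show "(J_mat (2 * p) * H) $$ (a, b) = (transpose_mat H' * J_mat (2 * p)) $$ (a, b)" .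
qed

text \<open>Hermiticity and the J-relation together say that \<open>H\<close> commutes with the
  antilinear partner map; a real eigenvalue is unaffected by the conjugation.\<close>

lemma kramers_eigenvector:
  assumes H: "hermitian (2 * p) H" and J: "J_mat (2 * p) * H = transpose_mat H * J_mat (2 * p)"
    and v: "\<And>i. i < 2 * p \<Longrightarrow> mat_fun (2 * p) H v i = of_real x * v i" and i: "i < 2 * p"
  shows "mat_fun (2 * p) H (kramers p v) i = of_real x * kramers p v i"
proof -
  note R = J_intertwine_entries[OF hermitian_carrier[OF H] hermitian_carrier[OF H] J]
  have h: "cnj (H $$ (a,b)) = H $$ (b,a)" if "a < 2 * p" "b < 2 * p" for a b using hermitianD[OF H that] .
  have ak: "mat_fun (2 * p) H (kramers p v) i = (\<Sum>j<p. - (H $$ (i,j) * cnj (v (j + p))) + H $$ (i, j + p) * cnj (v j))"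
    unfolding mat_fun_def sum_double by (intro sum.cong refl) (simp add: kramers_def)
  have ac: "cnj (mat_fun (2 * p) H v a) = (\<Sum>j<p. H $$ (j, a) * cnj (v j) + H $$ (j + p, a) * cnj (v (j + p)))"
    if "a < 2 * p" for a
    unfolding mat_fun_def sum_double cnj_sum using that by (intro sum.cong refl) (simp add: h)
  show ?thesis
  proof (cases "i < p")
    case True
    have i2: "i + p < 2 * p" using True by simp
    have "mat_fun (2 * p) H (kramers p v) i = - cnj (mat_fun (2 * p) H v (i + p))"
      unfolding ak ac[OF i2] sum_negf[symmetric]
    proof (intro sum.cong refl)
      fix j assume "j \<in> {..<p}"
      then have j: "j < p" by simp
      show "- (H $$ (i,j) * cnj (v (j + p))) + H $$ (i, j + p) * cnj (v j) =
         - (H $$ (j, i + p) * cnj (v j) + H $$ (j + p, i + p) * cnj (v (j + p)))"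
        using R(3)[OF True j] R(4)[OF True j] by simp
    qed
    then show ?thesis using v[of "i + p"] True by (simp add: kramers_def)
  next
    case False
    define a where "a = i - p"
    have a: "a < p" "i = a + p" using False i by (auto simp: a_def)
    have "mat_fun (2 * p) H (kramers p v) i = cnj (mat_fun (2 * p) H v a)"
      unfolding ak ac[of a, OF trans_less_add1[OF a(1), of p, folded mult_2]]
    proof (intro sum.cong refl)
      fix j assume "j \<in> {..<p}"
      then have j: "j < p" by simp
      show "- (H $$ (i,j) * cnj (v (j + p))) + H $$ (i, j + p) * cnj (v j) =
         H $$ (j, a) * cnj (v j) + H $$ (j + p, a) * cnj (v (j + p))"
        using R(1)[OF a(1) j] R(2)[OF a(1) j] a(2) by simp
    qed
    then show ?thesis using v[of a] a by (simp add: kramers_def)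
  qed
qed

text \<open>The next eigenvector is taken orthogonal to the \<open>r\<close> earlier ones and to
  their partners, which are eigenvectors as well; \<open>2 * r < 2 * p\<close> leaves room for it.
  Its own partner is automatically orthogonal to all of them, because the partner map is antiunitary
  with square -1.\<close>

lemma kramers_eigenbasis:
  assumes H: "hermitian (2 * p) H" and J: "J_mat (2 * p) * H = transpose_mat H * J_mat (2 * p)"
  shows "r \<le> p \<Longrightarrow> \<exists>c \<mu>. (\<forall>j<r. \<forall>i<2 * p. mat_fun (2 * p) H (c j) i = of_real (\<mu> j) * c j i) \<and>
     (\<forall>j<r. \<forall>l<r. ip (2 * p) (c j) (c l) = (if j = l then 1 else 0) \<and> ip (2 * p) (c j) (kramers p (c l)) = 0)"
proof (induction r)
  case 0
  then show ?case by simp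
next
  case (Suc r)
  let ?n = "2 * p"
  from Suc.IH[OF Suc_leD[OF Suc.prems]] obtain c \<mu> where
    cm: "(\<forall>j<r. \<forall>i<?n. mat_fun ?n H (c j) i = of_real (\<mu> j) * c j i) \<and>
      (\<forall>j<r. \<forall>l<r. ip ?n (c j) (c l) = (if j = l then 1 else 0) \<and> ip ?n (c j) (kramers p (c l)) = 0)" by (elim exE)
  note c = cm[THEN conjunct1, rule_format] cm[THEN conjunct2, rule_format, THEN conjunct1]
    cm[THEN conjunct2, rule_format, THEN conjunct2]
  define b where "b j = (if j < r then c j else kramers p (c (j - r)))" for j
  define \<nu> where "\<nu> j = (if j < r then \<mu> j else \<mu> (j - r))" for j
  have r2: "2 * r < ?n" using Suc.prems by simp
  have be: "mat_fun ?n H (b j) i = of_real (\<nu> j) * b j i" if "j < 2 * r" "i < ?n" for j i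
  proof (cases "j < r")
    case True then show ?thesis using c(1)[OF True that(2)] by (simp add: b_def \<nu>_def)
  next
    case False
    then have j: "j - r < r" using that(1) by simp
    show ?thesis using kramers_eigenvector[OF H J c(1)[OF j] that(2)] False by (simp add: b_def \<nu>_def)
  qed
  obtain v x where v: "\<exists>i<?n. v i \<noteq> 0" "\<And>i. i < ?n \<Longrightarrow> mat_fun ?n H v i = of_real x * v i"
    "\<And>j. j < 2 * r \<Longrightarrow> ip ?n (b j) v = 0"
    using eigenvector_in_complement[where c = b and \<mu> = \<nu>, OF H r2 be] by blast
  obtain t :: real where t: "t \<noteq> 0" "ip ?n (\<lambda>i. of_real t * v i) (\<lambda>i. of_real t * v i) = 1"
    using normalize[OF v(1)] by blast
  define w where "w i = of_real t * v i" for i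
  have w: "ip ?n w w = 1" "\<And>i. i < ?n \<Longrightarrow> mat_fun ?n H w i = of_real x * w i"
    "\<And>j. j < 2 * r \<Longrightarrow> ip ?n (b j) w = 0"
    using t(2) v(2,3) unfolding w_def[abs_def] mat_fun_scale ip_scale by simp_all
  have w1: "ip ?n (c j) w = 0" if "j < r" for j using w(3)[of j] that by (simp add: b_def)
  have w2: "ip ?n w (c j) = 0" if "j < r" for j using w1[OF that] ip_cnj[of ?n "c j" w] by simp
  have k1: "ip ?n (kramers p (c j)) w = 0" if "j < r" for j using w(3)[of "j + r"] that by (simp add: b_def)
  have k2: "ip ?n w (kramers p (c j)) = 0" if "j < r" for j using k1[OF that] ip_cnj[of ?n "kramers p (c j)" w] by simp
  have k3: "ip ?n (c j) (kramers p w) = 0" if "j < r" for j using k1[OF that] ip_kramers_left[of p "c j" w] by simp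
  show ?case
  proof (intro exI[of _ "c(r := w)"] exI[of _ "\<mu>(r := x)"] conjI allI impI)
    fix j i assume "j < Suc r" "i < ?n"
    then show "mat_fun ?n H ((c(r := w)) j) i = of_real ((\<mu>(r := x)) j) * (c(r := w)) j i"
      using c(1) w(2) by (cases "j = r") simp_all
  next
    fix j l assume "j < Suc r" "l < Suc r"
    then show "ip ?n ((c(r := w)) j) ((c(r := w)) l) = (if j = l then 1 else 0)"
      using c(2) w(1) w1 w2 by (cases "j = r"; cases "l = r") simp_all
  next
    fix j l assume "j < Suc r" "l < Suc r"
    then show "ip ?n ((c(r := w)) j) (kramers p ((c(r := w)) l)) = 0"
      using c(3) k2 k3 ip_kramers_self by (cases "j = r"; cases "l = r") simp_all
  qed
qed

section \<open>Models at the high-symmetry points\<close>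

definition diag_fun :: "nat \<Rightarrow> (nat \<Rightarrow> complex) \<Rightarrow> complex mat" where
  "diag_fun n f = mat n n (\<lambda>(i,j). if i = j then f i else 0)"

definition unitary_diag :: "nat \<Rightarrow> complex mat \<Rightarrow> (nat \<Rightarrow> complex) \<Rightarrow> complex mat" where
  "unitary_diag n V f = V * diag_fun n f * mat_adjoint V"

lemma diag_fun_carrier [simp]: "diag_fun n f \<in> carrier_mat n n" by (simp add: diag_fun_def)

lemma unitary_diag_carrier: "V \<in> carrier_mat n n \<Longrightarrow> unitary_diag n V f \<in> carrier_mat n n"
  unfolding unitary_diag_def by (intro mult_carrier_mat[of _ n n] diag_fun_carrier mat_adjoint_carrier)

lemma mult_diag_fun_index:
  assumes "V \<in> carrier_mat n n" "i < n" "j < n"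
  shows "(V * diag_fun n f) $$ (i,j) = V $$ (i,j) * f j"
proof -
  have "(V * diag_fun n f) $$ (i,j) = (\<Sum>l<n. if l = j then V $$ (i,j) * f j else 0)"
    unfolding mult_index[OF assms(1) diag_fun_carrier assms(2,3)]
    using assms by (intro sum.cong refl) (auto simp: diag_fun_def)
  then show ?thesis using assms by simp
qed

lemma unitary_diag_index:
  assumes V: "V \<in> carrier_mat n n" and ij: "i < n" "j < n"
  shows "unitary_diag n V f $$ (i,j) = (\<Sum>l<n. V $$ (i,l) * f l * cnj (V $$ (j,l)))"
  unfolding unitary_diag_def mult_index[OF mult_carrier_mat[OF V diag_fun_carrier] mat_adjoint_carrier[OF V] ij]
  using ij by (intro sum.cong refl) (simp add: mult_diag_fun_index[OF V] mat_adjoint_index[OF V] del: index_mult_mat)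

lemma unitary_diag_linear:
  assumes V: "V \<in> carrier_mat n n"
  shows "unitary_diag n V (\<lambda>i. a * f i + b * g i) = a \<cdot>\<^sub>m unitary_diag n V f + b \<cdot>\<^sub>m unitary_diag n V g"
proof (rule mat_eqI)
  show "unitary_diag n V (\<lambda>i. a * f i + b * g i) \<in> carrier_mat n n" "a \<cdot>\<^sub>m unitary_diag n V f + b \<cdot>\<^sub>m unitary_diag n V g \<in> carrier_mat n n"
    by (rule unitary_diag_carrier[OF V], rule add_carrier_mat[OF smult_carrier_mat[OF unitary_diag_carrier[OF V]]])
  fix i j assume ij: "i < n" "j < n"
  have c: "dim_row (unitary_diag n V f) = n" "dim_col (unitary_diag n V f) = n" for f
    using unitary_diag_carrier[OF V, of f] by auto
  show "unitary_diag n V (\<lambda>i. a * f i + b * g i) $$ (i,j) = (a \<cdot>\<^sub>m unitary_diag n V f + b \<cdot>\<^sub>m unitary_diag n V g) $$ (i,j)"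
  proof -
    have "(a \<cdot>\<^sub>m unitary_diag n V f + b \<cdot>\<^sub>m unitary_diag n V g) $$ (i,j) = a * unitary_diag n V f $$ (i,j) + b * unitary_diag n V g $$ (i,j)"
      using ij c by simp
    also have "\<dots> = unitary_diag n V (\<lambda>i. a * f i + b * g i) $$ (i,j)"
      unfolding unitary_diag_index[OF V ij] sum_distrib_left sum.distrib[symmetric]
      by (intro sum.cong refl) (simp add: algebra_simps)
    finally show ?thesis ..
  qed
qed

lemma diag_fun_mult: "diag_fun n f * diag_fun n g = diag_fun n (\<lambda>i. f i * g i)"
  by (intro mat_eqI[of _ n] mult_carrier_mat[of _ n n] diag_fun_carrier)
    (simp add: mult_diag_fun_index[OF diag_fun_carrier] del: index_mult_mat, simp add: diag_fun_def)

lemma diag_fun_one: "diag_fun n (\<lambda>i. 1) = 1\<^sub>m n"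
  by (intro mat_eqI[of _ n]) (auto simp: diag_fun_def)

lemma unitary_diag_one:
  assumes V: "unitary_mat n V"
  shows "unitary_diag n V (\<lambda>i. 1) = 1\<^sub>m n"
  unfolding unitary_diag_def diag_fun_one right_mult_one_mat[OF unitary_carrier[OF V]] by (rule unitary_right[OF V])

lemma unitary_diag_mult:
  assumes V: "unitary_mat n V"
  shows "unitary_diag n V f * unitary_diag n V g = unitary_diag n V (\<lambda>i. f i * g i)"
proof -
  note Vc = unitary_carrier[OF V]
  note aV = mat_adjoint_carrier[OF Vc]
  have VF: "V * diag_fun n f \<in> carrier_mat n n" for f by (rule mult_carrier_mat[OF Vc diag_fun_carrier])
  have "unitary_diag n V f * unitary_diag n V g = V * diag_fun n f * (mat_adjoint V * (V * diag_fun n g * mat_adjoint V))"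
    unfolding unitary_diag_def by (rule assoc_mult_mat[OF VF aV mult_carrier_mat[OF VF aV]])
  also have "mat_adjoint V * (V * diag_fun n g * mat_adjoint V) = (mat_adjoint V * (V * diag_fun n g)) * mat_adjoint V"
    by (rule assoc_mult_mat[OF aV VF aV, symmetric])
  also have "mat_adjoint V * (V * diag_fun n g) = (mat_adjoint V * V) * diag_fun n g"
    by (rule assoc_mult_mat[OF aV Vc diag_fun_carrier, symmetric])
  also have "mat_adjoint V * V = 1\<^sub>m n" using V by (simp add: unitary_mat_def)
  also have "1\<^sub>m n * diag_fun n g = diag_fun n g" by (rule left_mult_one_mat[OF diag_fun_carrier])
  also have "V * diag_fun n f * (diag_fun n g * mat_adjoint V) = (V * diag_fun n f * diag_fun n g) * mat_adjoint V"
    by (rule assoc_mult_mat[OF VF diag_fun_carrier aV, symmetric])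
  also have "V * diag_fun n f * diag_fun n g = V * (diag_fun n f * diag_fun n g)"
    by (rule assoc_mult_mat[OF Vc diag_fun_carrier diag_fun_carrier])
  finally show ?thesis unfolding diag_fun_mult unitary_diag_def .
qed

text \<open>The Cayley transform acts on the eigenvalues of a unitarily diagonalised matrix, so the
  spectra of the models can be written down explicitly.\<close>

lemma char_poly_cayley_unitary_diag:
  assumes V: "unitary_mat n V" and H: "H = unitary_diag n V (\<lambda>i. of_real (e i))"
  shows "char_poly (cayley n z H) = (\<Prod>a\<leftarrow>map (\<lambda>i. z - 2 * \<i> * z / (of_real (e i) + \<i>)) [0..<n]. [:- a, 1:])"
proof -
  note Vc = unitary_carrier[OF V]
  have ne: "complex_of_real x + \<i> \<noteq> 0" for x by (simp add: complex_eq_iff)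
  have B: "shift n H (- \<i>) = unitary_diag n V (\<lambda>i. of_real (e i) + \<i>)"
  proof -
    have "unitary_diag n V (\<lambda>i. of_real (e i) + \<i>) = 1 \<cdot>\<^sub>m H + \<i> \<cdot>\<^sub>m 1\<^sub>m n"
      using unitary_diag_linear[OF Vc, of 1 "\<lambda>i. of_real (e i)" \<i> "\<lambda>i. 1"] unfolding unitary_diag_one[OF V] H by simp
    also have "\<dots> = shift n H (- \<i>)" using unitary_diag_carrier[OF Vc, of "\<lambda>i. of_real (e i)"] unfolding H[symmetric]
      by (intro mat_eqI[of _ n]) auto
    finally show ?thesis by simp
  qed
  have "mat_inv (shift n H (- \<i>)) = unitary_diag n V (\<lambda>i. 1 / (of_real (e i) + \<i>))"
    unfolding B by (rule mat_inv_unique[OF unitary_diag_carrier[OF Vc] unitary_diag_carrier[OF Vc]])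
      (simp add: unitary_diag_mult[OF V] ne unitary_diag_one[OF V])
  then have "cayley n z H = z \<cdot>\<^sub>m unitary_diag n V (\<lambda>i. 1) + (- (2 * \<i> * z)) \<cdot>\<^sub>m unitary_diag n V (\<lambda>i. 1 / (of_real (e i) + \<i>))"
    unfolding cayley_def unitary_diag_one[OF V] using unitary_diag_carrier[OF Vc, of "\<lambda>i. 1 / (of_real (e i) + \<i>)"]
    by (intro mat_eqI[of _ n]) auto
  also have "\<dots> = unitary_diag n V (\<lambda>i. z - 2 * \<i> * z / (of_real (e i) + \<i>))"
    unfolding unitary_diag_linear[OF Vc, symmetric] by simp
  finally have c: "cayley n z H = unitary_diag n V (\<lambda>i. z - 2 * \<i> * z / (of_real (e i) + \<i>))" .
  let ?f = "\<lambda>i. z - 2 * \<i> * z / (of_real (e i) + \<i>)"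
  have "{unitary_diag n V ?f, diag_fun n ?f, V, mat_adjoint V} \<subseteq> carrier_mat n n"
    using unitary_diag_carrier[OF Vc] Vc mat_adjoint_carrier[OF Vc] diag_fun_carrier by blast
  moreover have "mat_adjoint V * V = 1\<^sub>m n" using V by (simp add: unitary_mat_def)
  ultimately have "similar_mat (unitary_diag n V ?f) (diag_fun n ?f)"
    using similar_matI[of "unitary_diag n V ?f" "diag_fun n ?f" V "mat_adjoint V" n] unitary_right[OF V] unfolding unitary_diag_def by blast
  then have "char_poly (cayley n z H) = char_poly (diag_fun n ?f)" unfolding c by (rule char_poly_similar)
  also have "\<dots> = (\<Prod>a\<leftarrow>diag_mat (diag_fun n ?f). [:- a, 1:])"
    by (rule char_poly_upper_triangular[OF diag_fun_carrier]) (auto simp: upper_triangular_def diag_fun_def)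
  also have "diag_mat (diag_fun n ?f) = map ?f [0..<n]" by (auto simp: diag_mat_def diag_fun_def)
  finally show ?thesis .
qed

lemma eigenbasis_matrix:
  assumes H: "H \<in> carrier_mat n n" and W: "W = mat n n (\<lambda>(i,j). b j i)"
    and o: "\<And>j l. j < n \<Longrightarrow> l < n \<Longrightarrow> ip n (b j) (b l) = (if j = l then 1 else 0)"
    and e: "\<And>j i. j < n \<Longrightarrow> i < n \<Longrightarrow> mat_fun n H (b j) i = of_real (\<mu> j) * b j i"
  shows "unitary_mat n W" "H = unitary_diag n W (\<lambda>i. of_real (\<mu> i))"
proof -
  have Wc: "W \<in> carrier_mat n n" by (simp add: W)
  have "mat_adjoint W * W = 1\<^sub>m n"
  proof (rule mat_eqI[OF mult_carrier_mat[OF mat_adjoint_carrier[OF Wc] Wc] one_carrier_mat])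
    fix i j assume ij: "i < n" "j < n"
    have "(mat_adjoint W * W) $$ (i,j) = ip n (b i) (b j)"
      unfolding mult_index[OF mat_adjoint_carrier[OF Wc] Wc ij] ip_def using ij
      by (intro sum.cong refl) (simp add: mat_adjoint_index[OF Wc], simp add: W)
    then show "(mat_adjoint W * W) $$ (i,j) = 1\<^sub>m n $$ (i,j)" using o[OF ij] ij by simp
  qed
  then show U: "unitary_mat n W" using Wc by (simp add: unitary_mat_def)
  have HW: "H * W = W * diag_fun n (\<lambda>i. of_real (\<mu> i))"
  proof (rule mat_eqI[OF mult_carrier_mat[OF H Wc] mult_carrier_mat[OF Wc diag_fun_carrier]])
    fix i j assume ij: "i < n" "j < n"
    have "(H * W) $$ (i,j) = mat_fun n H (b j) i"
      unfolding mult_index[OF H Wc ij] mat_fun_def using ij by (intro sum.cong refl) (simp add: W)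
    then show "(H * W) $$ (i,j) = (W * diag_fun n (\<lambda>i. of_real (\<mu> i))) $$ (i,j)"
      unfolding mult_diag_fun_index[OF Wc ij] using e[OF ij(2,1)] ij by (simp add: W)
  qed
  have "H = H * (W * mat_adjoint W)" unfolding unitary_right[OF U] right_mult_one_mat[OF H] ..
  also have "\<dots> = H * W * mat_adjoint W" by (rule assoc_mult_mat[OF H Wc mat_adjoint_carrier[OF Wc], symmetric])
  finally show "H = unitary_diag n W (\<lambda>i. of_real (\<mu> i))" unfolding HW unitary_diag_def .
qed

lemma mat_adjoint_adjoint:
  fixes A :: "complex mat"
  assumes A: "A \<in> carrier_mat n n"
  shows "mat_adjoint (mat_adjoint A) = A"
proof (rule mat_eqI[OF mat_adjoint_carrier[OF mat_adjoint_carrier[OF A]] A])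
  fix i j assume ij: "i < n" "j < n"
  show "mat_adjoint (mat_adjoint A) $$ (i,j) = A $$ (i,j)"
    unfolding mat_adjoint_index[OF mat_adjoint_carrier[OF A] ij] mat_adjoint_index[OF A ij(2,1)] by simp
qed

lemma hermitian_adjoint:
  assumes A: "hermitian n A"
  shows "mat_adjoint A = A"
proof (rule mat_eqI[OF mat_adjoint_carrier[OF hermitian_carrier[OF A]] hermitian_carrier[OF A]])
  fix i j assume ij: "i < n" "j < n"
  show "mat_adjoint A $$ (i,j) = A $$ (i,j)"
    unfolding mat_adjoint_index[OF hermitian_carrier[OF A] ij] by (rule hermitianD[OF A ij(2,1)])
qed

lemma hermitian_conjugate:
  assumes X: "hermitian n X" and W: "W \<in> carrier_mat n n"
  shows "hermitian n (W * X * mat_adjoint W)"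
proof (rule hermitian_iff_adjoint)
  note Xc = hermitian_carrier[OF X] and aW = mat_adjoint_carrier[OF W]
  show "W * X * mat_adjoint W \<in> carrier_mat n n" by (intro mult_carrier_mat[OF mult_carrier_mat[OF W Xc] aW])
  show "mat_adjoint (W * X * mat_adjoint W) = W * X * mat_adjoint W"
    unfolding mat_adjoint_mult[OF mult_carrier_mat[OF W Xc] aW] mat_adjoint_mult[OF W Xc]
      mat_adjoint_adjoint[OF W] hermitian_adjoint[OF X]
    by (rule assoc_mult_mat[OF W Xc aW, symmetric])
qed

text \<open>By \<open>s\<close>, \<open>W\<close> is an isometry of the bilinear form \<epsilon>:
  real orthogonal for the identity, unitary symplectic for J. Such changes of basis respect the
  matching relation.\<close>

lemma conjugate_intertwine:
  assumes W: "unitary_mat n W" and E: "\<epsilon> \<in> carrier_mat n n" and s: "transpose_mat W * \<epsilon> * W = \<epsilon>"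
    and X: "X \<in> carrier_mat n n" "X' \<in> carrier_mat n n" "\<epsilon> * X = transpose_mat X' * \<epsilon>"
  shows "\<epsilon> * (W * X * mat_adjoint W) = transpose_mat (W * X' * mat_adjoint W) * \<epsilon>"
proof -
  note Wc = unitary_carrier[OF W]
  note aW = mat_adjoint_carrier[OF Wc]
  have tW: "transpose_mat W \<in> carrier_mat n n" and tX: "transpose_mat X' \<in> carrier_mat n n"
    and taW: "transpose_mat (mat_adjoint W) \<in> carrier_mat n n" using Wc X aW by simp_all
  note tWE = mult_carrier_mat[OF tW E]
  have 1: "transpose_mat W * \<epsilon> = \<epsilon> * mat_adjoint W"
  proof -
    have "transpose_mat W * \<epsilon> = transpose_mat W * \<epsilon> * (W * mat_adjoint W)"
      unfolding unitary_right[OF W] by (rule right_mult_one_mat[OF tWE, symmetric])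
    also have "\<dots> = transpose_mat W * \<epsilon> * W * mat_adjoint W"
      by (rule assoc_mult_mat[OF tWE Wc aW, symmetric])
    finally show ?thesis unfolding s .
  qed
  have one: "transpose_mat (mat_adjoint W) * transpose_mat W = 1\<^sub>m n"
    using transpose_mult[OF Wc aW] unitary_right[OF W] by simp
  have 2: "\<epsilon> * W = transpose_mat (mat_adjoint W) * \<epsilon>"
  proof -
    have EW: "\<epsilon> * W \<in> carrier_mat n n" by (rule mult_carrier_mat[OF E Wc])
    have "\<epsilon> * W = (transpose_mat (mat_adjoint W) * transpose_mat W) * (\<epsilon> * W)"
      unfolding one by (rule left_mult_one_mat[OF EW, symmetric])
    also have "\<dots> = transpose_mat (mat_adjoint W) * (transpose_mat W * (\<epsilon> * W))" by (rule assoc_mult_mat[OF taW tW EW])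
    also have "transpose_mat W * (\<epsilon> * W) = \<epsilon>" using assoc_mult_mat[OF tW E Wc] s by simp
    finally show ?thesis .
  qed
  have "\<epsilon> * (W * X * mat_adjoint W) = \<epsilon> * W * X * mat_adjoint W"
    unfolding assoc_mult_mat[OF E mult_carrier_mat[OF Wc X(1)] aW, symmetric] assoc_mult_mat[OF E Wc X(1), symmetric] ..
  also have "\<dots> = transpose_mat (mat_adjoint W) * (\<epsilon> * X) * mat_adjoint W"
    unfolding 2 assoc_mult_mat[OF taW E X(1)] ..
  also have "\<dots> = transpose_mat (mat_adjoint W) * (transpose_mat X' * (\<epsilon> * mat_adjoint W))"
    unfolding X(3) assoc_mult_mat[OF taW mult_carrier_mat[OF tX E] aW] assoc_mult_mat[OF tX E aW] ..
  also have "\<dots> = transpose_mat (mat_adjoint W) * (transpose_mat X' * transpose_mat W) * \<epsilon>"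
    unfolding 1[symmetric] assoc_mult_mat[OF tX tW E, symmetric]
      assoc_mult_mat[OF taW mult_carrier_mat[OF tX tW] E, symmetric] ..
  also have "transpose_mat (mat_adjoint W) * (transpose_mat X' * transpose_mat W) = transpose_mat (W * X' * mat_adjoint W)"
    unfolding transpose_mult[OF mult_carrier_mat[OF Wc X(2)] aW] transpose_mult[OF Wc X(2)] ..
  finally show ?thesis .
qed

lemma unitary_mult:
  assumes U: "unitary_mat n U" and V: "unitary_mat n V"
  shows "unitary_mat n (U * V)"
proof -
  note c = unitary_carrier[OF U] unitary_carrier[OF V]
  note a = mat_adjoint_carrier[OF c(1)] mat_adjoint_carrier[OF c(2)]
  have "mat_adjoint (U * V) * (U * V) = mat_adjoint V * (mat_adjoint U * (U * V))"
    unfolding mat_adjoint_mult[OF c] by (rule assoc_mult_mat[OF a(2,1) mult_carrier_mat[OF c]])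
  also have "mat_adjoint U * (U * V) = V"
    unfolding assoc_mult_mat[OF a(1) c, symmetric] using U left_mult_one_mat[OF c(2)] by (simp add: unitary_mat_def)
  finally show ?thesis using V mult_carrier_mat[OF c] by (simp add: unitary_mat_def)
qed

lemma unitary_diag_conjugate:
  assumes W: "unitary_mat n W" and V: "unitary_mat n V"
  shows "W * unitary_diag n V f * mat_adjoint W = unitary_diag n (W * V) f"
proof -
  note Wc = unitary_carrier[OF W] and Vc = unitary_carrier[OF V]
  note aW = mat_adjoint_carrier[OF Wc] and aV = mat_adjoint_carrier[OF Vc]
  note VD = mult_carrier_mat[OF Vc diag_fun_carrier[of n f]]
  show ?thesis
    unfolding unitary_diag_def mat_adjoint_mult[OF Wc Vc] assoc_mult_mat[OF Wc VD aV, symmetric]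
      assoc_mult_mat[OF Wc Vc diag_fun_carrier, symmetric]
    by (rule assoc_mult_mat[OF mult_carrier_mat[OF mult_carrier_mat[OF Wc Vc] diag_fun_carrier] aV aW])
qed

text \<open>For each pair of distinct indices only one value of \<open>s\<close> makes the shifted
  levels collide, and the interval is infinite.\<close>

lemma distinct_shift:
  assumes "\<eta> > 0"
  shows "\<exists>s. 0 < s \<and> s < \<eta> \<and> inj_on (\<lambda>i. \<mu> i + s * real (Suc i)) {..<n}"
proof -
  define B where "B = (\<lambda>(i,j). (\<mu> j - \<mu> i) / (real i - real j)) ` ({..<n} \<times> {..<n})"
  have "finite B" by (simp add: B_def)
  moreover have "infinite {0<..<\<eta>}" using assms by (rule infinite_Ioo)
  ultimately have "\<not> {0<..<\<eta>} \<subseteq> B" using finite_subset by blast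
  then obtain s where "s \<in> {0<..<\<eta>}" and sB: "s \<notin> B" by blast
  then have s: "0 < s" "s < \<eta>" "s \<notin> B" by simp_all
  have "inj_on (\<lambda>i. \<mu> i + s * real (Suc i)) {..<n}"
  proof (rule inj_onI, rule ccontr)
    fix i j assume ij: "i \<in> {..<n}" "j \<in> {..<n}" "\<mu> i + s * real (Suc i) = \<mu> j + s * real (Suc j)" "i \<noteq> j"
    have "s * (real i - real j) = \<mu> j - \<mu> i" using ij(3) by (simp add: algebra_simps)
    then have "s = (\<mu> j - \<mu> i) / (real i - real j)" using ij(4) by (simp add: field_simps)
    then have "s \<in> B" unfolding B_def using ij(1,2) by (intro image_eqI[of _ _ "(i,j)"]) auto
    then show False using s(3) by blast
  qed
  then show ?thesis using s by blast
qed

lemma unitary_diag_close: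
  assumes W: "unitary_mat n W" and b: "\<And>i. i < n \<Longrightarrow> cmod (f i - g i) \<le> \<delta>" and \<eta>: "real n * \<delta> < \<eta>"
  shows "mclose n \<eta> (unitary_diag n W f) (unitary_diag n W g)"
  unfolding mclose_def
proof (intro allI impI)
  fix i j assume ij: "i < n" "j < n"
  have "cmod (unitary_diag n W f $$ (i,j) - unitary_diag n W g $$ (i,j)) =
      cmod (\<Sum>l<n. W $$ (i,l) * (f l - g l) * cnj (W $$ (j,l)))"
    unfolding unitary_diag_index[OF unitary_carrier[OF W] ij] sum_subtractf[symmetric] by (simp add: algebra_simps)
  also have "\<dots> \<le> (\<Sum>l<n. \<delta>)"
  proof (intro sum_norm_le)
    fix l assume l: "l \<in> {..<n}"
    have "cmod (W $$ (i,l) * (f l - g l) * cnj (W $$ (j,l))) \<le> 1 * \<delta> * 1"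
      unfolding norm_mult complex_mod_cnj using l ij b[of l] unitary_entry_le[OF W]
      by (intro mult_mono) (auto intro: order_trans[OF norm_ge_zero])
    then show "cmod (W $$ (i,l) * (f l - g l) * cnj (W $$ (j,l))) \<le> \<delta>" by simp
  qed
  finally show "cmod (unitary_diag n W f $$ (i,j) - unitary_diag n W g $$ (i,j)) < \<eta>" using \<eta> by simp
qed

lemma hermitian_unitary_diag:
  assumes "W \<in> carrier_mat n n"
  shows "hermitian n (unitary_diag n W (\<lambda>i. of_real (e i)))"
proof -
  have "hermitian n (diag_fun n (\<lambda>i. of_real (e i)))" by (rule hermitianI) (auto simp: diag_fun_def)
  from hermitian_conjugate[OF this assms] show ?thesis by (simp add: unitary_diag_def)
qed

text \<open>The symmetry makes \<open>H\<close> real symmetric. In a real eigenbasis the eigenvalues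
  are moved apart, and a real orthogonal \<open>W\<close> keeps the result real symmetric.\<close>

lemma bosonic_model:
  assumes H: "hermitian n H" and s: "1\<^sub>m n * H = transpose_mat H * 1\<^sub>m n" and \<eta>: "\<eta> > 0"
  shows "\<exists>W h. unitary_mat n W \<and> inj_on h {..<n} \<and> mclose n \<eta> (unitary_diag n W (\<lambda>i. of_real (h i))) H \<and>
     1\<^sub>m n * unitary_diag n W (\<lambda>i. of_real (h i)) = transpose_mat (unitary_diag n W (\<lambda>i. of_real (h i))) * 1\<^sub>m n"
proof -
  note Hc = hermitian_carrier[OF H]
  have sym: "H = transpose_mat H" using s Hc by simp
  have R: "cnj (H $$ (i,j)) = H $$ (i,j)" if "i < n" "j < n" for i j
    using hermitianD[OF H that] arg_cong[OF sym, of "\<lambda>M. M $$ (j,i)"] that Hc by simp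
  have "\<exists>c \<mu>. (\<forall>j<n. \<forall>i<n. cnj (c j i) = c j i \<and> mat_fun n H (c j) i = of_real (\<mu> j) * c j i) \<and>
     (\<forall>j<n. \<forall>l<n. ip n (c j) (c l) = (if j = l then 1 else 0))"
    by (rule real_eigenbasis[OF H _ order_refl]) (rule R)
  then obtain c \<mu> where
    cm: "(\<forall>j<n. \<forall>i<n. cnj (c j i) = c j i \<and> mat_fun n H (c j) i = of_real (\<mu> j) * c j i) \<and>
     (\<forall>j<n. \<forall>l<n. ip n (c j) (c l) = (if j = l then 1 else 0))" by (elim exE)
  note c = cm[THEN conjunct1, rule_format, THEN conjunct1] cm[THEN conjunct1, rule_format, THEN conjunct2]
    cm[THEN conjunct2, rule_format]
  define W where "W = mat n n (\<lambda>(i,j). c j i)"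
  note E = eigenbasis_matrix[OF Hc W_def c(3) c(2)]
  define M where "M = real n * real (Suc n)"
  have M: "M \<ge> 0" by (simp add: M_def)
  obtain t where t: "0 < t" "t < \<eta> / (M + 1)" "inj_on (\<lambda>i. \<mu> i + t * real (Suc i)) {..<n}"
  proof -
    have "\<eta> / (M + 1) > 0" using \<eta> M by simp
    from distinct_shift[OF this, of \<mu> n] show thesis using that by blast
  qed
  define h where "h i = \<mu> i + t * real (Suc i)" for i
  have tb: "real n * (t * real (Suc n)) < \<eta>"
  proof -
    have "real n * (t * real (Suc n)) = t * M" by (simp add: M_def)
    also have "\<dots> \<le> t * (M + 1)" using t(1) by (simp add: algebra_simps)
    also have "\<dots> < \<eta>" using t(2) M by (simp add: field_simps)
    finally show ?thesis .
  qed
  have "mclose n \<eta> (unitary_diag n W (\<lambda>i. of_real (h i))) (unitary_diag n W (\<lambda>i. of_real (\<mu> i)))"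
  proof (rule unitary_diag_close[OF E(1) _ tb])
    fix i assume i: "i < n"
    have "complex_of_real (h i) - of_real (\<mu> i) = of_real (t * real (Suc i))" by (simp add: h_def)
    then show "cmod (complex_of_real (h i) - of_real (\<mu> i)) \<le> t * real (Suc n)"
      using i t(1) by (simp only: norm_of_real) (simp add: mult_left_mono)
  qed
  moreover have "transpose_mat W * 1\<^sub>m n * W = 1\<^sub>m n"
  proof -
    have "transpose_mat W = mat_adjoint W"
      by (rule mat_eqI[of _ n]) (auto simp: W_def c(1) mat_adjoint_index[of _ n])
    then show ?thesis
      using E(1) right_mult_one_mat[OF mat_adjoint_carrier[OF unitary_carrier[OF E(1)]]]
      by (simp only: unitary_mat_def)
  qed
  moreover have "1\<^sub>m n * diag_fun n f = transpose_mat (diag_fun n f) * 1\<^sub>m n" for f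
    by (rule mat_eqI[of _ n]) (auto simp: diag_fun_def)
  ultimately show ?thesis
    using conjugate_intertwine[OF E(1) one_carrier_mat _ diag_fun_carrier diag_fun_carrier] t(3) E
    by (intro exI[of _ W] exI[of _ h]) (auto simp: unitary_diag_def h_def[abs_def])
qed


text \<open>Cosine and sine of half the argument of a + i b, obtained from a complex square root of
  that number divided by its modulus.\<close>

lemma rotation_exists: "\<exists>c s :: real. c\<^sup>2 + s\<^sup>2 = 1 \<and> sqrt (a\<^sup>2 + b\<^sup>2) * (c\<^sup>2 - s\<^sup>2) = a \<and> 2 * sqrt (a\<^sup>2 + b\<^sup>2) * c * s = b"
proof (cases "a\<^sup>2 + b\<^sup>2 = 0")
  case True
  then have "a = 0" "b = 0" by (simp_all add: sum_power2_eq_zero_iff)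
  then show ?thesis by (intro exI[of _ 1] exI[of _ 0]) simp
next
  case False
  define r where "r = sqrt (a\<^sup>2 + b\<^sup>2)"
  have r: "r > 0" using False sum_power2_ge_zero[of a b] by (simp add: r_def less_le)
  define w where "w = csqrt (Complex (a / r) (b / r))"
  have w2: "w\<^sup>2 = Complex (a / r) (b / r)" by (simp add: w_def)
  have "(cmod w)\<^sup>2 = cmod (Complex (a / r) (b / r))" by (simp add: w2[symmetric] norm_power)
  also have "\<dots> = sqrt ((a\<^sup>2 + b\<^sup>2) / r\<^sup>2)" by (simp add: cmod_def power_divide add_divide_distrib)
  also have "\<dots> = 1" using False by (simp add: r_def)
  finally have 1: "(Re w)\<^sup>2 + (Im w)\<^sup>2 = 1" by (simp add: cmod_power2)
  have "(Re w)\<^sup>2 - (Im w)\<^sup>2 = a / r" "2 * Re w * Im w = b / r"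
    using arg_cong[OF w2, of Re] arg_cong[OF w2, of Im] by (simp_all add: Re_power2 Im_power2)
  then have "r * ((Re w)\<^sup>2 - (Im w)\<^sup>2) = a" "2 * r * Re w * Im w = b" using r by (simp_all add: field_simps)
  then show ?thesis using 1 unfolding r_def by blast
qed

lemma double_index_cases:
  fixes i p :: nat
  assumes "i < 2 * p"
  obtains "i < p" | a where "i = a + p" "a < p"
  using assms by (metis add.commute le_add_diff_inverse linorder_not_less mult_2 nat_add_left_cancel_less)

text \<open>The \<open>2 \<times> 2\<close> blocks \<open>h i + a \<sigma>\<^sub>3 + b \<sigma>\<^sub>1\<close>, with eigenvalues \<open>h i \<plusminus> sqrt (a\<^sup>2 + b\<^sup>2)\<close>.\<close>
definition pauli :: "nat \<Rightarrow> (nat \<Rightarrow> real) \<Rightarrow> real \<Rightarrow> real \<Rightarrow> complex mat" where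
  "pauli p h a b = mat (2 * p) (2 * p) (\<lambda>(i,j).
     if i = j then of_real (if i < p then h i + a else h (i - p) - a)
     else if j = i + p \<or> i = j + p then of_real b else 0)"

lemma pauli_carrier: "pauli p h a b \<in> carrier_mat (2 * p) (2 * p)" by (simp add: pauli_def)

lemma pauli_hermitian: "hermitian (2 * p) (pauli p h a b)"
  by (rule hermitianI[OF pauli_carrier]) (auto simp: pauli_def)

text \<open>The traceless part of each block changes sign under the relation. Odd functions of
  \<open>k\<close> in place of \<open>a\<close> and \<open>b\<close> therefore satisfy the matching
  relation between \<open>k\<close> and \<open>- k\<close>.\<close>

lemma pauli_intertwine:
  "J_mat (2 * p) * pauli p h a b = transpose_mat (pauli p h (- a) (- b)) * J_mat (2 * p)"
  by (rule J_intertwineI[OF pauli_carrier pauli_carrier]) (auto simp: pauli_def)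

text \<open>The rotation by the half-angle from \<open>rotation_exists\<close>, acting in each plane
  spanned by the coordinates \<open>i\<close> and \<open>i + p\<close>, diagonalises all blocks at
  once.\<close>

lemma pauli_diagonal:
  "\<exists>V. unitary_mat (2 * p) V \<and> pauli p h a b =
     unitary_diag (2 * p) V (\<lambda>i. of_real (if i < p then h i + sqrt (a\<^sup>2 + b\<^sup>2) else h (i - p) - sqrt (a\<^sup>2 + b\<^sup>2)))"
proof -
  define r where "r = sqrt (a\<^sup>2 + b\<^sup>2)"
  obtain c s :: real where cs: "c\<^sup>2 + s\<^sup>2 = 1" "r * (c\<^sup>2 - s\<^sup>2) = a" "2 * r * c * s = b"
    using rotation_exists[of a b] unfolding r_def by blast
  define V where "V = mat (2 * p) (2 * p) (\<lambda>(i,j). if i = j then complex_of_real c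
     else if i = j + p then of_real s else if j = i + p then - of_real s else 0)"
  have Vc: "V \<in> carrier_mat (2 * p) (2 * p)" by (simp add: V_def)
  have V: "V $$ (i,l) = (if i = l then of_real c else 0)" "V $$ (i + p, l + p) = (if i = l then of_real c else 0)"
    "V $$ (i + p, l) = (if i = l then of_real s else 0)" "V $$ (i, l + p) = (if i = l then - of_real s else 0)"
    if "i < p" "l < p" for i l using that by (auto simp: V_def)
  have csc: "complex_of_real c * of_real c + of_real s * of_real s = 1"
    using arg_cong[OF cs(1), of complex_of_real] by (simp add: power2_eq_square)
  have VV: "mat_adjoint V * V = 1\<^sub>m (2 * p)"
  proof (rule mat_eqI[OF mult_carrier_mat[OF mat_adjoint_carrier[OF Vc] Vc] one_carrier_mat])
    fix i j assume ij: "i < 2 * p" "j < 2 * p"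
    have e: "(mat_adjoint V * V) $$ (i,j) = (\<Sum>l<p. cnj (V $$ (l,i)) * V $$ (l,j) + cnj (V $$ (l + p,i)) * V $$ (l + p,j))"
      unfolding mult_index[OF mat_adjoint_carrier[OF Vc] Vc ij] sum_double using ij
      by (intro sum.cong refl) (simp add: mat_adjoint_index[OF Vc])
    have d: "(\<Sum>l<p. if l = x then y else 0) = (y::complex)" if "x < p" for x y using that by simp
    show "(mat_adjoint V * V) $$ (i,j) = 1\<^sub>m (2 * p) $$ (i,j)"
      using ij(1)
    proof (cases rule: double_index_cases)
      case 1
      note i = this
      show ?thesis using ij(2)
      proof (cases rule: double_index_cases)
        case 1
        have "(mat_adjoint V * V) $$ (i,j) = (\<Sum>l<p. if l = i then (if i = j then 1 else 0) else 0)"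
          unfolding e by (intro sum.cong refl) (use i 1 csc in \<open>auto simp: V\<close>)
        then show ?thesis using i 1 by simp
      next
        case (2 a)
        have "(mat_adjoint V * V) $$ (i,j) = (\<Sum>l<p. 0)"
          unfolding e by (intro sum.cong refl) (use i 2 in \<open>auto simp: V\<close>)
        then show ?thesis using i 2 ij by simp
      qed
    next
      case (2 a)
      note i = this
      show ?thesis using ij(2)
      proof (cases rule: double_index_cases)
        case 1
        have "(mat_adjoint V * V) $$ (i,j) = (\<Sum>l<p. 0)"
          unfolding e by (intro sum.cong refl) (use i 1 in \<open>auto simp: V\<close>)
        then show ?thesis using i 1 ij by simp
      next
        case (2 a')
        have "(mat_adjoint V * V) $$ (i,j) = (\<Sum>l<p. if l = a then (if a = a' then 1 else 0) else 0)"
          unfolding e by (intro sum.cong refl) (use i 2 csc in \<open>auto simp: V add.commute\<close>)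
        then show ?thesis using i 2 ij by simp
      qed
    qed
  qed
  then have U: "unitary_mat (2 * p) V" using Vc by (simp add: unitary_mat_def)
  let ?e = "\<lambda>i. complex_of_real (if i < p then h i + r else h (i - p) - r)"
  have "pauli p h a b = unitary_diag (2 * p) V ?e"
  proof (rule mat_eqI[OF pauli_carrier unitary_diag_carrier[OF Vc]])
    fix i j assume ij: "i < 2 * p" "j < 2 * p"
    have e: "unitary_diag (2 * p) V ?e $$ (i,j) = (\<Sum>l<p. V $$ (i,l) * of_real (h l + r) * cnj (V $$ (j,l)) +
        V $$ (i,l + p) * of_real (h l - r) * cnj (V $$ (j,l + p)))"
      unfolding unitary_diag_index[OF Vc ij] sum_double by (intro sum.cong refl) simp
    have k1: "c * (h x + r) * c + s * (h x - r) * s = h x + a" for x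
    proof -
      have "c * (h x + r) * c + s * (h x - r) * s = h x * (c\<^sup>2 + s\<^sup>2) + r * (c\<^sup>2 - s\<^sup>2)"
        by (simp add: power2_eq_square algebra_simps)
      then show ?thesis using cs by simp
    qed
    have k2: "s * (h x + r) * s + c * (h x - r) * c = h x - a" for x
    proof -
      have "s * (h x + r) * s + c * (h x - r) * c = h x * (c\<^sup>2 + s\<^sup>2) - r * (c\<^sup>2 - s\<^sup>2)"
        by (simp add: power2_eq_square algebra_simps)
      then show ?thesis using cs by simp
    qed
    have k3: "c * (h x + r) * s - s * (h x - r) * c = b" for x
      using cs(3) by (simp add: algebra_simps)
    note kc = k1[THEN arg_cong[of _ _ complex_of_real]] k2[THEN arg_cong[of _ _ complex_of_real]] k3[THEN arg_cong[of _ _ complex_of_real]]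
    show "pauli p h a b $$ (i,j) = unitary_diag (2 * p) V ?e $$ (i,j)"
      using ij(1)
    proof (cases rule: double_index_cases)
      case 1
      note i = this
      show ?thesis using ij(2)
      proof (cases rule: double_index_cases)
        case 1
        have "unitary_diag (2 * p) V ?e $$ (i,j) = (\<Sum>l<p. if l = i then (if i = j then of_real (h i + a) else 0) else 0)"
          unfolding e by (intro sum.cong refl) (use i 1 kc(1)[of i] in \<open>auto simp: V\<close>)
        then show ?thesis using i 1 by (simp add: pauli_def)
      next
        case (2 x)
        have "unitary_diag (2 * p) V ?e $$ (i,j) = (\<Sum>l<p. if l = i then (if i = x then of_real b else 0) else 0)"
          unfolding e by (intro sum.cong refl) (use i 2 kc(3)[of i] in \<open>auto simp: V\<close>)
        then show ?thesis using i 2 ij by (simp add: pauli_def)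
      qed
    next
      case (2 x)
      note i = this
      show ?thesis using ij(2)
      proof (cases rule: double_index_cases)
        case 1
        have "unitary_diag (2 * p) V ?e $$ (i,j) = (\<Sum>l<p. if l = x then (if x = j then of_real b else 0) else 0)"
          unfolding e by (intro sum.cong refl) (use i 1 kc(3)[of x] in \<open>auto simp: V mult_ac\<close>)
        then show ?thesis using i 1 ij by (auto simp: pauli_def)
      next
        case (2 x')
        have "unitary_diag (2 * p) V ?e $$ (i,j) = (\<Sum>l<p. if l = x then (if x = x' then of_real (h x - a) else 0) else 0)"
          unfolding e by (intro sum.cong refl) (use i 2 kc(2)[of x] in \<open>auto simp: V\<close>)
        then show ?thesis using i 2 ij by (auto simp: pauli_def)
      qed
    qed
  qed
  then show ?thesis using U unfolding r_def by blast
qed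

text \<open>A Kramers eigenbasis with the partners as last \<open>p\<close> columns is a symplectic
  unitary matrix. Moving the \<open>p\<close> levels apart and giving partners the same level
  separates the pairs while the degeneracy forced inside each pair stays.\<close>

lemma fermionic_model:
  assumes H: "hermitian (2 * p) H" and J: "J_mat (2 * p) * H = transpose_mat H * J_mat (2 * p)" and \<eta>: "\<eta> > 0"
  shows "\<exists>W h. unitary_mat (2 * p) W \<and> transpose_mat W * J_mat (2 * p) * W = J_mat (2 * p) \<and> inj_on h {..<p} \<and>
     mclose (2 * p) \<eta> (W * pauli p h 0 0 * mat_adjoint W) H"
proof -
  let ?n = "2 * p"
  note Hc = hermitian_carrier[OF H]
  have "\<exists>c \<mu>. (\<forall>j<p. \<forall>i<?n. mat_fun ?n H (c j) i = of_real (\<mu> j) * c j i) \<and>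
     (\<forall>j<p. \<forall>l<p. ip ?n (c j) (c l) = (if j = l then 1 else 0) \<and> ip ?n (c j) (kramers p (c l)) = 0)"
    by (rule kramers_eigenbasis[OF H J order_refl])
  then obtain c \<mu> where
    cm: "(\<forall>j<p. \<forall>i<?n. mat_fun ?n H (c j) i = of_real (\<mu> j) * c j i) \<and>
      (\<forall>j<p. \<forall>l<p. ip ?n (c j) (c l) = (if j = l then 1 else 0) \<and> ip ?n (c j) (kramers p (c l)) = 0)" by (elim exE)
  note c = cm[THEN conjunct1, rule_format] cm[THEN conjunct2, rule_format, THEN conjunct1]
    cm[THEN conjunct2, rule_format, THEN conjunct2]
  define b where "b j = (if j < p then c j else kramers p (c (j - p)))" for j
  define \<nu> where "\<nu> j = (if j < p then \<mu> j else \<mu> (j - p))" for j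
  define W where "W = mat ?n ?n (\<lambda>(i,j). b j i)"
  have Wc: "W \<in> carrier_mat ?n ?n" by (simp add: W_def)
  have bl: "b j = c j" if "j < p" for j using that by (simp add: b_def)
  have bh: "b (j + p) = kramers p (c j)" for j by (simp add: b_def)
  have kc: "ip ?n (kramers p (c j)) (c l) = 0" if "j < p" "l < p" for j l
    using ip_cnj[of ?n "c l" "kramers p (c j)"] c(3)[OF that(2,1)] by simp
  have kk: "ip ?n (kramers p (c j)) (kramers p (c l)) = (if j = l then 1 else 0)" if "j < p" "l < p" for j l
    unfolding ip_kramers using c(2)[OF that] by simp
  have o: "ip ?n (b j) (b l) = (if j = l then 1 else 0)" if jl: "j < ?n" "l < ?n" for j l
    using jl(1)
  proof (cases rule: double_index_cases)
    case 1
    note j = this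
    show ?thesis using jl(2)
    proof (cases rule: double_index_cases)
      case 1 then show ?thesis using j c(2)[OF j 1] by (simp add: bl)
    next
      case (2 y) then show ?thesis using j c(3)[OF j 2(2)] by (simp add: bl bh)
    qed
  next
    case (2 x)
    note j = this
    show ?thesis using jl(2)
    proof (cases rule: double_index_cases)
      case 1 then show ?thesis using j kc[OF j(2) 1] by (simp add: bl bh)
    next
      case (2 y) then show ?thesis using j kk[OF j(2) 2(2)] by (simp add: bh)
    qed
  qed
  have e: "mat_fun ?n H (b j) i = of_real (\<nu> j) * b j i" if ji: "j < ?n" "i < ?n" for j i
    using ji(1)
  proof (cases rule: double_index_cases)
    case 1 then show ?thesis using c(1)[OF 1 ji(2)] by (simp add: bl \<nu>_def)
  next
    case (2 x) then show ?thesis using kramers_eigenvector[OF H J c(1)[OF 2(2)] ji(2)] by (simp add: bh \<nu>_def)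
  qed
  note E = eigenbasis_matrix[OF Hc W_def o e]
  have JW: "transpose_mat W * J_mat ?n * W = J_mat ?n"
  proof -
    have tW: "transpose_mat W \<in> carrier_mat ?n ?n" using Wc by simp
    have JWc: "J_mat ?n * W \<in> carrier_mat ?n ?n" by (rule mult_carrier_mat[OF J_mat_carrier Wc])
    \<comment> \<open>Applying J to a column gives, up to sign and conjugation, its Kramers partner;
      the entries of \<open>transpose_mat W * J_mat ?n * W\<close> thus become inner products of
      basis vectors with partners.\<close>
    have JWi: "(J_mat ?n * W) $$ (a,j) = - cnj (kramers p (b j) a)" if aj: "a < ?n" "j < ?n" for a j
    proof -
      have "(J_mat ?n * W) $$ (a,j) = (\<Sum>l<?n. if l = (if a < p then a + p else a - p)
          then (if a < p then b j (a + p) else - b j (a - p)) else 0)"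
        unfolding mult_index[OF J_mat_carrier Wc aj] using aj
        by (intro sum.cong refl) (auto simp: J_mat_def W_def)
      then show ?thesis using aj by (auto simp: kramers_def)
    qed
    have k2: "ip ?n v (kramers p (b (j + p))) = - ip ?n v (c j)" for v j
      unfolding bh ip_def sum_negf[symmetric] by (intro sum.cong refl) (simp add: kramers_kramers)
    have "transpose_mat W * (J_mat ?n * W) = J_mat ?n"
    proof (rule mat_eqI[OF mult_carrier_mat[OF tW JWc] J_mat_carrier])
      fix i j assume ij: "i < ?n" "j < ?n"
      have t: "(transpose_mat W * (J_mat ?n * W)) $$ (i,j) = - cnj (ip ?n (b i) (kramers p (b j)))"
        unfolding mult_index[OF tW JWc ij] ip_def cnj_sum sum_negf[symmetric]
      proof (intro sum.cong refl)
        fix l assume "l \<in> {..<?n}"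
        then have l: "l < ?n" by simp
        have "transpose_mat W $$ (i,l) = b i l" using ij(1) l by (simp add: W_def)
        then show "transpose_mat W $$ (i,l) * (J_mat ?n * W) $$ (l,j) = - cnj (cnj (b i l) * kramers p (b j) l)"
          unfolding JWi[OF l ij(2)] by simp
      qed
      show "(transpose_mat W * (J_mat ?n * W)) $$ (i,j) = J_mat ?n $$ (i,j)"
        using ij(1)
      proof (cases rule: double_index_cases)
        case 1
        note i = this
        show ?thesis using ij(2)
        proof (cases rule: double_index_cases)
          case 1 then show ?thesis unfolding t using i c(3)[OF i 1] by (simp add: bl J_mat_def)
        next
          case (2 y) then show ?thesis unfolding t unfolding 2(1) k2 using i c(2)[OF i 2(2)] by (simp add: bl J_mat_def)
        qed
      next
        case (2 x)
        note i = this
        show ?thesis using ij(2)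
        proof (cases rule: double_index_cases)
          case 1 then show ?thesis unfolding t unfolding i(1) bh using i kk[OF i(2) 1] by (simp add: bl J_mat_def)
        next
          case (2 y) then show ?thesis unfolding t unfolding 2(1) k2 unfolding i(1) bh using i kc[OF i(2) 2(2)] by (simp add: J_mat_def)
        qed
      qed
    qed
    then show ?thesis using assoc_mult_mat[OF tW J_mat_carrier Wc] by simp
  qed
  define M where "M = real ?n * real (Suc p)"
  have M: "M \<ge> 0" by (simp add: M_def)
  obtain t where t: "0 < t" "t < \<eta> / (M + 1)" "inj_on (\<lambda>i. \<mu> i + t * real (Suc i)) {..<p}"
  proof -
    have "\<eta> / (M + 1) > 0" using \<eta> M by simp
    from distinct_shift[OF this, of \<mu> p] show thesis using that by blast
  qed
  define h where "h i = \<mu> i + t * real (Suc i)" for i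
  have tb: "real ?n * (t * real (Suc p)) < \<eta>"
  proof -
    have "real ?n * (t * real (Suc p)) = t * M" by (simp add: M_def)
    also have "\<dots> \<le> t * (M + 1)" using t(1) by (simp add: algebra_simps)
    also have "\<dots> < \<eta>" using t(2) M by (simp add: field_simps)
    finally show ?thesis .
  qed
  let ?g = "\<lambda>i. complex_of_real (if i < p then h i else h (i - p))"
  have "mclose ?n \<eta> (unitary_diag ?n W ?g) (unitary_diag ?n W (\<lambda>i. of_real (\<nu> i)))"
  proof (rule unitary_diag_close[OF E(1) _ tb])
    fix i assume i: "i < ?n"
    define x where "x = (if i < p then i else i - p)"
    have x: "x < p" using i by (auto simp: x_def)
    have "?g i - of_real (\<nu> i) = of_real (t * real (Suc x))" by (simp add: h_def x_def \<nu>_def)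
    then show "cmod (?g i - of_real (\<nu> i)) \<le> t * real (Suc p)"
      using x t(1) by (simp only: norm_of_real) (simp add: mult_left_mono)
  qed
  moreover have "diag_fun ?n ?g = pauli p h 0 0"
    by (rule mat_eqI[OF diag_fun_carrier pauli_carrier]) (auto simp: diag_fun_def pauli_def)
  ultimately have "mclose ?n \<eta> (W * pauli p h 0 0 * mat_adjoint W) (unitary_diag ?n W (\<lambda>i. of_real (\<nu> i)))"
    by (simp only: unitary_diag_def)
  then have "mclose ?n \<eta> (W * pauli p h 0 0 * mat_adjoint W) H" by (subst E(2))
  then show ?thesis using E(1) JW t(3) unfolding h_def[abs_def] by blast
qed

text \<open>Half the splitting of each Kramers pair in the model; it vanishes exactly at the
  high-symmetry points (\<open>sine_norm_zero_iff\<close>).\<close>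

definition sine_norm :: "real \<times> real \<Rightarrow> real" where
  "sine_norm k = sqrt ((sin (2 * pi * fst k))\<^sup>2 + (sin (2 * pi * snd k))\<^sup>2)"

lemma mcont_mult:
  assumes "\<And>x. A x \<in> carrier_mat n n" "\<And>x. B x \<in> carrier_mat n n" "mcont n S A" "mcont n S B"
  shows "mcont n S (\<lambda>x. A x * B x)"
  unfolding mcont_def
proof (intro allI impI)
  fix i j assume ij: "i < n" "j < n"
  show "continuous_on S (\<lambda>x. (A x * B x) $$ (i,j))"
    unfolding mult_index[OF assms(1,2) ij]
    using assms(3,4) ij by (intro continuous_on_sum continuous_on_mult) (auto simp: mcont_def)
qed

lemma mcont_const: "mcont n S (\<lambda>x. A)"
  by (simp add: mcont_def)

text \<open>A perturbation of a matrix at a high-symmetry point to a matching family; in the fermionic case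
  the degeneracy is lifted to first order away from the point.\<close>
lemma local_model:
  assumes ad: "admissible_eps m \<epsilon>" and m: "m \<ge> 1" and H: "hermitian m H" and s: "\<epsilon> * H = transpose_mat H * \<epsilon>" and \<eta>: "\<eta> > 0"
  obtains G h where "\<And>k. hermitian m (G k)" "mcont m UNIV G" "periodic G" "\<And>k. \<epsilon> * G k = transpose_mat (G (- k)) * \<epsilon>"
    "\<And>k. high_symmetry_point k \<Longrightarrow> mclose m \<eta> (G k) H"
    "if \<epsilon> = 1\<^sub>m m then inj_on h {..<m} \<and> (\<forall>k. \<exists>V. unitary_mat m V \<and> G k = unitary_diag m V (\<lambda>i. of_real (h i)))
     else even m \<and> inj_on h {..<m div 2} \<and> (\<forall>k. \<exists>V. unitary_mat m V \<and>
        G k = unitary_diag m V (\<lambda>i. of_real (if i < m div 2 then h i + sine_norm k else h (i - m div 2) - sine_norm k)))"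
proof (cases "\<epsilon> = 1\<^sub>m m")
  case True
  obtain W h where W: "unitary_mat m W" "inj_on h {..<m}" "mclose m \<eta> (unitary_diag m W (\<lambda>i. of_real (h i))) H"
    "1\<^sub>m m * unitary_diag m W (\<lambda>i. of_real (h i)) = transpose_mat (unitary_diag m W (\<lambda>i. of_real (h i))) * 1\<^sub>m m"
    using bosonic_model[OF H _ \<eta>] s unfolding True by blast
  show thesis
  proof (rule that[of "\<lambda>k. unitary_diag m W (\<lambda>i. of_real (h i))" h])
    show "hermitian m (unitary_diag m W (\<lambda>i. of_real (h i)))" by (rule hermitian_unitary_diag[OF unitary_carrier[OF W(1)]])
    show "mcont m UNIV (\<lambda>k. unitary_diag m W (\<lambda>i. of_real (h i)))" by (rule mcont_const)
    show "periodic (\<lambda>k. unitary_diag m W (\<lambda>i. of_real (h i)))" by (simp add: periodic_def)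
    show "if \<epsilon> = 1\<^sub>m m then inj_on h {..<m} \<and> (\<forall>k. \<exists>V. unitary_mat m V \<and> unitary_diag m W (\<lambda>i. of_real (h i)) = unitary_diag m V (\<lambda>i. of_real (h i)))
     else even m \<and> inj_on h {..<m div 2} \<and> (\<forall>k. \<exists>V. unitary_mat m V \<and>
        unitary_diag m W (\<lambda>i. of_real (h i)) = unitary_diag m V (\<lambda>i. of_real (if i < m div 2 then h i + sine_norm k else h (i - m div 2) - sine_norm k)))"
      using True W(1,2) by auto
  qed (use W(3,4) True in auto)
next
  case False
  then have ev: "even m" and J: "\<epsilon> = J_mat m" using ad by (auto simp: admissible_eps_def)
  obtain p where p: "m = 2 * p" using ev by (rule evenE)
  have pd: "m div 2 = p" using p by simp
  obtain W h where W: "unitary_mat m W" "transpose_mat W * \<epsilon> * W = \<epsilon>" "inj_on h {..<p}"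
    "mclose m \<eta> (W * pauli p h 0 0 * mat_adjoint W) H"
    using fermionic_model[of p H \<eta>] H s \<eta> unfolding J p by blast
  note Wc = unitary_carrier[OF W(1)]
  \<comment> \<open>Odd and periodic, as \<open>pauli_intertwine\<close> and the periodicity of
    \<open>G\<close> require, with common zeros exactly at the high-symmetry points.\<close>
  let ?a = "\<lambda>k :: real \<times> real. sin (2 * pi * fst k)" and ?b = "\<lambda>k :: real \<times> real. sin (2 * pi * snd k)"
  define G where "G k = W * pauli p h (?a k) (?b k) * mat_adjoint W" for k
  have Pc: "pauli p h x y \<in> carrier_mat m m" for x y using pauli_carrier p by simp
  show thesis
  proof (rule that[of G h])
    show "hermitian m (G k)" for k
      unfolding G_def using pauli_hermitian p by (intro hermitian_conjugate[OF _ Wc]) simp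
    show "mcont m UNIV G"
    proof -
      have "mcont m UNIV (\<lambda>k. pauli p h (?a k) (?b k))"
        unfolding mcont_def
      proof (intro allI impI)
        fix i j assume ij: "i < m" "j < m"
        have e: "(\<lambda>k. pauli p h (?a k) (?b k) $$ (i,j)) = (\<lambda>k. if i = j then (if i < p then of_real (h i + ?a k) else of_real (h (i - p) - ?a k))
           else if j = i + p \<or> i = j + p then of_real (?b k) else 0)"
          using ij p by (auto simp: pauli_def)
        show "continuous_on UNIV (\<lambda>k. pauli p h (?a k) (?b k) $$ (i,j))"
          unfolding e by (cases "i = j"; cases "i < p"; cases "j = i + p \<or> i = j + p") (auto intro!: continuous_intros)
      qed
      then show ?thesis unfolding G_def
        by (intro mcont_mult mult_carrier_mat[OF Wc Pc] mat_adjoint_carrier[OF Wc] mcont_const Wc Pc)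
    qed
    show "periodic G" unfolding periodic_def G_def by (simp add: sin_int_shift)
    show "\<epsilon> * G k = transpose_mat (G (- k)) * \<epsilon>" for k
    proof -
      have "\<epsilon> * pauli p h (?a k) (?b k) = transpose_mat (pauli p h (?a (- k)) (?b (- k))) * \<epsilon>"
        using pauli_intertwine[of p h "?a k" "?b k"] unfolding J p by simp
      from conjugate_intertwine[OF W(1) _ W(2) Pc Pc this] show ?thesis
        unfolding G_def using J J_mat_carrier by simp
    qed
    show "mclose m \<eta> (G k) H" if "high_symmetry_point k" for k
    proof -
      have "sin (2 * pi * x) = 0" if x: "2 * x \<in> \<int>" for x :: real
      proof -
        from x obtain j :: int where "2 * x = of_int j" by (auto elim: Ints_cases)
        then have "2 * pi * x = of_int j * pi" by (metis mult.assoc mult.commute)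
        then show ?thesis by (simp add: sin_int_times_real sin_zero_iff_int2)
      qed
      then have "?a k = 0" "?b k = 0" using that by (auto simp: high_symmetry_point_def)
      then show ?thesis using W(4) by (simp only: G_def)
    qed
    have "\<exists>V. unitary_mat m V \<and> G k = unitary_diag m V (\<lambda>i. of_real (if i < p then h i + sine_norm k else h (i - p) - sine_norm k))" for k
    proof -
      obtain V where V: "unitary_mat m V" "pauli p h (?a k) (?b k) = unitary_diag m V (\<lambda>i. of_real (if i < p then h i + sine_norm k else h (i - p) - sine_norm k))"
        using pauli_diagonal[of p h "?a k" "?b k"] unfolding p sine_norm_def by blast
      show ?thesis
        using unitary_mult[OF W(1) V(1)] unitary_diag_conjugate[OF W(1) V(1)] unfolding G_def V(2) by blast
    qed
    then show "if \<epsilon> = 1\<^sub>m m then inj_on h {..<m} \<and> (\<forall>k. \<exists>V. unitary_mat m V \<and> G k = unitary_diag m V (\<lambda>i. of_real (h i)))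
     else even m \<and> inj_on h {..<m div 2} \<and> (\<forall>k. \<exists>V. unitary_mat m V \<and>
        G k = unitary_diag m V (\<lambda>i. of_real (if i < m div 2 then h i + sine_norm k else h (i - m div 2) - sine_norm k)))"
      using False W(3) ev unfolding pd by simp
  qed
qed

section \<open>Spectra of the models\<close>

lemma order_char_poly_card:
  fixes A :: "complex mat"
  assumes "char_poly A = (\<Prod>a\<leftarrow>map g [0..<m]. [:- a, 1:])"
  shows "Polynomial.order w (char_poly A) = card {i. i < m \<and> g i = w}"
proof -
  have "Polynomial.order w (char_poly A) = sum_list (map (Polynomial.order w) (map (\<lambda>a. [:- a, 1:]) (map g [0..<m])))"
    unfolding assms by (rule order_prod_list) auto
  also have "\<dots> = (\<Sum>i\<in>{0..<m}. if g i = w then 1 else 0)"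
    unfolding map_map sum_set_upt_conv_sum_list_nat[symmetric]
    by (intro sum.cong) (auto simp: order_linear')
  also have "\<dots> = card ({0..<m} \<inter> {i. g i = w})" by (simp add: sum.If_cases)
  also have "{0..<m} \<inter> {i. g i = w} = {i. i < m \<and> g i = w}" by auto
  finally show ?thesis .
qed

lemma simple_spectrum_inj:
  assumes A: "char_poly A = (\<Prod>a\<leftarrow>map g [0..<m]. [:- a, 1:])" and g: "inj_on g {..<m}"
  shows "simple_spectrum A"
  unfolding simple_spectrum_def order_char_poly_card[OF A]
proof
  fix w
  have "finite {i. i < m \<and> g i = w}" by simp
  moreover have "i = j" if "i \<in> {i. i < m \<and> g i = w}" "j \<in> {i. i < m \<and> g i = w}" for i j
    using that g by (auto simp: inj_on_def)
  ultimately show "card {i. i < m \<and> g i = w} \<le> 1"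
    by (metis card_le_Suc0_iff_eq One_nat_def)
qed

text \<open>The difference equals 2 i z (x - y) / ((x + i) (y + i)), and each factor of the
  denominator has modulus at most \<open>B + 1\<close>.\<close>

lemma cayley_eigenvalue_distance:
  assumes z: "cmod z = 1" and x: "\<bar>x\<bar> \<le> B" and y: "\<bar>y\<bar> \<le> B"
  shows "cmod ((z - 2 * \<i> * z / (of_real x + \<i>)) - (z - 2 * \<i> * z / (of_real y + \<i>))) \<ge> 2 * \<bar>x - y\<bar> / (B + 1)\<^sup>2"
proof -
  have ne: "complex_of_real x + \<i> \<noteq> 0" "complex_of_real y + \<i> \<noteq> 0" by (simp_all add: complex_eq_iff)
  have le: "cmod (complex_of_real x + \<i>) \<le> B + 1" "cmod (complex_of_real y + \<i>) \<le> B + 1"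
    using norm_triangle_ineq[of "complex_of_real x" \<i>] norm_triangle_ineq[of "complex_of_real y" \<i>] x y by simp_all
  have "(z - 2 * \<i> * z / (of_real x + \<i>)) - (z - 2 * \<i> * z / (of_real y + \<i>)) =
      2 * \<i> * z * (of_real (x - y)) / ((of_real x + \<i>) * (of_real y + \<i>))"
    using ne by (simp add: field_simps)
  then have "cmod ((z - 2 * \<i> * z / (of_real x + \<i>)) - (z - 2 * \<i> * z / (of_real y + \<i>))) =
      2 * \<bar>x - y\<bar> / (cmod (of_real x + \<i>) * cmod (of_real y + \<i>))"
    using z by (simp add: norm_divide norm_mult del: of_real_diff)
  also have "\<dots> \<ge> 2 * \<bar>x - y\<bar> / (B + 1)\<^sup>2"
    unfolding power2_eq_square
    by (intro divide_left_mono mult_mono le mult_pos_pos) (use ne x in \<open>auto intro: order_trans[OF norm_ge_zero le(1)]\<close>)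
  finally show ?thesis .
qed

lemma cayley_eigenvalue_inj:
  assumes z: "cmod z = 1" and e: "z - 2 * \<i> * z / (of_real x + \<i>) = z - 2 * \<i> * z / (of_real y + \<i>)"
  shows "x = y"
proof -
  have "2 * \<bar>x - y\<bar> / (max \<bar>x\<bar> \<bar>y\<bar> + 1)\<^sup>2 \<le> 0"
    using cayley_eigenvalue_distance[OF z, of x "max \<bar>x\<bar> \<bar>y\<bar>" y] e by simp
  moreover have "(max \<bar>x\<bar> \<bar>y\<bar> + 1)\<^sup>2 > 0" by (intro zero_less_power) (auto simp: max_def)
  ultimately show ?thesis by (simp add: divide_le_0_iff)
qed

lemma inj_on_gap:
  assumes "inj_on (h :: nat \<Rightarrow> real) {..<p}"
  shows "\<exists>g>0. \<forall>i<p. \<forall>j<p. i \<noteq> j \<longrightarrow> g \<le> \<bar>h i - h j\<bar>"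
proof -
  \<comment> \<open>Inserting 1 keeps \<open>T\<close> nonempty when there are no two distinct
    indices.\<close>
  define T where "T = insert 1 ((\<lambda>(i,j). \<bar>h i - h j\<bar>) ` {(i,j). i < p \<and> j < p \<and> i \<noteq> j})"
  have "finite {(i,j). i < p \<and> j < p \<and> i \<noteq> j}"
    by (rule finite_subset[of _ "{..<p} \<times> {..<p}"]) auto
  then have fin: "finite T" by (simp add: T_def)
  have "Min T > 0" using fin assms by (subst Min_gr_iff) (auto simp: T_def inj_on_def)
  moreover have "Min T \<le> \<bar>h i - h j\<bar>" if "i < p" "j < p" "i \<noteq> j" for i j
    using fin that by (intro Min_le) (auto simp: T_def)
  ultimately show ?thesis by blast
qed

text \<open>Measuring the radius by \<open>lattice_gap\<close> covers all lattice translates of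
  \<open>c\<close> at once.\<close>

definition local_form :: "nat \<Rightarrow> complex mat \<Rightarrow> (real \<times> real \<Rightarrow> complex mat) \<Rightarrow> real \<times> real \<Rightarrow> real \<Rightarrow> real \<Rightarrow> bool" where
  "local_form m \<epsilon> \<alpha> c r A \<longleftrightarrow> r > 0 \<and> A > 0 \<and> (\<forall>k. lattice_gap (k - c) < r \<longrightarrow>
     (if \<epsilon> = 1\<^sub>m m then simple_spectrum (\<alpha> k)
      else (high_symmetry_point k \<longrightarrow> doubly_degenerate_spectrum (\<alpha> k)) \<and>
           (\<not> high_symmetry_point k \<longrightarrow> simple_spectrum (\<alpha> k)) \<and> clustered_spectrum m A (\<alpha> k)))"

lemma sin_zero_half_integer: "sin (2 * pi * x) = 0 \<longleftrightarrow> 2 * x \<in> \<int>"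
proof
  assume "sin (2 * pi * x) = 0"
  then obtain i :: int where "2 * pi * x = of_int i * pi" using sin_zero_iff_int2 by blast
  then have "2 * x = of_int i" by simp
  then show "2 * x \<in> \<int>" by simp
next
  assume "2 * x \<in> \<int>"
  then obtain j :: int where "2 * x = of_int j" by (auto elim: Ints_cases)
  then have "2 * pi * x = of_int j * pi" by (metis mult.assoc mult.commute)
  then show "sin (2 * pi * x) = 0" using sin_zero_iff_int2 by blast
qed

lemma sine_norm_zero_iff: "sine_norm k = 0 \<longleftrightarrow> high_symmetry_point k"
proof -
  have "sine_norm k = 0 \<longleftrightarrow> sin (2 * pi * fst k) = 0 \<and> sin (2 * pi * snd k) = 0"
    unfolding sine_norm_def real_sqrt_eq_0_iff by (rule sum_power2_eq_zero_iff)
  then show ?thesis unfolding sin_zero_half_integer high_symmetry_point_def by simp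
qed

lemma sine_norm_nonneg: "sine_norm k \<ge> 0" by (simp add: sine_norm_def)

text \<open>By \<open>4 * r < g\<close>, levels from different pairs stay at least
  \<open>g - 2 * r\<close>, hence \<open>g / 2\<close>, apart, while inside a pair they differ by
  \<open>2 * r\<close>. With all levels bounded by \<open>B + 1\<close>,
  \<open>cayley_eigenvalue_distance\<close> turns the real gap \<open>g / 2\<close> into
  \<open>g / (B + 2)\<^sup>2\<close> on the circle.\<close>

lemma paired_spectrum:
  fixes h :: "nat \<Rightarrow> real" and p :: nat
  assumes z: "cmod z = 1" and h: "\<And>i j. i < p \<Longrightarrow> j < p \<Longrightarrow> i \<noteq> j \<Longrightarrow> g \<le> \<bar>h i - h j\<bar>" and g: "g > 0"
    and B: "\<And>i. i < p \<Longrightarrow> \<bar>h i\<bar> \<le> B" and r: "0 \<le> r" "4 * r < g" "r \<le> 1"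
    and f: "f = (\<lambda>i. z - 2 * \<i> * z / (complex_of_real (if i < p then h i + r else h (i - p) - r) + \<i>))"
    and A: "char_poly A = (\<Prod>a\<leftarrow>map f [0..<2 * p]. [:- a, 1:])"
  shows "r = 0 \<Longrightarrow> doubly_degenerate_spectrum A" "r > 0 \<Longrightarrow> simple_spectrum A" "p > 0 \<Longrightarrow> clustered_spectrum (2 * p) (g / (B + 2)\<^sup>2) A"
proof -
  define e where "e i = (if i < p then h i + r else h (i - p) - r)" for i
  \<comment> \<open>The pair to which level \<open>i\<close> belongs; it also serves as the cluster
    map.\<close>
  define q where "q i = (if i < p then i else i - p)" for i :: nat
  have fe: "f i = z - 2 * \<i> * z / (complex_of_real (e i) + \<i>)" for i by (simp add: f e_def)
  have q: "q i < p" if "i < 2 * p" for i using that by (auto simp: q_def)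
  have eh: "\<bar>e i - h (q i)\<bar> \<le> r" for i using r(1) by (simp add: e_def q_def)
  have far: "g / 2 \<le> \<bar>e i - e j\<bar>" if "i < 2 * p" "j < 2 * p" "q i \<noteq> q j" for i j
    using h[OF q[OF that(1)] q[OF that(2)] that(3)] eh[of i] eh[of j] r(2) by linarith
  have eB: "\<bar>e i\<bar> \<le> B + 1" if "i < 2 * p" for i
    using B[OF q[OF that]] eh[of i] r(3) by linarith
  have finj: "e i = e j" if "f i = f j" for i j
    using cayley_eigenvalue_inj[OF z] that unfolding fe by blast
  show "simple_spectrum A" if rp: "r > 0"
  proof (rule simple_spectrum_inj[OF A], rule inj_onI)
    fix i j assume ij: "i \<in> {..<2 * p}" "j \<in> {..<2 * p}" "f i = f j"
    have ee: "e i = e j" by (rule finj[OF ij(3)])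
    have qq: "q i = q j"
    proof (rule ccontr)
      assume "q i \<noteq> q j"
      then have "g / 2 \<le> \<bar>e i - e j\<bar>" using ij by (intro far) auto
      then show False using ee g by simp
    qed
    show "i = j"
    proof (cases "i < p"; cases "j < p")
      assume "i < p" "j < p" then show ?thesis using qq by (simp add: q_def)
    next
      assume "i < p" "\<not> j < p" then show ?thesis using qq ee rp by (simp add: q_def e_def)
    next
      assume "\<not> i < p" "j < p" then show ?thesis using qq ee rp by (simp add: q_def e_def)
    next
      assume "\<not> i < p" "\<not> j < p" then show ?thesis using qq by (simp add: q_def)
    qed
  qed
  show "doubly_degenerate_spectrum A" if r0: "r = 0"
    unfolding doubly_degenerate_spectrum_def
  proof (intro allI impI)
    fix w assume w: "poly (char_poly A) w = 0"
    have "poly (char_poly A) w = (\<Prod>a\<leftarrow>map f [0..<2 * p]. w - a)"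
      unfolding A by (simp add: poly_prod_list o_def)
    then obtain i where i: "i < 2 * p" "f i = w" using w by (auto simp: prod_list_zero_iff)
    have "{j. j < 2 * p \<and> f j = w} = {q i, q i + p}"
    proof (intro equalityI subsetI)
      fix j assume "j \<in> {j. j < 2 * p \<and> f j = w}"
      then have j: "j < 2 * p" "f j = f i" using i by auto
      have "q j = q i"
      proof (rule ccontr)
        assume "q j \<noteq> q i"
        then have "g / 2 \<le> \<bar>e j - e i\<bar>" using j i by (intro far) auto
        then show False using finj[OF j(2)] g by simp
      qed
      then show "j \<in> {q i, q i + p}" by (cases "j < p") (auto simp: q_def)
    next
      fix j assume "j \<in> {q i, q i + p}"
      then have "q j = q i" "j < 2 * p" using q[OF i(1)] by (auto simp: q_def split: if_splits)
      moreover have "e j = h (q j)" "e i = h (q i)" using r0 by (simp_all add: e_def q_def)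
      ultimately show "j \<in> {j. j < 2 * p \<and> f j = w}" using i(2) fe[of i] fe[of j] by simp
    qed
    then have "card {j. j < 2 * p \<and> f j = w} = card {q i, q i + p}" by simp
    also have "\<dots> = 2" using q[OF i(1)] by simp
    finally show "Polynomial.order w (char_poly A) = 2" unfolding order_char_poly_card[OF A] .
  qed
  show "clustered_spectrum (2 * p) (g / (B + 2)\<^sup>2) A" if p: "p > 0"
    unfolding clustered_spectrum_def
  proof (intro exI[of _ "map f [0..<2 * p]"] conjI exI[of _ q])
    show "length (map f [0..<2 * p]) = 2 * p" by simp
    show "char_poly A = (\<Prod>e\<leftarrow>map f [0..<2 * p]. [:- e, 1:])" by (rule A)
    show "\<forall>i<2 * p. q i < 2 * p div 2" using q by simp
    show "\<forall>x<2 * p div 2. card {i. i < 2 * p \<and> q i = x} = 2"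
    proof (intro allI impI)
      fix x assume x: "x < 2 * p div 2"
      have "{i. i < 2 * p \<and> q i = x} = {x, x + p}" using x by (auto simp: q_def split: if_splits)
      then show "card {i. i < 2 * p \<and> q i = x} = 2" using p by simp
    qed
    show "\<forall>i<2 * p. \<forall>j<2 * p. q i \<noteq> q j \<longrightarrow> g / (B + 2)\<^sup>2 \<le> cmod (map f [0..<2 * p] ! i - map f [0..<2 * p] ! j)"
    proof (intro allI impI)
      fix i j assume ij: "i < 2 * p" "j < 2 * p" "q i \<noteq> q j"
      have "g / (B + 2)\<^sup>2 \<le> 2 * \<bar>e i - e j\<bar> / (B + 2)\<^sup>2"
        using far[OF ij] by (intro divide_right_mono) auto
      also have "\<dots> \<le> cmod (f i - f j)"
        using cayley_eigenvalue_distance[OF z eB[OF ij(1)] eB[OF ij(2)]] unfolding fe by (simp add: add.assoc)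
      finally show "g / (B + 2)\<^sup>2 \<le> cmod (map f [0..<2 * p] ! i - map f [0..<2 * p] ! j)" using ij by simp
    qed
  qed
qed

text \<open>Since \<open>c + c\<close> is a lattice vector, periodic functions cannot distinguish
  \<open>c\<close> from \<open>- c\<close>.\<close>

lemma high_symmetry_shift:
  assumes "high_symmetry_point c"
  shows "lattice_gap (k + c) = lattice_gap (k - c)" "periodic F \<Longrightarrow> F (- c) = F c"
proof -
  obtain a where a: "2 * fst c = of_int a" using assms unfolding high_symmetry_point_def by (auto elim: Ints_cases)
  obtain b where b: "2 * snd c = of_int b" using assms unfolding high_symmetry_point_def by (auto elim: Ints_cases)
  have "fst c + fst c = of_int a" "snd c + snd c = of_int b" using a b by simp_all
  then have cc: "c + c = (of_int a, of_int b)" by (simp add: prod_eq_iff)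
  have "k + c = (k - c) + (c + c)" by simp
  then show "lattice_gap (k + c) = lattice_gap (k - c)" unfolding cc by (simp only: lattice_gap_periodic)
  assume F: "periodic F"
  have "c = - c + (c + c)" by simp
  then have "c = - c + (of_int a, of_int b)" unfolding cc .
  then show "F (- c) = F c" using periodicD[OF F, of "- c" a b] by simp
qed

text \<open>Finitely many open periodic conditions hold at \<open>c\<close>;
  \<open>lattice_gap_ball\<close> supplies a common radius for them.\<close>

lemma chart_neighbourhood:
  assumes al: "matching_family m \<epsilon> \<alpha>" and z: "det (shift m (\<alpha> c) z) \<noteq> 0"
    and G: "mcont m UNIV G" "periodic G" "mclose m \<eta> (G c) (inv_cayley m z (\<alpha> c))"
  shows "\<exists>\<rho>>0. \<forall>k. lattice_gap (k - c) < \<rho> \<longrightarrow> det (shift m (\<alpha> k) z) \<noteq> 0 \<and> mclose m \<eta> (G k) (inv_cayley m z (\<alpha> k))"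
proof -
  note a = matchingD[OF al]
  have ac: "\<alpha> k \<in> carrier_mat m m" for k using unitary_carrier[OF a(3)] .
  let ?U = "{k. det (shift m (\<alpha> k) z) \<noteq> 0}"
  have "continuous_on UNIV (\<lambda>k. det (shift m (\<alpha> k) z))"
    by (intro mcont_det[OF shift_carrier[OF ac]] mcont_shift ac a(1))
  then have oU: "open ?U" by (intro open_Collect_neq continuous_on_const)
  let ?V = "\<lambda>i j. {k\<in>?U. cmod (G k $$ (i,j) - inv_cayley m z (\<alpha> k) $$ (i,j)) < \<eta>}"
  have oV: "open (?V i j)" if "i < m" "j < m" for i j
  proof -
    have "mcont m ?U (\<lambda>k. inv_cayley m z (\<alpha> k))" by (rule mcont_inv_cayley[OF ac mcont_subset[OF a(1)]]) auto
    then have "continuous_on ?U (\<lambda>k. cmod (G k $$ (i,j) - inv_cayley m z (\<alpha> k) $$ (i,j)))"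
      using mcont_subset[OF G(1) subset_UNIV, of ?U] that unfolding mcont_def by (intro continuous_on_norm continuous_on_diff) blast+
    from continuous_open_preimage[OF this oU open_lessThan[of \<eta>]]
    have "open (?U \<inter> (\<lambda>k. cmod (G k $$ (i,j) - inv_cayley m z (\<alpha> k) $$ (i,j))) -` {..<\<eta>})" .
    moreover have "?U \<inter> (\<lambda>k. cmod (G k $$ (i,j) - inv_cayley m z (\<alpha> k) $$ (i,j))) -` {..<\<eta>} = ?V i j" by auto
    ultimately show ?thesis by simp
  qed
  let ?W = "?U \<inter> (\<Inter>i\<in>{..<m}. \<Inter>j\<in>{..<m}. ?V i j)"
  have "open ?W" using oU oV by (intro open_Int open_INT ballI finite_lessThan) auto
  moreover have "c \<in> ?W" using z G(3) by (auto simp: mclose_def)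
  moreover have "periodic_set ?W"
    unfolding periodic_set_def
  proof (intro allI impI)
    fix k and x y :: int assume k: "k \<in> ?W"
    show "k + (of_int x, of_int y) \<in> ?W" using k unfolding mem_Collect_eq INT_iff Int_iff a(2) periodicD[OF G(2)] .
  qed
  ultimately obtain \<rho> where \<rho>: "\<rho> > 0" "\<And>k. lattice_gap (k - c) < \<rho> \<Longrightarrow> k \<in> ?W" using lattice_gap_ball[of ?W c] by blast
  have "det (shift m (\<alpha> k) z) \<noteq> 0 \<and> mclose m \<eta> (G k) (inv_cayley m z (\<alpha> k))" if "lattice_gap (k - c) < \<rho>" for k
    using \<rho>(2)[OF that] unfolding mclose_def by blast
  then show ?thesis using \<rho>(1) by blast
qed

lemma sine_norm_small:
  assumes c: "high_symmetry_point c" and g: "g > 0"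
  shows "\<exists>\<rho>>0. \<forall>k. lattice_gap (k - c) < \<rho> \<longrightarrow> sine_norm k < g"
proof -
  have "continuous_on UNIV sine_norm" unfolding sine_norm_def by (intro continuous_intros)
  then have "open {k. sine_norm k < g}" by (intro open_Collect_less continuous_on_const)
  moreover have "c \<in> {k. sine_norm k < g}" using sine_norm_zero_iff[of c] c g by simp
  moreover have "periodic_set {k. sine_norm k < g}" by (simp add: periodic_set_def sine_norm_def sin_int_shift)
  ultimately have "\<exists>\<rho>>0. \<forall>k. lattice_gap (k - c) < \<rho> \<longrightarrow> k \<in> {k. sine_norm k < g}" by (rule lattice_gap_ball)
  then show ?thesis by simp
qed

lemma intertwine_smult_diff:
  fixes \<epsilon> A B A' B' :: "complex mat"
  assumes c: "\<epsilon> \<in> carrier_mat n n" "A \<in> carrier_mat n n" "B \<in> carrier_mat n n" "A' \<in> carrier_mat n n" "B' \<in> carrier_mat n n"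
    and r: "\<epsilon> * A = transpose_mat A' * \<epsilon>" "\<epsilon> * B = transpose_mat B' * \<epsilon>"
  shows "\<epsilon> * (t \<cdot>\<^sub>m (A - B)) = transpose_mat (t \<cdot>\<^sub>m (A' - B')) * \<epsilon>"
proof -
  have e: "t \<cdot>\<^sub>m (A - B) = t \<cdot>\<^sub>m A + (- t) \<cdot>\<^sub>m B" if "A \<in> carrier_mat n n" "B \<in> carrier_mat n n" for A B :: "complex mat"
    using that by (intro mat_eqI[of _ n]) (auto simp: algebra_simps)
  show ?thesis
    unfolding e[OF c(2,3)] e[OF c(4,5)]
    by (rule intertwine_add[OF c(1) smult_carrier_mat[OF c(2)] smult_carrier_mat[OF c(3)] smult_carrier_mat[OF c(4)]
        smult_carrier_mat[OF c(5)] intertwine_smult[OF c(1,2,4) r(1)] intertwine_smult[OF c(1,3,5) r(2)]])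
qed

text \<open>Since \<open>c\<close> and \<open>- c\<close> are congruent, the sublevel sets of
  \<open>lattice_gap (k - c)\<close> are invariant under reflection, and the bump inherits the
  matching relation directly from the model and the chart value. Inside radius \<open>r\<close> the
  new family is the Cayley transform of the model, whose spectrum is explicit.\<close>

lemma symmetric_point_step:
  assumes al: "matching_family m \<epsilon> \<alpha>" and ad: "admissible_eps m \<epsilon>" and m: "m \<ge> 1"
    and c: "high_symmetry_point c" and \<delta>: "\<delta> > 0"
  obtains \<beta> r A where "near m \<epsilon> \<delta> \<alpha> \<beta>" "local_form m \<epsilon> \<beta> c r A" "\<And>k. lattice_gap (k - c) \<ge> 1 \<Longrightarrow> \<beta> k = \<alpha> k"
proof -
  note a = matchingD[OF al]
  have ac: "\<alpha> k \<in> carrier_mat m m" for k using unitary_carrier[OF a(3)] .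
  have eps: "eps_sym m \<epsilon>" by (rule eps_sym_admissible[OF ad])
  note ec = eps_symD(1)[OF eps]
  obtain z where z: "cmod z = 1" "det (shift m (\<alpha> c) z) \<noteq> 0" using exists_unit_non_eigenvalue[OF ac] by blast
  define H where "H k = inv_cayley m z (\<alpha> k)" for k
  have Hh: "hermitian m (H k)" if "det (shift m (\<alpha> k) z) \<noteq> 0" for k
    unfolding H_def by (rule inv_cayley_hermitian[OF a(3) z(1) that])
  have Hp: "periodic H" using a(2) by (simp add: periodic_def H_def)
  have Hint: "\<epsilon> * H k = transpose_mat (H (- k)) * \<epsilon>" if "det (shift m (\<alpha> k) z) \<noteq> 0" "det (shift m (\<alpha> (- k)) z) \<noteq> 0" for k
    unfolding H_def by (rule transpose_intertwine_inv_cayley[OF ac that(1) ac that(2) ec a(4)])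
  have am: "\<alpha> (- c) = \<alpha> c" by (rule high_symmetry_shift(2)[OF c matching_periodic[OF al]])
  then have Hc: "\<epsilon> * H c = transpose_mat (H c) * \<epsilon>" using Hint[of c] z(2) by (simp add: H_def)
  define M where "M = 2 * real m * real m"
  have M: "M \<ge> 0" by (simp add: M_def)
  define \<eta> where "\<eta> = \<delta> / (M + 1)"
  have \<eta>: "\<eta> > 0" using \<delta> M by (simp add: \<eta>_def)
  have \<eta>b: "2 * real m * real m * \<eta> < \<delta>"
  proof -
    have "\<delta> * M < \<delta> * (M + 1)" using \<delta> by (intro mult_strict_left_mono) auto
    then have "M * \<eta> < \<delta>" using M by (simp add: \<eta>_def divide_less_eq mult.commute)
    then show ?thesis by (simp add: M_def)
  qed
  obtain G h where Gh: "\<And>k. hermitian m (G k)" and Gc: "mcont m UNIV G" and Gp: "periodic G"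
    and Gm: "\<And>k. \<epsilon> * G k = transpose_mat (G (- k)) * \<epsilon>"
    and Gcl: "\<And>k. high_symmetry_point k \<Longrightarrow> mclose m \<eta> (G k) (H c)"
    and Gf: "if \<epsilon> = 1\<^sub>m m then inj_on h {..<m} \<and> (\<forall>k. \<exists>V. unitary_mat m V \<and> G k = unitary_diag m V (\<lambda>i. of_real (h i)))
     else even m \<and> inj_on h {..<m div 2} \<and> (\<forall>k. \<exists>V. unitary_mat m V \<and>
        G k = unitary_diag m V (\<lambda>i. of_real (if i < m div 2 then h i + sine_norm k else h (i - m div 2) - sine_norm k)))"
    using local_model[OF ad m Hh[OF z(2)] Hc \<eta>] by blast
  obtain \<rho> where \<rho>: "\<rho> > 0" "\<And>k. lattice_gap (k - c) < \<rho> \<Longrightarrow> det (shift m (\<alpha> k) z) \<noteq> 0"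
    "\<And>k. lattice_gap (k - c) < \<rho> \<Longrightarrow> mclose m \<eta> (G k) (H k)"
    using chart_neighbourhood[OF al z(2) Gc Gp Gcl[OF c, unfolded H_def]] unfolding H_def by blast
  \<comment> \<open>The perturbation is supported in \<open>lattice_gap (k - c) \<le> 2 * r\<close>;
    capping \<rho> by 1 keeps this inside \<open>lattice_gap (k - c) < 1\<close>, away from the
    other classes of high-symmetry points.\<close>
  define r where "r = min \<rho> 1 / 4"
  have r: "r > 0" "3 * r < \<rho>" "2 * r < 1" using \<rho>(1) by (auto simp: r_def)
  have Hh': "hermitian m (H k)" if "lattice_gap (k - c) < 3 * r" for k using that r(2) by (intro Hh \<rho>(2)) simp
  have Hc': "mcont m {k. lattice_gap (k - c) < 3 * r} H"
    unfolding H_def using \<rho>(2) r(2) by (intro mcont_inv_cayley ac mcont_subset[OF a(1)]) auto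
  have cl: "mclose m \<eta> (G k) (H k)" if "lattice_gap (k - c) \<le> 2 * r" for k using that r by (intro \<rho>(3)) simp
  note bd = r(1) Gh Hh' Gp Hp Gc Hc' cl \<eta>
  define E where "E = bump_diff m c r G H"
  have Eh: "hermitian m (E k)" for k unfolding E_def using bump_diff_hermitian[OF bd] .
  have Eout: "E k = 0\<^sub>m m m" if "lattice_gap (k - c) > 2 * r" for k unfolding E_def using bump_diff_outside[OF bd that] .
  have sw: "lattice_gap (- k - c) = lattice_gap (k - c)" for k using high_symmetry_shift(1)[OF c] by (simp add: lattice_gap_plus_swap)
  have Em: "\<epsilon> * E k = transpose_mat (E (- k)) * \<epsilon>" for k
  proof (cases "lattice_gap (k - c) < 3 * r")
    case True
    then have d: "det (shift m (\<alpha> k) z) \<noteq> 0" "det (shift m (\<alpha> (- k)) z) \<noteq> 0" using \<rho>(2) r(2) by (simp_all add: sw)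
    show ?thesis unfolding E_def bump_diff_def sw using True
      intertwine_smult_diff[OF ec hermitian_carrier[OF Gh] hermitian_carrier[OF Hh[OF d(1)]] hermitian_carrier[OF Gh]
        hermitian_carrier[OF Hh[OF d(2)]] Gm Hint[OF d]] by simp
  next
    case False
    then show ?thesis unfolding E_def bump_diff_def sw using ec by simp
  qed
  obtain \<beta> where b: "near m \<epsilon> \<delta> \<alpha> \<beta>" "\<And>k. k \<in> {k. lattice_gap (k - c) < 3 * r} \<Longrightarrow> \<beta> k = cayley m z (inv_cayley m z (\<alpha> k) + E k)"
    "\<And>k. E k = 0\<^sub>m m m \<Longrightarrow> \<beta> k = \<alpha> k"
  proof (rule local_modification[where E = E, OF al eps_symD(1,2)[OF eps] z(1) _ closed_lattice_gap_le[of c "2 * r"] _ _ Eh _ _ Em _ _ \<eta>b \<delta>])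
    show "open {k. lattice_gap (k - c) < 3 * r}" by (intro open_Collect_less continuous_lattice_gap_diff continuous_on_const)
    show "{k. lattice_gap (k - c) \<le> 2 * r} \<subseteq> {k. lattice_gap (k - c) < 3 * r}" using r(1) by auto
    show "det (shift m (\<alpha> k) z) \<noteq> 0" if "k \<in> {k. lattice_gap (k - c) < 3 * r}" for k using that r(2) by (intro \<rho>(2)) simp
    show "mcont m UNIV E" unfolding E_def using bump_diff_continuous[OF bd] .
    show "periodic E" unfolding E_def using bump_diff_periodic[OF bd] .
    show "E k = 0\<^sub>m m m" if "k \<notin> {k. lattice_gap (k - c) \<le> 2 * r}" for k using that by (intro Eout) simp
    show "cmod (E k $$ (i,j)) \<le> \<eta>" if "i < m" "j < m" for i j k unfolding E_def using bump_diff_bound[OF bd that] .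
  qed (rule that)
  have bin: "\<beta> k = cayley m z (G k)" if k: "lattice_gap (k - c) \<le> r" for k
  proof -
    have k3: "lattice_gap (k - c) < 3 * r" using k r(1) by simp
    have "E k = G k - H k" unfolding E_def by (rule bump_diff_inside[OF bd k])
    then have "H k + E k = G k"
      using hermitian_carrier[OF Gh[of k]] hermitian_carrier[OF Hh'[OF k3]] by (intro mat_eqI[of _ m]) auto
    then show ?thesis using b(2)[of k] k3 by (simp add: H_def)
  qed
  let ?f = "\<lambda>x. z - 2 * \<i> * z / (complex_of_real x + \<i>)"
  have "\<exists>r' A. local_form m \<epsilon> \<beta> c r' A"
  proof (cases "\<epsilon> = 1\<^sub>m m")
    case True
    have "simple_spectrum (\<beta> k)" if k: "lattice_gap (k - c) < r" for k
    proof -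
      obtain V where V: "unitary_mat m V" "G k = unitary_diag m V (\<lambda>i. of_real (h i))"
        using Gf[unfolded if_P[OF True], THEN conjunct2, rule_format, of k] by blast
      have "inj_on (\<lambda>i. ?f (h i)) {..<m}"
      proof (rule inj_onI)
        fix i j assume ij: "i \<in> {..<m}" "j \<in> {..<m}" "?f (h i) = ?f (h j)"
        have "h i = h j" by (rule cayley_eigenvalue_inj[OF z(1) ij(3)])
        moreover have "inj_on h {..<m}" using Gf True by simp
        ultimately show "i = j" using ij(1,2) by (auto dest: inj_onD)
      qed
      then have "simple_spectrum (cayley m z (G k))" by (rule simple_spectrum_inj[OF char_poly_cayley_unitary_diag[OF V]])
      then show ?thesis using bin[of k] k by simp
    qed
    then have "local_form m \<epsilon> \<beta> c r 1" using True r(1) by (simp add: local_form_def)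
    then show ?thesis by blast
  next
    case False
    then have ev: "even m" and hi: "inj_on h {..<m div 2}"
      and GV: "\<And>k. \<exists>V. unitary_mat m V \<and> G k = unitary_diag m V (\<lambda>i. of_real (if i < m div 2 then h i + sine_norm k else h (i - m div 2) - sine_norm k))"
      using Gf unfolding if_not_P[OF False] by blast+
    define p where "p = m div 2"
    have mp: "m = 2 * p" "p > 0" using ev m by (auto simp: p_def)
    obtain g where g: "g > 0" "\<And>i j. i < p \<Longrightarrow> j < p \<Longrightarrow> i \<noteq> j \<Longrightarrow> g \<le> \<bar>h i - h j\<bar>"
      using inj_on_gap[OF hi] unfolding p_def[symmetric] by blast
    define B where "B = Max ((\<lambda>i. \<bar>h i\<bar>) ` {..<p})"
    have B: "\<bar>h i\<bar> \<le> B" if "i < p" for i unfolding B_def using that by (intro Max_ge) auto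
    have B0: "B + 2 > 0" using B[OF mp(2)] by linarith
    \<comment> \<open>These thresholds match the conditions \<open>4 * r < g\<close> and
      \<open>r \<le> 1\<close> of \<open>paired_spectrum\<close>, with \<open>sine_norm k\<close> in
      the role of its \<open>r\<close>.\<close>
    obtain \<rho>' where r': "\<rho>' > 0" "\<And>k. lattice_gap (k - c) < \<rho>' \<Longrightarrow> sine_norm k < min 1 (g / 4)"
      using sine_norm_small[OF c, of "min 1 (g / 4)"] g(1) by auto
    have "(high_symmetry_point k \<longrightarrow> doubly_degenerate_spectrum (\<beta> k)) \<and>
           (\<not> high_symmetry_point k \<longrightarrow> simple_spectrum (\<beta> k)) \<and> clustered_spectrum m (g / (B + 2)\<^sup>2) (\<beta> k)"
      if k: "lattice_gap (k - c) < min r \<rho>'" for k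
    proof -
      obtain V where V: "unitary_mat m V" "G k = unitary_diag m V (\<lambda>i. of_real (if i < p then h i + sine_norm k else h (i - p) - sine_norm k))"
        using GV unfolding p_def by blast
      have cp: "char_poly (\<beta> k) = (\<Prod>a\<leftarrow>map (\<lambda>i. ?f (if i < p then h i + sine_norm k else h (i - p) - sine_norm k)) [0..<2 * p]. [:- a, 1:])"
        using char_poly_cayley_unitary_diag[OF V, of z] bin[of k] k unfolding mp(1) by simp
      have rk: "4 * sine_norm k < g" "sine_norm k \<le> 1" using r'(2)[of k] k by auto
      note P = paired_spectrum[OF z(1) g(2) g(1) B sine_norm_nonneg rk refl cp]
      show ?thesis
      proof (intro conjI impI)
        show "doubly_degenerate_spectrum (\<beta> k)" if hk: "high_symmetry_point k"
        proof -
          have rz: "sine_norm k = 0" by (rule iffD2[OF sine_norm_zero_iff hk])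
          show ?thesis by (rule P(1)) (assumption | rule rz)+
        qed
        show "simple_spectrum (\<beta> k)" if "\<not> high_symmetry_point k"
        proof -
          have rp: "sine_norm k > 0" using that sine_norm_zero_iff[of k] sine_norm_nonneg[of k] by linarith
          show ?thesis by (rule P(2)) (assumption | rule rp)+
        qed
        show "clustered_spectrum m (g / (B + 2)\<^sup>2) (\<beta> k)" unfolding mp(1) by (rule P(3)) (assumption | rule mp(2))+
      qed
    qed
    then have "local_form m \<epsilon> \<beta> c (min r \<rho>') (g / (B + 2)\<^sup>2)"
      using False r(1) r'(1) g(1) B0 by (simp add: local_form_def)
    then show ?thesis by blast
  qed
  then obtain r' A where "local_form m \<epsilon> \<beta> c r' A" by blast
  moreover have "\<beta> k = \<alpha> k" if "lattice_gap (k - c) \<ge> 1" for k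
    using that r(3) by (intro b(3) Eout) simp
  ultimately show thesis using that b(1) by blast
qed

section \<open>Generic approximation\<close>

definition symmetry_reps :: "(real \<times> real) set" where
  "symmetry_reps = {(0,0), (1/2,0), (0,1/2), (1/2,1/2)}"

lemma symmetry_reps_high_symmetry: "c \<in> symmetry_reps \<Longrightarrow> high_symmetry_point c"
  by (auto simp: symmetry_reps_def high_symmetry_point_def)

lemma half_integer_rep:
  fixes x :: real
  assumes "2 * x \<in> \<int>"
  obtains (integer) a :: int where "x = of_int a" | (half) a :: int where "x = 1/2 + of_int a"
proof -
  obtain j :: int where j: "2 * x = of_int j" using assms by (auto elim: Ints_cases)
  show thesis
  proof (cases "even j")
    case True
    then obtain i where "j = 2 * i" by (rule evenE)
    then show thesis using that(1)[of i] j by simp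
  next
    case False
    then obtain i where "j = 2 * i + 1" by (rule oddE)
    then show thesis using that(2)[of i] j by simp
  qed
qed

lemma high_symmetry_rep:
  assumes "high_symmetry_point k"
  obtains c a b where "c \<in> symmetry_reps" "k = c + (of_int a, of_int b)"
proof -
  have 1: "2 * fst k \<in> \<int>" "2 * snd k \<in> \<int>" using assms by (auto simp: high_symmetry_point_def)
  have rep: "\<exists>u a. u \<in> {0, 1/2} \<and> x = u + real_of_int a" if "2 * x \<in> \<int>" for x :: real
    using that
  proof (cases rule: half_integer_rep)
    case (integer a)
    then show ?thesis by (intro exI[of _ 0] exI[of _ a]) simp
  next
    case (half a)
    then show ?thesis by (intro exI[of _ "1/2"] exI[of _ a]) simp
  qed
  obtain u a where u: "u \<in> {0, 1/2}" "fst k = u + real_of_int a" using rep[OF 1(1)] by blast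
  obtain v b where v: "v \<in> {0, 1/2}" "snd k = v + real_of_int b" using rep[OF 1(2)] by blast
  show thesis
    by (rule that[of "(u, v)" a b]) (use u v in \<open>auto simp: symmetry_reps_def prod_eq_iff\<close>)
qed

text \<open>Distinct representatives differ by 1/2 in some coordinate, where the two cosines are
  opposite and cancel. So the regions \<open>lattice_gap (k - c) < 1\<close> around them are
  disjoint.\<close>

lemma symmetry_reps_far:
  assumes "c \<in> symmetry_reps" "c' \<in> symmetry_reps" "c \<noteq> c'"
  shows "lattice_gap (k - c) + lattice_gap (k - c') \<ge> 2"
proof -
  have h: "cos (2 * pi * (x - 1/2)) = - cos (2 * pi * x)" for x :: real
    using cos_minus_pi[of "2 * pi * x"] by (simp add: right_diff_distrib)
  have b: "- 1 \<le> cos (2 * pi * x)" "cos (2 * pi * x) \<le> 1" for x :: real by simp_all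
  show ?thesis
    using assms by (auto simp: symmetry_reps_def lattice_gap_def h) (insert b[of "fst k"] b[of "snd k"], linarith)+
qed

lemma local_form_shrink: "local_form m \<epsilon> \<alpha> c r A \<Longrightarrow> 0 < r' \<Longrightarrow> r' \<le> r \<Longrightarrow> local_form m \<epsilon> \<alpha> c r' A"
  unfolding local_form_def by (meson less_le_trans)

lemma clustered_spectrum_mono:
  assumes "clustered_spectrum m A' M" "A \<le> A'"
  shows "clustered_spectrum m A M"
proof -
  from assms(1)[unfolded clustered_spectrum_def] obtain es where es: "length es = m"
    "char_poly M = (\<Prod>e\<leftarrow>es. [:- e, 1:])"
    and ex: "\<exists>c :: nat \<Rightarrow> nat. (\<forall>i<m. c i < m div 2) \<and> (\<forall>p < m div 2. card {i. i < m \<and> c i = p} = 2) \<and>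
          (\<forall>i<m. \<forall>j<m. c i \<noteq> c j \<longrightarrow> A' \<le> cmod (es ! i - es ! j))"
    by blast
  from ex obtain c :: "nat \<Rightarrow> nat" where c: "\<forall>i<m. c i < m div 2" "\<forall>p < m div 2. card {i. i < m \<and> c i = p} = 2"
    "\<forall>i<m. \<forall>j<m. c i \<noteq> c j \<longrightarrow> A' \<le> cmod (es ! i - es ! j)" by blast
  have "\<forall>i<m. \<forall>j<m. c i \<noteq> c j \<longrightarrow> A \<le> cmod (es ! i - es ! j)" using c(3) assms(2) order_trans by blast
  then show ?thesis unfolding clustered_spectrum_def using es c(1,2) by (intro exI[of _ es] conjI exI[of _ c])
qed

text \<open>Each step changes the family only where \<open>lattice_gap (k - c) < 1\<close>, so the
  local forms at the other representatives survive with their radius cut down to at most 1.\<close>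

lemma generic_near_symmetry:
  assumes ad: "admissible_eps m \<epsilon>" and m: "m \<ge> 1" and fin: "finite C" and C: "C \<subseteq> symmetry_reps"
    and al: "matching_family m \<epsilon> \<alpha>"
  shows "\<delta> > 0 \<Longrightarrow> \<exists>\<beta>. near m \<epsilon> \<delta> \<alpha> \<beta> \<and> (\<forall>c\<in>C. \<exists>r A. local_form m \<epsilon> \<beta> c r A)"
  using fin C
proof (induction C arbitrary: \<delta> rule: finite_induct)
  case empty
  then show ?case using near_refl[OF al] by blast
next
  case (insert c C)
  have c: "c \<in> symmetry_reps" and CC: "C \<subseteq> symmetry_reps" using insert.prems(2) by auto
  have d2: "\<delta> / 2 > 0" using insert.prems(1) by simp
  obtain \<beta> where b: "near m \<epsilon> (\<delta>/2) \<alpha> \<beta>" "\<forall>c\<in>C. \<exists>r A. local_form m \<epsilon> \<beta> c r A"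
    using insert.IH[OF d2 CC] by blast
  have bm: "matching_family m \<epsilon> \<beta>" using b(1) by (simp add: near_def)
  obtain \<gamma> r A where g: "near m \<epsilon> (\<delta>/2) \<beta> \<gamma>" "local_form m \<epsilon> \<gamma> c r A" "\<And>k. lattice_gap (k - c) \<ge> 1 \<Longrightarrow> \<gamma> k = \<beta> k"
    using symmetric_point_step[OF bm ad m symmetry_reps_high_symmetry[OF c] d2] by blast
  have "\<exists>r A. local_form m \<epsilon> \<gamma> c' r A" if c': "c' \<in> insert c C" for c'
  proof (cases "c' = c")
    case True then show ?thesis using g(2) by blast
  next
    case False
    then have "c' \<in> C" using c' by simp
    then obtain r' A' where l: "local_form m \<epsilon> \<beta> c' r' A'" using b(2) by blast
    have rp: "min r' 1 > 0" using l by (simp add: local_form_def)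
    have l1: "local_form m \<epsilon> \<beta> c' (min r' 1) A'" by (rule local_form_shrink[OF l rp]) simp
    have eq: "\<gamma> k = \<beta> k" if "lattice_gap (k - c') < min r' 1" for k
    proof (rule g(3))
      have "lattice_gap (k - c) + lattice_gap (k - c') \<ge> 2" using \<open>c' \<in> C\<close> CC c False by (intro symmetry_reps_far) auto
      then show "lattice_gap (k - c) \<ge> 1" using that by simp
    qed
    have "local_form m \<epsilon> \<gamma> c' (min r' 1) A'"
      using l1 eq unfolding local_form_def by metis
    then show ?thesis by blast
  qed
  moreover have "near m \<epsilon> \<delta> \<alpha> \<gamma>" using near_trans[OF b(1) g(1)] by simp
  ultimately show ?case by blast
qed

theorem generic_approximation:
  assumes al: "matching_family m \<epsilon> \<alpha>" and ad: "admissible_eps m \<epsilon>" and m: "m \<ge> 1"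
    and nh: "equiv_null_homotopic m \<epsilon> \<alpha>" and \<delta>: "\<delta> > 0"
  shows "\<exists>\<beta>. matching_family m \<epsilon> \<beta> \<and> generic_form m \<epsilon> \<beta> \<and> (\<forall>k. mclose m \<delta> (\<beta> k) (\<alpha> k))"
proof -
  have finR: "finite symmetry_reps" by (simp add: symmetry_reps_def)
  have ne: "symmetry_reps \<noteq> {}" by (simp add: symmetry_reps_def)
  have d2: "\<delta> / 2 > 0" using \<delta> by simp
  obtain \<beta> where b: "near m \<epsilon> (\<delta>/2) \<alpha> \<beta>" "\<forall>c\<in>symmetry_reps. \<exists>r A. local_form m \<epsilon> \<beta> c r A"
    using generic_near_symmetry[OF ad m finR subset_refl al d2] by blast
  have bm: "matching_family m \<epsilon> \<beta>" using b(1) by (simp add: near_def)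
  have "\<forall>c\<in>symmetry_reps. \<exists>x. local_form m \<epsilon> \<beta> c (fst x) (snd x)" using b(2) by simp
  from bchoice[OF this] obtain x where x: "\<And>c. c \<in> symmetry_reps \<Longrightarrow> local_form m \<epsilon> \<beta> c (fst (x c)) (snd (x c))" by blast
  define r where "r = Min ((\<lambda>c. fst (x c)) ` symmetry_reps)"
  define A where "A = Min ((\<lambda>c. snd (x c)) ` symmetry_reps)"
  have r: "r > 0" "\<And>c. c \<in> symmetry_reps \<Longrightarrow> r \<le> fst (x c)"
    unfolding r_def using finR ne x by (auto simp: Min_gr_iff local_form_def)
  have A: "A > 0" "\<And>c. c \<in> symmetry_reps \<Longrightarrow> A \<le> snd (x c)"
    unfolding A_def using finR ne x by (auto simp: Min_gr_iff local_form_def)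
  have lf: "local_form m \<epsilon> \<beta> c r (snd (x c))" if "c \<in> symmetry_reps" for c
    by (rule local_form_shrink[OF x[OF that] r(1) r(2)[OF that]])
  \<comment> \<open>The models are frozen where some gap is at most \<open>r / 4\<close>, the
    complement of \<open>?N\<close>. On the annuli \<open>?S\<close> the spectrum is already simple
    and has to be preserved; on \<open>?F\<close> it is to be made simple. \<open>?S\<close> and
    \<open>?F\<close> together cover \<open>?N\<close>, so every point that may change ends up with
    simple spectrum.\<close>
  let ?S = "(\<Inter>c\<in>symmetry_reps. {k. r / 4 \<le> lattice_gap (k - c)}) \<inter> (\<Union>c\<in>symmetry_reps. {k. lattice_gap (k - c) \<le> r / 2})"
  let ?F = "\<Inter>c\<in>symmetry_reps. {k. r / 2 \<le> lattice_gap (k - c)}"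
  let ?N = "\<Inter>c\<in>symmetry_reps. {k. r / 4 < lattice_gap (k - c)}"
  have hsN: "k \<notin> ?N" if "high_symmetry_point k" for k
  proof -
    obtain c a b where c: "c \<in> symmetry_reps" "k = c + (of_int a, of_int b)" using high_symmetry_rep[OF \<open>high_symmetry_point k\<close>] .
    have "lattice_gap (k - c) = 0" using lattice_gap_periodic[of 0 a b] unfolding c(2) by (simp add: lattice_gap_def)
    then show ?thesis using c(1) r(1) by force
  qed
  have hsS: "\<not> high_symmetry_point k" if "k \<in> ?S" for k
  proof
    assume "high_symmetry_point k"
    then obtain c a b where c: "c \<in> symmetry_reps" "k = c + (of_int a, of_int b)" by (rule high_symmetry_rep)
    have "lattice_gap (k - c) = 0" using lattice_gap_periodic[of 0 a b] unfolding c(2) by (simp add: lattice_gap_def)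
    then show False using c(1) r(1) that by force
  qed
  have per: "lattice_gap (k + (of_int a, of_int b) - c) = lattice_gap (k - c)" for k c and a b :: int by (rule lattice_gap_shift_periodic)
  obtain \<gamma> where g: "near m \<epsilon> (\<delta>/2) \<beta> \<gamma>" "\<And>k. k \<notin> ?N \<Longrightarrow> \<gamma> k = \<beta> k" "\<And>k. k \<in> ?S \<union> ?F \<Longrightarrow> simple_spectrum (\<gamma> k)"
  proof (rule generic_away_from_symmetry[OF bm eps_sym_admissible[OF ad], of ?S ?F ?N "\<delta>/2"])
    show "closed ?S"
      using finR by (intro closed_Int closed_INT closed_UN ballI closed_Collect_le continuous_lattice_gap_diff continuous_on_const)
    show "closed ?F" by (intro closed_INT ballI closed_Collect_le continuous_lattice_gap_diff continuous_on_const)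
    show "open ?N" using finR by (intro open_INT ballI open_Collect_less continuous_lattice_gap_diff continuous_on_const)
    show "periodic_set ?S" "periodic_set ?F" "periodic_set ?N" by (auto simp: periodic_set_def per)
    show "?F \<subseteq> ?N" using r(1) by force
    show "simple_spectrum (\<beta> k)" if "k \<in> ?S" for k
    proof -
      obtain c where "c \<in> symmetry_reps" "lattice_gap (k - c) \<le> r / 2" using \<open>k \<in> ?S\<close> by blast
      then have "c \<in> symmetry_reps" "lattice_gap (k - c) < r" using r(1) by auto
      from lf[OF this(1), unfolded local_form_def, THEN conjunct2, THEN conjunct2, rule_format, OF this(2)]
      show ?thesis using hsS[OF \<open>k \<in> ?S\<close>] by (simp split: if_splits)
    qed
    show "- k \<in> ?N" if "k \<in> ?N" for k
      using \<open>k \<in> ?N\<close> high_symmetry_shift(1)[OF symmetry_reps_high_symmetry] by (auto simp: lattice_gap_plus_swap)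
    show "\<not> high_symmetry_point k" if "k \<in> ?F" for k
    proof
      assume "high_symmetry_point k"
      from hsN[OF this] show False using \<open>k \<in> ?F\<close> r(1) by force
    qed
  qed (rule d2, rule that)
  have gm: "matching_family m \<epsilon> \<gamma>" using g(1) by (simp add: near_def)
  have ag: "near m \<epsilon> \<delta> \<alpha> \<gamma>" using near_trans[OF b(1) g(1)] by simp
  have inN: "simple_spectrum (\<gamma> k)" if "k \<in> ?N" for k
  proof -
    have "k \<in> ?S \<union> ?F" using \<open>k \<in> ?N\<close> by force
    then show ?thesis by (rule g(3))
  qed
  have outN: "\<exists>c\<in>symmetry_reps. lattice_gap (k - c) < r \<and> \<gamma> k = \<beta> k" if "k \<notin> ?N" for k
  proof -
    obtain c where "c \<in> symmetry_reps" "lattice_gap (k - c) \<le> r / 4" using \<open>k \<notin> ?N\<close> by force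
    then show ?thesis using r(1) g(2)[OF \<open>k \<notin> ?N\<close>] by force
  qed
  have gen: "generic_form m \<epsilon> \<gamma>"
  proof (cases "\<epsilon> = 1\<^sub>m m")
    case True
    have "simple_spectrum (\<gamma> k)" for k
    proof (cases "k \<in> ?N")
      case T: True then show ?thesis by (rule inN)
    next
      case False
      then obtain c where "c \<in> symmetry_reps" "lattice_gap (k - c) < r" "\<gamma> k = \<beta> k" using outN by blast
      from lf[OF this(1), unfolded local_form_def, THEN conjunct2, THEN conjunct2, rule_format, OF this(2)]
      show ?thesis using True \<open>\<gamma> k = \<beta> k\<close> by simp
    qed
    then show ?thesis using True ag nh by (simp add: generic_form_def near_def)
  next
    case False
    have lg: "(high_symmetry_point k \<longrightarrow> doubly_degenerate_spectrum (\<beta> k)) \<and>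
        (\<not> high_symmetry_point k \<longrightarrow> simple_spectrum (\<beta> k)) \<and> clustered_spectrum m (snd (x c)) (\<beta> k)"
      if "c \<in> symmetry_reps" "lattice_gap (k - c) < r" for c k
      using lf[OF that(1), unfolded local_form_def if_not_P[OF False], THEN conjunct2, THEN conjunct2, rule_format, OF that(2)]
      by blast
    have s: "simple_spectrum (\<gamma> k)" if "\<not> high_symmetry_point k" for k
      using inN[of k] outN[of k] lg[of _ k] that by (cases "k \<in> ?N") auto
    have d: "doubly_degenerate_spectrum (\<gamma> k)" if "high_symmetry_point k" for k
      using outN[OF hsN[OF that]] lg[of _ k] that by auto
    obtain R where R: "R > 0" "\<And>k. \<bar>fst k\<bar> < R \<Longrightarrow> \<bar>snd k\<bar> < R \<Longrightarrow> lattice_gap k < r / 4" using lattice_gap_small[of "r / 4"] r(1) by auto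
    have cl: "clustered_spectrum m A (\<gamma> k)" if ks: "high_symmetry_point ks" "k \<in> ball ks R" for ks k
    proof -
      obtain c a b where c: "c \<in> symmetry_reps" "ks = c + (of_int a, of_int b)" using high_symmetry_rep[OF ks(1)] .
      have n: "norm (k - ks) < R" using ks(2) by (simp add: dist_norm norm_minus_commute)
      have "\<bar>fst (k - ks)\<bar> < R" "\<bar>snd (k - ks)\<bar> < R"
        using norm_fst_le[of "fst (k - ks)" "snd (k - ks)"] norm_snd_le[of "snd (k - ks)" "fst (k - ks)"] n
        unfolding prod.collapse real_norm_def by linarith+
      then have "lattice_gap (k - ks) < r / 4" by (rule R(2))
      moreover have "k - c = (k - ks) + (of_int a, of_int b)" unfolding c(2) by simp
      ultimately have Dc: "lattice_gap (k - c) < r / 4" by (simp only: lattice_gap_periodic)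
      then have "k \<notin> ?N" using c(1) by force
      then have "\<gamma> k = \<beta> k" by (rule g(2))
      moreover have "clustered_spectrum m (snd (x c)) (\<beta> k)" using lg[OF c(1), of k] Dc r(1) by simp
      ultimately show ?thesis using clustered_spectrum_mono[OF _ A(2)[OF c(1)]] by simp
    qed
    have "\<exists>A R. A > 0 \<and> R > 0 \<and> (\<forall>ks k. high_symmetry_point ks \<longrightarrow> k \<in> ball ks R \<longrightarrow> clustered_spectrum m A (\<gamma> k))"
      using A(1) R(1) cl by blast
    moreover have "equiv_null_homotopic m \<epsilon> \<gamma>" using ag nh by (simp add: near_def)
    ultimately show ?thesis unfolding generic_form_def if_not_P[OF False] using s d by blast
  qed
  show ?thesis using gm gen ag unfolding near_def by blast
qed

lemma cvec_norm_nonneg: "cvec_norm v \<ge> 0"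
  by (simp add: cvec_norm_def sum_nonneg)

text \<open>Entries of a unit vector are at most 1, which bounds each entry of the image by
  \<open>m * d\<close> and its norm by the sum of these \<open>m\<close> entries.\<close>

lemma mat_op_norm_bound:
  assumes X: "X \<in> carrier_mat m m" and m: "m \<ge> 1" and b: "\<And>i j. i < m \<Longrightarrow> j < m \<Longrightarrow> cmod (X $$ (i,j)) \<le> d"
  shows "0 \<le> mat_op_norm X" "mat_op_norm X \<le> real m * real m * d"
proof -
  let ?Q = "{cvec_norm (X *\<^sub>v v) | v. v \<in> carrier_vec (dim_col X) \<and> cvec_norm v = 1}"
  have d: "d \<ge> 0" by (rule order_trans[OF norm_ge_zero b[of 0 0]]) (use m in simp_all)
  have le: "q \<le> real m * real m * d" if "q \<in> ?Q" for q
  proof -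
    obtain v where v: "v \<in> carrier_vec m" "cvec_norm v = 1" "q = cvec_norm (X *\<^sub>v v)" using \<open>q \<in> ?Q\<close> X by auto
    have "(\<Sum>i<m. (cmod (v $ i))\<^sup>2) = 1" using v(1,2) by (simp add: cvec_norm_def)
    moreover have "(cmod (v $ j))\<^sup>2 \<le> (\<Sum>i<m. (cmod (v $ i))\<^sup>2)" if "j < m" for j
      using that by (intro member_le_sum[of j "{..<m}" "\<lambda>i. (cmod (v $ i))\<^sup>2"]) auto
    ultimately have v1: "cmod (v $ j) \<le> 1" if "j < m" for j
      using that by (simp add: power_le_one_iff abs_square_le_1)
    have row: "cmod ((X *\<^sub>v v) $ i) \<le> real m * d" if i: "i < m" for i
    proof -
      have "(X *\<^sub>v v) $ i = (\<Sum>j<m. X $$ (i,j) * v $ j)"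
        using X v(1) i by (auto simp: scalar_prod_def lessThan_atLeast0 intro!: sum.cong)
      also have "cmod \<dots> \<le> (\<Sum>j<m. d)"
      proof (intro sum_norm_le)
        fix j assume "j \<in> {..<m}"
        then have "cmod (X $$ (i,j) * v $ j) \<le> d * 1"
          unfolding norm_mult using b[OF i] v1 d by (intro mult_mono) auto
        then show "cmod (X $$ (i,j) * v $ j) \<le> d" by simp
      qed
      finally show ?thesis by simp
    qed
    have "dim_vec (X *\<^sub>v v) = m" using X by simp
    then have "q = L2_set (\<lambda>i. cmod ((X *\<^sub>v v) $ i)) {..<m}"
      unfolding v(3) cvec_norm_def L2_set_def by simp
    also have "\<dots> \<le> (\<Sum>i<m. \<bar>cmod ((X *\<^sub>v v) $ i)\<bar>)" by (rule L2_set_le_sum_abs)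
    also have "\<dots> \<le> (\<Sum>i<m. real m * d)" using row by (intro sum_mono) simp
    finally show ?thesis by simp
  qed
  \<comment> \<open>The supremum needs a nonempty set of values; the unit vector provides an
    element, which uses \<open>m \<ge> 1\<close>.\<close>
  have e: "unit_vec m 0 \<in> carrier_vec (dim_col X)" using X by simp
  have "cvec_norm (unit_vec m 0 :: complex vec) = 1"
  proof -
    have "(\<Sum>i<m. (cmod ((unit_vec m 0 :: complex vec) $ i))\<^sup>2) = (\<Sum>i<m. if i = 0 then 1 else 0)"
      by (intro sum.cong) auto
    then show ?thesis using m by (simp add: cvec_norm_def)
  qed
  then have q: "cvec_norm (X *\<^sub>v unit_vec m 0) \<in> ?Q" using e by blast
  have bdd: "bdd_above ?Q" using le by (intro bdd_aboveI)
  have "cvec_norm (X *\<^sub>v unit_vec m 0) \<le> mat_op_norm X" unfolding mat_op_norm_def by (rule cSup_upper[OF q bdd])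
  then show "0 \<le> mat_op_norm X" using cvec_norm_nonneg order_trans by blast
  show "mat_op_norm X \<le> real m * real m * d" unfolding mat_op_norm_def using q le by (intro cSup_least) auto
qed

theorem theorem4p2:
  fixes m :: nat and \<epsilon> :: "complex mat" and \<alpha> :: "real \<times> real \<Rightarrow> complex mat"
  assumes "m \<ge> 1"
    and "admissible_eps m \<epsilon>"
    and "matching_family m \<epsilon> \<alpha>"
    and "equiv_null_homotopic m \<epsilon> \<alpha>"
  shows "\<exists>\<alpha>s :: nat \<Rightarrow> real \<times> real \<Rightarrow> complex mat.
           (\<forall>n. matching_family m \<epsilon> (\<alpha>s n)) \<and>
           (\<lambda>n. SUP k. mat_op_norm (\<alpha>s n k - \<alpha> k)) \<longlonglongrightarrow> 0 \<and>
           (\<forall>n. generic_form m \<epsilon> (\<alpha>s n))"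
proof -
  have "\<forall>n. \<exists>\<beta>. matching_family m \<epsilon> \<beta> \<and> generic_form m \<epsilon> \<beta> \<and> (\<forall>k. mclose m (1 / real (Suc n)) (\<beta> k) (\<alpha> k))"
    using generic_approximation[OF assms(3,2,1,4)] by simp
  from choice[OF this] obtain \<alpha>s where as: "\<And>n. matching_family m \<epsilon> (\<alpha>s n)" "\<And>n. generic_form m \<epsilon> (\<alpha>s n)"
    "\<And>n k. mclose m (1 / real (Suc n)) (\<alpha>s n k) (\<alpha> k)" by blast
  have nb: "0 \<le> mat_op_norm (\<alpha>s n k - \<alpha> k)" "mat_op_norm (\<alpha>s n k - \<alpha> k) \<le> real m * real m * (1 / real (Suc n))" for n k
  proof -
    have c: "\<alpha>s n k \<in> carrier_mat m m" "\<alpha> k \<in> carrier_mat m m"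
      using unitary_carrier[OF matchingD(3)[OF as(1)]] unitary_carrier[OF matchingD(3)[OF assms(3)]] by blast+
    have X: "\<alpha>s n k - \<alpha> k \<in> carrier_mat m m" by (rule minus_carrier_mat[OF c(2)])
    have e: "cmod ((\<alpha>s n k - \<alpha> k) $$ (i,j)) \<le> 1 / real (Suc n)" if "i < m" "j < m" for i j
    proof -
      have "(\<alpha>s n k - \<alpha> k) $$ (i,j) = \<alpha>s n k $$ (i,j) - \<alpha> k $$ (i,j)" using c that by auto
      then show ?thesis using as(3)[of n k] that unfolding mclose_def by (simp add: less_imp_le)
    qed
    note bnd = mat_op_norm_bound[OF X assms(1) e]
    show "0 \<le> mat_op_norm (\<alpha>s n k - \<alpha> k)" by (rule bnd(1))
    show "mat_op_norm (\<alpha>s n k - \<alpha> k) \<le> real m * real m * (1 / real (Suc n))" by (rule bnd(2))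
  qed
  have "(\<lambda>n. SUP k. mat_op_norm (\<alpha>s n k - \<alpha> k)) \<longlonglongrightarrow> 0"
  proof (rule tendsto_sandwich)
    show "\<forall>\<^sub>F n in sequentially. 0 \<le> (SUP k. mat_op_norm (\<alpha>s n k - \<alpha> k))"
    proof (intro always_eventually allI)
      fix n
      \<comment> \<open>The values are bounded above by \<open>nb\<close>, so a single point, here
        \<open>k = 0\<close>, bounds the supremum from below.\<close>
      have "mat_op_norm (\<alpha>s n 0 - \<alpha> 0) \<le> (SUP k. mat_op_norm (\<alpha>s n k - \<alpha> k))"
        by (rule cSUP_upper) (auto intro!: bdd_aboveI2 nb(2))
      then show "0 \<le> (SUP k. mat_op_norm (\<alpha>s n k - \<alpha> k))" using nb(1)[of n 0] by linarith
    qed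
    show "\<forall>\<^sub>F n in sequentially. (SUP k. mat_op_norm (\<alpha>s n k - \<alpha> k)) \<le> real m * real m * (1 / real (Suc n))"
      by (intro always_eventually allI, rule cSUP_least, simp, rule nb(2))
    have "(\<lambda>n. real m * real m * (1 / real (Suc n))) \<longlonglongrightarrow> real m * real m * 0"
      by (intro tendsto_mult tendsto_const LIMSEQ_Suc[OF lim_inverse_n'])
    then show "(\<lambda>n. real m * real m * (1 / real (Suc n))) \<longlonglongrightarrow> 0" by simp
  qed simp
  then show ?thesis using as(1,2) by blast
qed

end
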